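(* Let $s_0\in(0,1]$. Suppose $\dim\ker N_{s_0}=2$, and denote the corresponding eigenfunctions of $L_+^{s_0}$ and $L_-^{s_0}$ (for the eigenvalue $0$) by $u_{s_0}^{(1)}$ and $v_{s_0}^{(2)}$, respectively. (1) If $\langle u_{s_0}^{(1)},v_{s_0}^{(2)}\rangle\ne0$, then $s^2\lambda\notin\operatorname{Spec}(N_s)$ for real $(\lambda,s)$ in a punctured neighbourhood of $(0,s_0)$. (2) If $\langle u_{s_0}^{(1)},v_{s_0}^{(2)}\rangle=0$ and $$\frac{\langle\widehat v_{s_0}^{(1)},u_{s_0}^{(1)}\rangle}{(\partial_xu_{s_0}^{(1)}(\ell))^2}+\frac{\langle\widehat u_{s_0}^{(2)},v_{s_0}^{(2)}\rangle}{(\partial_xv_{s_0}^{(2)}(\ell))^2}\neq0,$$ where $\widehat u_{s_0}^{(2)}\in\operatorname{dom}(L_+^{s_0})$ and $\widehat v_{s_0}^{(1)}\in\operatorname{dom}(L_-^{s_0})$ denote solutions to $L_+^{s_0}\widehat u_{s_0}^{(2)}=v_{s_0}^{(2)}$ and $-L_-^{s_0}\widehat v_{s_0}^{(1)}=u_{s_0}^{(1)}$, then for real $|\lambda|\ll1$ there exist $C^2$ curves $s_1(\lambda)$ and $s_2(\lambda)$ such that, for $k=1,2$: (i) $s_k(\lambda)^2\lambda\in\operatorname{Spec}(N_{s_k(\lambda)})$; (ii) $s_k(0)=s_0$; (iii) $\dot s_k(0)=0$; and the concavities satisfy $$\ddot s_1(0)=-\frac{2s_0^5}{\ell}\frac{\langle\widehat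 v_{s_0}^{(1)},u_{s_0}^{(1)}\rangle}{(\partial_xu_{s_0}^{(1)}(\ell))^2},\qquad \ddot s_2(0)=\frac{2s_0^5}{\ell}\frac{\langle\widehat u_{s_0}^{(2)},v_{s_0}^{(2)}\rangle}{(\partial_xv_{s_0}^{(2)}(\ell))^2}.$$ Moreover, there exist continuous curves $\mathbf u_{s_1(\lambda)}$ and $\mathbf u_{s_2(\lambda)}$ of eigenfunctions (of $N_{s_k(\lambda)}$ for the eigenvalue $s_k(\lambda)^2\lambda$) such that, as $\lambda\to0$, $$\mathbf u_{s_1(\lambda)}\to\begin{pmatrix}u_{s_0}^{(1)}\\ 0\end{pmatrix},\qquad \mathbf u_{s_2(\lambda)}\to\begin{pmatrix}0\\ v_{s_0}^{(2)}\end{pmatrix}.$$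
   Context: $\ell>0$ and $g,h$ are real-valued $C^2$ functions on $[0,\ell]$ (when $s>1$ occurs, i.e. for $s_0=1$, taken to be defined and $C^2$ on $[0,\ell']$ for some $\ell'>\ell$). Put $L_+^s=-\partial_{xx}-s^2g(sx)$, $L_-^s=-\partial_{xx}-s^2h(sx)$, unbounded operators in $L^2(0,\ell)$ with domain $H^2(0,\ell)\cap H^1_0(0,\ell)$, and $N_s=\begin{pmatrix}0&-L_-^s\\ L_+^s&0\end{pmatrix}$ in $L^2(0,\ell)^2$ with domain $(H^2(0,\ell)\cap H^1_0(0,\ell))^2$. $\langle\cdot,\cdot\rangle$ is the $L^2(0,\ell)$ inner product; eigenfunctions are real-valued; dot denotes $d/d\lambda$. Since $\ker N_{s_0}=\ker L_+^{s_0}\oplus\ker L_-^{s_0}$ and eigenvalues of $L_\pm^{s_0}$ are simple, $\dim\ker N_{s_0}=2$ means both $L_\pm^{s_0}$ have one-dimensional kernel. The solutions $\widehat u_{s_0}^{(2)},\widehat v_{s_0}^{(1)}$ exist when $\langle u_{s_0}^{(1)},v_{s_0}^{(2)}\rangle=0$ and are not unique, but the displayed expressions do not depend on the choice. *)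

theory Defs
  imports "HOL-Analysis.Analysis"
begin

text \<open>
  Elements of \<open>L\<^sup>2(0,l)\<close> are handled through representatives \<open>real \<Rightarrow> 'a\<close>, with \<open>aeq\<close> as equality.
  The definitions are polymorphic in the values: \<open>L\<^sup>2(0,l)\<^sup>2\<close> is \<open>L2 l\<close> with values in
  \<open>complex \<times> complex\<close> (whose norm is the Euclidean one). Only values on \<open>{0<..<l}\<close> matter.
\<close>

definition aeq :: "real \<Rightarrow> (real \<Rightarrow> 'a) \<Rightarrow> (real \<Rightarrow> 'a) \<Rightarrow> bool" where
  "aeq l f g \<longleftrightarrow> (AE x in lebesgue_on {0<..<l}. f x = g x)"

definition L2 :: "real \<Rightarrow> (real \<Rightarrow> 'a::real_normed_vector) set" where
  "L2 l = {f. f \<in> borel_measurable (lebesgue_on {0<..<l}) \<and>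
              integrable (lebesgue_on {0<..<l}) (\<lambda>x. (norm (f x))\<^sup>2)}"

definition l2norm :: "real \<Rightarrow> (real \<Rightarrow> 'a::real_normed_vector) \<Rightarrow> real" where
  "l2norm l f = sqrt (LINT x|lebesgue_on {0<..<l}. (norm (f x))\<^sup>2)"

text \<open>Only needed for real-valued functions.\<close>

definition ip :: "real \<Rightarrow> (real \<Rightarrow> real) \<Rightarrow> (real \<Rightarrow> real) \<Rightarrow> real" where
  "ip l f g = (LINT x|lebesgue_on {0<..<l}. f x * g x)"

text \<open>\<open>C\<^sub>c\<^sup>\<infinity>(0,l)\<close>, the functions being extended by zero to the real line.\<close>

definition test_fun :: "real \<Rightarrow> (real \<Rightarrow> complex) set" where
  "test_fun l = {\<phi>. (\<exists>D. D 0 = \<phi> \<and> (\<forall>n x. (D n has_vector_derivative D (Suc n) x) (at x)))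
                   \<and> closure {x. \<phi> x \<noteq> 0} \<subseteq> {0<..<l}}"

definition test_deriv :: "(real \<Rightarrow> complex) \<Rightarrow> real \<Rightarrow> complex" where
  "test_deriv \<phi> = (\<lambda>x. vector_derivative \<phi> (at x))"

definition has_weak_deriv :: "real \<Rightarrow> (real \<Rightarrow> complex) \<Rightarrow> (real \<Rightarrow> complex) \<Rightarrow> bool" where
  "has_weak_deriv l f f' \<longleftrightarrow>
     (\<forall>\<phi>\<in>test_fun l. (LINT x|lebesgue_on {0<..<l}. f x * test_deriv \<phi> x)
                    = - (LINT x|lebesgue_on {0<..<l}. f' x * \<phi> x))"

definition H1 :: "real \<Rightarrow> (real \<Rightarrow> complex) set" where
  "H1 l = {f \<in> L2 l. \<exists>f'\<in>L2 l. has_weak_deriv l f f'}"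

definition H2 :: "real \<Rightarrow> (real \<Rightarrow> complex) set" where
  "H2 l = {f \<in> L2 l. \<exists>f'\<in>L2 l. \<exists>f''\<in>L2 l. has_weak_deriv l f f' \<and> has_weak_deriv l f' f''}"

text \<open>A representative of the weak derivative, which is unique up to \<open>aeq\<close>.\<close>

definition wderiv :: "real \<Rightarrow> (real \<Rightarrow> complex) \<Rightarrow> real \<Rightarrow> complex" where
  "wderiv l f = (SOME f'. f' \<in> L2 l \<and> has_weak_deriv l f f')"

text \<open>\<open>H\<^sup>1\<^sub>0(0,l)\<close> is the closure of the test functions in the \<open>H\<^sup>1\<close> norm.\<close>

definition H10 :: "real \<Rightarrow> (real \<Rightarrow> complex) set" where
  "H10 l = {f \<in> H1 l. \<exists>\<phi>::nat \<Rightarrow> real \<Rightarrow> complex. (\<forall>n. \<phi> n \<in> test_fun l) \<and>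
              (\<lambda>n. l2norm l (\<lambda>x. f x - \<phi> n x)) \<longlonglongrightarrow> 0 \<and>
              (\<lambda>n. l2norm l (\<lambda>x. wderiv l f x - test_deriv (\<phi> n) x)) \<longlonglongrightarrow> 0}"

text \<open>With \<open>q = g\<close> or \<open>q = h\<close> this is \<open>L\<^sub>+\<^sup>s\<close> or \<open>L\<^sub>-\<^sup>s\<close>; the domain does not depend on \<open>s\<close>.\<close>

definition dom_L :: "real \<Rightarrow> (real \<Rightarrow> complex) set" where
  "dom_L l = H2 l \<inter> H10 l"

definition Lop :: "real \<Rightarrow> (real \<Rightarrow> real) \<Rightarrow> real \<Rightarrow> (real \<Rightarrow> complex) \<Rightarrow> real \<Rightarrow> complex" where
  "Lop l q s f = (\<lambda>x. - wderiv l (wderiv l f) x - complex_of_real (s\<^sup>2 * q (s * x)) * f x)"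

definition dom_N :: "real \<Rightarrow> (real \<Rightarrow> complex \<times> complex) set" where
  "dom_N l = {w. fst \<circ> w \<in> dom_L l \<and> snd \<circ> w \<in> dom_L l}"

definition Nop :: "real \<Rightarrow> (real \<Rightarrow> real) \<Rightarrow> (real \<Rightarrow> real) \<Rightarrow> real
    \<Rightarrow> (real \<Rightarrow> complex \<times> complex) \<Rightarrow> real \<Rightarrow> complex \<times> complex" where
  "Nop l g h s w = (\<lambda>x. (- Lop l h s (snd \<circ> w) x, Lop l g s (fst \<circ> w) x))"

definition smul :: "complex \<Rightarrow> complex \<times> complex \<Rightarrow> complex \<times> complex" where
  "smul c z = (c * fst z, c * snd z)"

text \<open>
  The spectrum of an operator \<open>A\<close> in \<open>L\<^sup>2(0,l)\<^sup>2\<close> with domain \<open>D\<close>: the complement of the set of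
  \<open>\<mu>\<close> for which \<open>A - \<mu>\<close> is a bijection from \<open>D\<close> onto \<open>L\<^sup>2(0,l)\<^sup>2\<close> (modulo \<open>aeq\<close>) with bounded inverse.
\<close>

definition resolvent_set :: "real \<Rightarrow> (real \<Rightarrow> complex \<times> complex) set
    \<Rightarrow> ((real \<Rightarrow> complex \<times> complex) \<Rightarrow> real \<Rightarrow> complex \<times> complex) \<Rightarrow> complex set" where
  "resolvent_set l D A = {\<mu>.
     (\<forall>f\<in>D. aeq l (\<lambda>x. A f x - smul \<mu> (f x)) (\<lambda>x. 0) \<longrightarrow> aeq l f (\<lambda>x. 0)) \<and>
     (\<forall>w\<in>L2 l. \<exists>f\<in>D. aeq l (\<lambda>x. A f x - smul \<mu> (f x)) w) \<and>
     (\<exists>C. \<forall>f\<in>D. l2norm l f \<le> C * l2norm l (\<lambda>x. A f x - smul \<mu> (f x)))}"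

definition Spec_N :: "real \<Rightarrow> (real \<Rightarrow> real) \<Rightarrow> (real \<Rightarrow> real) \<Rightarrow> real \<Rightarrow> complex set" where
  "Spec_N l g h s = - resolvent_set l (dom_N l) (Nop l g h s)"

definition ker_N :: "real \<Rightarrow> (real \<Rightarrow> real) \<Rightarrow> (real \<Rightarrow> real) \<Rightarrow> real
    \<Rightarrow> (real \<Rightarrow> complex \<times> complex) set" where
  "ker_N l g h s = {w \<in> dom_N l. aeq l (Nop l g h s w) (\<lambda>x. 0)}"

text \<open>The complex dimension of \<open>K\<close> modulo \<open>aeq\<close> is \<open>n\<close>: there is a basis \<open>b 0, \<dots>, b (n - 1)\<close>.\<close>

definition has_dim :: "real \<Rightarrow> (real \<Rightarrow> complex \<times> complex) set \<Rightarrow> nat \<Rightarrow> bool" where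
  "has_dim l K n \<longleftrightarrow> (\<exists>b::nat \<Rightarrow> real \<Rightarrow> complex \<times> complex.
     (\<forall>i<n. b i \<in> K) \<and>
     (\<forall>c. aeq l (\<lambda>x. \<Sum>i<n. smul (c i) (b i x)) (\<lambda>x. 0) \<longrightarrow> (\<forall>i<n. c i = 0)) \<and>
     (\<forall>w\<in>K. \<exists>c. aeq l w (\<lambda>x. \<Sum>i<n. smul (c i) (b i x))))"

text \<open>Real-valued functions as elements of the complex spaces.\<close>

definition cplx :: "(real \<Rightarrow> real) \<Rightarrow> real \<Rightarrow> complex" where
  "cplx u = (\<lambda>x. complex_of_real (u x))"

definition cplx2 :: "(real \<Rightarrow> real \<times> real) \<Rightarrow> real \<Rightarrow> complex \<times> complex" where
  "cplx2 w = (\<lambda>x. (complex_of_real (fst (w x)), complex_of_real (snd (w x))))"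

definition eigenfun_L :: "real \<Rightarrow> (real \<Rightarrow> real) \<Rightarrow> real \<Rightarrow> real \<Rightarrow> (real \<Rightarrow> real) \<Rightarrow> bool" where
  "eigenfun_L l q s \<mu> u \<longleftrightarrow> cplx u \<in> dom_L l \<and> \<not> aeq l u (\<lambda>x. 0) \<and>
     aeq l (Lop l q s (cplx u)) (\<lambda>x. complex_of_real \<mu> * cplx u x)"

definition eigenfun_N :: "real \<Rightarrow> (real \<Rightarrow> real) \<Rightarrow> (real \<Rightarrow> real) \<Rightarrow> real \<Rightarrow> real
    \<Rightarrow> (real \<Rightarrow> real \<times> real) \<Rightarrow> bool" where
  "eigenfun_N l g h s \<mu> w \<longleftrightarrow> cplx2 w \<in> dom_N l \<and> \<not> aeq l w (\<lambda>x. 0) \<and>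
     aeq l (Nop l g h s (cplx2 w)) (\<lambda>x. smul (complex_of_real \<mu>) (cplx2 w x))"

text \<open>\<open>\<partial>\<^sub>xu(l)\<close> for (a representative \<open>u\<close> of) an \<open>H\<^sup>2\<close> function, via its \<open>C\<^sup>1\<close> representative on \<open>{0..l}\<close>.\<close>

definition dx_end :: "real \<Rightarrow> (real \<Rightarrow> real) \<Rightarrow> real" where
  "dx_end l u = (THE d. \<exists>w w'. aeq l u w \<and>
     (\<forall>x\<in>{0..l}. (w has_real_derivative w' x) (at x within {0..l})) \<and>
     continuous_on {0..l} w' \<and> d = w' l)"

definition C2_on :: "real set \<Rightarrow> (real \<Rightarrow> real) \<Rightarrow> bool" where
  "C2_on S f \<longleftrightarrow> (\<exists>f' f''.
     (\<forall>x\<in>S. (f has_real_derivative f' x) (at x within S)) \<and>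
     (\<forall>x\<in>S. (f' has_real_derivative f'' x) (at x within S)) \<and>
     continuous_on S f'')"

definition L2_continuous_on :: "real \<Rightarrow> real set \<Rightarrow> (real \<Rightarrow> real \<Rightarrow> real \<times> real) \<Rightarrow> bool" where
  "L2_continuous_on l I U \<longleftrightarrow>
     (\<forall>a\<in>I. ((\<lambda>t. l2norm l (\<lambda>x. U t x - U a x)) \<longlongrightarrow> 0) (at a within I))"

end

theory Submission
  imports Defs
begin

text \<open>
  Why the theorem holds. Put \<open>w x = (U (s * x), V (s * x))\<close>. Then \<open>N\<^sub>s w = s\<^sup>2 \<lambda> w\<close> becomes the
  system \<open>U'' = - g U - \<lambda> V\<close>, \<open>V'' = - h V + \<lambda> U\<close> on \<open>(0, s l)\<close>, in which \<open>s\<close> survives only through the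
  end point. The solutions that vanish at \<open>0\<close> are spanned by \<open>(A, \<lambda> B)\<close> and \<open>(\<lambda> C, E)\<close>, where
  \<open>A\<close>, \<open>B\<close>, \<open>C\<close>, \<open>E\<close> are functions of \<open>\<mu> = \<lambda>\<^sup>2\<close> and \<open>y\<close>: power series in \<open>\<mu>\<close> whose coefficients
  \<open>a k\<close>, \<open>b k\<close>, \<open>c k\<close>, \<open>e k\<close> solve a recursive chain of scalar initial value problems
  (\<open>analytic_pair_exists\<close>). So the question is where the determinant \<open>D = A E - \<mu> B C\<close> vanishes at
  \<open>y = s l\<close>: if it does, the solution that vanishes at both end points is an eigenfunction
  (\<open>soln_eigenfun_N\<close>), and if it does not, the boundary value problem has a bounded
  solution operator on \<open>L\<^sup>2\<close> (\<open>determinant_nonzero_imp_resolvent\<close>). At \<open>\<mu> = 0\<close> the functions \<open>A\<close> and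
  \<open>E\<close> are the rescaled solutions \<open>a 0\<close>, \<open>e 0\<close> of the scalar problems; both vanish at \<open>y0 = s0 l\<close>, with
  nonzero slopes \<open>p\<close> and \<open>q\<close>.

  Part (1). By the Wronskian identity \<open>b 0 y0 * q\<close> and \<open>c 0 y0 * p\<close> are minus and plus the integral of
  \<open>a 0 * e 0\<close>, which is \<open>\<langle>u, v\<rangle>\<close> up to a nonzero factor. With \<open>\<delta> = y - y0\<close> this gives
  \<open>p q D = \<delta>\<^sup>2 X + \<mu> Y\<close> where \<open>X\<close> and \<open>Y\<close> are positive near \<open>(0, y0)\<close>. As \<open>\<mu> = \<lambda>\<^sup>2 \<ge> 0\<close>, the determinant
  vanishes only at \<open>(0, y0)\<close> itself (\<open>determinant_nonzero_near\<close>).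

  Part (2). If \<open>\<langle>u, v\<rangle> = 0\<close>, then all four functions vanish at \<open>(0, y0)\<close>. Blow up this point by
  \<open>y = y0 + \<mu> \<tau>\<close>: each function is \<open>\<mu>\<close> times a \<open>C\<^sup>2\<close> function of \<open>(\<mu>, \<tau>)\<close>, and \<open>D = \<mu>\<^sup>2 F\<close> with
  \<open>F (0, \<tau>) = (p \<tau> + a 1 y0) (q \<tau> + e 1 y0)\<close>. A further use of the Wronskian identity shows that the
  two quotients of the hypothesis are \<open>a 1 y0 / (s0\<^sup>5 p)\<close> and \<open>- e 1 y0 / (s0\<^sup>5 q)\<close>
  (\<open>resolvent_pairing\<close>), so the hypothesis says that the two roots of \<open>F (0, \<tau>)\<close> are distinct.
  The implicit function theorem continues them to \<open>C\<^sup>2\<close> functions \<open>T1\<close>, \<open>T2\<close> of \<open>\<mu>\<close>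
  (\<open>bifurcating_curve\<close>), and \<open>s\<^sub>k \<lambda> = s0 + \<lambda>\<^sup>2 T\<^sub>k (\<lambda>\<^sup>2) / l\<close> has vanishing slope and second derivative
  \<open>2 T\<^sub>k 0 / l\<close> at \<open>0\<close> (\<open>curve_C2\<close>).

  The operators are given through weak derivatives and the closure of the test functions. They are
  connected to classical solutions by the description of the domain of \<open>L\<close> as the functions that are
  second primitives of \<open>L\<^sup>2\<close> functions and vanish at both end points (\<open>dom_L_representative\<close> and
  \<open>dom_L_intro\<close>).
\<close>

section \<open>Functions of class \<open>C\<^sup>k\<close>\<close>

text \<open>
  Derivatives are applied to one direction at a time, so that iterated derivatives stay real-valued
  and spaces of multilinear maps are avoided. On an open set this is the usual class \<open>C\<^sup>k\<close>.
\<close>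

fun Ck :: "nat \<Rightarrow> 'a::real_normed_vector set \<Rightarrow> ('a \<Rightarrow> real) \<Rightarrow> bool" where
  "Ck 0 S f \<longleftrightarrow> continuous_on S f"
| "Ck (Suc n) S f \<longleftrightarrow> (\<exists>f'. (\<forall>z\<in>S. (f has_derivative f' z) (at z within S)) \<and> (\<forall>v. Ck n S (\<lambda>z. f' z v)))"

lemma Ck_continuous_on: "Ck n S f \<Longrightarrow> continuous_on S f"
  by (cases n) (auto simp: continuous_on_eq_continuous_within intro: has_derivative_continuous)

lemma Ck_SucD: "Ck (Suc n) S f \<Longrightarrow> Ck n S f"
proof (induction n arbitrary: f)
  case 0
  then show ?case using Ck_continuous_on by (metis Ck.simps(1))
next
  case (Suc n)
  from Suc.prems obtain f' where
    "\<forall>z\<in>S. (f has_derivative f' z) (at z within S)" "\<And>v. Ck (Suc n) S (\<lambda>z. f' z v)"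
    unfolding Ck.simps(2)[of "Suc n"] by blast
  with Suc.IH show ?case unfolding Ck.simps(2) by blast
qed

lemma Ck_mono: "Ck n S f \<Longrightarrow> m \<le> n \<Longrightarrow> Ck m S f"
  by (induction n) (auto simp: le_Suc_eq simp del: Ck.simps dest: Ck_SucD)

lemma Ck_subset: "Ck n S f \<Longrightarrow> T \<subseteq> S \<Longrightarrow> Ck n T f"
proof (induction n arbitrary: f)
  case 0
  then show ?case by (auto intro: continuous_on_subset)
next
  case (Suc n)
  then show ?case unfolding Ck.simps by (meson has_derivative_subset subsetD)
qed

lemma Ck_const [simp]: "Ck n S (\<lambda>z. c)"
  by (induction n arbitrary: c) (auto intro!: exI[of _ "\<lambda>z v. 0"])

lemma Ck_bounded_linear: "bounded_linear f \<Longrightarrow> Ck n S f"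
proof (cases n)
  case 0
  then show "bounded_linear f \<Longrightarrow> Ck n S f"
    by (simp add: linear_continuous_on)
next
  case (Suc m)
  then show "bounded_linear f \<Longrightarrow> Ck n S f"
    by (auto intro!: exI[of _ "\<lambda>z. f"] bounded_linear_imp_has_derivative)
qed

lemma Ck_add: "Ck n S f \<Longrightarrow> Ck n S g \<Longrightarrow> Ck n S (\<lambda>z. f z + g z)"
proof (induction n arbitrary: f g)
  case 0
  then show ?case by (auto intro: continuous_intros)
next
  case (Suc n)
  then obtain f' g' where
    "\<forall>z\<in>S. (f has_derivative f' z) (at z within S)" "\<And>v. Ck n S (\<lambda>z. f' z v)"
    "\<forall>z\<in>S. (g has_derivative g' z) (at z within S)" "\<And>v. Ck n S (\<lambda>z. g' z v)"
    by auto
  with Suc.IH show ?case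
    by (auto intro!: exI[of _ "\<lambda>z v. f' z v + g' z v"] derivative_intros)
qed

lemma Ck_mult: "Ck n S f \<Longrightarrow> Ck n S g \<Longrightarrow> Ck n S (\<lambda>z. f z * g z)"
proof (induction n arbitrary: f g)
  case 0
  then show ?case by (auto intro: continuous_intros)
next
  case (Suc n)
  then obtain f' g' where
    *: "\<forall>z\<in>S. (f has_derivative f' z) (at z within S)" "\<And>v. Ck n S (\<lambda>z. f' z v)"
    "\<forall>z\<in>S. (g has_derivative g' z) (at z within S)" "\<And>v. Ck n S (\<lambda>z. g' z v)"
    by auto
  have "Ck n S (\<lambda>z. f z * g' z v + f' z v * g z)" for v
    using Suc.prems Ck_SucD * by (intro Ck_add Suc.IH) auto
  with * show ?case
    by (auto intro!: exI[of _ "\<lambda>z v. f z * g' z v + f' z v * g z"] has_derivative_mult)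
qed

lemma Ck_uminus: "Ck n S f \<Longrightarrow> Ck n S (\<lambda>z. - f z)"
  using Ck_mult[OF Ck_const[of n S "-1"]] by simp

lemma Ck_diff: "Ck n S f \<Longrightarrow> Ck n S g \<Longrightarrow> Ck n S (\<lambda>z. f z - g z)"
  using Ck_add[OF _ Ck_uminus] by fastforce

lemma Ck_inverse: "Ck n S f \<Longrightarrow> (\<And>z. z \<in> S \<Longrightarrow> f z \<noteq> 0) \<Longrightarrow> Ck n S (\<lambda>z. inverse (f z))"
proof (induction n)
  case 0
  then show ?case by (auto intro: continuous_intros)
next
  case (Suc n)
  then obtain f' where
    *: "\<forall>z\<in>S. (f has_derivative f' z) (at z within S)" "\<And>v. Ck n S (\<lambda>z. f' z v)"
    by auto
  have "Ck n S (\<lambda>z. inverse (f z))"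
    using Suc Ck_SucD by blast
  then have "Ck n S (\<lambda>z. - (inverse (f z) * f' z v * inverse (f z)))" for v
    using * by (intro Ck_uminus Ck_mult) auto
  with * show ?case using Suc.prems(2)
    by (auto intro!: exI[of _ "\<lambda>z v. - (inverse (f z) * f' z v * inverse (f z))"] has_derivative_inverse)
qed

lemma Ck_compose:
  fixes f :: "real \<Rightarrow> real"
  assumes "Ck n T f" "Ck n S u" "u ` S \<subseteq> T"
  shows "Ck n S (\<lambda>z. f (u z))"
  using assms
proof (induction n arbitrary: f)
  case 0
  then show ?case
    by (auto intro: continuous_on_compose2)
next
  case (Suc n)
  then obtain f' u' where
    *: "\<forall>z\<in>T. (f has_derivative f' z) (at z within T)" "\<And>v. Ck n T (\<lambda>z. f' z v)"
    "\<forall>z\<in>S. (u has_derivative u' z) (at z within S)" "\<And>v. Ck n S (\<lambda>z. u' z v)"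
    by auto
  have "((\<lambda>z. f (u z)) has_derivative (\<lambda>v. f' (u z) 1 * u' z v)) (at z within S)" if "z \<in> S" for z
  proof -
    have uz: "u z \<in> T" using that Suc.prems by auto
    have "((\<lambda>z. f (u z)) has_derivative (\<lambda>v. f' (u z) (u' z v))) (at z within S)"
      using * uz that Suc.prems(3) by (intro has_derivative_in_compose2[of T f f' u S z]) auto
    moreover have "f' (u z) (u' z v) = f' (u z) 1 * u' z v" for v
    proof -
      interpret bounded_linear "f' (u z)" using * uz has_derivative_bounded_linear by blast
      show ?thesis using scaleR[of "u' z v" 1] by (simp add: mult.commute)
    qed
    ultimately show ?thesis by simp
  qed
  moreover have "Ck n S (\<lambda>z. f' (u z) 1 * u' z v)" for v
    using Suc.IH[OF *(2)[of 1] Ck_SucD[OF Suc.prems(2)] Suc.prems(3)] *(4)[of v] by (rule Ck_mult)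
  ultimately show ?case
    unfolding Ck.simps by (intro exI[of _ "\<lambda>z v. f' (u z) 1 * u' z v"] conjI allI ballI)
qed

text \<open>
  The chain rule expresses the derivative by the two partial derivatives of \<open>f\<close>, which are of class
  \<open>C\<^sup>n\<close>, composed with the same inner map; hence the induction over arbitrary \<open>f\<close>.
\<close>

lemma Ck_compose2:
  fixes f :: "real \<times> real \<Rightarrow> real"
  assumes "Ck n T f" "Ck n S u" "Ck n S w" "(\<lambda>z. (u z, w z)) ` S \<subseteq> T"
  shows "Ck n S (\<lambda>z. f (u z, w z))"
  using assms
proof (induction n arbitrary: f)
  case 0
  then show ?case
    by (auto intro!: continuous_on_compose2[of T f S "\<lambda>z. (u z, w z)"] continuous_intros)
next
  case (Suc n)
  then obtain f' u' w' where
    *: "\<forall>z\<in>T. (f has_derivative f' z) (at z within T)" "\<And>v. Ck n T (\<lambda>z. f' z v)"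
    "\<forall>z\<in>S. (u has_derivative u' z) (at z within S)" "\<And>v. Ck n S (\<lambda>z. u' z v)"
    "\<forall>z\<in>S. (w has_derivative w' z) (at z within S)" "\<And>v. Ck n S (\<lambda>z. w' z v)"
    by auto
  have "((\<lambda>z. f (u z, w z)) has_derivative
      (\<lambda>v. f' (u z, w z) (1,0) * u' z v + f' (u z, w z) (0,1) * w' z v)) (at z within S)" if "z \<in> S" for z
  proof -
    have uz: "(u z, w z) \<in> T" using that Suc.prems by auto
    have "((\<lambda>z. f (u z, w z)) has_derivative (\<lambda>v. f' (u z, w z) (u' z v, w' z v))) (at z within S)"
      using * uz that Suc.prems(4)
      by (intro has_derivative_in_compose2[of T f f' "\<lambda>z. (u z, w z)" S z "\<lambda>v. (u' z v, w' z v)"])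
         (auto intro!: derivative_intros)
    moreover have "f' (u z, w z) (u' z v, w' z v) = f' (u z, w z) (1,0) * u' z v + f' (u z, w z) (0,1) * w' z v" for v
    proof -
      interpret bounded_linear "f' (u z, w z)" using * uz has_derivative_bounded_linear by blast
      have "(u' z v, w' z v) = u' z v *\<^sub>R (1,0) + w' z v *\<^sub>R (0,1)" by simp
      then show ?thesis using add scaleR by (metis mult.commute real_scaleR_def)
    qed
    ultimately show ?thesis by simp
  qed
  moreover have "Ck n S (\<lambda>z. f' (u z, w z) (1,0) * u' z v + f' (u z, w z) (0,1) * w' z v)" for v
    using Suc.prems *(2,4,6) Ck_SucD by (intro Ck_add Ck_mult Suc.IH) blast+
  ultimately show ?case
    unfolding Ck.simps
    by (intro exI[of _ "\<lambda>z v. f' (u z, w z) (1,0) * u' z v + f' (u z, w z) (0,1) * w' z v"]) blast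
qed

lemma Ck_real_SucI:
  fixes f :: "real \<Rightarrow> real"
  assumes "\<And>x. x \<in> S \<Longrightarrow> (f has_real_derivative f' x) (at x within S)" "Ck n S f'"
  shows "Ck (Suc n) S f"
  using assms unfolding Ck.simps has_field_derivative_def
  by (intro exI[of _ "\<lambda>x. (*) (f' x)"]) (auto intro: Ck_mult)

lemma Ck_real_SucE:
  fixes f :: "real \<Rightarrow> real"
  assumes "Ck (Suc n) S f"
  obtains f' where "\<And>x. x \<in> S \<Longrightarrow> (f has_real_derivative f' x) (at x within S)" "Ck n S f'"
proof -
  obtain D where D: "\<forall>z\<in>S. (f has_derivative D z) (at z within S)" "\<And>v. Ck n S (\<lambda>z. D z v)"
    using assms by auto
  have "(f has_real_derivative D x 1) (at x within S)" if "x \<in> S" for x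
  proof -
    interpret bounded_linear "D x" using D that has_derivative_bounded_linear by blast
    have "D x = (*) (D x 1)"
    proof
      fix v show "D x v = D x 1 * v" using scaleR[of v 1] by (simp add: mult.commute)
    qed
    with D that show ?thesis unfolding has_field_derivative_def by metis
  qed
  with D(2)[of 1] show ?thesis using that[of "\<lambda>z. D z 1"] by blast
qed

lemma Ck_2_imp_C2_on:
  assumes "Ck 2 S f" shows "C2_on S f"
proof -
  obtain f' where 1: "\<And>x. x \<in> S \<Longrightarrow> (f has_real_derivative f' x) (at x within S)" "Ck (Suc 0) S f'"
    using assms Ck_real_SucE unfolding numeral_2_eq_2 by blast
  obtain f'' where 2: "\<And>x. x \<in> S \<Longrightarrow> (f' has_real_derivative f'' x) (at x within S)" "Ck 0 S f''"
    using 1(2) Ck_real_SucE by blast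
  show ?thesis unfolding C2_on_def using 1(1) 2 by (intro exI[of _ f'] exI[of _ f'']) simp
qed

text \<open>
  Differentiation under the integral replaces \<open>\<phi>\<close> by its derivative and raises the exponent of \<open>t\<close>
  by one, so the induction has to carry all moments.
\<close>

lemma parametric_moment_Ck:
  fixes \<phi> :: "real \<Rightarrow> real"
  assumes "Ck n {-r<..<r} \<phi>"
  shows "Ck n {-r<..<r} (\<lambda>z. integral {0..1} (\<lambda>t. t ^ k * \<phi> (t * z)))"
  using assms
proof (induction n arbitrary: \<phi> k)
  case (0 \<phi> k)
  have "continuous_on {-r<..<r} (\<lambda>z. integral (cbox 0 1) (\<lambda>t. t ^ k * \<phi> (t * z)))"
  proof (rule integral_continuous_on_param)
    have "t * z \<in> {-r<..<r}" if "z \<in> {-r<..<r}" "t \<in> {0..1}" for t z :: real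
    proof -
      have "\<bar>t * z\<bar> \<le> \<bar>z\<bar>" using that by (simp add: abs_mult mult_left_le_one_le)
      with that show ?thesis by auto
    qed
    then show "continuous_on ({-r<..<r} \<times> cbox 0 1) (\<lambda>(z, t). t ^ k * \<phi> (t * z))"
      using 0 by (auto simp: case_prod_beta intro!: continuous_intros continuous_on_compose2[of "{-r<..<r}" \<phi>])
  qed
  then show ?case by simp
next
  case (Suc n)
  obtain f' where f': "\<And>x. x \<in> {-r<..<r} \<Longrightarrow> (\<phi> has_real_derivative f' x) (at x within {-r<..<r})"
      "Ck n {-r<..<r} f'"
    using Ck_real_SucE Suc.prems by blast
  have in': "t * z \<in> {-r<..<r}" if "z \<in> {-r<..<r}" "t \<in> {0..1}" for t z :: real
  proof -
    have "\<bar>t * z\<bar> \<le> \<bar>z\<bar>" using that by (simp add: abs_mult mult_left_le_one_le)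
    with that show ?thesis by auto
  qed
  have cphi: "continuous_on {-r<..<r} \<phi>" using Suc.prems Ck_continuous_on by blast
  have cf': "continuous_on {-r<..<r} f'" using f'(2) Ck_continuous_on by blast
  have "((\<lambda>z. integral (cbox 0 1) (\<lambda>t. t ^ k * \<phi> (t * z))) has_real_derivative
      integral (cbox 0 1) (\<lambda>t. t ^ Suc k * f' (t * z))) (at z within {-r<..<r})" if z: "z \<in> {-r<..<r}" for z
  proof (rule leibniz_rule_field_derivative[OF _ _ _ z])
    fix x t :: real assume xt: "x \<in> {-r<..<r}" "t \<in> cbox 0 1"
    have "((\<lambda>z. \<phi> (t * z)) has_real_derivative f' (t * x) * t) (at x within {-r<..<r})"
    proof -
      have "(\<phi> has_real_derivative f' (t * x)) (at (t * x))"
        using f'(1)[OF in'[OF xt(1)], of t] in'[of x t] xt at_within_open[of "t * x" "{-r<..<r}"] by simp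
      moreover have "((\<lambda>z. t * z) has_real_derivative t) (at x within {-r<..<r})"
        by (auto intro!: derivative_eq_intros)
      ultimately show ?thesis
        using DERIV_chain2 [of \<phi> "f' (t*x)" "\<lambda>z. t * z" x t "{-r<..<r}"] by blast
    qed
    from DERIV_cmult[OF this, of "t ^ k"]
    show "((\<lambda>z. t ^ k * \<phi> (t * z)) has_real_derivative t ^ Suc k * f' (t * x)) (at x within {-r<..<r})"
      by (simp add: mult_ac)
  next
    fix x :: real assume x: "x \<in> {-r<..<r}"
    show "(\<lambda>t. t ^ k * \<phi> (t * x)) integrable_on cbox 0 1"
      using x in' by (intro integrable_continuous continuous_intros continuous_on_compose2[OF cphi]) auto
  next
    show "continuous_on ({-r<..<r} \<times> cbox 0 1) (\<lambda>(z, t). t ^ Suc k * f' (t * z))"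
      using in' by (auto simp: case_prod_beta intro!: continuous_intros continuous_on_compose2[OF cf'])
  qed auto
  then show ?case using Suc.IH[OF f'(2), of "Suc k"]
    by (intro Ck_real_SucI[where f' = "\<lambda>z. integral {0..1} (\<lambda>t. t ^ Suc k * f' (t * z))"]) simp_all
qed

text \<open>
  Hadamard's lemma: \<open>f (c + z)\<close> is \<open>z\<close> times the integral of \<open>f' (c + t z)\<close> over \<open>t\<close> in \<open>[0, 1]\<close>, which
  loses only the one derivative that \<open>f'\<close> has lost.
\<close>

lemma Hadamard_quotient_Ck:
  fixes f :: "real \<Rightarrow> real"
  assumes "Ck (Suc n) {a<..<b} f" and r: "0 < r" "{c-r<..<c+r} \<subseteq> {a<..<b}" and "f c = 0"
    and d: "(f has_real_derivative d) (at c)"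
  shows "\<exists>P. Ck n {-r<..<r} P \<and> (\<forall>z\<in>{-r<..<r}. f (c + z) = z * P z) \<and> P 0 = d"
proof -
  have c: "c \<in> {a<..<b}" by (rule subsetD[OF r(2)]) (use r(1) in simp)
  obtain f' where f': "\<And>x. x \<in> {a<..<b} \<Longrightarrow> (f has_real_derivative f' x) (at x within {a<..<b})" "Ck n {a<..<b} f'"
    using Ck_real_SucE assms(1) by blast
  have f'at: "(f has_real_derivative f' x) (at x)" if "x \<in> {a<..<b}" for x
    using f'(1)[OF that] at_within_open[of x "{a<..<b}"] that by simp
  define P where "P = (\<lambda>z. integral {0..1} (\<lambda>t. t ^ 0 * f' (c + t * z)))"
  have "Ck n {-r<..<r} (\<lambda>z. f' (c + z))"
    using r by (intro Ck_compose[OF f'(2)] Ck_add Ck_const Ck_bounded_linear) (auto simp: bounded_linear_ident)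
  from parametric_moment_Ck[OF this, of 0] have "Ck n {-r<..<r} P" by (simp add: P_def)
  moreover have "f (c + z) = z * P z" if z: "z \<in> {-r<..<r}" for z
  proof -
    have in': "c + t * z \<in> {a<..<b}" if "t \<in> {0..1}" for t :: real
    proof -
      have "\<bar>t * z\<bar> \<le> \<bar>z\<bar>" using that by (simp add: abs_mult mult_left_le_one_le)
      then have "c + t * z \<in> {c-r<..<c+r}" using z by auto
      with r show ?thesis by blast
    qed
    have "((\<lambda>t. f' (c + t * z) * z) has_integral (f (c + 1 * z) - f (c + 0 * z))) {0..1}"
    proof (rule fundamental_theorem_of_calculus)
      fix t :: real assume t: "t \<in> {0..1}"
      have "((\<lambda>t. c + t * z) has_real_derivative z) (at t within {0..1})"
        by (auto intro!: derivative_eq_intros)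
      then have "((\<lambda>t. f (c + t * z)) has_real_derivative f' (c + t * z) * z) (at t within {0..1})"
        by (rule DERIV_chain2[where f = f and g = "\<lambda>t. c + t * z", OF f'at[OF in'[OF t]]])
      then show "((\<lambda>t. f (c + t * z)) has_vector_derivative f' (c + t * z) * z) (at t within {0..1})"
        by (simp add: has_real_derivative_iff_has_vector_derivative)
    qed simp
    then have "integral {0..1} (\<lambda>t. f' (c + t * z) * z) = f (c + z)"
      using integral_unique assms(4) by (simp only: mult_1 mult_zero_left add_0_right diff_zero)
    then show ?thesis by (simp add: P_def mult.commute)
  qed
  moreover have "P 0 = d"
    using DERIV_unique[OF d f'at[OF c]] by (simp add: P_def)
  ultimately show ?thesis by blast
qed

text \<open>
  The inverse function theorem for \<open>(x, t) \<mapsto> (x, F (x, t))\<close> yields a differentiable solution \<open>T\<close>. The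
  formula \<open>T' = - F\<^sub>x / F\<^sub>t\<close> along the graph then raises the regularity of \<open>T\<close> one order at a time.
\<close>

lemma implicit_function_Ck:
  fixes F :: "real \<times> real \<Rightarrow> real"
  assumes "open W" "Ck (Suc n) W F" "(0, t0) \<in> W" "F (0, t0) = 0"
    and d: "((\<lambda>t. F (0, t)) has_real_derivative d) (at t0)" "d \<noteq> 0"
  shows "\<exists>e>0. \<exists>T. Ck (Suc n) {-e<..<e} T \<and> T 0 = t0 \<and>
    (\<forall>x\<in>{-e<..<e}. (x, T x) \<in> W \<and> F (x, T x) = 0)"
proof -
  obtain F' where F'0: "\<And>z. z \<in> W \<Longrightarrow> (F has_derivative F' z) (at z within W)"
      and F'Ck: "\<And>v. Ck n W (\<lambda>z. F' z v)"
    using assms(2) by auto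
  have F': "(F has_derivative F' z) (at z)" if "z \<in> W" for z
    using F'0[OF that] at_within_open[OF that \<open>open W\<close>] by simp
  have lin: "bounded_linear (F' z)" if "z \<in> W" for z
    using F'[OF that] has_derivative_bounded_linear by blast
  have F'split: "F' z (a, b) = F' z (1, 0) * a + F' z (0, 1) * b" if "z \<in> W" for z a b
  proof -
    interpret bounded_linear "F' z" using lin that .
    have "(a, b) = a *\<^sub>R (1, 0) + b *\<^sub>R (0, 1)" by simp
    then show ?thesis by (metis add scaleR mult.commute real_scaleR_def)
  qed
  have "((\<lambda>t. F (0, t)) has_derivative (\<lambda>v. F' (0, t0) (0, v))) (at t0)"
    by (rule has_derivative_compose[of "\<lambda>t. (0::real, t)" "\<lambda>v. (0, v)" t0 UNIV F "F' (0, t0)", OF _ F'[OF assms(3)]])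
      (rule has_derivative_Pair[OF has_derivative_const has_derivative_ident])
  then have dF: "F' (0, t0) (0, 1) = d"
    using d(1) has_derivative_unique unfolding has_field_derivative_def by (metis mult.right_neutral)
  \<comment> \<open>\<open>D\<close> is the derivative of \<open>(x, t) \<mapsto> (x, F (x, t))\<close> and \<open>J\<close> the inverse of its value at \<open>(0, t0)\<close>.\<close>
  define D where "D z = Blinfun (\<lambda>v. (fst v, F' z v))" for z
  have D: "blinfun_apply (D z) = (\<lambda>v. (fst v, F' z v))" if "z \<in> W" for z
    unfolding D_def by (intro bounded_linear_Blinfun_apply bounded_linear_Pair bounded_linear_fst lin that)
  define c where "c = F' (0, t0) (1, 0)"
  define J where "J = Blinfun (\<lambda>v::real\<times>real. (fst v, (snd v - c * fst v) / d))"
  have J: "blinfun_apply J = (\<lambda>v. (fst v, (snd v - c * fst v) / d))"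
    unfolding J_def divide_inverse
    by (intro bounded_linear_Blinfun_apply bounded_linear_Pair bounded_linear_fst bounded_linear_mult_const
      bounded_linear_const_mult bounded_linear_sub bounded_linear_snd)
  have JD: "J o\<^sub>L D (0, t0) = id_blinfun"
  proof (rule blinfun_eqI)
    fix v :: "real \<times> real"
    show "(J o\<^sub>L D (0, t0)) v = id_blinfun v"
      using F'split[OF assms(3), of "fst v" "snd v"] d(2)
      by (simp add: J D[OF assms(3)] c_def dF)
  qed
  have D_cont: "continuous_on W D"
  proof (rule continuous_on_blinfun_componentwise)
    fix i :: "real \<times> real"
    have "continuous_on W (\<lambda>z. (fst i, F' z i))"
      using Ck_continuous_on[OF F'Ck] by (intro continuous_intros)
    then show "continuous_on W (\<lambda>z. blinfun_apply (D z) i)"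
      by (rule continuous_on_eq) (simp add: D)
  qed
  have D_der: "((\<lambda>z. (fst z, F z)) has_derivative blinfun_apply (D z)) (at z)" if "z \<in> W" for z
    unfolding D[OF that] using F'[OF that] by (auto intro!: derivative_intros)
  obtain U V g where U: "open U" "U \<subseteq> W" "(0, t0) \<in> U" "open V" "(fst (0, t0), F (0, t0)) \<in> V"
    "homeomorphism U V (\<lambda>z. (fst z, F z)) g"
    "\<And>y. y \<in> V \<Longrightarrow> g differentiable (at y)"
    "\<And>y. y \<in> V \<Longrightarrow> bij (blinfun_apply (D (g y)))"
  proof (rule inverse_function_theorem[OF assms(1) D_der D_cont assms(3) JD])
    fix U V g g'
    assume a: "open U" "U \<subseteq> W" "(0, t0) \<in> U" "open V" "(fst (0, t0), F (0, t0)) \<in> V"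
      "homeomorphism U V (\<lambda>z. (fst z, F z)) g"
      and b: "\<And>y. y \<in> V \<Longrightarrow> (g has_derivative (g' y)) (at y)"
      and c: "\<And>y. y \<in> V \<Longrightarrow> bij (blinfun_apply (D (g y)))"
    show ?thesis
      by (rule that[OF a differentiableI[OF b] c])
  qed
  have "(0, 0) \<in> V" using U(5) assms(4) by simp
  then obtain e where e: "0 < e" "ball (0, 0) e \<subseteq> V" using U(4) open_contains_ball by blast
  have inV: "(x, 0) \<in> V" if "x \<in> {-e<..<e}" for x
    using that e(2) by (intro subsetD[OF e(2)]) (auto simp: dist_Pair_Pair abs_less_iff)
  define T where "T x = snd (g (x, 0))" for x
  have gT: "g (x, 0) = (x, T x)" "(x, T x) \<in> W" "F (x, T x) = 0" if "x \<in> {-e<..<e}" for x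
  proof -
    have *: "g (x, 0) \<in> U" "(fst (g (x, 0)), F (g (x, 0))) = (x, 0)"
      using U(6) inV[OF that] unfolding homeomorphism_def by auto
    then show "g (x, 0) = (x, T x)" by (simp add: T_def prod_eq_iff)
    with * U(2) show "(x, T x) \<in> W" "F (x, T x) = 0" by auto
  qed
  have Fne: "F' (x, T x) (0, 1) \<noteq> 0" if "x \<in> {-e<..<e}" for x
  proof
    assume "F' (x, T x) (0, 1) = 0"
    then have "blinfun_apply (D (x, T x)) (0, 1) = blinfun_apply (D (x, T x)) 0"
      by (simp add: D[OF gT(2)[OF that]] linear_simps lin[OF gT(2)[OF that]])
    moreover have "bij (blinfun_apply (D (x, T x)))"
      using U(8)[OF inV[OF that]] gT(1)[OF that] by simp
    ultimately have "(0, 1) = (0 :: real \<times> real)" by (metis bij_is_inj injD)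
    then show False by (simp add: prod_eq_iff)
  qed
  have T': "(T has_real_derivative - (F' (x, T x) (1, 0)) * inverse (F' (x, T x) (0, 1))) (at x)" if x: "x \<in> {-e<..<e}" for x
  proof -
    obtain G where G: "(g has_derivative G) (at (x, 0))"
      using U(7)[OF inV[OF x]] unfolding differentiable_def by blast
    have "((\<lambda>x. g (x, 0)) has_derivative (\<lambda>v. G (v, 0))) (at x)"
      by (rule has_derivative_compose[of "\<lambda>x. (x, 0::real)" "\<lambda>v. (v, 0)" x UNIV g G, OF _ G])
        (rule has_derivative_Pair[OF has_derivative_ident has_derivative_const])
    then have "(T has_derivative (\<lambda>v. snd (G (v, 0)))) (at x)"
      unfolding T_def by (rule has_derivative_snd)
    then obtain t where t: "(T has_real_derivative t) (at x)"
      using differentiable_def real_differentiable_def by blast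
    then have "((\<lambda>x. (x, T x)) has_derivative (\<lambda>v. (v, t * v))) (at x)"
      unfolding has_field_derivative_def by (intro derivative_intros)
    then have d1: "((\<lambda>x. F (x, T x)) has_derivative (\<lambda>v. F' (x, T x) (v, t * v))) (at x)"
      by (rule has_derivative_compose[where g = F and f = "\<lambda>x. (x, T x)", OF _ F'[OF gT(2)[OF x]]])
    have d2: "((\<lambda>x. F (x, T x)) has_derivative (\<lambda>v. 0)) (at x)"
      by (rule has_derivative_transform_within_open[of "\<lambda>x. 0" _ x UNIV "{-e<..<e}"]) (use x gT(3) in auto)
    have "F' (x, T x) (1, t * 1) = 0"
      using fun_cong[OF has_derivative_unique[OF d1 d2], of 1] .
    then have "F' (x, T x) (1, 0) + F' (x, T x) (0, 1) * t = 0"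
      using F'split[OF gT(2)[OF x], of 1 "t * 1"] by simp
    then have "t = - (F' (x, T x) (1, 0)) * inverse (F' (x, T x) (0, 1))"
      using Fne[OF x] by (simp add: field_simps)
    with t show ?thesis by simp
  qed
  have "Ck m {-e<..<e} T" if "m \<le> Suc n" for m
    using that
  proof (induction m)
    case 0
    have "isCont T x" if "x \<in> {-e<..<e}" for x using DERIV_isCont[OF T'[OF that]] .
    then show ?case by (simp add: continuous_at_imp_continuous_on)
  next
    case (Suc m)
    have "Ck m {-e<..<e} (\<lambda>x. F' (x, T x) v)" for v
      using Suc gT(2) Ck_mono[OF F'Ck, of m]
      by (intro Ck_compose2[where T = W and f = "\<lambda>z. F' z v" and u = "\<lambda>x. x"] Ck_bounded_linear[OF bounded_linear_ident]) auto
    then show ?case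
      using T' Fne by (intro Ck_real_SucI[where f' = "\<lambda>x. - (F' (x, T x) (1, 0)) * inverse (F' (x, T x) (0, 1))"]
        Ck_mult Ck_uminus Ck_inverse) (auto intro: has_field_derivative_at_within)
  qed
  moreover have "T 0 = t0"
  proof -
    have "g (fst (0, t0), F (0, t0)) = (0, t0)" using U(3,6) unfolding homeomorphism_def by blast
    then show ?thesis by (simp add: T_def assms(4))
  qed
  ultimately show ?thesis using e(1) gT(2,3) by blast
qed

text \<open>
  Curves in \<open>\<lambda>\<^sup>2\<close> are used on the same interval of \<open>\<lambda>\<close>, which is legitimate once its radius is at most \<open>1\<close>.
\<close>

lemma square_in_interval:
  fixes x \<delta> :: real
  assumes "x \<in> {-\<delta><..<\<delta>}" "\<delta> \<le> 1" "\<delta> \<le> \<epsilon>"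
  shows "x\<^sup>2 \<in> {-\<epsilon><..<\<epsilon>}"
proof -
  have "\<bar>x\<bar> < \<delta>" using assms(1) by auto
  then have "x\<^sup>2 \<le> \<bar>x\<bar>" using assms(2) mult_left_le_one_le[of "\<bar>x\<bar>" "\<bar>x\<bar>"] by (simp add: power2_eq_square)
  with \<open>\<bar>x\<bar> < \<delta>\<close> assms(3) abs_ge_zero[of x] zero_le_power2[of x] show ?thesis
    by (simp only: greaterThanLessThan_iff) linarith
qed

text \<open>
  The parameter enters only through its square, whence the vanishing slope at \<open>0\<close>; in the second
  derivative at \<open>0\<close> only the term with both derivatives on \<open>x\<^sup>2\<close> remains.
\<close>

lemma curve_C2:
  fixes T :: "real \<Rightarrow> real" and s0 l :: real
  assumes T: "Ck 2 {-\<epsilon><..<\<epsilon>} T" and \<epsilon>: "0 < \<epsilon>" and \<delta>: "0 < \<delta>" "\<delta> \<le> 1" "\<delta> \<le> \<epsilon>"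
  defines "s \<equiv> \<lambda>x. s0 + x\<^sup>2 * T (x\<^sup>2) / l"
  shows "C2_on {-\<delta><..<\<delta>} s" "s 0 = s0" "deriv s 0 = 0" "deriv (deriv s) 0 = 2 * T 0 / l" "continuous_on {-\<delta><..<\<delta>} s"
proof -
  have sq: "x\<^sup>2 \<in> {-\<epsilon><..<\<epsilon>}" if "x \<in> {-\<delta><..<\<delta>}" for x
    using square_in_interval[OF that \<delta>(2,3)] .
  have Csq: "Ck 2 {-\<delta><..<\<delta>} (\<lambda>x. x\<^sup>2)"
    unfolding power2_eq_square by (intro Ck_mult Ck_bounded_linear bounded_linear_ident)
  have Cs: "Ck 2 {-\<delta><..<\<delta>} s"
    unfolding s_def divide_inverse using sq
    by (intro Ck_add Ck_mult Ck_const Csq Ck_compose[OF T]) auto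
  then show "C2_on {-\<delta><..<\<delta>} s" by (rule Ck_2_imp_C2_on)
  show "s 0 = s0" by (simp add: s_def)
  show "continuous_on {-\<delta><..<\<delta>} s" by (rule Ck_continuous_on[OF Cs])
  obtain T' T'' where T': "\<And>x. x \<in> {-\<epsilon><..<\<epsilon>} \<Longrightarrow> (T has_real_derivative T' x) (at x within {-\<epsilon><..<\<epsilon>})"
    "\<And>x. x \<in> {-\<epsilon><..<\<epsilon>} \<Longrightarrow> (T' has_real_derivative T'' x) (at x within {-\<epsilon><..<\<epsilon>})"
    using Ck_2_imp_C2_on[OF T] unfolding C2_on_def by metis
  have at: "at x within {-\<epsilon><..<\<epsilon>} = at x" if "x \<in> {-\<epsilon><..<\<epsilon>}" for x
    using that by (intro at_within_open) auto
  have sq': "((\<lambda>x. x\<^sup>2) has_real_derivative 2 * x) (at x)" for x :: real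
    by (auto intro!: derivative_eq_intros)
  have dT: "((\<lambda>x. T (x\<^sup>2)) has_real_derivative T' (x\<^sup>2) * (2 * x)) (at x)"
    "((\<lambda>x. T' (x\<^sup>2)) has_real_derivative T'' (x\<^sup>2) * (2 * x)) (at x)" if "x \<in> {-\<delta><..<\<delta>}" for x
    using T'(1)[OF sq[OF that]] T'(2)[OF sq[OF that]] unfolding at[OF sq[OF that]]
    by (auto intro: DERIV_chain2[OF _ sq'])
  define s' where "s' x = (2 * x * T (x\<^sup>2) + T' (x\<^sup>2) * (2 * x) * x\<^sup>2) / l" for x
  have ds: "(s has_real_derivative s' x) (at x)" if x: "x \<in> {-\<delta><..<\<delta>}" for x
  proof -
    have "(s has_real_derivative 0 + (2 * x * T (x\<^sup>2) + T' (x\<^sup>2) * (2 * x) * x\<^sup>2) / l) (at x)"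
      unfolding s_def by (intro DERIV_add DERIV_const DERIV_cdivide DERIV_mult sq' dT x)
    then show ?thesis by (simp add: s'_def)
  qed
  have 0: "0 \<in> {-\<delta><..<\<delta>}" using \<delta> by simp
  show "deriv s 0 = 0" using DERIV_imp_deriv[OF ds[OF 0]] by (simp add: s'_def)
  have "((\<lambda>x. 2 * x * T (x\<^sup>2) + T' (x\<^sup>2) * (2 * x) * x\<^sup>2) has_real_derivative 2 * T 0) (at 0)"
    using dT[OF 0] by (auto intro!: derivative_eq_intros sq')
  then have "(s' has_real_derivative 2 * T 0 / l) (at 0)"
    unfolding s'_def by (rule DERIV_cdivide)
  then have "(deriv s has_real_derivative 2 * T 0 / l) (at 0)"
    by (rule has_field_derivative_transform_within_open[of _ _ _ "{-\<delta><..<\<delta>}"]) (use 0 DERIV_imp_deriv[OF ds] in auto)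
  then show "deriv (deriv s) 0 = 2 * T 0 / l" by (rule DERIV_imp_deriv)
qed

section \<open>Power series with coefficients that depend on a second variable\<close>

definition pser :: "(nat \<Rightarrow> real \<Rightarrow> real) \<Rightarrow> real \<times> real \<Rightarrow> real" where
  "pser a z = (\<Sum>k. fst z ^ k * a k (snd z))"

text \<open>
  A form of ``the radius of convergence is at least \<open>\<rho>\<close>, uniformly for \<open>y\<close> in \<open>S\<close>'' that passes directly
  to the series obtained by termwise differentiation.
\<close>

definition coeff_bdd :: "real \<Rightarrow> real set \<Rightarrow> (nat \<Rightarrow> real \<Rightarrow> real) \<Rightarrow> bool" where
  "coeff_bdd \<rho> S a \<longleftrightarrow> (\<forall>k. continuous_on S (a k)) \<and>
     (\<forall>r. 0 < r \<and> r < \<rho> \<longrightarrow> (\<exists>M. \<forall>k. \<forall>y\<in>S. \<bar>a k y\<bar> * r ^ k \<le> M))"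

text \<open>
  The coefficients of the derivative of the power series in its expansion variable.
\<close>

definition dshift :: "(nat \<Rightarrow> real \<Rightarrow> real) \<Rightarrow> nat \<Rightarrow> real \<Rightarrow> real" where
  "dshift a = (\<lambda>k y. real (Suc k) * a (Suc k) y)"

lemma continuous_on_Icc_bounded:
  fixes f :: "real \<Rightarrow> 'b::real_normed_vector"
  assumes "continuous_on {a..b} f"
  shows "\<exists>B\<ge>0. \<forall>x\<in>{a..b}. norm (f x) \<le> B"
proof -
  have "bounded (f ` {a..b})" using compact_continuous_image[OF assms compact_Icc] compact_imp_bounded by auto
  then obtain B where "\<forall>x\<in>{a..b}. norm (f x) \<le> B" unfolding bounded_iff by auto
  then show ?thesis by (intro exI[of _ "max 0 B"]) (auto simp: le_max_iff_disj)
qed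

text \<open>
  The coefficient bound at a radius strictly between \<open>r\<close> and \<open>\<rho>\<close> gives a geometric majorant.
\<close>

lemma coeff_bdd_summable:
  assumes "coeff_bdd \<rho> S a" "0 < r" "r < \<rho>"
  obtains m where "summable m" "\<And>k x y. \<bar>x\<bar> \<le> r \<Longrightarrow> y \<in> S \<Longrightarrow> \<bar>x ^ k * a k y\<bar> \<le> m k"
proof -
  define r' where "r' = (r + \<rho>) / 2"
  have r': "r < r'" "r' < \<rho>" "0 < r'" using assms by (auto simp: r'_def)
  obtain M where M: "\<And>k y. y \<in> S \<Longrightarrow> \<bar>a k y\<bar> * r' ^ k \<le> M"
    using assms(1) r' unfolding coeff_bdd_def by blast
  show ?thesis
  proof (rule that[of "\<lambda>k. M * (r / r') ^ k"])
    show "summable (\<lambda>k. M * (r / r') ^ k)"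
      using r' assms by (intro summable_mult summable_geometric) auto
    fix k :: nat and x y :: real
    assume *: "\<bar>x\<bar> \<le> r" "y \<in> S"
    have "\<bar>x ^ k * a k y\<bar> \<le> r ^ k * \<bar>a k y\<bar>"
      using * by (auto simp: abs_mult power_abs intro!: mult_right_mono power_mono)
    also have "\<dots> = (r / r') ^ k * (\<bar>a k y\<bar> * r' ^ k)"
      using r' by (simp add: power_divide)
    also have "\<dots> \<le> (r / r') ^ k * M"
      using M[OF *(2)] r' assms by (intro mult_left_mono) auto
    finally show "\<bar>x ^ k * a k y\<bar> \<le> M * (r / r') ^ k" by (simp add: mult.commute)
  qed
qed

lemma coeff_bdd_Suc:
  assumes "coeff_bdd \<rho> S a"
  shows "coeff_bdd \<rho> S (\<lambda>k. a (Suc k))"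
  unfolding coeff_bdd_def
proof (intro conjI allI impI)
  fix r assume r: "0 < r \<and> r < \<rho>"
  then obtain M where M: "\<And>k y. y \<in> S \<Longrightarrow> \<bar>a k y\<bar> * r ^ k \<le> M"
    using assms unfolding coeff_bdd_def by blast
  have "\<bar>a (Suc k) y\<bar> * r ^ k \<le> M / r" if "y \<in> S" for k y
    using M[OF that, of "Suc k"] r by (simp add: field_simps)
  then show "\<exists>M. \<forall>k. \<forall>y\<in>S. \<bar>a (Suc k) y\<bar> * r ^ k \<le> M" by blast
qed (use assms in \<open>auto simp: coeff_bdd_def\<close>)

text \<open>
  The factor \<open>k + 1\<close> is absorbed by passing to a slightly larger radius.
\<close>

lemma coeff_bdd_dshift:
  assumes "coeff_bdd \<rho> S a"
  shows "coeff_bdd \<rho> S (dshift a)"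
  unfolding coeff_bdd_def dshift_def
proof (intro conjI allI impI)
  fix k show "continuous_on S (\<lambda>y. real (Suc k) * a (Suc k) y)"
    using assms by (intro continuous_intros) (auto simp: coeff_bdd_def)
next
  fix r assume r: "0 < r \<and> r < \<rho>"
  define r' where "r' = (r + \<rho>) / 2"
  have r': "r < r'" "r' < \<rho>" "0 < r'" using r by (auto simp: r'_def)
  obtain M where M: "\<And>k y. y \<in> S \<Longrightarrow> \<bar>a (Suc k) y\<bar> * r' ^ k \<le> M"
    using coeff_bdd_Suc[OF assms] r' unfolding coeff_bdd_def by blast
  have "(\<lambda>k. real k * (r / r') ^ k) \<longlonglongrightarrow> 0" "(\<lambda>k. (r / r') ^ k) \<longlonglongrightarrow> 0"
    using r r' by (auto intro!: powser_times_n_limit_0 LIMSEQ_power_zero)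
  from tendsto_add[OF this] have "Bseq (\<lambda>k. real (Suc k) * (r / r') ^ k)"
    by (intro convergent_imp_Bseq convergentI) (simp add: algebra_simps)
  then obtain N where N: "\<And>k. \<bar>real (Suc k) * (r / r') ^ k\<bar> \<le> N"
    unfolding Bseq_def by auto
  have "\<bar>real (Suc k) * a (Suc k) y\<bar> * r ^ k \<le> N * M" if "y \<in> S" for k y
  proof -
    have "\<bar>real (Suc k) * a (Suc k) y\<bar> * r ^ k = \<bar>real (Suc k) * (r / r') ^ k\<bar> * (\<bar>a (Suc k) y\<bar> * r' ^ k)"
      using r r' by (simp add: abs_mult power_divide)
    also have "\<dots> \<le> N * M"
      using N[of k] N[of 0] M[OF that, of k] r' r
      by (intro mult_mono) (auto intro: order_trans[OF abs_ge_zero])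
    finally show ?thesis .
  qed
  then show "\<exists>M. \<forall>k. \<forall>y\<in>S. \<bar>real (Suc k) * a (Suc k) y\<bar> * r ^ k \<le> M" by blast
qed

lemma coeff_bdd_linear:
  assumes a: "coeff_bdd \<rho> {u..v} a" and b: "coeff_bdd \<rho> {u..v} b"
    and c: "continuous_on {u..v} c" and d: "continuous_on {u..v} d"
  shows "coeff_bdd \<rho> {u..v} (\<lambda>k y. c y * a k y + d y * b k y)"
  unfolding coeff_bdd_def
proof (intro conjI allI impI)
  fix k show "continuous_on {u..v} (\<lambda>y. c y * a k y + d y * b k y)"
    using a b by (intro continuous_intros c d) (auto simp: coeff_bdd_def)
next
  fix r assume r: "0 < r \<and> r < \<rho>"
  obtain B1 B2 where B: "0 \<le> B1" "\<forall>x\<in>{u..v}. \<bar>c x\<bar> \<le> B1" "0 \<le> B2" "\<forall>x\<in>{u..v}. \<bar>d x\<bar> \<le> B2"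
    using continuous_on_Icc_bounded[OF c] continuous_on_Icc_bounded[OF d] by auto
  obtain M1 M2 where M: "\<forall>k. \<forall>y\<in>{u..v}. \<bar>a k y\<bar> * r ^ k \<le> M1" "\<forall>k. \<forall>y\<in>{u..v}. \<bar>b k y\<bar> * r ^ k \<le> M2"
    using a b r unfolding coeff_bdd_def by blast
  have "\<bar>c y * a k y + d y * b k y\<bar> * r ^ k \<le> B1 * M1 + B2 * M2" if y: "y \<in> {u..v}" for k y
  proof -
    have "\<bar>c y * a k y + d y * b k y\<bar> * r ^ k \<le> (\<bar>c y\<bar> * \<bar>a k y\<bar> + \<bar>d y\<bar> * \<bar>b k y\<bar>) * r ^ k"
      using r abs_triangle_ineq[of "c y * a k y" "d y * b k y"] by (intro mult_right_mono) (auto simp: abs_mult)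
    also have "\<dots> = \<bar>c y\<bar> * (\<bar>a k y\<bar> * r ^ k) + \<bar>d y\<bar> * (\<bar>b k y\<bar> * r ^ k)" by (simp add: algebra_simps)
    also have "\<dots> \<le> B1 * M1 + B2 * M2" using B M y r by (intro add_mono mult_mono) auto
    finally show ?thesis .
  qed
  then show "\<exists>M. \<forall>k. \<forall>y\<in>{u..v}. \<bar>c y * a k y + d y * b k y\<bar> * r ^ k \<le> M" by blast
qed

lemma coeff_bdd_geometric:
  assumes "\<And>k. continuous_on S (a k)" "0 < \<kappa>" "\<And>k y. y \<in> S \<Longrightarrow> \<bar>a k y\<bar> \<le> M * \<kappa> ^ k" "0 \<le> M"
  shows "coeff_bdd (1 / \<kappa>) S a"
  unfolding coeff_bdd_def
proof (intro conjI allI impI assms(1))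
  fix r assume r: "0 < r \<and> r < 1 / \<kappa>"
  have "\<bar>a k y\<bar> * r ^ k \<le> M" if "y \<in> S" for k y
  proof -
    have "\<bar>a k y\<bar> * r ^ k \<le> M * \<kappa> ^ k * r ^ k" using assms(3)[OF that] r by (intro mult_right_mono) auto
    also have "\<dots> = M * (\<kappa> * r) ^ k" by (simp add: power_mult_distrib)
    also have "\<dots> \<le> M * 1"
      using r assms(2,4) by (intro mult_left_mono power_le_one) (auto simp: field_simps)
    finally show ?thesis by simp
  qed
  then show "\<exists>M. \<forall>k. \<forall>y\<in>S. \<bar>a k y\<bar> * r ^ k \<le> M" by blast
qed

text \<open>
  Uniform convergence is only available on smaller strips; continuity and differentiability do not
  notice the restriction to such a strip.
\<close>

lemma within_strip:
  fixes x y \<rho> r :: real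
  assumes "\<bar>x\<bar> < r" "r < \<rho>"
  shows "at (x, y) within {-\<rho><..<\<rho>} \<times> S = at (x, y) within {-r<..<r} \<times> S"
proof (rule at_within_nhd[of _ "{-r<..<r} \<times> UNIV"])
  show "open ({-r<..<r} \<times> (UNIV :: real set))" by (intro open_Times) auto
  show "({-\<rho><..<\<rho>} \<times> S) \<inter> ({-r<..<r} \<times> UNIV) - {(x, y)} = ({-r<..<r} \<times> S) \<inter> ({-r<..<r} \<times> UNIV) - {(x, y)}"
    using assms by auto
qed (use assms in auto)

lemma pser_summable:
  assumes "coeff_bdd \<rho> S a" "x \<in> {-\<rho><..<\<rho>}" "y \<in> S"
  shows "summable (\<lambda>k. x ^ k * a k y)"
proof -
  have "\<bar>x\<bar> < \<rho>" using assms(2) by auto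
  then obtain r where r: "\<bar>x\<bar> < r" "r < \<rho>" using dense by blast
  then obtain m where m: "summable m" "\<And>k x y. \<bar>x\<bar> \<le> r \<Longrightarrow> y \<in> S \<Longrightarrow> \<bar>x ^ k * a k y\<bar> \<le> m k"
    using coeff_bdd_summable[OF assms(1), of r] by (metis abs_ge_zero order_le_less_trans)
  show ?thesis using r assms(3) by (intro summable_comparison_test[OF _ m(1)]) (auto intro!: m(2))
qed

lemma pser_linear:
  assumes a: "coeff_bdd \<rho> S a" and b: "coeff_bdd \<rho> S b" and x: "x \<in> {-\<rho><..<\<rho>}" and y: "y \<in> S"
  shows "pser (\<lambda>k y. c y * a k y + d y * b k y) (x, y) = c y * pser a (x, y) + d y * pser b (x, y)"
proof -
  have "(\<lambda>k. c y * (x ^ k * a k y) + d y * (x ^ k * b k y)) sums (c y * pser a (x, y) + d y * pser b (x, y))"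
    unfolding pser_def fst_conv snd_conv
    by (intro sums_add sums_mult summable_sums pser_summable[OF a x y] pser_summable[OF b x y])
  then show ?thesis unfolding pser_def by (simp add: algebra_simps sums_iff)
qed

lemma pser_at_0: "pser a (0, y) = a 0 y"
  using powser_zero[of "\<lambda>k. a k y"] by (simp add: pser_def mult.commute)

lemma pser_Suc:
  assumes "coeff_bdd \<rho> S a" "x \<in> {-\<rho><..<\<rho>}" "y \<in> S"
  shows "pser a (x, y) = a 0 y + x * pser (\<lambda>k. a (Suc k)) (x, y)"
proof -
  obtain r where r: "\<bar>x\<bar> < r" "r < \<rho>" using assms(2) by (metis abs_less_iff dense greaterThanLessThan_iff minus_less_iff)
  obtain m where m: "summable m" "\<And>k x y. \<bar>x\<bar> \<le> r \<Longrightarrow> y \<in> S \<Longrightarrow> \<bar>x ^ k * a (Suc k) y\<bar> \<le> m k"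
    using coeff_bdd_summable[OF coeff_bdd_Suc[OF assms(1)], of r] r by (metis abs_ge_zero order_le_less_trans)
  have "summable (\<lambda>k. x ^ k * a (Suc k) y)"
    using r assms(3) by (intro summable_comparison_test[OF _ m(1)]) (auto intro!: m(2))
  then have "(\<lambda>k. x * (x ^ k * a (Suc k) y)) sums (x * pser (\<lambda>k. a (Suc k)) (x, y))"
    unfolding pser_def by (auto intro!: sums_mult summable_sums)
  then have "(\<lambda>k. x ^ Suc k * a (Suc k) y) sums (x * pser (\<lambda>k. a (Suc k)) (x, y))"
    by (simp add: mult.assoc)
  from sums_Suc[OF this] show ?thesis
    unfolding pser_def by (simp add: sums_iff)
qed

lemma pser_continuous_on:
  assumes "coeff_bdd \<rho> S a"
  shows "continuous_on ({-\<rho><..<\<rho>} \<times> S) (pser a)"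
  unfolding continuous_on_eq_continuous_within
proof
  fix z assume z: "z \<in> {-\<rho><..<\<rho>} \<times> S"
  obtain r where r: "\<bar>fst z\<bar> < r" "r < \<rho>" using z by (metis abs_less_iff dense greaterThanLessThan_iff mem_Times_iff minus_less_iff)
  obtain m where m: "summable m" "\<And>k x y. \<bar>x\<bar> \<le> r \<Longrightarrow> y \<in> S \<Longrightarrow> \<bar>x ^ k * a k y\<bar> \<le> m k"
    using coeff_bdd_summable[OF assms, of r] r by (metis abs_ge_zero order_le_less_trans)
  have "uniform_limit ({-r<..<r} \<times> S) (\<lambda>n z. \<Sum>k<n. fst z ^ k * a k (snd z)) (pser a) sequentially"
    unfolding pser_def using m(2) by (intro Weierstrass_m_test[OF _ m(1)]) auto
  then have "continuous_on ({-r<..<r} \<times> S) (pser a)"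
    using assms by (intro uniform_limit_theorem[OF _ \<open>uniform_limit _ _ _ _\<close>])
      (auto intro!: always_eventually continuous_intros continuous_on_compose2[of S _ _ snd] simp: coeff_bdd_def)
  then have "continuous (at z within {-r<..<r} \<times> S) (pser a)"
    using z r unfolding continuous_on_eq_continuous_within by (auto simp: abs_less_iff)
  then show "continuous (at z within {-\<rho><..<\<rho>} \<times> S) (pser a)"
    using within_strip[OF r, of "snd z" S] by simp
qed

text \<open>
  On each strip \<open>\<bar>x\<bar> < r\<close> with \<open>r < \<rho>\<close> the two series of partial derivatives converge uniformly, so the
  series may be differentiated term by term.
\<close>

lemma pser_has_derivative:
  assumes "coeff_bdd \<rho> S a" "coeff_bdd \<rho> S a'" "convex S"
    and a': "\<And>k y. y \<in> S \<Longrightarrow> (a k has_real_derivative a' k y) (at y within S)"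
    and z: "z \<in> {-\<rho><..<\<rho>} \<times> S"
  shows "(pser a has_derivative (\<lambda>v. pser (dshift a) z * fst v + pser a' z * snd v)) (at z within {-\<rho><..<\<rho>} \<times> S)"
proof -
  obtain r where r: "\<bar>fst z\<bar> < r" "r < \<rho>" using z by (metis abs_less_iff dense greaterThanLessThan_iff mem_Times_iff minus_less_iff)
  then have r0: "0 < r" by simp
  let ?S = "{-r<..<r} \<times> S"
  obtain m where m: "summable m" "\<And>k x y. \<bar>x\<bar> \<le> r \<Longrightarrow> y \<in> S \<Longrightarrow> \<bar>x ^ k * a k y\<bar> \<le> m k"
    using coeff_bdd_summable[OF assms(1) r0 r(2)] by metis
  obtain m1 where m1: "summable m1" "\<And>k x y. \<bar>x\<bar> \<le> r \<Longrightarrow> y \<in> S \<Longrightarrow> \<bar>x ^ k * dshift a k y\<bar> \<le> m1 k"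
    using coeff_bdd_summable[OF coeff_bdd_dshift[OF assms(1)] r0 r(2)] by metis
  obtain m2 where m2: "summable m2" "\<And>k x y. \<bar>x\<bar> \<le> r \<Longrightarrow> y \<in> S \<Longrightarrow> \<bar>x ^ k * a' k y\<bar> \<le> m2 k"
    using coeff_bdd_summable[OF assms(2) r0 r(2)] by metis
  have u1: "uniform_limit ?S (\<lambda>n z. \<Sum>k<n. fst z ^ k * dshift a k (snd z)) (pser (dshift a)) sequentially"
    unfolding pser_def using m1(2) by (intro Weierstrass_m_test[OF _ m1(1)]) auto
  have u2: "uniform_limit ?S (\<lambda>n z. \<Sum>k<n. fst z ^ k * a' k (snd z)) (pser a') sequentially"
    unfolding pser_def using m2(2) by (intro Weierstrass_m_test[OF _ m2(1)]) auto
  let ?f' = "\<lambda>k z v. real k * fst z ^ (k - 1) * fst v * a k (snd z) + fst z ^ k * (a' k (snd z) * snd v)"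
  have "\<exists>g. \<forall>x\<in>?S. (\<lambda>k. fst x ^ k * a k (snd x)) sums (g x) \<and>
     (g has_derivative (\<lambda>v. pser (dshift a) x * fst v + pser a' x * snd v)) (at x within ?S)"
  proof (rule has_derivative_series[where f' = ?f'])
    show "convex ?S" using assms(3) by (intro convex_Times) auto
    show "z \<in> ?S" using z r by auto
    show "(\<lambda>k. fst z ^ k * a k (snd z)) sums pser a z"
      unfolding pser_def using z r
      by (intro summable_sums summable_comparison_test[OF _ m(1)]) (auto intro!: m(2))
  next
    fix n x assume x: "x \<in> ?S"
    have "((\<lambda>z. a n (snd z)) has_derivative (\<lambda>v. a' n (snd x) * snd v)) (at x within ?S)"
      using a' x
      by (intro has_derivative_in_compose2[of S "a n" "\<lambda>y. (*) (a' n y)" snd ?S x snd])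
        (auto simp: has_field_derivative_def intro!: derivative_intros)
    then show "((\<lambda>z. fst z ^ n * a n (snd z)) has_derivative ?f' n x) (at x within ?S)"
      by (auto intro!: derivative_eq_intros simp: algebra_simps)
  next
    fix e :: real assume e: "0 < e"
    have 1: "\<forall>\<^sub>F n in sequentially. \<forall>x\<in>?S. dist (\<Sum>k<n. fst x ^ k * dshift a k (snd x)) (pser (dshift a) x) < e / 2"
      using uniform_limitD[OF u1, of "e/2"] e by simp
    have 2: "\<forall>\<^sub>F n in sequentially. \<forall>x\<in>?S. dist (\<Sum>k<n. fst x ^ k * a' k (snd x)) (pser a' x) < e / 2"
      using uniform_limitD[OF u2, of "e/2"] e by simp
    have 3: "\<forall>x\<in>?S. \<forall>h. norm ((\<Sum>i<Suc n. ?f' i x h) - (pser (dshift a) x * fst h + pser a' x * snd h)) \<le> e * norm h"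
      if A: "\<forall>x\<in>?S. dist (\<Sum>k<n. fst x ^ k * dshift a k (snd x)) (pser (dshift a) x) < e / 2"
       "\<forall>x\<in>?S. dist (\<Sum>k<Suc n. fst x ^ k * a' k (snd x)) (pser a' x) < e / 2" for n
    proof (intro ballI allI)
      fix x h assume x: "x \<in> ?S"
      let ?s1 = "\<Sum>k<n. fst x ^ k * dshift a k (snd x)" and ?s2 = "\<Sum>k<Suc n. fst x ^ k * a' k (snd x)"
      have "(\<Sum>i<Suc n. ?f' i x h) = (\<Sum>i<Suc n. real i * fst x ^ (i - 1) * fst h * a i (snd x)) + ?s2 * snd h"
        by (simp only: sum.distrib sum_distrib_right mult.assoc)
      also have "(\<Sum>i<Suc n. real i * fst x ^ (i - 1) * fst h * a i (snd x)) = ?s1 * fst h"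
        unfolding sum.lessThan_Suc_shift sum_distrib_right dshift_def by (simp add: mult_ac)
      finally have "norm ((\<Sum>i<Suc n. ?f' i x h) - (pser (dshift a) x * fst h + pser a' x * snd h))
         = \<bar>(?s1 - pser (dshift a) x) * fst h + (?s2 - pser a' x) * snd h\<bar>"
        by (simp only: real_norm_def) (simp add: algebra_simps)
      also have "\<dots> \<le> \<bar>?s1 - pser (dshift a) x\<bar> * \<bar>fst h\<bar> + \<bar>?s2 - pser a' x\<bar> * \<bar>snd h\<bar>"
        by (rule order_trans[OF abs_triangle_ineq]) (simp only: abs_mult order_refl)
      also have "\<dots> \<le> e / 2 * norm h + e / 2 * norm h"
      proof (intro add_mono mult_mono)
        show "\<bar>fst h\<bar> \<le> norm h" "\<bar>snd h\<bar> \<le> norm h"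
          using norm_fst_le[of "fst h" "snd h"] norm_snd_le[of "snd h" "fst h"] by auto
        show "\<bar>?s1 - pser (dshift a) x\<bar> \<le> e / 2" "\<bar>?s2 - pser a' x\<bar> \<le> e / 2"
          using A(1)[rule_format, OF x] A(2)[rule_format, OF x] unfolding dist_real_def by simp_all
      qed (use e in auto)
      finally show "norm ((\<Sum>i<Suc n. ?f' i x h) - (pser (dshift a) x * fst h + pser a' x * snd h)) \<le> e * norm h"
        by simp
    qed
    have "\<forall>\<^sub>F n in sequentially. \<forall>x\<in>?S. dist (\<Sum>k<Suc n. fst x ^ k * a' k (snd x)) (pser a' x) < e / 2"
      using 2 by (subst eventually_sequentially_Suc[of "\<lambda>n. \<forall>x\<in>?S. dist (\<Sum>k<n. fst x ^ k * a' k (snd x)) (pser a' x) < e / 2"])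
    with 1 have "\<forall>\<^sub>F n in sequentially. \<forall>x\<in>?S. \<forall>h. norm ((\<Sum>i<Suc n. ?f' i x h) - (pser (dshift a) x * fst h + pser a' x * snd h)) \<le> e * norm h"
      by eventually_elim (rule 3)
    then show "\<forall>\<^sub>F n in sequentially. \<forall>x\<in>?S. \<forall>h. norm ((\<Sum>i<n. ?f' i x h) - (pser (dshift a) x * fst h + pser a' x * snd h)) \<le> e * norm h"
      by (subst (asm) eventually_sequentially_Suc)
  qed
  then obtain g where g: "\<And>x. x \<in> ?S \<Longrightarrow> (\<lambda>k. fst x ^ k * a k (snd x)) sums (g x)"
     "\<And>x. x \<in> ?S \<Longrightarrow> (g has_derivative (\<lambda>v. pser (dshift a) x * fst v + pser a' x * snd v)) (at x within ?S)"
    by blast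
  have zS: "z \<in> ?S" using z r by auto
  have "pser a x = g x" if "x \<in> ?S" for x
    using g(1)[OF that] sums_unique unfolding pser_def by metis
  then have "(pser a has_derivative (\<lambda>v. pser (dshift a) z * fst v + pser a' z * snd v)) (at z within ?S)"
    using has_derivative_transform[OF zS _ g(2)[OF zS]] by blast
  then show ?thesis
    using within_strip[OF r, of "snd z" S] by simp
qed

lemma pser_has_real_derivative:
  assumes "coeff_bdd \<rho> S a" "coeff_bdd \<rho> S a'" "convex S"
    and a': "\<And>k y. y \<in> S \<Longrightarrow> (a k has_real_derivative a' k y) (at y within S)"
    and z: "x \<in> {-\<rho><..<\<rho>}" "y \<in> S"
  shows "((\<lambda>y. pser a (x, y)) has_real_derivative pser a' (x, y)) (at y within S)"
  unfolding has_field_derivative_def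
proof (rule has_derivative_eq_rhs)
  show "((\<lambda>y. pser a (x, y)) has_derivative (\<lambda>v. pser (dshift a) (x, y) * fst (0, v) + pser a' (x, y) * snd (0::real, v))) (at y within S)"
    using pser_has_derivative[OF assms(1-4)] z
    by (intro has_derivative_in_compose2[of "{-\<rho><..<\<rho>} \<times> S" "pser a" "\<lambda>z v. pser (dshift a) z * fst v + pser a' z * snd v" "\<lambda>y. (x, y)" S y "\<lambda>v. (0, v)"])
      (auto intro!: derivative_intros derivative_eq_intros)
qed auto

text \<open>
  All derivatives of the coefficients up to order \<open>n\<close> have to obey the bound of \<open>coeff_bdd\<close> with the
  same radius; this is what makes the series \<open>C\<^sup>n\<close> in both variables jointly.
\<close>

fun coeff_Ck :: "nat \<Rightarrow> real \<Rightarrow> real set \<Rightarrow> (nat \<Rightarrow> real \<Rightarrow> real) \<Rightarrow> bool" where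
  "coeff_Ck 0 \<rho> S a \<longleftrightarrow> coeff_bdd \<rho> S a"
| "coeff_Ck (Suc n) \<rho> S a \<longleftrightarrow> coeff_bdd \<rho> S a \<and>
     (\<exists>a'. (\<forall>k. \<forall>y\<in>S. (a k has_real_derivative a' k y) (at y within S)) \<and> coeff_Ck n \<rho> S a')"

lemma coeff_Ck_bdd: "coeff_Ck n \<rho> S a \<Longrightarrow> coeff_bdd \<rho> S a"
  by (cases n) auto

lemma coeff_Ck_SucD: "coeff_Ck (Suc n) \<rho> S a \<Longrightarrow> coeff_Ck n \<rho> S a"
proof (induction n arbitrary: a)
  case (Suc n)
  then obtain a' where "coeff_bdd \<rho> S a" "\<forall>k. \<forall>y\<in>S. (a k has_real_derivative a' k y) (at y within S)"
    "coeff_Ck (Suc n) \<rho> S a'" by (metis coeff_Ck.simps(2))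
  with Suc.IH show ?case by (metis coeff_Ck.simps(2))
qed auto

lemma coeff_Ck_Suc: "coeff_Ck n \<rho> S a \<Longrightarrow> coeff_Ck n \<rho> S (\<lambda>k. a (Suc k))"
proof (induction n arbitrary: a)
  case (Suc n)
  then obtain a' where "coeff_bdd \<rho> S a" "\<forall>k. \<forall>y\<in>S. (a k has_real_derivative a' k y) (at y within S)"
    "coeff_Ck n \<rho> S a'" by auto
  with Suc.IH[of a'] show ?case by (auto intro!: coeff_bdd_Suc exI[of _ "\<lambda>k. a' (Suc k)"])
qed (auto intro: coeff_bdd_Suc)

lemma coeff_Ck_dshift: "coeff_Ck n \<rho> S a \<Longrightarrow> coeff_Ck n \<rho> S (dshift a)"
proof (induction n arbitrary: a)
  case (Suc n)
  then obtain a' where *: "coeff_bdd \<rho> S a" "\<forall>k. \<forall>y\<in>S. (a k has_real_derivative a' k y) (at y within S)"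
    "coeff_Ck n \<rho> S a'" by auto
  have "\<forall>k. \<forall>y\<in>S. (dshift a k has_real_derivative dshift a' k y) (at y within S)"
    using *(2) unfolding dshift_def by (auto intro!: DERIV_cmult simp del: of_nat_Suc)
  with * Suc.IH[of a'] show ?case by (auto intro!: coeff_bdd_dshift)
qed (auto intro: coeff_bdd_dshift)

lemma coeff_Ck_radius_mono: "coeff_Ck n \<rho> S a \<Longrightarrow> \<rho>' \<le> \<rho> \<Longrightarrow> coeff_Ck n \<rho>' S a"
proof (induction n arbitrary: a)
  case 0
  then show ?case by (simp add: coeff_bdd_def)
next
  case (Suc n)
  then obtain a' where "coeff_bdd \<rho> S a" "\<forall>k. \<forall>y\<in>S. (a k has_real_derivative a' k y) (at y within S)"
    "coeff_Ck n \<rho> S a'" by auto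
  moreover have "coeff_bdd \<rho>' S a" using \<open>coeff_bdd \<rho> S a\<close> Suc.prems(2) by (simp add: coeff_bdd_def)
  ultimately show ?case using Suc.IH[of a'] Suc.prems(2) by auto
qed

lemma pser_Ck:
  assumes "coeff_Ck n \<rho> S a" "convex S"
  shows "Ck n ({-\<rho><..<\<rho>} \<times> S) (pser a)"
  using assms(1)
proof (induction n arbitrary: a)
  case 0
  then show ?case by (simp add: pser_continuous_on)
next
  case (Suc n)
  then obtain a' where *: "coeff_bdd \<rho> S a" "\<And>k y. y\<in>S \<Longrightarrow> (a k has_real_derivative a' k y) (at y within S)"
    "coeff_Ck n \<rho> S a'" by auto
  have "Ck n ({-\<rho><..<\<rho>} \<times> S) (\<lambda>z. pser (dshift a) z * fst v + pser a' z * snd v)" for v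
    using Suc.IH[OF *(3)] Suc.IH[OF coeff_Ck_dshift[OF coeff_Ck_SucD[OF Suc.prems]]]
    by (intro Ck_add Ck_mult Ck_const)
  then show ?case
    using pser_has_derivative[OF *(1) coeff_Ck_bdd[OF *(3)] assms(2) *(2)]
    unfolding Ck.simps
    by (intro exI[of _ "\<lambda>z v. pser (dshift a) z * fst v + pser a' z * snd v"] conjI ballI allI)
qed

section \<open>Second-order initial value problems\<close>

lemma integral_exp_weight:
  fixes K c :: real
  assumes "0 < K" "0 \<le> c"
  shows "((\<lambda>t. K * exp (2 * K * t)) has_integral ((exp (2 * K * c) - 1) / 2)) {0..c}"
proof -
  have "((\<lambda>t. K * exp (2 * K * t)) has_integral (exp (2 * K * c) / 2 - exp (2 * K * 0) / 2)) {0..c}"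
    using assms
    by (intro fundamental_theorem_of_calculus)
       (auto intro!: derivative_eq_intros simp flip: has_real_derivative_iff_has_vector_derivative)
  then show ?thesis by (simp add: diff_divide_distrib)
qed

text \<open>
  Picard iteration on the whole interval at once. For the unknown \<open>w x = exp (- 2 K x) y x\<close> the Volterra
  operator is a contraction with factor \<open>1/2\<close> in the supremum norm. Only the integrated equation is
  asserted, since \<open>\<phi>\<close> need not be differentiable.
\<close>

lemma volterra_exists:
  fixes A :: "real \<Rightarrow> 'e::banach \<Rightarrow> 'e"
  assumes "0 < K" "0 \<le> L"
    and lip: "\<And>t v w. t \<in> {0..L} \<Longrightarrow> norm (A t v - A t w) \<le> K * norm (v - w)"
    and cont: "continuous_on ({0..L} \<times> UNIV) (\<lambda>(t, v). A t v)"
    and \<phi>: "continuous_on {0..L} \<phi>"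
  shows "\<exists>y. continuous_on {0..L} y \<and>
    (\<forall>x\<in>{0..L}. ((\<lambda>t. A t (y t)) has_integral (y x - \<phi> x)) {0..x})"
proof -
  \<comment> \<open>Bounded continuous functions on the line, constant outside the interval, stand for continuous functions
    on the interval; this is what the clamping below is for.\<close>
  define I where "I w t = A t (exp (2 * K * t) *\<^sub>R w t)" for w t
  define G where "G w x = exp (- 2 * K * x) *\<^sub>R (\<phi> x + integral {0..x} (I w))" for w x
  have contI: "continuous_on {0..L} (I w)" if "continuous_on {0..L} w" for w
  proof -
    have "continuous_on {0..L} (\<lambda>t. (t, exp (2 * K * t) *\<^sub>R w t))"
      by (intro continuous_intros that)
    then show ?thesis
      unfolding I_def using continuous_on_compose2[OF cont, of "{0..L}" "\<lambda>t. (t, exp (2 * K * t) *\<^sub>R w t)"]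
      by auto
  qed
  have intI: "I w integrable_on {0..x}" if "continuous_on {0..L} w" "x \<in> {0..L}" for w x
    using continuous_on_subset[OF contI[OF that(1)], of "{0..x}"] that by (intro integrable_continuous_real) auto
  have contG: "continuous_on {0..L} (G w)" if "continuous_on {0..L} w" for w
    unfolding G_def using intI[OF that, of L] \<open>0 \<le> L\<close>
    by (intro continuous_intros \<phi> indefinite_integral_continuous_1) auto
  have "\<exists>g::real \<Rightarrow>\<^sub>C 'e. \<forall>x. apply_bcontfun g x = G (apply_bcontfun w) (clamp 0 L x)" for w :: "real \<Rightarrow>\<^sub>C 'e"
  proof -
    have "continuous_on (cbox 0 L) (G (apply_bcontfun w))" using contG[of "apply_bcontfun w"] by simp
    from continuous_on_cbox_bcontfunE[OF this] show ?thesis by metis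
  qed
  then obtain T :: "(real \<Rightarrow>\<^sub>C 'e) \<Rightarrow> (real \<Rightarrow>\<^sub>C 'e)"
    where T: "\<And>w x. apply_bcontfun (T w) x = G (apply_bcontfun w) (clamp 0 L x)" by metis
  have "dist (T w) (T v) \<le> 1 / 2 * dist w v" for w v
  proof (rule dist_bound)
    fix x
    define c where "c = clamp 0 L x"
    have c: "c \<in> {0..L}" unfolding c_def using clamp_in_interval[of 0 L x] \<open>0 \<le> L\<close> by simp
    have I1: "I w integrable_on {0..c}" and I2: "I v integrable_on {0..c}" using c by (auto intro!: intI)
    have "norm (integral {0..c} (I w) - integral {0..c} (I v)) = norm (integral {0..c} (\<lambda>t. I w t - I v t))"
      by (simp add: Henstock_Kurzweil_Integration.integral_diff I1 I2)
    also have "\<dots> \<le> integral {0..c} (\<lambda>t. K * exp (2 * K * t) * dist w v)"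
    proof (rule integral_norm_bound_integral)
      show "(\<lambda>t. I w t - I v t) integrable_on {0..c}" by (intro integrable_diff I1 I2)
      show "(\<lambda>t. K * exp (2 * K * t) * dist w v) integrable_on {0..c}"
        by (intro integrable_continuous_real continuous_intros)
      fix t assume t: "t \<in> {0..c}"
      have "norm (I w t - I v t) \<le> K * norm (exp (2 * K * t) *\<^sub>R w t - exp (2 * K * t) *\<^sub>R v t)"
        unfolding I_def using t c by (intro lip) auto
      also have "\<dots> = K * exp (2 * K * t) * dist (w t) (v t)"
        by (simp add: dist_norm flip: scaleR_diff_right)
      also have "\<dots> \<le> K * exp (2 * K * t) * dist w v"
        using \<open>0 < K\<close> dist_bounded[of w t v] by (intro mult_left_mono) auto
      finally show "norm (I w t - I v t) \<le> K * exp (2 * K * t) * dist w v" .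
    qed
    also have "\<dots> = (exp (2 * K * c) - 1) / 2 * dist w v"
      using has_integral_mult_left[OF integral_exp_weight[OF \<open>0 < K\<close>, of c], of "dist w v"] c
      by (intro integral_unique) auto
    also have "\<dots> \<le> exp (2 * K * c) / 2 * dist w v"
      by (intro mult_right_mono) auto
    finally have "exp (- 2 * K * c) * norm (integral {0..c} (I w) - integral {0..c} (I v))
      \<le> exp (- 2 * K * c) * (exp (2 * K * c) / 2 * dist w v)"
      by (intro mult_left_mono) auto
    also have "\<dots> = 1 / 2 * dist w v" by (simp add: exp_minus)
    finally show "dist (T w x) (T v x) \<le> 1 / 2 * dist w v"
      unfolding T c_def[symmetric] G_def dist_norm by (simp flip: scaleR_diff_right)
  qed
  then obtain w where w: "T w = w" using banach_fix_type[of "1/2" T] by auto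
  have wG: "w x = G w x" if "x \<in> {0..L}" for x
    using T[of w x] w that by simp
  \<comment> \<open>Undo the weight.\<close>
  define y where "y x = exp (2 * K * x) *\<^sub>R w x" for x
  show ?thesis
  proof (intro exI[of _ y] conjI ballI)
    show "continuous_on {0..L} y" unfolding y_def by (intro continuous_intros continuous_on_apply_bcontfun)
    fix x assume x: "x \<in> {0..L}"
    have "y x = \<phi> x + integral {0..x} (I w)"
      unfolding y_def by (subst wG[OF x]) (simp add: G_def flip: exp_add)
    then show "((\<lambda>t. A t (y t)) has_integral (y x - \<phi> x)) {0..x}"
      using integrable_integral[OF intI[of "apply_bcontfun w" x]] x by (simp add: I_def[abs_def] y_def[abs_def])
  qed
qed

text \<open>
  If \<open>m\<close> is the maximum of \<open>exp (- 2 K x) u x\<close>, then the hypothesis at the maximum point yields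
  \<open>m \<le> M + m / 2\<close>.
\<close>

lemma gronwall_bound:
  fixes u :: "real \<Rightarrow> real"
  assumes "0 < K" "0 \<le> L" "0 \<le> M" and u: "continuous_on {0..L} u"
    and bd: "\<And>x. x \<in> {0..L} \<Longrightarrow> u x \<le> M + K * integral {0..x} u"
    and x: "x \<in> {0..L}"
  shows "u x \<le> 2 * M * exp (2 * K * L)"
proof -
  have "continuous_on {0..L} (\<lambda>x. exp (- 2 * K * x) * u x)" by (intro continuous_intros u)
  then obtain c where c: "c \<in> {0..L}" "\<And>x. x \<in> {0..L} \<Longrightarrow> exp (- 2 * K * x) * u x \<le> exp (- 2 * K * c) * u c"
    using continuous_attains_sup[of "{0..L}" "\<lambda>x. exp (- 2 * K * x) * u x"] \<open>0 \<le> L\<close> by auto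
  define m where "m = exp (- 2 * K * c) * u c"
  have um: "u t \<le> m * exp (2 * K * t)" if "t \<in> {0..L}" for t
    using c(2)[OF that] by (simp add: m_def exp_minus divide_simps mult_ac)
  have m: "m \<le> 2 * M"
  proof (cases "m \<le> 0")
    case True then show ?thesis using \<open>0 \<le> M\<close> by simp
  next
    case False
    have cu: "continuous_on {0..c} u" using c by (intro continuous_on_subset[OF u]) auto
    have "K * integral {0..c} u = integral {0..c} (\<lambda>t. K * u t)" by simp
    also have "\<dots> \<le> integral {0..c} (\<lambda>t. K * exp (2 * K * t) * m)"
    proof (rule integral_le)
      fix t assume "t \<in> {0..c}"
      then have "u t \<le> m * exp (2 * K * t)" using c by (intro um) auto
      then show "K * u t \<le> K * exp (2 * K * t) * m" using \<open>0 < K\<close> by (simp add: mult_ac)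
    qed (intro integrable_continuous_real continuous_intros cu)+
    also have "\<dots> = (exp (2 * K * c) - 1) / 2 * m"
      using has_integral_mult_left[OF integral_exp_weight[OF \<open>0 < K\<close>, of c], of m] c
      by (intro integral_unique) auto
    also have "\<dots> \<le> exp (2 * K * c) / 2 * m"
      using False by (intro mult_right_mono) auto
    finally have "u c \<le> M + exp (2 * K * c) / 2 * m"
      using bd[OF c(1)] by simp
    then have "m \<le> exp (- 2 * K * c) * (M + exp (2 * K * c) / 2 * m)"
      unfolding m_def by (intro mult_left_mono) auto
    also have "\<dots> = exp (- 2 * K * c) * M + m / 2" by (simp add: algebra_simps flip: exp_add mult.assoc)
    also have "exp (- 2 * K * c) * M \<le> 1 * M" using c \<open>0 < K\<close> \<open>0 \<le> M\<close> by (intro mult_right_mono) auto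
    finally show ?thesis by simp
  qed
  have "u x \<le> m * exp (2 * K * x)" by (rule um[OF x])
  also have "\<dots> \<le> 2 * M * exp (2 * K * x)" using m by (intro mult_right_mono) auto
  also have "\<dots> \<le> 2 * M * exp (2 * K * L)" using x \<open>0 < K\<close> \<open>0 \<le> M\<close> by (intro mult_left_mono) auto
  finally show ?thesis .
qed

text \<open>
  The equation \<open>w'' = A t w + \<psi>'\<close> as a first-order system for \<open>(w, w')\<close>. The inhomogeneity enters through its
  primitive \<open>\<psi>\<close>, so that it may be any integrable function.
\<close>

lemma second_order_exists:
  fixes A :: "real \<Rightarrow> 'e::banach \<Rightarrow> 'e"
  assumes "0 \<le> K" "0 \<le> L"
    and lip: "\<And>t v w. t \<in> {0..L} \<Longrightarrow> norm (A t v - A t w) \<le> K * norm (v - w)"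
    and cont: "continuous_on ({0..L} \<times> UNIV) (\<lambda>(t, v). A t v)"
    and \<psi>: "continuous_on {0..L} \<psi>"
  shows "\<exists>w w'. continuous_on {0..L} w \<and> continuous_on {0..L} w' \<and>
    (\<forall>x\<in>{0..L}. (w' has_integral w x) {0..x}) \<and>
    (\<forall>x\<in>{0..L}. ((\<lambda>t. A t (w t)) has_integral (w' x - \<psi> x)) {0..x})"
proof -
  define B where "B t z = (snd z, A t (fst z))" for t and z :: "'e \<times> 'e"
  have F1: "norm (B t v - B t w) \<le> (1 + K) * norm (v - w)" if "t \<in> {0..L}" for t v w
  proof -
    have "norm (B t v - B t w) \<le> norm (snd v - snd w) + norm (A t (fst v) - A t (fst w))"
      unfolding B_def by (simp add: norm_Pair_le)
    also have "\<dots> \<le> norm (v - w) + K * norm (v - w)"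
    proof (intro add_mono order_trans[OF lip[OF that]] mult_left_mono)
      show "norm (snd v - snd w) \<le> norm (v - w)" "norm (fst v - fst w) \<le> norm (v - w)"
        by (metis norm_snd_le prod.collapse snd_diff) (metis norm_fst_le prod.collapse fst_diff)
    qed (rule \<open>0 \<le> K\<close>)
    finally show ?thesis by (simp add: algebra_simps)
  qed
  have F2: "continuous_on ({0..L} \<times> UNIV) (\<lambda>(t, v). B t v)"
  proof -
    have "continuous_on ({0..L} \<times> UNIV) (\<lambda>z. (case (fst z, fst (snd z :: 'e \<times> 'e)) of (t, v) \<Rightarrow> A t v))"
      by (rule continuous_on_compose2[OF cont]) (auto intro!: continuous_intros)
    then show ?thesis
      unfolding B_def by (auto simp: case_prod_beta intro!: continuous_intros)
  qed
  have F3: "continuous_on {0..L} (\<lambda>x. (0::'e, \<psi> x))" by (intro continuous_intros \<psi>)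
  have F0: "0 < 1 + K" using \<open>0 \<le> K\<close> by simp
  obtain y where y: "continuous_on {0..L} y"
    "\<And>x. x \<in> {0..L} \<Longrightarrow> ((\<lambda>t. B t (y t)) has_integral (y x - (0, \<psi> x))) {0..x}"
    using volterra_exists[OF F0 \<open>0 \<le> L\<close> F1 F2 F3] by blast
  show ?thesis
  proof (rule exI[of _ "\<lambda>x. fst (y x)"], rule exI[of _ "\<lambda>x. snd (y x)"], intro conjI ballI)
    fix x assume x: "x \<in> {0..L}"
    have y2: "((\<lambda>t. B t (y t)) has_integral (y x - (0, \<psi> x))) {0..x}" using y(2) x by blast
    note * = has_integral_linear[OF y2 bounded_linear_fst] has_integral_linear[OF y2 bounded_linear_snd]
    show "((\<lambda>x. snd (y x)) has_integral fst (y x)) {0..x}"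
      using *(1) by (simp add: B_def o_def)
    show "((\<lambda>t. A t (fst (y t))) has_integral (snd (y x) - \<psi> x)) {0..x}"
      using *(2) by (simp add: B_def o_def)
  qed (auto intro!: continuous_intros y)
qed

text \<open>
  Gronwall's inequality for \<open>\<bar>w\<bar> + \<bar>w'\<bar>\<close>. For \<open>M = 0\<close> it says that zero data force \<open>w = 0\<close>, which is how uniqueness is used below.
\<close>

lemma second_order_bound:
  fixes A :: "real \<Rightarrow> 'e::banach \<Rightarrow> 'e"
  assumes "0 \<le> K" "0 \<le> L" "0 \<le> M"
    and bd: "\<And>t v. t \<in> {0..L} \<Longrightarrow> norm (A t v) \<le> K * norm v"
    and w: "continuous_on {0..L} w" and w': "continuous_on {0..L} w'"
    and eq1: "\<And>x. x \<in> {0..L} \<Longrightarrow> (w' has_integral w x) {0..x}"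
    and eq2: "\<And>x. x \<in> {0..L} \<Longrightarrow> ((\<lambda>t. A t (w t)) has_integral (w' x - \<psi> x)) {0..x}"
    and \<psi>: "\<And>x. x \<in> {0..L} \<Longrightarrow> norm (\<psi> x) \<le> M"
    and x: "x \<in> {0..L}"
  shows "norm (w x) \<le> 2 * M * exp (2 * (1 + K) * L)" "norm (w' x) \<le> 2 * M * exp (2 * (1 + K) * L)"
proof -
  define u where "u x = norm (w x) + norm (w' x)" for x
  have "u x \<le> 2 * M * exp (2 * (1 + K) * L)"
  proof (rule gronwall_bound[OF _ \<open>0 \<le> L\<close> \<open>0 \<le> M\<close> _ _ x])
    show cu: "continuous_on {0..L} u" unfolding u_def by (intro continuous_intros w w')
    fix x assume x: "x \<in> {0..L}"
    have cw: "continuous_on {0..x} w" "continuous_on {0..x} w'" "continuous_on {0..x} u"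
      using x by (auto intro: continuous_on_subset[OF w] continuous_on_subset[OF w'] continuous_on_subset[OF cu])
    have "norm (w x) \<le> integral {0..x} (\<lambda>t. norm (w' t))"
      using eq1[OF x] cw by (metis integral_norm_bound_integral integral_unique integrable_continuous_real continuous_on_norm has_integral_integrable order_refl)
    moreover have "norm (w' x - \<psi> x) \<le> integral {0..x} (\<lambda>t. K * norm (w t))"
      unfolding integral_unique[OF eq2[OF x], symmetric] using x bd
      by (intro integral_norm_bound_integral has_integral_integrable[OF eq2[OF x]] integrable_continuous_real continuous_intros cw) auto
    moreover have "norm (w' x) \<le> norm (w' x - \<psi> x) + M"
      using norm_triangle_ineq[of "w' x - \<psi> x" "\<psi> x"] \<psi>[OF x] by simp
    moreover have "integral {0..x} (\<lambda>t. norm (w' t)) + integral {0..x} (\<lambda>t. K * norm (w t))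
       = integral {0..x} (\<lambda>t. norm (w' t) + K * norm (w t))"
      by (intro Henstock_Kurzweil_Integration.integral_add[symmetric] integrable_continuous_real continuous_intros cw)
    moreover have "\<dots> \<le> integral {0..x} (\<lambda>t. (1 + K) * u t)"
      unfolding u_def using \<open>0 \<le> K\<close>
      by (intro integral_le integrable_continuous_real continuous_intros cw) (auto simp: algebra_simps)
    ultimately show "u x \<le> M + (1 + K) * integral {0..x} u"
      by (simp add: u_def[abs_def])
  qed (use \<open>0 \<le> K\<close> in auto)
  then show "norm (w x) \<le> 2 * M * exp (2 * (1 + K) * L)" "norm (w' x) \<le> 2 * M * exp (2 * (1 + K) * L)"
    unfolding u_def by (smt (verit) norm_ge_zero)+
qed

text \<open>
  The initial value problem \<open>w'' + q w = f\<close>, \<open>w 0 = 0\<close>, \<open>w' 0 = a\<close> on the closed interval.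
\<close>

definition ode2 :: "real \<Rightarrow> (real \<Rightarrow> real) \<Rightarrow> (real \<Rightarrow> real) \<Rightarrow> real \<Rightarrow> (real \<Rightarrow> real) \<Rightarrow> (real \<Rightarrow> real) \<Rightarrow> bool" where
  "ode2 L q f a w w' \<longleftrightarrow> w 0 = 0 \<and> w' 0 = a \<and>
     (\<forall>x\<in>{0..L}. (w has_real_derivative w' x) (at x within {0..L}) \<and>
        (w' has_real_derivative (f x - q x * w x)) (at x within {0..L}))"

lemma ode2_continuous_on:
  assumes "ode2 L q f a w w'" shows "continuous_on {0..L} w" "continuous_on {0..L} w'"
proof -
  have "(w has_real_derivative w' x) (at x within {0..L})"
    "(w' has_real_derivative (f x - q x * w x)) (at x within {0..L})" if "x \<in> {0..L}" for x
    using assms that unfolding ode2_def by auto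
  note * = this
  show "continuous_on {0..L} w" by (rule DERIV_continuous_on[OF *(1)])
  show "continuous_on {0..L} w'" by (rule DERIV_continuous_on[OF *(2)])
qed

lemma ode2_exists:
  assumes "0 \<le> L" and q: "continuous_on {0..L} q" and f: "continuous_on {0..L} f"
  shows "\<exists>w w'. ode2 L q f a w w'"
proof -
  have "bounded (q ` {0..L})" using compact_continuous_image[OF q] compact_imp_bounded by auto
  then obtain K where K: "\<And>t. t \<in> {0..L} \<Longrightarrow> \<bar>q t\<bar> \<le> K" unfolding bounded_iff by force
  then have K0: "0 \<le> K" using \<open>0 \<le> L\<close> by (meson abs_ge_zero atLeastAtMost_iff order_refl order_trans)
  have fi: "f integrable_on {0..L}" by (rule integrable_continuous_real[OF f])
  have F1: "norm (- q t * v - - q t * w) \<le> K * norm (v - w)" if "t \<in> {0..L}" for t v w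
  proof -
    have "- q t * v - - q t * w = q t * (w - v)" by (simp add: algebra_simps)
    then show ?thesis
      using mult_right_mono[OF K[OF that] abs_ge_zero[of "w - v"]] by (simp add: abs_mult abs_minus_commute)
  qed
  have F2: "continuous_on ({0..L} \<times> UNIV) (\<lambda>(t, v). - q t * v)"
    by (auto simp: case_prod_beta intro!: continuous_intros continuous_on_compose2[OF q])
  have F3: "continuous_on {0..L} (\<lambda>x. a + integral {0..x} f)"
    by (intro continuous_intros indefinite_integral_continuous_1 fi)
  obtain w w' where w: "continuous_on {0..L} w" "continuous_on {0..L} w'"
    "\<And>x. x \<in> {0..L} \<Longrightarrow> (w' has_integral w x) {0..x}"
    "\<And>x. x \<in> {0..L} \<Longrightarrow> ((\<lambda>t. - q t * w t) has_integral (w' x - (a + integral {0..x} f))) {0..x}"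
    using second_order_exists[OF K0 \<open>0 \<le> L\<close> F1 F2 F3] by blast
  have w1: "w x = integral {0..x} w'" if "x \<in> {0..L}" for x using w(3)[OF that] by (simp add: integral_unique)
  have w2: "w' x = a + integral {0..x} (\<lambda>t. f t - q t * w t)" if "x \<in> {0..L}" for x
  proof -
    have "(f has_integral integral {0..x} f) {0..x}"
      using integrable_on_subinterval[OF fi, of 0 x] that by auto
    from has_integral_add[OF this w(4)[OF that]]
    show ?thesis by (simp add: integral_unique)
  qed
  have "ode2 L q f a w w'"
    unfolding ode2_def
  proof (intro conjI ballI)
    show "w 0 = 0" "w' 0 = a" using w1[of 0] w2[of 0] \<open>0 \<le> L\<close> by auto
    fix x assume x: "x \<in> {0..L}"
    have "((\<lambda>x. integral {0..x} w') has_real_derivative w' x) (at x within {0..L})"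
      by (rule integral_has_real_derivative[OF w(2) x])
    then show "(w has_real_derivative w' x) (at x within {0..L})"
      by (rule has_field_derivative_transform_within[OF _ zero_less_one x]) (use w1 in auto)
    have "((\<lambda>x. a + integral {0..x} (\<lambda>t. f t - q t * w t)) has_real_derivative 0 + (f x - q x * w x)) (at x within {0..L})"
      by (intro DERIV_add DERIV_const integral_has_real_derivative[OF _ x] continuous_intros f q w)
    then have "((\<lambda>x. a + integral {0..x} (\<lambda>t. f t - q t * w t)) has_real_derivative (f x - q x * w x)) (at x within {0..L})"
      by simp
    then show "(w' has_real_derivative (f x - q x * w x)) (at x within {0..L})"
      by (rule has_field_derivative_transform_within[OF _ zero_less_one x]) (use w2 in auto)
  qed
  then show ?thesis by blast
qed

lemma has_integral_of_derivative:
  fixes f f' :: "real \<Rightarrow> real"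
  assumes "\<And>x. x \<in> {0..L} \<Longrightarrow> (f has_real_derivative f' x) (at x within {0..L})" "x \<in> {0..L}"
  shows "(f' has_integral (f x - f 0)) {0..x}"
proof (rule fundamental_theorem_of_calculus)
  show "0 \<le> x" using assms(2) by simp
  fix t assume "t \<in> {0..x}"
  then have "(f has_real_derivative f' t) (at t within {0..x})"
    using assms by (intro DERIV_subset[OF assms(1)]) auto
  then show "(f has_vector_derivative f' t) (at t within {0..x})"
    by (simp add: has_real_derivative_iff_has_vector_derivative)
qed

lemma ode2_bound:
  assumes "0 \<le> L" "0 \<le> M" and q: "\<And>x. x \<in> {0..L} \<Longrightarrow> \<bar>q x\<bar> \<le> K"
    and w: "ode2 L q f a w w'" and f: "continuous_on {0..L} f" "\<And>x. x \<in> {0..L} \<Longrightarrow> \<bar>f x\<bar> \<le> M"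
    and x: "x \<in> {0..L}"
  shows "\<bar>w x\<bar> \<le> 2 * (\<bar>a\<bar> + L * M) * exp (2 * (1 + K) * L)" "\<bar>w' x\<bar> \<le> 2 * (\<bar>a\<bar> + L * M) * exp (2 * (1 + K) * L)"
proof -
  have K0: "0 \<le> K" using q[of 0] \<open>0 \<le> L\<close> by (meson abs_ge_zero atLeastAtMost_iff order_refl order_trans)
  have bd: "norm (- q t * v) \<le> K * norm v" if "t \<in> {0..L}" for t v
    using mult_right_mono[OF q[OF that] abs_ge_zero[of v]] by (simp add: abs_mult)
  have e1: "(w' has_integral w x) {0..x}" if "x \<in> {0..L}" for x
    using has_integral_of_derivative[of L w w' x] w that by (auto simp: ode2_def)
  have fi: "(f has_integral integral {0..x} f) {0..x}" if "x \<in> {0..L}" for x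
    using that by (intro integrable_integral integrable_continuous_real continuous_on_subset[OF f(1)]) auto
  have e2: "((\<lambda>t. - q t * w t) has_integral (w' x - (a + integral {0..x} f))) {0..x}" if "x \<in> {0..L}" for x
    using has_integral_diff[OF has_integral_of_derivative[of L w' "\<lambda>x. f x - q x * w x" x] fi[OF that]] w that
    by (auto simp: ode2_def algebra_simps)
  have psi: "norm (a + integral {0..x} f) \<le> \<bar>a\<bar> + L * M" if "x \<in> {0..L}" for x
  proof -
    have "norm (integral {0..x} f) \<le> M * (x - 0)"
      using that f by (intro integral_bound continuous_on_subset[OF f(1)]) auto
    also have "\<dots> \<le> L * M" using that mult_right_mono[of x L M] \<open>0 \<le> M\<close> by (simp add: mult.commute)
    finally show ?thesis by (simp add: norm_triangle_le)
  qed
  have "0 \<le> \<bar>a\<bar> + L * M" using assms by auto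
  note * = second_order_bound[OF K0 \<open>0 \<le> L\<close> this bd ode2_continuous_on[OF w] e1 e2 psi x]
  show "\<bar>w x\<bar> \<le> 2 * (\<bar>a\<bar> + L * M) * exp (2 * (1 + K) * L)" "\<bar>w' x\<bar> \<le> 2 * (\<bar>a\<bar> + L * M) * exp (2 * (1 + K) * L)"
    using *(1,2) by simp_all
qed

text \<open>
  Lagrange's identity: in the derivative of \<open>w' z - w z'\<close> the terms with \<open>q\<close> cancel. All relations between
  inner products and boundary values below come from here.
\<close>

lemma ode2_wronskian:
  assumes w: "ode2 L q f a w w'" and z: "ode2 L q k b z z'" and y: "y \<in> {0..L}"
  shows "((\<lambda>t. f t * z t - k t * w t) has_integral (w' y * z y - w y * z' y)) {0..y}"
proof -
  have "((\<lambda>t. f t * z t - k t * w t) has_integral ((w' y * z y - w y * z' y) - (w' 0 * z 0 - w 0 * z' 0))) {0..y}"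
  proof (rule has_integral_of_derivative[OF _ y])
    fix x assume x: "x \<in> {0..L}"
    have d: "(w has_real_derivative w' x) (at x within {0..L})" "(z has_real_derivative z' x) (at x within {0..L})"
      "(w' has_real_derivative (f x - q x * w x)) (at x within {0..L})" "(z' has_real_derivative (k x - q x * z x)) (at x within {0..L})"
      using w z x by (auto simp: ode2_def)
    have "((\<lambda>y. w' y * z y - w y * z' y) has_real_derivative
        (((f x - q x * w x) * z x + z' x * w' x) - (w' x * z' x + (k x - q x * z x) * w x))) (at x within {0..L})"
      by (intro DERIV_diff DERIV_mult d)
    then show "((\<lambda>y. w' y * z y - w y * z' y) has_real_derivative (f x * z x - k x * w x)) (at x within {0..L})"
      by (simp add: algebra_simps)
  qed
  then show ?thesis using w z by (simp add: ode2_def)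
qed

text \<open>
  Otherwise \<open>w\<close>, run backwards from \<open>y\<close>, would have zero initial data and hence vanish identically,
  against \<open>w' 0 = 1\<close>.
\<close>

lemma ode2_zero_slope_nonzero:
  assumes L: "0 \<le> L" and q: "continuous_on {0..L} q" and w: "ode2 L q (\<lambda>x. 0) 1 w w'" and y: "y \<in> {0..L}" and "0 < y" and "w y = 0"
  shows "w' y \<noteq> 0"
proof
  assume "w' y = 0"
  define r where "r x = w (y - x)" for x
  define r' where "r' x = - w' (y - x)" for x
  have sub: "y - x \<in> {0..L}" if "x \<in> {0..y}" for x using that y by auto
  have im: "(\<lambda>x. y - x) ` {0..y} \<subseteq> {0..L}" using sub by blast
  have "ode2 y (\<lambda>x. q (y - x)) (\<lambda>x. 0) 0 r r'"
    unfolding ode2_def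
  proof (intro conjI ballI)
    show "r 0 = 0" "r' 0 = 0" using \<open>w y = 0\<close> \<open>w' y = 0\<close> by (simp_all add: r_def r'_def)
    fix x assume x: "x \<in> {0..y}"
    have i: "((\<lambda>x. y - x) has_real_derivative -1) (at x within {0..y})" by (auto intro!: derivative_eq_intros)
    have d: "(w has_real_derivative w' (y - x)) (at (y - x) within (\<lambda>x. y - x) ` {0..y})"
      "(w' has_real_derivative (0 - q (y - x) * w (y - x))) (at (y - x) within (\<lambda>x. y - x) ` {0..y})"
      using w sub[OF x] im unfolding ode2_def by (meson DERIV_subset)+
    show "(r has_real_derivative r' x) (at x within {0..y})"
      using DERIV_image_chain[OF d(1) i] by (simp add: r_def[abs_def] r'_def o_def)
    show "(r' has_real_derivative 0 - q (y - x) * r x) (at x within {0..y})"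
      using DERIV_minus[OF DERIV_image_chain[OF d(2) i]] by (simp add: r_def r'_def[abs_def] o_def)
  qed
  moreover have "bounded (q ` {0..L})" using compact_continuous_image[OF q compact_Icc] compact_imp_bounded by auto
  then obtain K where "\<forall>x\<in>{0..L}. \<bar>q x\<bar> \<le> K" unfolding bounded_iff by auto
  then have "\<And>x. x \<in> {0..y} \<Longrightarrow> \<bar>q (y - x)\<bar> \<le> K" using sub by blast
  ultimately have "\<bar>r' y\<bar> \<le> 2 * (\<bar>0\<bar> + y * 0) * exp (2 * (1 + K) * y)"
    using \<open>0 < y\<close> by (intro ode2_bound(2)[of y 0 "\<lambda>x. q (y - x)" K "\<lambda>x. 0" 0 r r' y]) auto
  then have "w' 0 = 0" by (simp add: r'_def)
  then show False using w by (simp add: ode2_def)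
qed

text \<open>
  The equation gives the second derivative in terms of \<open>w\<close>, so \<open>w\<close> gains two derivatives over the
  coefficients.
\<close>

lemma ode2_Ck:
  assumes w: "ode2 L q f \<alpha> w w'" and q: "Ck 1 {0<..<L} q" and f: "Ck 1 {0<..<L} f"
  shows "Ck 3 {0<..<L} w"
proof -
  have d: "(w has_real_derivative w' x) (at x within {0<..<L})"
    "(w' has_real_derivative (f x - q x * w x)) (at x within {0<..<L})" if x: "x \<in> {0<..<L}" for x
  proof -
    have "x \<in> {0..L}" "{0<..<L} \<subseteq> {0..L}" using x by auto
    then show "(w has_real_derivative w' x) (at x within {0<..<L})"
      "(w' has_real_derivative (f x - q x * w x)) (at x within {0<..<L})"
      using w unfolding ode2_def by (meson DERIV_subset)+
  qed
  have "continuous_on {0<..<L} w'" using ode2_continuous_on(2)[OF w] by (rule continuous_on_subset) auto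
  then have "Ck (Suc 0) {0<..<L} w" by (intro Ck_real_SucI[OF d(1)]) auto
  then have C1: "Ck (Suc 0) {0<..<L} (\<lambda>x. f x - q x * w x)" using q f by (intro Ck_diff Ck_mult) auto
  have C2: "Ck (Suc (Suc 0)) {0<..<L} w'"
    by (rule Ck_real_SucI[where f' = "\<lambda>x. f x - q x * w x", OF _ C1]) (rule d(2))
  show ?thesis
    unfolding numeral_3_eq_3 by (rule Ck_real_SucI[where f' = w', OF _ C2]) (rule d(1))
qed

lemma rescale_in:
  fixes s :: real
  assumes "0 < s" "s * l \<le> L" "x \<in> {0..l}"
  shows "s * x \<in> {0..L}"
proof -
  have "0 \<le> s * x" "s * x \<le> s * l" using assms by auto
  with assms(2) show ?thesis by simp
qed

lemma DERIV_rescale: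
  assumes f: "(f has_real_derivative d) (at (s * x) within {0..L})" and s: "0 < s" "s * l \<le> L" and x: "x \<in> {0..l}"
  shows "((\<lambda>x. f (s * x)) has_real_derivative s * d) (at x within {0..l})"
proof -
  have "(\<lambda>x. s * x) ` {0..l} \<subseteq> {0..L}" by (rule image_subsetI) (rule rescale_in[OF s])
  then have 1: "(f has_real_derivative d) (at (s * x) within (\<lambda>x. s * x) ` {0..l})" by (rule DERIV_subset[OF f])
  have 2: "((\<lambda>x. s * x) has_real_derivative s) (at x within {0..l})" by (auto intro!: derivative_eq_intros)
  show ?thesis using DERIV_image_chain[OF 1 2] by (simp add: o_def mult.commute[of d s])
qed

lemma ode2_rescale:
  assumes w: "ode2 L q f a w w'" and s: "0 < s" "s * l \<le> L"
  shows "ode2 l (\<lambda>x. s\<^sup>2 * q (s * x)) (\<lambda>x. k * s\<^sup>2 * f (s * x)) (k * s * a) (\<lambda>x. k * w (s * x)) (\<lambda>x. k * s * w' (s * x))"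
  unfolding ode2_def
proof (intro conjI ballI)
  show "k * w (s * 0) = 0" "k * s * w' (s * 0) = k * s * a" using w by (auto simp: ode2_def)
  fix x assume x: "x \<in> {0..l}"
  have d: "(w has_real_derivative w' (s * x)) (at (s * x) within {0..L})"
    "(w' has_real_derivative f (s * x) - q (s * x) * w (s * x)) (at (s * x) within {0..L})"
    using w rescale_in[OF s x] by (auto simp: ode2_def)
  show "((\<lambda>x. k * w (s * x)) has_real_derivative k * s * w' (s * x)) (at x within {0..l})"
    using DERIV_cmult[OF DERIV_rescale[OF d(1) s x], of k] by (simp add: mult_ac)
  have "((\<lambda>x. k * s * w' (s * x)) has_real_derivative k * s * (s * (f (s * x) - q (s * x) * w (s * x)))) (at x within {0..l})"
    by (rule DERIV_cmult[OF DERIV_rescale[OF d(2) s x]])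
  then show "((\<lambda>x. k * s * w' (s * x)) has_real_derivative k * s\<^sup>2 * f (s * x) - s\<^sup>2 * q (s * x) * (k * w (s * x))) (at x within {0..l})"
    by (simp add: power2_eq_square algebra_simps)
qed

lemma ode2_cong: "ode2 L q f a w w' \<Longrightarrow> (\<And>x. x \<in> {0..L} \<Longrightarrow> f x = k x) \<Longrightarrow> a = b \<Longrightarrow> ode2 L q k b w w'"
  by (simp add: ode2_def)

section \<open>Solutions of the coupled system as power series\<close>

text \<open>
  The equations for \<open>a 0, b 0, a 1, b 1, \<dots>\<close> are solved one after the other: each inhomogeneity is the
  previous solution.
\<close>

lemma ode2_family:
  fixes g h :: "real \<Rightarrow> real"
  assumes L: "0 \<le> L" and g: "continuous_on {0..L} g" and h: "continuous_on {0..L} h"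
  shows "\<exists>a a' b b'. ode2 L g (\<lambda>x. 0) 1 (a 0) (a' 0) \<and>
    (\<forall>n. ode2 L h (\<lambda>x. \<sigma> * a n x) 0 (b n) (b' n)) \<and>
    (\<forall>n. ode2 L g (\<lambda>x. - \<sigma> * b n x) 0 (a (Suc n)) (a' (Suc n)))"
proof -
  \<comment> \<open>The state at step \<open>n\<close> consists of \<open>a n\<close>, \<open>a' n\<close>, \<open>b n\<close>, \<open>b' n\<close>; \<open>P\<close> is the invariant and \<open>Q\<close> links consecutive states.\<close>
  define P where "P n t = (case t of (a, a', b, b') \<Rightarrow> (n = (0::nat) \<longrightarrow> ode2 L g (\<lambda>x. 0) 1 a a') \<and>
     continuous_on {0..L} a \<and> ode2 L h (\<lambda>x. \<sigma> * a x) 0 b b')" for n t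
  define Q where "Q n t t' = (case t of (a, a', b, b') \<Rightarrow> case t' of (c, c', d, d') \<Rightarrow> ode2 L g (\<lambda>x. - \<sigma> * b x) 0 c c')" for n :: nat and t t'
    :: "(real \<Rightarrow> real) \<times> (real \<Rightarrow> real) \<times> (real \<Rightarrow> real) \<times> (real \<Rightarrow> real)"
  have "\<exists>t. P 0 t"
  proof -
    obtain a a' where a: "ode2 L g (\<lambda>x. 0) 1 a a'" using ode2_exists[OF L g continuous_on_const] by blast
    have "continuous_on {0..L} (\<lambda>x. \<sigma> * a x)" by (intro continuous_intros ode2_continuous_on[OF a])
    from ode2_exists[OF L h this] obtain b b' where "ode2 L h (\<lambda>x. \<sigma> * a x) 0 b b'" by blast
    with a ode2_continuous_on[OF a] show ?thesis by (intro exI[of _ "(a, a', b, b')"]) (simp add: P_def)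
  qed
  moreover have "\<exists>t'. P (Suc n) t' \<and> Q n t t'" if "P n t" for n t
  proof -
    obtain a a' b b' where t: "t = (a, a', b, b')" by (cases t) auto
    have b: "ode2 L h (\<lambda>x. \<sigma> * a x) 0 b b'" using that by (simp add: P_def t)
    have "continuous_on {0..L} (\<lambda>x. - \<sigma> * b x)" by (intro continuous_intros ode2_continuous_on[OF b])
    from ode2_exists[OF L g this] obtain c c' where c: "ode2 L g (\<lambda>x. - \<sigma> * b x) 0 c c'" by blast
    have "continuous_on {0..L} (\<lambda>x. \<sigma> * c x)" by (intro continuous_intros ode2_continuous_on[OF c])
    from ode2_exists[OF L h this] obtain d d' where "ode2 L h (\<lambda>x. \<sigma> * c x) 0 d d'" by blast
    with c ode2_continuous_on[OF c] show ?thesis by (intro exI[of _ "(c, c', d, d')"]) (simp add: P_def Q_def t)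
  qed
  ultimately obtain f where f: "\<forall>n. P n (f n) \<and> Q n (f n) (f (Suc n))"
    using dependent_nat_choice[of P Q] by blast
  show ?thesis
  proof (rule exI[of _ "\<lambda>n. fst (f n)"], rule exI[of _ "\<lambda>n. fst (snd (f n))"],
      rule exI[of _ "\<lambda>n. fst (snd (snd (f n)))"], rule exI[of _ "\<lambda>n. snd (snd (snd (f n)))"], intro conjI allI)
    show "ode2 L g (\<lambda>x. 0) 1 (fst (f 0)) (fst (snd (f 0)))"
      using conjunct1[OF f[rule_format, of 0]] by (simp add: P_def case_prod_beta)
    fix n
    show "ode2 L h (\<lambda>x. \<sigma> * fst (f n) x) 0 (fst (snd (snd (f n)))) (snd (snd (snd (f n))))"
      using conjunct1[OF f[rule_format, of n]] by (simp add: P_def case_prod_beta)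
    show "ode2 L g (\<lambda>x. - \<sigma> * fst (snd (snd (f n))) x) 0 (fst (f (Suc n))) (fst (snd (f (Suc n))))"
      using conjunct2[OF f[rule_format, of n]] by (simp add: Q_def case_prod_beta)
  qed
qed

text \<open>
  With \<open>x = \<lambda>\<^sup>2\<close> the functions \<open>A = pser a\<close> and \<open>B = pser b\<close> solve \<open>A'' = - g A - \<sigma> x B\<close>, \<open>B'' = \<sigma> A - h B\<close> with
  \<open>(A, A', B, B') = (0, 1, 0, 0)\<close> at \<open>y = 0\<close>. For \<open>\<sigma> = 1\<close> this makes \<open>(A, \<lambda> B)\<close> a solution of
  \<open>U'' = - g U - \<lambda> V\<close>, \<open>V'' = - h V + \<lambda> U\<close>; for \<open>\<sigma> = -1\<close> and with \<open>g\<close> and \<open>h\<close> exchanged, \<open>(\<lambda> B, A)\<close> is one. The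
  equations of the lowest coefficients are recorded as well, because they determine the determinant
  to leading order.
\<close>

definition analytic_pair :: "real \<Rightarrow> (real \<Rightarrow> real) \<Rightarrow> (real \<Rightarrow> real) \<Rightarrow> real \<Rightarrow> real \<Rightarrow> (nat \<Rightarrow> real \<Rightarrow> real)
    \<Rightarrow> (nat \<Rightarrow> real \<Rightarrow> real) \<Rightarrow> (nat \<Rightarrow> real \<Rightarrow> real) \<Rightarrow> (nat \<Rightarrow> real \<Rightarrow> real) \<Rightarrow> bool" where
  "analytic_pair L g h \<sigma> \<rho> a a' b b' \<longleftrightarrow> 0 < \<rho> \<and> coeff_Ck 2 \<rho> {0..L} a \<and> coeff_Ck 2 \<rho> {0..L} b \<and>
     ode2 L g (\<lambda>x. 0) 1 (a 0) (a' 0) \<and> ode2 L h (\<lambda>x. \<sigma> * a 0 x) 0 (b 0) (b' 0) \<and>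
     ode2 L g (\<lambda>x. - \<sigma> * b 0 x) 0 (a 1) (a' 1) \<and>
     (\<forall>x\<in>{-\<rho><..<\<rho>}. pser a (x, 0) = 0 \<and> pser b (x, 0) = 0 \<and> pser a' (x, 0) = 1 \<and> pser b' (x, 0) = 0 \<and>
       (\<forall>y\<in>{0..L}. ((\<lambda>y. pser a (x, y)) has_real_derivative pser a' (x, y)) (at y within {0..L}) \<and>
         ((\<lambda>y. pser b (x, y)) has_real_derivative pser b' (x, y)) (at y within {0..L}) \<and>
         ((\<lambda>y. pser a' (x, y)) has_real_derivative (- g y * pser a (x, y) - \<sigma> * (x * pser b (x, y)))) (at y within {0..L}) \<and>
         ((\<lambda>y. pser b' (x, y)) has_real_derivative (\<sigma> * pser a (x, y) - h y * pser b (x, y))) (at y within {0..L})))"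

lemma analytic_pair_radius_mono:
  assumes "analytic_pair L g h \<sigma> \<rho> a a' b b'" "0 < \<rho>'" "\<rho>' \<le> \<rho>"
  shows "analytic_pair L g h \<sigma> \<rho>' a a' b b'"
proof -
  have "coeff_Ck 2 \<rho>' {0..L} a" "coeff_Ck 2 \<rho>' {0..L} b"
    using assms(1) coeff_Ck_radius_mono[OF _ assms(3)] unfolding analytic_pair_def by auto
  moreover have "{-\<rho>'<..<\<rho>'} \<subseteq> {-\<rho><..<\<rho>}" using assms(3) by auto
  ultimately show ?thesis using assms(1,2) unfolding analytic_pair_def by blast
qed

text \<open>
  Each step of the recursion multiplies the supremum norms of a solution and of its derivative by at
  most a constant \<open>\<kappa>\<close>, so the \<open>k\<close>-th coefficients are of size \<open>\<kappa>\<^sup>2\<^sup>k\<close> up to a constant and the series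
  converge for \<open>\<bar>x\<bar> < 1 / \<kappa>\<^sup>2\<close>.
\<close>

lemma analytic_pair_exists:
  fixes g h :: "real \<Rightarrow> real"
  assumes L: "0 \<le> L" and g: "continuous_on {0..L} g" and h: "continuous_on {0..L} h" and \<sigma>: "\<bar>\<sigma>\<bar> \<le> 1"
  shows "\<exists>\<rho> a a' b b'. analytic_pair L g h \<sigma> \<rho> a a' b b'"
proof -
  obtain a a' b b' where a0: "ode2 L g (\<lambda>x. 0) 1 (a 0) (a' 0)"
    and b: "\<And>n. ode2 L h (\<lambda>x. \<sigma> * a n x) 0 (b n) (b' n)"
    and aS: "\<And>n. ode2 L g (\<lambda>x. - \<sigma> * b n x) 0 (a (Suc n)) (a' (Suc n))"
    using ode2_family[OF L g h, of \<sigma>] by blast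
  obtain K1 K2 where K12: "0 \<le> K1" "\<forall>x\<in>{0..L}. \<bar>g x\<bar> \<le> K1" "0 \<le> K2" "\<forall>x\<in>{0..L}. \<bar>h x\<bar> \<le> K2"
    using continuous_on_Icc_bounded[OF g] continuous_on_Icc_bounded[OF h] by auto
  define K where "K = K1 + K2"
  have K: "\<bar>g x\<bar> \<le> K" "\<bar>h x\<bar> \<le> K" if "x \<in> {0..L}" for x
    using bspec[OF K12(2) that] bspec[OF K12(4) that] K12(1,3) unfolding K_def by linarith+
  have K0: "0 \<le> K" using K12 by (simp add: K_def)
  \<comment> \<open>The constant of \<open>ode2_bound\<close> with room for initial slope \<open>1\<close> and for an inhomogeneity on \<open>[0, L]\<close>.\<close>
  define \<kappa> where "\<kappa> = 2 * (1 + L) * exp (2 * (1 + K) * L)"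
  have \<kappa>1: "1 \<le> \<kappa>"
  proof -
    have "1 * 1 \<le> (2 * (1 + L)) * exp (2 * (1 + K) * L)" using L K0 by (intro mult_mono) auto
    then show ?thesis by (simp add: \<kappa>_def)
  qed
  have \<kappa>le: "2 * (\<bar>t\<bar> + L * M) * exp (2 * (1 + K) * L) \<le> \<kappa> * N" if "\<bar>t\<bar> + L * M \<le> (1 + L) * N" for t M N
  proof -
    have "(\<bar>t\<bar> + L * M) * (2 * exp (2 * (1 + K) * L)) \<le> (1 + L) * N * (2 * exp (2 * (1 + K) * L))"
      using that by (intro mult_right_mono) auto
    then show ?thesis by (simp only: \<kappa>_def mult_ac)
  qed
  have ca: "continuous_on {0..L} (a n)" "continuous_on {0..L} (a' n)" for n
    using ode2_continuous_on[OF a0] ode2_continuous_on[OF aS] by (cases n; simp)+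
  have cb: "continuous_on {0..L} (b n)" "continuous_on {0..L} (b' n)" for n
    using ode2_continuous_on[OF b] by simp_all
  have stepb: "\<bar>b n x\<bar> \<le> \<kappa> * N \<and> \<bar>b' n x\<bar> \<le> \<kappa> * N" if "\<And>x. x \<in> {0..L} \<Longrightarrow> \<bar>a n x\<bar> \<le> N" "x \<in> {0..L}" "0 \<le> N" for n x N
  proof -
    have f: "\<bar>\<sigma> * a n x\<bar> \<le> N" if "x \<in> {0..L}" for x
      using mult_mono[OF \<sigma> \<open>\<And>x. x \<in> {0..L} \<Longrightarrow> \<bar>a n x\<bar> \<le> N\<close>[OF that]] by (simp add: abs_mult)
    have c: "continuous_on {0..L} (\<lambda>x. \<sigma> * a n x)" by (intro continuous_intros ca)
    have "L * N \<le> (1 + L) * N" using that L by (intro mult_right_mono) auto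
    then have "2 * (\<bar>0\<bar> + L * N) * exp (2 * (1 + K) * L) \<le> \<kappa> * N" by (intro \<kappa>le) simp
    with ode2_bound[OF L \<open>0 \<le> N\<close> K(2) b c f that(2)] show ?thesis by (meson order_trans)
  qed
  have stepa: "\<bar>a (Suc n) x\<bar> \<le> \<kappa> * N \<and> \<bar>a' (Suc n) x\<bar> \<le> \<kappa> * N" if "\<And>x. x \<in> {0..L} \<Longrightarrow> \<bar>b n x\<bar> \<le> N" "x \<in> {0..L}" "0 \<le> N" for n x N
  proof -
    have f: "\<bar>- \<sigma> * b n x\<bar> \<le> N" if "x \<in> {0..L}" for x
      using mult_mono[OF \<sigma> \<open>\<And>x. x \<in> {0..L} \<Longrightarrow> \<bar>b n x\<bar> \<le> N\<close>[OF that]] by (simp add: abs_mult)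
    have c: "continuous_on {0..L} (\<lambda>x. - \<sigma> * b n x)" by (intro continuous_intros cb)
    have "L * N \<le> (1 + L) * N" using that L by (intro mult_right_mono) auto
    then have "2 * (\<bar>0\<bar> + L * N) * exp (2 * (1 + K) * L) \<le> \<kappa> * N" by (intro \<kappa>le) simp
    with ode2_bound[OF L \<open>0 \<le> N\<close> K(1) aS c f that(2)] show ?thesis by (meson order_trans)
  qed
  have ab: "\<forall>x\<in>{0..L}. \<bar>a n x\<bar> \<le> \<kappa> * (\<kappa>\<^sup>2) ^ n \<and> \<bar>a' n x\<bar> \<le> \<kappa> * (\<kappa>\<^sup>2) ^ n \<and>
     \<bar>b n x\<bar> \<le> \<kappa>\<^sup>2 * (\<kappa>\<^sup>2) ^ n \<and> \<bar>b' n x\<bar> \<le> \<kappa>\<^sup>2 * (\<kappa>\<^sup>2) ^ n" for n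
  proof (induction n)
    case 0
    have "\<bar>1\<bar> + L * 0 \<le> (1 + L) * 1" using L by simp
    note * = \<kappa>le[OF this]
    have A: "\<bar>a 0 x\<bar> \<le> \<kappa> \<and> \<bar>a' 0 x\<bar> \<le> \<kappa>" if x: "x \<in> {0..L}" for x
    proof -
      have "\<bar>a 0 x\<bar> \<le> 2 * (\<bar>1\<bar> + L * 0) * exp (2 * (1 + K) * L)" "\<bar>a' 0 x\<bar> \<le> 2 * (\<bar>1\<bar> + L * 0) * exp (2 * (1 + K) * L)"
        by (rule ode2_bound[OF L order_refl K(1) a0 continuous_on_const _ x]; simp)+
      with * show ?thesis by linarith
    qed
    with stepb[of 0 \<kappa>] \<kappa>1 show ?case by (simp add: power2_eq_square)
  next
    case (Suc n)
    have p: "0 \<le> \<kappa>\<^sup>2 * (\<kappa>\<^sup>2) ^ n" by simp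
    have A: "\<bar>a (Suc n) x\<bar> \<le> \<kappa> * (\<kappa>\<^sup>2 * (\<kappa>\<^sup>2) ^ n) \<and> \<bar>a' (Suc n) x\<bar> \<le> \<kappa> * (\<kappa>\<^sup>2 * (\<kappa>\<^sup>2) ^ n)" if "x \<in> {0..L}" for x
      using stepa[of n _ x] Suc p that by blast
    have p': "0 \<le> \<kappa> * (\<kappa>\<^sup>2 * (\<kappa>\<^sup>2) ^ n)" using \<kappa>1 by simp
    have B: "\<bar>b (Suc n) x\<bar> \<le> \<kappa> * (\<kappa> * (\<kappa>\<^sup>2 * (\<kappa>\<^sup>2) ^ n)) \<and> \<bar>b' (Suc n) x\<bar> \<le> \<kappa> * (\<kappa> * (\<kappa>\<^sup>2 * (\<kappa>\<^sup>2) ^ n))" if "x \<in> {0..L}" for x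
      using stepb[of "Suc n" _ x] A p' that by blast
    have "\<kappa> * (\<kappa> * (\<kappa>\<^sup>2 * (\<kappa>\<^sup>2) ^ n)) = \<kappa>\<^sup>2 * (\<kappa>\<^sup>2) ^ Suc n" by (simp add: power2_eq_square mult_ac)
    with A B show ?case by simp
  qed
  define \<rho> where "\<rho> = 1 / \<kappa>\<^sup>2"
  have \<rho>: "0 < \<rho>" using \<kappa>1 by (simp add: \<rho>_def)
  have k2: "0 < \<kappa>\<^sup>2" "0 \<le> \<kappa>" using \<kappa>1 by auto
  have bda: "coeff_bdd \<rho> {0..L} a" unfolding \<rho>_def using ab k2 by (intro coeff_bdd_geometric[of _ _ _ \<kappa>] ca) auto
  have bda': "coeff_bdd \<rho> {0..L} a'" unfolding \<rho>_def using ab k2 by (intro coeff_bdd_geometric[of _ _ _ \<kappa>] ca) auto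
  have bdb: "coeff_bdd \<rho> {0..L} b" unfolding \<rho>_def using ab k2 by (intro coeff_bdd_geometric[of _ _ _ "\<kappa>\<^sup>2"] cb) auto
  have bdb': "coeff_bdd \<rho> {0..L} b'" unfolding \<rho>_def using ab k2 by (intro coeff_bdd_geometric[of _ _ _ "\<kappa>\<^sup>2"] cb) auto
  \<comment> \<open>The coefficients of \<open>x * pser b\<close>, which occur in the equation for \<open>pser a\<close>.\<close>
  define bs where "bs k = (case k of 0 \<Rightarrow> (\<lambda>y. 0) | Suc j \<Rightarrow> b j)" for k
  have bdbs: "coeff_bdd \<rho> {0..L} bs"
    unfolding \<rho>_def
  proof (rule coeff_bdd_geometric[where M = 1])
    show "continuous_on {0..L} (bs k)" for k using cb by (cases k) (auto simp: bs_def)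
    show "\<bar>bs k y\<bar> \<le> 1 * (\<kappa>\<^sup>2) ^ k" if "y \<in> {0..L}" for k y
      using ab that by (cases k) (auto simp: bs_def)
  qed (use k2 in auto)
  define a'' where "a'' k y = - g y * a k y + (- \<sigma>) * bs k y" for k y
  define b'' where "b'' k y = \<sigma> * a k y + (- h y) * b k y" for k y
  have bda'': "coeff_bdd \<rho> {0..L} a''"
    unfolding a''_def[abs_def] by (intro coeff_bdd_linear bda bdbs continuous_intros g)
  have bdb'': "coeff_bdd \<rho> {0..L} b''"
    unfolding b''_def[abs_def] by (intro coeff_bdd_linear bda bdb continuous_intros h)
  have da: "(a k has_real_derivative a' k y) (at y within {0..L})" "(a' k has_real_derivative a'' k y) (at y within {0..L})" if "y \<in> {0..L}" for k y
    using a0 aS that by (cases k; auto simp: ode2_def a''_def bs_def algebra_simps)+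
  have db: "(b k has_real_derivative b' k y) (at y within {0..L})" "(b' k has_real_derivative b'' k y) (at y within {0..L})" if "y \<in> {0..L}" for k y
    using b[of k] that by (auto simp: ode2_def b''_def algebra_simps)
  have Cka: "coeff_Ck 2 \<rho> {0..L} a"
    unfolding numeral_2_eq_2 coeff_Ck.simps using da bda bda' bda'' by (intro conjI exI[of _ a'] exI[of _ a'']) auto
  have Ckb: "coeff_Ck 2 \<rho> {0..L} b"
    unfolding numeral_2_eq_2 coeff_Ck.simps using db bdb bdb' bdb'' by (intro conjI exI[of _ b'] exI[of _ b'']) auto
  have cx: "convex {0..L}" by simp
  have z0: "(0::real) \<in> {0..L}" using L by simp
  have main: "pser a (x, 0) = 0 \<and> pser b (x, 0) = 0 \<and> pser a' (x, 0) = 1 \<and> pser b' (x, 0) = 0 \<and>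
       (\<forall>y\<in>{0..L}. ((\<lambda>y. pser a (x, y)) has_real_derivative pser a' (x, y)) (at y within {0..L}) \<and>
         ((\<lambda>y. pser b (x, y)) has_real_derivative pser b' (x, y)) (at y within {0..L}) \<and>
         ((\<lambda>y. pser a' (x, y)) has_real_derivative (- g y * pser a (x, y) - \<sigma> * (x * pser b (x, y)))) (at y within {0..L}) \<and>
         ((\<lambda>y. pser b' (x, y)) has_real_derivative (\<sigma> * pser a (x, y) - h y * pser b (x, y))) (at y within {0..L}))"
    if x: "x \<in> {-\<rho><..<\<rho>}" for x
  proof (intro conjI ballI)
    have "a k 0 = 0" "b k 0 = 0" "b' k 0 = 0" for k using a0 aS b by (cases k; auto simp: ode2_def)+
    then show "pser a (x, 0) = 0" "pser b (x, 0) = 0" "pser b' (x, 0) = 0" by (simp_all add: pser_def)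
    have "a' 0 0 = 1" "a' (Suc k) 0 = 0" for k using a0 aS by (auto simp: ode2_def)
    then show "pser a' (x, 0) = 1"
      using pser_Suc[OF bda' x z0] by (simp add: pser_def)
    fix y assume y: "y \<in> {0..L}"
    show "((\<lambda>y. pser a (x, y)) has_real_derivative pser a' (x, y)) (at y within {0..L})"
      by (rule pser_has_real_derivative[OF bda bda' cx da(1) x y])
    show "((\<lambda>y. pser b (x, y)) has_real_derivative pser b' (x, y)) (at y within {0..L})"
      by (rule pser_has_real_derivative[OF bdb bdb' cx db(1) x y])
    have bs: "pser bs (x, y) = x * pser b (x, y)"
      using pser_Suc[OF bdbs x y] by (simp add: bs_def[abs_def])
    have "pser a'' (x, y) = - g y * pser a (x, y) + (- \<sigma>) * pser bs (x, y)"
      unfolding a''_def[abs_def] by (rule pser_linear[OF bda bdbs x y])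
    with bs pser_has_real_derivative[OF bda' bda'' cx da(2) x y]
    show "((\<lambda>y. pser a' (x, y)) has_real_derivative (- g y * pser a (x, y) - \<sigma> * (x * pser b (x, y)))) (at y within {0..L})"
      by simp
    have "pser b'' (x, y) = \<sigma> * pser a (x, y) + (- h y) * pser b (x, y)"
      unfolding b''_def[abs_def] by (rule pser_linear[OF bda bdb x y])
    with pser_has_real_derivative[OF bdb' bdb'' cx db(2) x y]
    show "((\<lambda>y. pser b' (x, y)) has_real_derivative (\<sigma> * pser a (x, y) - h y * pser b (x, y))) (at y within {0..L})"
      by simp
  qed
  have a1: "ode2 L g (\<lambda>x. - \<sigma> * b 0 x) 0 (a 1) (a' 1)" using aS[of 0] by simp
  show ?thesis
    unfolding analytic_pair_def
    by (rule exI[of _ \<rho>], rule exI[of _ a], rule exI[of _ a'], rule exI[of _ b], rule exI[of _ b'])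
      (intro conjI \<rho> Cka Ckb a0 b a1 ballI main)
qed

section \<open>Blow-up at a double zero of the determinant\<close>

text \<open>
  On the line \<open>y = y0 + x t\<close> the whole series is divisible by \<open>x\<close>: in the coefficient of order \<open>0\<close> by
  Hadamard's lemma, since it vanishes at \<open>y0\<close>, and in the rest by the explicit factor.
\<close>

lemma pser_blow_up:
  assumes Ca: "coeff_Ck 2 \<rho> {0..L} a" and \<rho>: "0 < \<rho>" and Ka: "Ck 3 {0<..<L} (a 0)"
    and r: "0 < r" "{y0 - r<..<y0 + r} \<subseteq> {0<..<L}" and z: "a 0 y0 = 0" and d: "(a 0 has_real_derivative p) (at y0)"
  shows "\<exists>A. Ck 2 {z. \<bar>fst z\<bar> < \<rho> \<and> \<bar>fst z * snd z\<bar> < r} A \<and>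
     (\<forall>x t. \<bar>x\<bar> < \<rho> \<longrightarrow> \<bar>x * t\<bar> < r \<longrightarrow> pser a (x, y0 + x * t) = x * A (x, t)) \<and> (\<forall>t. A (0, t) = t * p + a 1 y0)"
proof -
  have "Ck (Suc 2) {0<..<L} (a 0)" using Ka by (simp only: numeral_3_eq_3 numeral_2_eq_2)
  from Hadamard_quotient_Ck[OF this r z d] obtain P where
    P: "Ck 2 {-r<..<r} P" "\<forall>z\<in>{-r<..<r}. a 0 (y0 + z) = z * P z" "P 0 = p" by blast
  let ?W = "{z. \<bar>fst z\<bar> < \<rho> \<and> \<bar>fst z * snd z\<bar> < r} :: (real \<times> real) set"
  define R where "R = pser (\<lambda>k. a (Suc k))"
  define A where "A z = snd z * P (fst z * snd z) + R (fst z, y0 + fst z * snd z)" for z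
  have CR: "Ck 2 ({-\<rho><..<\<rho>} \<times> {0..L}) R"
    unfolding R_def by (rule pser_Ck[OF coeff_Ck_Suc[OF Ca]]) simp
  have inL: "y0 + x * t \<in> {0..L}" if "\<bar>x * t\<bar> < r" for x t
  proof -
    have "y0 + x * t \<in> {y0 - r<..<y0 + r}" using that by auto
    then have "y0 + x * t \<in> {0<..<L}" using r(2) by blast
    then show ?thesis by auto
  qed
  have C1: "Ck 2 ?W (\<lambda>z. fst z)" and C2: "Ck 2 ?W (\<lambda>z. snd z)"
    by (intro Ck_bounded_linear bounded_linear_fst bounded_linear_snd)+
  have C3: "Ck 2 ?W (\<lambda>z. fst z * snd z)" by (intro Ck_mult C1 C2)
  have "Ck 2 ?W A"
    unfolding A_def
  proof (intro Ck_add Ck_mult C2)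
    show "Ck 2 ?W (\<lambda>z. P (fst z * snd z))"
      by (rule Ck_compose[OF P(1) C3]) auto
    show "Ck 2 ?W (\<lambda>z. R (fst z, y0 + fst z * snd z))"
      using inL by (intro Ck_compose2[OF CR] C1 Ck_add Ck_const C3) auto
  qed
  moreover have "pser a (x, y0 + x * t) = x * A (x, t)" if "\<bar>x\<bar> < \<rho>" "\<bar>x * t\<bar> < r" for x t
  proof -
    have "pser a (x, y0 + x * t) = a 0 (y0 + x * t) + x * R (x, y0 + x * t)"
      unfolding R_def using that inL[OF that(2)] by (intro pser_Suc[OF coeff_Ck_bdd[OF Ca]]) auto
    also have "a 0 (y0 + x * t) = (x * t) * P (x * t)" using P(2)[rule_format, of "x * t"] that by (simp add: abs_less_iff)
    finally show ?thesis by (simp add: A_def algebra_simps)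
  qed
  moreover have "A (0, t) = t * p + a 1 y0" for t
    by (simp add: A_def P(3) R_def pser_at_0)
  ultimately show ?thesis by blast
qed

text \<open>
  After division by \<open>x\<^sup>2\<close> the determinant becomes a \<open>C\<^sup>2\<close> function \<open>F\<close> with
  \<open>F (0, t) = (t p + a 1 y0) (t q + e 1 y0)\<close>. Its root \<open>- a 1 y0 / p\<close> is simple because the other one is
  different, so it continues to a curve of zeros. There the matrix \<open>(A, x C; B, E)\<close> is singular with \<open>E \<noteq> 0\<close>,
  so \<open>(1, k)\<close> with \<open>k = - B / E\<close> spans its kernel.
\<close>

lemma bifurcating_curve:
  assumes y0: "y0 \<in> {0<..<L}" and \<rho>: "0 < \<rho>"
    and Ca: "coeff_Ck 2 \<rho> {0..L} a" "coeff_Ck 2 \<rho> {0..L} b" "coeff_Ck 2 \<rho> {0..L} c" "coeff_Ck 2 \<rho> {0..L} e"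
    and Ka: "Ck 3 {0<..<L} (a 0)" "Ck 3 {0<..<L} (b 0)" "Ck 3 {0<..<L} (c 0)" "Ck 3 {0<..<L} (e 0)"
    and z: "a 0 y0 = 0" "b 0 y0 = 0" "c 0 y0 = 0" "e 0 y0 = 0"
    and da: "(a 0 has_real_derivative p) (at y0)" "p \<noteq> 0" and de: "(e 0 has_real_derivative q) (at y0)" "q \<noteq> 0"
    and nd: "- a 1 y0 / p \<noteq> - e 1 y0 / q"
  shows "\<exists>\<epsilon>>0. \<exists>T k. Ck 2 {-\<epsilon><..<\<epsilon>} T \<and> T 0 = - a 1 y0 / p \<and> continuous_on {-\<epsilon><..<\<epsilon>} k \<and>
     (\<forall>x\<in>{-\<epsilon><..<\<epsilon>}. x \<in> {-\<rho><..<\<rho>} \<and> y0 + x * T x \<in> {0<..<L} \<and>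
        pser a (x, y0 + x * T x) + x * k x * pser c (x, y0 + x * T x) = 0 \<and>
        pser b (x, y0 + x * T x) + k x * pser e (x, y0 + x * T x) = 0)"
proof -
  define r where "r = min y0 (L - y0)"
  have r: "0 < r" "{y0 - r<..<y0 + r} \<subseteq> {0<..<L}" using y0 by (auto simp: r_def)
  let ?W = "{z. \<bar>fst z\<bar> < \<rho> \<and> \<bar>fst z * snd z\<bar> < r} :: (real \<times> real) set"
  have dex: "\<exists>p. (f has_real_derivative p) (at y0)" if "Ck 3 {0<..<L} f" for f
  proof -
    have "Ck (Suc 2) {0<..<L} f" using that by (simp only: numeral_3_eq_3 numeral_2_eq_2)
    then obtain f' where "\<And>x. x \<in> {0<..<L} \<Longrightarrow> (f has_real_derivative f' x) (at x within {0<..<L})"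
      using Ck_real_SucE by blast
    then show ?thesis using y0 at_within_open[of y0 "{0<..<L}"] by (metis open_greaterThanLessThan)
  qed
  obtain db where db: "(b 0 has_real_derivative db) (at y0)" using dex[OF Ka(2)] by blast
  obtain dc where dc: "(c 0 has_real_derivative dc) (at y0)" using dex[OF Ka(3)] by blast
  obtain A where A: "Ck 2 ?W A" "\<And>x t. \<bar>x\<bar> < \<rho> \<Longrightarrow> \<bar>x * t\<bar> < r \<Longrightarrow> pser a (x, y0 + x * t) = x * A (x, t)"
    "\<And>t. A (0, t) = t * p + a 1 y0"
    using pser_blow_up[OF Ca(1) \<rho> Ka(1) r z(1) da(1)] by blast
  obtain B where B: "Ck 2 ?W B" "\<And>x t. \<bar>x\<bar> < \<rho> \<Longrightarrow> \<bar>x * t\<bar> < r \<Longrightarrow> pser b (x, y0 + x * t) = x * B (x, t)"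
    using pser_blow_up[OF Ca(2) \<rho> Ka(2) r z(2) db] by blast
  obtain C where C: "Ck 2 ?W C" "\<And>x t. \<bar>x\<bar> < \<rho> \<Longrightarrow> \<bar>x * t\<bar> < r \<Longrightarrow> pser c (x, y0 + x * t) = x * C (x, t)"
    using pser_blow_up[OF Ca(3) \<rho> Ka(3) r z(3) dc] by blast
  obtain E where E: "Ck 2 ?W E" "\<And>x t. \<bar>x\<bar> < \<rho> \<Longrightarrow> \<bar>x * t\<bar> < r \<Longrightarrow> pser e (x, y0 + x * t) = x * E (x, t)"
    "\<And>t. E (0, t) = t * q + e 1 y0"
    using pser_blow_up[OF Ca(4) \<rho> Ka(4) r z(4) de(1)] by blast
  define F where "F z = A z * E z - fst z * (B z * C z)" for z
  have "Ck 2 ?W F"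
    unfolding F_def by (intro Ck_diff Ck_mult Ck_bounded_linear bounded_linear_fst A(1) B(1) C(1) E(1))
  then have CF: "Ck (Suc 1) ?W F" by (simp only: Suc_1)
  have oW: "open ?W"
    by (intro open_Collect_conj open_Collect_less continuous_intros)
  define t0 where "t0 = - a 1 y0 / p"
  define d where "d = p * (t0 * q + e 1 y0)"
  have Et0: "t0 * q + e 1 y0 \<noteq> 0" using nd de(2) by (simp add: t0_def field_simps)
  then have d: "d \<noteq> 0" using da(2) by (simp add: d_def)
  have F0: "F (0, t) = (t * p + a 1 y0) * (t * q + e 1 y0)" for t by (simp add: F_def A(3) E(3))
  have A0: "t0 * p + a 1 y0 = 0" using da(2) by (simp add: t0_def)
  have "((\<lambda>t. (t * p + a 1 y0) * (t * q + e 1 y0)) has_real_derivative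
      (1 * p + 0) * (t0 * q + e 1 y0) + (1 * q + 0) * (t0 * p + a 1 y0)) (at t0)"
    by (intro DERIV_mult DERIV_add DERIV_cmult_right DERIV_ident DERIV_const)
  then have dF: "((\<lambda>t. F (0, t)) has_real_derivative d) (at t0)"
    unfolding F0 d_def by (simp add: A0 del: One_nat_def)
  have "(0, t0) \<in> ?W" using \<rho> r by simp
  moreover have F00: "F (0, t0) = 0" by (simp add: F0 A0 del: One_nat_def)
  ultimately obtain \<epsilon>1 T where T: "0 < \<epsilon>1" "Ck (Suc 1) {-\<epsilon>1<..<\<epsilon>1} T" "T 0 = t0"
    "\<And>x. x \<in> {-\<epsilon>1<..<\<epsilon>1} \<Longrightarrow> (x, T x) \<in> ?W \<and> F (x, T x) = 0"
    using implicit_function_Ck[OF oW CF _ F00 dF d] by blast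
  have cT: "continuous_on {-\<epsilon>1<..<\<epsilon>1} T" using T(2) Ck_continuous_on by blast
  have comp: "continuous_on {-\<epsilon>1<..<\<epsilon>1} (\<lambda>x. f (x, T x))" if "Ck 2 ?W f" for f
    using T(4) by (intro continuous_on_compose2[OF Ck_continuous_on[OF that]] continuous_intros cT) auto
  have "isCont (\<lambda>x. E (x, T x)) 0"
    using comp[OF E(1)] T(1) by (simp add: continuous_on_eq_continuous_at)
  moreover have "E (0, T 0) \<noteq> 0" using Et0 by (simp add: T(3) E(3))
  ultimately have "\<forall>\<^sub>F x in at 0. E (x, T x) \<noteq> 0"
    unfolding isCont_def by (rule tendsto_imp_eventually_ne)
  then obtain \<epsilon>2 where \<epsilon>2: "0 < \<epsilon>2" "\<And>x. x \<noteq> 0 \<Longrightarrow> \<bar>x\<bar> < \<epsilon>2 \<Longrightarrow> E (x, T x) \<noteq> 0"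
    unfolding eventually_at by (auto simp: dist_real_def)
  define \<epsilon> where "\<epsilon> = min \<epsilon>1 \<epsilon>2"
  have \<epsilon>: "0 < \<epsilon>" "{-\<epsilon><..<\<epsilon>} \<subseteq> {-\<epsilon>1<..<\<epsilon>1}" using T(1) \<epsilon>2(1) by (auto simp: \<epsilon>_def)
  have Ene: "E (x, T x) \<noteq> 0" if "x \<in> {-\<epsilon><..<\<epsilon>}" for x
  proof (cases "x = 0")
    case False
    have "\<bar>x\<bar> < \<epsilon>2" using that unfolding \<epsilon>_def by simp linarith
    with False show ?thesis using \<epsilon>2(2) by blast
  qed (simp add: \<open>E (0, T 0) \<noteq> 0\<close>)
  define k where "k x = - B (x, T x) / E (x, T x)" for x
  have "continuous_on {-\<epsilon><..<\<epsilon>} k"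
    unfolding k_def using Ene
    by (intro continuous_intros continuous_on_subset[OF comp[OF B(1)] \<epsilon>(2)] continuous_on_subset[OF comp[OF E(1)] \<epsilon>(2)]) auto
  moreover have "Ck 2 {-\<epsilon><..<\<epsilon>} T" using Ck_subset[OF T(2) \<epsilon>(2)] by (simp only: Suc_1)
  moreover have "x \<in> {-\<rho><..<\<rho>} \<and> y0 + x * T x \<in> {0<..<L} \<and>
        pser a (x, y0 + x * T x) + x * k x * pser c (x, y0 + x * T x) = 0 \<and>
        pser b (x, y0 + x * T x) + k x * pser e (x, y0 + x * T x) = 0" if x: "x \<in> {-\<epsilon><..<\<epsilon>}" for x
  proof -
    have W: "\<bar>x\<bar> < \<rho>" "\<bar>x * T x\<bar> < r" and F: "F (x, T x) = 0" using T(4)[of x] \<epsilon>(2) x by auto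
    have "y0 + x * T x \<in> {y0 - r<..<y0 + r}" using W(2) by auto
    then have "y0 + x * T x \<in> {0<..<L}" using r(2) by blast
    moreover have "E (x, T x) \<noteq> 0" by (rule Ene[OF x])
    moreover have "A (x, T x) * E (x, T x) = x * (B (x, T x) * C (x, T x))" using F by (simp add: F_def)
    ultimately show ?thesis using W unfolding A(2)[OF W] B(2)[OF W] C(2)[OF W] E(2)[OF W] k_def
      by (auto simp: field_simps)
  qed
  ultimately show ?thesis using \<epsilon>(1) T(3) unfolding t0_def by blast
qed

section \<open>Smooth functions and test functions\<close>

definition smooth :: "(real \<Rightarrow> 'a::real_normed_vector) \<Rightarrow> bool" where
  "smooth f \<longleftrightarrow> (\<exists>D. D 0 = f \<and> (\<forall>n x. (D n has_vector_derivative D (Suc n) x) (at x)))"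

text \<open>
  A function is smooth as soon as it belongs to some class in which every function has a derivative.
  This replaces formulas for the \<open>n\<close>-th derivative.
\<close>

lemma smooth_coinduct:
  assumes "f \<in> S" and "\<And>f. f \<in> S \<Longrightarrow> \<exists>f'\<in>S. \<forall>x. (f has_vector_derivative f' x) (at x)"
  shows "smooth f"
proof -
  obtain N where N: "\<And>f. f \<in> S \<Longrightarrow> N f \<in> S \<and> (\<forall>x. (f has_vector_derivative N f x) (at x))"
    using assms(2) by metis
  have "(N ^^ n) f \<in> S" for n by (induction n) (use assms(1) N in auto)
  then show ?thesis
    unfolding smooth_def using N by (intro exI[of _ "\<lambda>n. (N ^^ n) f"]) auto
qed

lemma smooth_derivative:
  assumes "smooth f"
  shows "\<exists>f'. smooth f' \<and> (\<forall>x. (f has_vector_derivative f' x) (at x))"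
proof -
  obtain D where D: "D 0 = f" "\<And>n x. (D n has_vector_derivative D (Suc n) x) (at x)"
    using assms unfolding smooth_def by blast
  then have "smooth (D (Suc 0))" unfolding smooth_def by (intro exI[of _ "\<lambda>n. D (Suc n)"]) auto
  with D show ?thesis by metis
qed

lemma smooth_antiderivative:
  assumes "smooth f'" "\<And>x. (f has_vector_derivative f' x) (at x)"
  shows "smooth f"
proof (rule smooth_coinduct[of _ "insert f (Collect smooth)"])
  fix k assume "k \<in> insert f (Collect smooth)"
  then show "\<exists>f'\<in>insert f (Collect smooth). \<forall>x. (k has_vector_derivative f' x) (at x)"
    using assms smooth_derivative[of k] by blast
qed simp

lemma smooth_continuous_on:
  assumes "smooth f" shows "continuous_on S f"
proof -
  obtain f' where f': "\<And>x. (f has_vector_derivative f' x) (at x)" using smooth_derivative[OF assms] by auto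
  have "isCont f x" for x using f' by (rule has_vector_derivative_continuous)
  then show ?thesis by (simp add: continuous_at_imp_continuous_on)
qed

text \<open>
  The Leibniz rule turns a product into a sum of products; closing under both operations at once
  gives a class to which \<open>smooth_coinduct\<close> applies.
\<close>

inductive_set smooth_alg :: "(real \<Rightarrow> 'a::real_normed_algebra) set" where
  gen: "smooth f \<Longrightarrow> f \<in> smooth_alg"
| add: "f \<in> smooth_alg \<Longrightarrow> g \<in> smooth_alg \<Longrightarrow> (\<lambda>x. f x + g x) \<in> smooth_alg"
| mult: "f \<in> smooth_alg \<Longrightarrow> g \<in> smooth_alg \<Longrightarrow> (\<lambda>x. f x * g x) \<in> smooth_alg"

lemma smooth_alg_smooth:
  assumes "f \<in> smooth_alg" shows "smooth f"
proof (rule smooth_coinduct[OF assms])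
  fix f :: "real \<Rightarrow> 'a" assume "f \<in> smooth_alg"
  then show "\<exists>f'\<in>smooth_alg. \<forall>x. (f has_vector_derivative f' x) (at x)"
  proof induction
    case (gen f) then show ?case using smooth_derivative smooth_alg.gen by blast
  next
    case (add f g)
    then obtain f' g' where "f' \<in> smooth_alg" "g' \<in> smooth_alg"
      "\<forall>x. (f has_vector_derivative f' x) (at x)" "\<forall>x. (g has_vector_derivative g' x) (at x)" by blast
    then show ?case
      by (intro bexI[of _ "\<lambda>x. f' x + g' x"]) (auto intro: smooth_alg.add has_vector_derivative_add)
  next
    case (mult f g)
    then obtain f' g' where "f' \<in> smooth_alg" "g' \<in> smooth_alg"
      "\<forall>x. (f has_vector_derivative f' x) (at x)" "\<forall>x. (g has_vector_derivative g' x) (at x)" by blast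
    with mult show ?case
      by (intro bexI[of _ "\<lambda>x. f x * g' x + f' x * g x"])
        (auto intro: smooth_alg.add smooth_alg.mult has_vector_derivative_mult)
  qed
qed

lemma smooth_add: "smooth f \<Longrightarrow> smooth g \<Longrightarrow> smooth (\<lambda>x. f x + g x)"
  for f g :: "real \<Rightarrow> 'a::real_normed_algebra"
  using smooth_alg_smooth[OF smooth_alg.add[OF smooth_alg.gen smooth_alg.gen]] .

lemma smooth_mult: "smooth f \<Longrightarrow> smooth g \<Longrightarrow> smooth (\<lambda>x. f x * g x)"
  for f g :: "real \<Rightarrow> 'a::real_normed_algebra"
  using smooth_alg_smooth[OF smooth_alg.mult[OF smooth_alg.gen smooth_alg.gen]] .

lemma smooth_const: "smooth (\<lambda>x. c)"
proof (rule smooth_coinduct[of _ "{\<lambda>x. c, \<lambda>x. 0}"])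
  fix f :: "real \<Rightarrow> 'a" assume "f \<in> {\<lambda>x. c, \<lambda>x. 0}"
  then show "\<exists>f'\<in>{\<lambda>x. c, \<lambda>x. 0}. \<forall>x. (f has_vector_derivative f' x) (at x)"
    by (intro bexI[of _ "\<lambda>x. 0"]) auto
qed simp

lemma smooth_polynomial: "polynomial_function p \<Longrightarrow> smooth p" for p :: "real \<Rightarrow> 'a::euclidean_space"
proof (rule smooth_coinduct[of _ "Collect polynomial_function"])
  fix f :: "real \<Rightarrow> 'a" assume "f \<in> Collect polynomial_function"
  then obtain f' where "polynomial_function f'" "\<And>x. (f has_vector_derivative f' x) (at x)"
    using has_vector_derivative_polynomial_function[of f] by auto
  then show "\<exists>f'\<in>Collect polynomial_function. \<forall>x. (f has_vector_derivative f' x) (at x)"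
    by (intro bexI[of _ f']) auto
qed simp

lemma smooth_of_real: "smooth f \<Longrightarrow> smooth (\<lambda>x. of_real (f x) :: complex)"
proof -
  assume "smooth f"
  then obtain D where D: "D 0 = f" "\<And>n x. (D n has_vector_derivative D (Suc n) x) (at x)"
    unfolding smooth_def by blast
  then show ?thesis unfolding smooth_def
    by (intro exI[of _ "\<lambda>n x. of_real (D n x)"]) (auto intro: bounded_linear.has_vector_derivative[OF bounded_linear_of_real])
qed

lemma smooth_affine:
  assumes "smooth f" shows "smooth (\<lambda>x. f (m * x + c))"
proof -
  obtain D where D: "D 0 = f" "\<And>n x. (D n has_vector_derivative D (Suc n) x) (at x)"
    using assms unfolding smooth_def by blast
  have "((\<lambda>x. m ^ n *\<^sub>R D n (m * x + c)) has_vector_derivative m ^ Suc n *\<^sub>R D (Suc n) (m * x + c)) (at x)" for n x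
  proof -
    have "((\<lambda>x. m * x + c) has_vector_derivative m) (at x)"
      by (auto intro!: derivative_eq_intros)
    from vector_diff_chain_at[OF this D(2)]
    have "((\<lambda>x. D n (m * x + c)) has_vector_derivative m *\<^sub>R D (Suc n) (m * x + c)) (at x)"
      by (simp add: o_def)
    from has_vector_derivative_scaleR[OF DERIV_const[of "m ^ n"] this] show ?thesis
      by (simp add: mult.commute)
  qed
  then show ?thesis unfolding smooth_def
    by (intro exI[of _ "\<lambda>n x. m ^ n *\<^sub>R D n (m * x + c)"]) (simp add: D(1))
qed

text \<open>
  The functions \<open>x\<^sup>-\<^sup>k exp (- 1 / x)\<close>, extended by \<open>0\<close> to \<open>x \<le> 0\<close>. Their linear span is closed under
  differentiation; the case \<open>k = 0\<close> is the standard smooth function that is not analytic at \<open>0\<close>.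
\<close>

definition flat :: "nat \<Rightarrow> real \<Rightarrow> real" where
  "flat k x = (if x \<le> 0 then 0 else inverse x ^ k / exp (inverse x))"

lemma flat_tendsto_0: "(flat k \<longlongrightarrow> 0) (at 0)"
proof (rule filterlim_split_at)
  show "(flat k \<longlongrightarrow> 0) (at_left 0)"
    by (rule tendsto_eventually) (auto simp: flat_def eventually_at_filter)
  have "((\<lambda>x. inverse x ^ k / exp (inverse x)) \<longlongrightarrow> 0) (at_right (0::real))"
    by (rule filterlim_compose[OF tendsto_power_div_exp_0 filterlim_inverse_at_top_right])
  then show "(flat k \<longlongrightarrow> 0) (at_right 0)"
    by (rule Lim_transform_eventually) (auto simp: flat_def eventually_at_filter)
qed

lemma flat_derivative:
  "(flat k has_real_derivative flat (k + 2) x - real k * flat (k + 1) x) (at x)"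
proof -
  consider "x < 0" | "x = 0" | "0 < x" by linarith
  then show ?thesis
  proof cases
    case 1
    have "((\<lambda>x. 0) has_real_derivative 0) (at x)" by simp
    then show ?thesis
      using 1 by (intro has_field_derivative_transform_within_open[of "\<lambda>x. 0" _ x "{..<0}" "flat k"]) (auto simp: flat_def)
  next
    case 2
    have "((\<lambda>h. (flat k (0 + h) - flat k 0) / h) \<longlongrightarrow> 0) (at 0)"
      by (rule Lim_transform_eventually[OF flat_tendsto_0[of "Suc k"]])
        (auto simp: flat_def eventually_at_filter field_simps)
    then have "(flat k has_real_derivative 0) (at 0)" unfolding DERIV_def by simp
    with 2 show ?thesis by (simp add: flat_def)
  next
    case 3
    have d1: "(inverse has_real_derivative - (inverse x ^ 2)) (at x)"
      using DERIV_inverse[of x UNIV] 3 by (simp add: numeral_2_eq_2)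
    have "((\<lambda>x. inverse x ^ k) has_real_derivative real k * (- (inverse x ^ 2) * inverse x ^ (k - Suc 0))) (at x)"
      by (rule DERIV_power[OF d1])
    also have "real k * (- (inverse x ^ 2) * inverse x ^ (k - Suc 0)) = - real k * inverse x ^ (k + 1)"
      by (cases k) (simp_all add: power2_eq_square algebra_simps)
    finally have "((\<lambda>x. inverse x ^ k * exp (- inverse x)) has_real_derivative
        (- real k * inverse x ^ (k + 1)) * exp (- inverse x) + exp (- inverse x) * (- (- (inverse x ^ 2))) * inverse x ^ k) (at x)"
      by (rule DERIV_mult) (rule DERIV_chain2[OF DERIV_exp DERIV_minus[OF d1]])
    also have "(- real k * inverse x ^ (k + 1)) * exp (- inverse x) + exp (- inverse x) * (- (- (inverse x ^ 2))) * inverse x ^ k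
      = inverse x ^ (k+2) * exp (- inverse x) - real k * (inverse x ^ (k+1) * exp (- inverse x))"
      by (simp add: power_add power2_eq_square algebra_simps)
    finally have "((\<lambda>x. inverse x ^ k * exp (- inverse x)) has_real_derivative
       inverse x ^ (k+2) * exp (- inverse x) - real k * (inverse x ^ (k+1) * exp (- inverse x))) (at x)" .
    then have "((\<lambda>x. inverse x ^ k * exp (- inverse x)) has_real_derivative flat (k + 2) x - real k * flat (k + 1) x) (at x)"
      using 3 by (simp add: flat_def exp_minus divide_inverse)
    then show ?thesis
      by (rule has_field_derivative_transform_within_open[of _ _ x "{0<..}"])
        (use 3 in \<open>auto simp: flat_def exp_minus divide_inverse\<close>)
  qed
qed

lemma smooth_flat: "smooth (flat k)"
proof -
  define S where "S = {f. \<exists>c K. f = (\<lambda>x. \<Sum>k<K. c k * flat k x)}"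
  have SI: "(\<lambda>x. \<Sum>k<K. c k * flat k x) \<in> S" for c :: "nat \<Rightarrow> real" and K unfolding S_def by blast
  show ?thesis
  proof (rule smooth_coinduct[of _ S])
    have "(\<lambda>x. \<Sum>j<Suc k. (if j = k then 1 else 0) * flat j x) = flat k"
      by (auto simp: sum.lessThan_Suc)
    then show "flat k \<in> S" using SI[of "\<lambda>j. if j = k then 1 else 0" "Suc k"] by simp
    fix f assume "f \<in> S"
    then obtain c K where f: "f = (\<lambda>x. \<Sum>k<K. c k * flat k x)" unfolding S_def by blast
    \<comment> \<open>The coefficients after differentiation, by shifting the two terms of \<open>flat_derivative\<close>.\<close>
    define d where "d j = (if 2 \<le> j then c (j - 2) else 0) - (if 1 \<le> j \<and> j - 1 < K then c (j - 1) * real (j - 1) else 0)" for j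
    have "(f has_real_derivative (\<Sum>k<K. c k * (flat (k + 2) x - real k * flat (k + 1) x))) (at x)" for x
      unfolding f by (intro DERIV_sum DERIV_cmult flat_derivative)
    moreover have "(\<Sum>k<K. c k * (flat (k + 2) x - real k * flat (k + 1) x)) = (\<Sum>j<Suc (Suc K). d j * flat j x)" for x
    proof -
      have "(\<Sum>j<Suc (Suc K). (if 2 \<le> j then c (j - 2) else 0) * flat j x) = (\<Sum>k<K. c k * flat (k + 2) x)"
        unfolding sum.lessThan_Suc_shift by simp
      moreover have "(\<Sum>j<Suc (Suc K). (if 1 \<le> j \<and> j - 1 < K then c (j - 1) * real (j - 1) else 0) * flat j x)
         = (\<Sum>k<K. c k * real k * flat (k + 1) x)"
        by (subst sum.lessThan_Suc_shift) (simp add: sum.lessThan_Suc)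
      ultimately show ?thesis
        unfolding d_def by (simp only: left_diff_distrib sum_subtractf right_diff_distrib mult.assoc)
    qed
    ultimately have "\<forall>x. (f has_vector_derivative (\<Sum>j<Suc (Suc K). d j * flat j x)) (at x)"
      by (simp add: has_real_derivative_iff_has_vector_derivative)
    then show "\<exists>f'\<in>S. \<forall>x. (f has_vector_derivative f' x) (at x)"
      by (rule bexI[OF _ SI])
  qed
qed

text \<open>
  As \<open>n\<close> grows these smooth functions, supported in compact subintervals of \<open>(a, b)\<close>, tend pointwise to
  the indicator function of \<open>(a, b)\<close>.
\<close>

definition cutoff :: "real \<Rightarrow> real \<Rightarrow> nat \<Rightarrow> real \<Rightarrow> real" where
  "cutoff a b n x = flat 0 (real n * (x - a) - 1) * flat 0 (real n * (b - x) - 1)"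

lemma flat_0_bounds: "0 \<le> flat 0 x" "flat 0 x \<le> 1"
  by (auto simp: flat_def divide_simps)

lemma cutoff_bounds: "0 \<le> cutoff a b n x" "cutoff a b n x \<le> 1"
  unfolding cutoff_def using flat_0_bounds by (auto intro!: mult_le_one)

lemma smooth_cutoff: "smooth (cutoff a b n)"
proof -
  have "smooth (\<lambda>x. flat 0 (real n * x + (- real n * a - 1)) * flat 0 (- real n * x + (real n * b - 1)))"
    by (intro smooth_mult smooth_affine smooth_flat)
  also have "(\<lambda>x. flat 0 (real n * x + (- real n * a - 1)) * flat 0 (- real n * x + (real n * b - 1))) = cutoff a b n"
    by (auto simp: cutoff_def algebra_simps)
  finally show ?thesis .
qed

lemma cutoff_support: "{x. cutoff a b n x \<noteq> 0} \<subseteq> {a + 1 / real n .. b - 1 / real n}" and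
   cutoff_0: "cutoff a b 0 x = 0"
proof (safe, goal_cases)
  case (1 x)
  then have *: "0 < real n * (x - a) - 1" "0 < real n * (b - x) - 1"
    by (auto simp: cutoff_def flat_def split: if_splits)
  then have "n \<noteq> 0" by (cases n) auto
  with * show ?case by (auto simp: field_simps)
qed (simp add: cutoff_def flat_def)

lemma cutoff_outside: "x \<notin> {a<..<b} \<Longrightarrow> cutoff a b n x = 0"
proof -
  assume x: "x \<notin> {a<..<b}"
  have "real n * (x - a) \<le> 0 \<or> real n * (b - x) \<le> 0"
    using x by (auto simp: mult_le_0_iff)
  then show ?thesis by (auto simp: cutoff_def flat_def)
qed

lemma flat_0_tendsto_1:
  assumes "0 < c" shows "(\<lambda>n. flat 0 (real n * c - 1)) \<longlonglongrightarrow> 1"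
proof -
  have *: "filterlim (\<lambda>n. real n * c - 1) at_top sequentially"
  proof -
    have "filterlim (\<lambda>n. real n * c) at_top sequentially"
      by (rule filterlim_at_top_mult_tendsto_pos[OF tendsto_const assms filterlim_real_sequentially])
    from filterlim_tendsto_add_at_top[OF tendsto_const[of "-1"] this] show ?thesis by simp
  qed
  have "(\<lambda>n. 1 / exp (inverse (real n * c - 1))) \<longlonglongrightarrow> 1 / exp 0"
    by (intro tendsto_intros tendsto_inverse_0_at_top *) auto
  moreover have "\<forall>\<^sub>F n in sequentially. 1 / exp (inverse (real n * c - 1)) = flat 0 (real n * c - 1)"
    using eventually_compose_filterlim[OF eventually_gt_at_top[of 0] *]
    by eventually_elim (auto simp: flat_def)
  ultimately show ?thesis by (simp add: Lim_transform_eventually)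
qed

lemma cutoff_tendsto: "(\<lambda>n. cutoff a b n x) \<longlonglongrightarrow> indicator {a<..<b} x"
proof (cases "x \<in> {a<..<b}")
  case True
  then have "(\<lambda>n. cutoff a b n x) \<longlonglongrightarrow> 1 * 1"
    unfolding cutoff_def by (intro tendsto_mult flat_0_tendsto_1) auto
  with True show ?thesis by simp
qed (simp add: cutoff_outside)

lemma test_fun_iff: "\<phi> \<in> test_fun l \<longleftrightarrow> smooth \<phi> \<and> closure {x. \<phi> x \<noteq> 0} \<subseteq> {0<..<l}"
  by (simp add: test_fun_def smooth_def)

lemma cutoff_test_fun:
  assumes "smooth p" "0 \<le> a" "b \<le> l"
  shows "(\<lambda>x. p x * of_real (cutoff a b n x)) \<in> test_fun l"
proof (cases "n = 0")
  case True
  then show ?thesis by (simp add: test_fun_iff cutoff_0 smooth_const)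
next
  case False
  have "closure {x. p x * of_real (cutoff a b n x) \<noteq> 0} \<subseteq> {a + 1 / real n .. b - 1 / real n}"
    using cutoff_support[of a b n] by (intro closure_minimal) auto
  also have "\<dots> \<subseteq> {0<..<l}"
  proof -
    have "0 < 1 / real n" using False by simp
    then show ?thesis using assms(2,3) by (simp only: subset_iff greaterThanLessThan_iff atLeastAtMost_iff) linarith
  qed
  finally show ?thesis
    unfolding test_fun_iff using assms(1)
    by (intro conjI smooth_mult smooth_of_real smooth_cutoff)
qed

lemma test_fun_derivative:
  assumes "\<phi> \<in> test_fun l"
  shows "(\<phi> has_vector_derivative test_deriv \<phi> x) (at x)" "smooth (test_deriv \<phi>)"
proof -
  obtain f' where f': "smooth f'" "\<And>x. (\<phi> has_vector_derivative f' x) (at x)"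
    using assms smooth_derivative[of \<phi>] unfolding test_fun_iff by auto
  then have "test_deriv \<phi> = f'" unfolding test_deriv_def by (auto intro: vector_derivative_at)
  with f' show "(\<phi> has_vector_derivative test_deriv \<phi> x) (at x)" "smooth (test_deriv \<phi>)" by auto
qed

lemma test_fun_outside: "\<phi> \<in> test_fun l \<Longrightarrow> x \<notin> {0<..<l} \<Longrightarrow> \<phi> x = 0"
  unfolding test_fun_iff by (metis (mono_tags, lifting) closure_subset mem_Collect_eq subsetD)

lemma test_fun_compact_support:
  assumes "\<phi> \<in> test_fun l" "0 < l"
  shows "\<exists>a b. 0 < a \<and> a < b \<and> b < l \<and> (\<forall>x. x \<notin> {a..b} \<longrightarrow> \<phi> x = 0)"
proof -
  \<comment> \<open>The midpoint is inserted because the support may be empty.\<close>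
  let ?K = "insert (l / 2) (closure {x. \<phi> x \<noteq> 0})"
  have "{x. \<phi> x \<noteq> 0} \<subseteq> {0<..<l}" using test_fun_outside[OF assms(1)] by blast
  also have "\<dots> \<subseteq> {0..l}" by auto
  finally have "bounded {x. \<phi> x \<noteq> 0}"
    by (rule bounded_subset[OF compact_imp_bounded[OF compact_Icc]])
  then have K: "compact ?K" by (intro compact_insert) (simp add: compact_closure)
  obtain a where a: "a \<in> ?K" "\<And>x. x \<in> ?K \<Longrightarrow> a \<le> x" using compact_attains_inf[OF K] by blast
  obtain b where b: "b \<in> ?K" "\<And>x. x \<in> ?K \<Longrightarrow> x \<le> b" using compact_attains_sup[OF K] by blast
  have K0: "?K \<subseteq> {0<..<l}" using assms unfolding test_fun_iff by auto
  then have "0 < a" "b < l" "a \<le> b" using a b by auto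
  show ?thesis
  proof (rule exI[of _ "a / 2"], rule exI[of _ "(b + l) / 2"], intro conjI allI impI)
    fix x assume x: "x \<notin> {a / 2..(b + l) / 2}"
    show "\<phi> x = 0"
    proof (rule ccontr)
      assume "\<phi> x \<noteq> 0"
      then have "x \<in> closure {x. \<phi> x \<noteq> 0}" by (intro subsetD[OF closure_subset]) simp
      then have "x \<in> ?K" by (rule insertI2)
      then have "a \<le> x" "x \<le> b" using a(2) b(2) by blast+
      with x \<open>0 < a\<close> \<open>b < l\<close> show False by auto
    qed
  qed (use \<open>0 < a\<close> \<open>b < l\<close> \<open>a \<le> b\<close> in \<open>auto simp: field_simps\<close>)
qed

text \<open>
  The primitive that vanishes at \<open>0\<close> is constant to the left and to the right of the support of \<open>\<psi>\<close>; the
  mean value zero makes the second constant vanish as well.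
\<close>

lemma test_fun_primitive:
  assumes "\<psi> \<in> test_fun l" "0 < l" "integral {0..l} \<psi> = 0"
  obtains \<phi> where "\<phi> \<in> test_fun l" "test_deriv \<phi> = \<psi>"
proof -
  obtain a b where ab: "0 < a" "a < b" "b < l" "\<And>x. x \<notin> {a..b} \<Longrightarrow> \<psi> x = 0"
    using test_fun_compact_support[OF assms(1,2)] by metis
  have sm: "smooth \<psi>" using assms(1) test_fun_iff by blast
  have "isCont \<psi> x" for x using smooth_continuous_on[OF sm, of UNIV] by (simp add: continuous_on_eq_continuous_at)
  then obtain F where F: "\<And>x. (F has_vector_derivative \<psi> x) (at x)"
    using einterval_antiderivative[of "-\<infinity>" "\<infinity>" \<psi>] by auto
  define \<phi> where "\<phi> x = F x - F 0" for x
  have d: "(\<phi> has_vector_derivative \<psi> x) (at x)" for x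
    unfolding \<phi>_def using has_vector_derivative_diff[OF F has_vector_derivative_const] by simp
  have "(\<psi> has_integral (\<phi> l - \<phi> 0)) {0..l}"
    using assms(2) has_vector_derivative_at_within[OF d]
    by (intro fundamental_theorem_of_calculus) simp_all
  then have \<phi>0: "\<phi> 0 = 0" "\<phi> l = 0" using assms(3) by (auto simp: \<phi>_def integral_unique)
  have z: "\<phi> x = \<phi> y" if "convex S" "x \<in> S" "y \<in> S" "S \<inter> {a..b} = {}" for x y S
  proof -
    have "(\<phi> has_vector_derivative 0) (at x within S)" if "x \<in> S" for x
      using d[of x] ab(4)[of x] that \<open>S \<inter> {a..b} = {}\<close> has_vector_derivative_at_within by (metis disjoint_iff)
    then show ?thesis
      using has_vector_derivative_zero_constant[OF that(1), of \<phi>] that(2,3) by metis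
  qed
  have out: "\<phi> x = 0" if "x \<notin> {a..b}" for x
  proof (cases "x < a")
    case True
    have "{..<a} \<inter> {a..b} = {}" by auto
    then show ?thesis using z[of "{..<a}" x 0] True ab \<phi>0 by simp
  next
    case False
    have "{b<..} \<inter> {a..b} = {}" by auto
    then show ?thesis using z[of "{b<..}" x l] False that ab \<phi>0 by simp
  qed
  have "{x. \<phi> x \<noteq> 0} \<subseteq> {a..b}" using out by blast
  then have "closure {x. \<phi> x \<noteq> 0} \<subseteq> {a..b}" by (intro closure_minimal) auto
  then have "\<phi> \<in> test_fun l"
    unfolding test_fun_iff using smooth_antiderivative[OF sm d] ab by auto
  moreover have "test_deriv \<phi> = \<psi>" unfolding test_deriv_def using d by (auto intro: vector_derivative_at)
  ultimately show ?thesis using that by blast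
qed

section \<open>Integration on \<open>(0, l)\<close> and weak derivatives\<close>

abbreviation Lm :: "real \<Rightarrow> real measure" where "Lm l \<equiv> lebesgue_on {0<..<l}"

lemma finite_measure_Lm: "finite_measure (Lm l)"
  by (rule finite_measure_lebesgue_on) (rule lmeasurable_interval)

lemma borel_measurable_Lm: "continuous_on {0<..<l} f \<Longrightarrow> f \<in> borel_measurable (Lm l)"
  by (rule continuous_imp_measurable_on_sets_lebesgue) auto

lemma borel_measurable_Lm': "continuous_on {0..l} f \<Longrightarrow> f \<in> borel_measurable (Lm l)"
  by (rule borel_measurable_Lm) (erule continuous_on_subset, auto)

lemma AE_LmI: "(\<And>x. x \<in> {0<..<l} \<Longrightarrow> P x) \<Longrightarrow> AE x in Lm l. P x"
  by (rule AE_I2) simp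

lemma integrable_Lm_bounded:
  fixes f :: "real \<Rightarrow> 'b::{banach,second_countable_topology}"
  assumes "f \<in> borel_measurable (Lm l)" "\<And>x. x \<in> {0<..<l} \<Longrightarrow> norm (f x) \<le> B"
  shows "integrable (Lm l) f"
  using assms by (intro finite_measure.integrable_const_bound[OF finite_measure_Lm, of _ B] AE_LmI)

lemma integrable_Lm_continuous:
  fixes f :: "real \<Rightarrow> 'b::{banach,second_countable_topology}"
  assumes "continuous_on {0..l} f"
  shows "integrable (Lm l) f"
proof -
  obtain B where B: "\<forall>x\<in>{0..l}. norm (f x) \<le> B" using continuous_on_Icc_bounded[OF assms] by auto
  show ?thesis by (rule integrable_Lm_bounded[OF borel_measurable_Lm'[OF assms], of B]) (use B in auto)
qed

lemma absolutely_integrable_Lm: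
  fixes f :: "real \<Rightarrow> 'b::euclidean_space"
  assumes "integrable (Lm l) f"
  shows "f absolutely_integrable_on {0..l}"
proof -
  have "f absolutely_integrable_on {0<..<l}"
    using assms integrable_restrict_space[of "{0<..<l}" lebesgue f] by (simp add: set_integrable_def)
  then show ?thesis by (simp only: absolutely_integrable_on_Icc_iff_Ioo)
qed

lemma LINT_Lm:
  fixes f :: "real \<Rightarrow> 'b::euclidean_space"
  assumes "integrable (Lm l) f"
  shows "integral\<^sup>L (Lm l) f = integral {0..l} f"
  using lebesgue_integral_eq_integral[OF assms] by (simp add: integral_open_interval_real)

lemma integrable_on_Lm:
  fixes f :: "real \<Rightarrow> 'b::euclidean_space"
  assumes "integrable (Lm l) f" "x \<in> {0..l}"
  shows "f absolutely_integrable_on {0..x}" "f integrable_on {0..x}"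
proof -
  show *: "f absolutely_integrable_on {0..x}"
    using absolutely_integrable_on_subinterval[OF absolutely_integrable_Lm[OF assms(1)], of 0 x] assms(2) by auto
  show "f integrable_on {0..x}" using * absolutely_integrable_on_def by blast
qed

lemma primitive_continuous_on:
  fixes f :: "real \<Rightarrow> 'b::euclidean_space"
  assumes "integrable (Lm l) f" "0 \<le> l"
  shows "continuous_on {0..l} (\<lambda>x. c + integral {0..x} f)"
  using integrable_on_Lm(2)[OF assms(1), of l] assms(2)
  by (intro continuous_intros indefinite_integral_continuous_1) auto

lemma primitive_bound:
  fixes f :: "real \<Rightarrow> 'b::euclidean_space"
  assumes "integrable (Lm l) f" "x \<in> {0..l}"
  shows "norm (integral {0..x} f) \<le> (LINT t|Lm l. norm (f t))"
proof -
  have n: "(\<lambda>t. norm (f t)) integrable_on {0..x}" "(\<lambda>t. norm (f t)) integrable_on {0..l}"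
    using integrable_on_Lm(1)[OF assms] absolutely_integrable_Lm[OF assms(1)] absolutely_integrable_on_def by blast+
  have "norm (integral {0..x} f) \<le> integral {0..x} (\<lambda>t. norm (f t))"
    using integrable_on_Lm(2)[OF assms] n by (intro integral_norm_bound_integral) auto
  also have "\<dots> \<le> integral {0..l} (\<lambda>t. norm (f t))"
    using assms(2) n by (intro integral_subset_le) auto
  also have "\<dots> = (LINT t|Lm l. norm (f t))"
    using LINT_Lm[OF integrable_norm[OF assms(1)]] by simp
  finally show ?thesis .
qed

lemma LINT_Lm_upto:
  fixes f :: "real \<Rightarrow> complex"
  assumes "integrable (Lm l) f" "x \<in> {0..l}"
  shows "(LINT t|Lm l. (if t \<le> x then f t else 0)) = integral {0..x} f"
proof -
  have [measurable]: "(\<lambda>t. t) \<in> borel_measurable (Lm l)" by (intro borel_measurable_Lm continuous_intros)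
  have [measurable]: "f \<in> borel_measurable (Lm l)" using assms(1) by auto
  have "integrable (Lm l) (\<lambda>t. if t \<le> x then f t else 0)"
    by (rule Bochner_Integration.integrable_bound[OF assms(1)]) auto
  then have "(LINT t|Lm l. (if t \<le> x then f t else 0)) = integral {0..l} (\<lambda>t. if t \<in> {..x} then f t else 0)"
    by (simp add: LINT_Lm)
  also have "\<dots> = integral ({..x} \<inter> {0..l}) f" by (rule Henstock_Kurzweil_Integration.integral_restrict_Int)
  also have "{..x} \<inter> {0..l} = {0..x}" using assms(2) by auto
  finally show ?thesis .
qed

lemma LINT_Lm_from:
  fixes f :: "real \<Rightarrow> complex"
  assumes "integrable (Lm l) f" "x \<in> {0..l}"
  shows "(LINT t|Lm l. (if x \<le> t then f t else 0)) = integral {x..l} f"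
proof -
  have [measurable]: "(\<lambda>t. t) \<in> borel_measurable (Lm l)" by (intro borel_measurable_Lm continuous_intros)
  have [measurable]: "f \<in> borel_measurable (Lm l)" using assms(1) by auto
  have "integrable (Lm l) (\<lambda>t. if x \<le> t then f t else 0)"
    by (rule Bochner_Integration.integrable_bound[OF assms(1)]) auto
  then have "(LINT t|Lm l. (if x \<le> t then f t else 0)) = integral {0..l} (\<lambda>t. if t \<in> {x..} then f t else 0)"
    by (simp add: LINT_Lm)
  also have "\<dots> = integral ({x..} \<inter> {0..l}) f" by (rule Henstock_Kurzweil_Integration.integral_restrict_Int)
  also have "{x..} \<inter> {0..l} = {x..l}" using assms(2) by auto
  finally show ?thesis .
qed

lemma integrable_Lm_mult_continuous:
  fixes f :: "real \<Rightarrow> complex"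
  assumes "integrable (Lm l) f" "continuous_on {0..l} d"
  shows "integrable (Lm l) (\<lambda>x. f x * d x)"
proof -
  obtain B where B: "0 \<le> B" "\<forall>x\<in>{0..l}. norm (d x) \<le> B" using continuous_on_Icc_bounded[OF assms(2)] by auto
  have [measurable]: "f \<in> borel_measurable (Lm l)" "d \<in> borel_measurable (Lm l)"
    using assms borel_measurable_Lm' by auto
  show ?thesis
  proof (rule Bochner_Integration.integrable_bound)
    show "integrable (Lm l) (\<lambda>x. norm (f x) * B)" by (intro integrable_mult_left integrable_norm assms(1))
    show "AE x in Lm l. norm (f x * d x) \<le> norm (norm (f x) * B)"
      using B by (intro AE_LmI) (auto simp: norm_mult intro!: mult_left_mono)
  qed measurable
qed

text \<open>
  Integration by parts for a merely integrable \<open>F\<close>: Fubini's theorem on the triangle \<open>t \<le> x\<close>, where the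
  inner integral of the derivative of the test function over \<open>[t, l]\<close> is \<open>- \<phi> t\<close>.
\<close>

lemma weak_deriv_primitive:
  assumes "0 < l" and F: "integrable (Lm l) F" and z: "\<And>x. x \<in> {0<..<l} \<Longrightarrow> z x = c + integral {0..x} F"
  shows "has_weak_deriv l z F"
  unfolding has_weak_deriv_def
proof
  fix \<phi> assume \<phi>: "\<phi> \<in> test_fun l"
  let ?D = "test_deriv \<phi>"
  interpret finite_measure "Lm l" by (rule finite_measure_Lm)
  interpret P: pair_sigma_finite "Lm l" "Lm l" ..
  have cD: "continuous_on S ?D" for S using test_fun_derivative(2)[OF \<phi>] smooth_continuous_on by blast
  obtain B where B: "0 \<le> B" "\<forall>x\<in>{0..l}. norm (?D x) \<le> B" using continuous_on_Icc_bounded[OF cD] by metis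
  have [measurable]: "(\<lambda>t. t) \<in> borel_measurable (Lm l)" by (intro borel_measurable_Lm continuous_intros)
  have Fm[measurable]: "F \<in> borel_measurable (Lm l)" using F by auto
  have Dm[measurable]: "?D \<in> borel_measurable (Lm l)" by (intro borel_measurable_Lm cD)
  have Di: "integrable (Lm l) ?D" by (intro integrable_Lm_continuous cD)
  have ftc: "integral {t..l} ?D = - \<phi> t" if "t \<in> {0..l}" for t
  proof -
    have "(?D has_integral (\<phi> l - \<phi> t)) {t..l}"
      using that has_vector_derivative_at_within[OF test_fun_derivative(1)[OF \<phi>]]
      by (intro fundamental_theorem_of_calculus) simp_all
    then show ?thesis using test_fun_outside[OF \<phi>, of l] by (simp add: integral_unique)
  qed
  define f where "f x t = (if t \<le> x then F t * ?D x else 0)" for x t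
  have G: "integrable (Lm l \<Otimes>\<^sub>M Lm l) (\<lambda>z. F (snd z))"
    by (rule P.Fubini_integrable) (auto intro: F)
  have "integrable (Lm l \<Otimes>\<^sub>M Lm l) (case_prod f)"
  proof (rule Bochner_Integration.integrable_bound)
    show "integrable (Lm l \<Otimes>\<^sub>M Lm l) (\<lambda>z. norm (F (snd z)) * B)"
      by (intro integrable_mult_left integrable_norm G)
    show "case_prod f \<in> borel_measurable (Lm l \<Otimes>\<^sub>M Lm l)"
      unfolding f_def case_prod_beta by measurable
    show "AE z in Lm l \<Otimes>\<^sub>M Lm l. norm (case_prod f z) \<le> norm (norm (F (snd z)) * B)"
      using B by (intro AE_I2) (auto simp: f_def norm_mult space_pair_measure intro!: mult_left_mono)
  qed
  from P.Fubini_integral[OF this]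
  have fub: "(LINT t|Lm l. LINT x|Lm l. f x t) = (LINT x|Lm l. LINT t|Lm l. f x t)" .
  have 1: "(LINT t|Lm l. f x t) = integral {0..x} F * ?D x" if "x \<in> {0<..<l}" for x
  proof -
    have "(LINT t|Lm l. f x t) = (LINT t|Lm l. (if t \<le> x then F t else 0) * ?D x)"
      unfolding f_def by (intro Bochner_Integration.integral_cong) auto
    also have "\<dots> = (LINT t|Lm l. (if t \<le> x then F t else 0)) * ?D x"
      by (rule integral_mult_left_zero)
    finally show ?thesis using LINT_Lm_upto[OF F, of x] that by simp
  qed
  have 2: "(LINT x|Lm l. f x t) = - (F t * \<phi> t)" if "t \<in> {0<..<l}" for t
  proof -
    have "(LINT x|Lm l. f x t) = (LINT x|Lm l. F t * (if t \<le> x then ?D x else 0))"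
      unfolding f_def by (intro Bochner_Integration.integral_cong) auto
    also have "\<dots> = F t * (LINT x|Lm l. (if t \<le> x then ?D x else 0))"
      by (rule integral_mult_right_zero)
    finally show ?thesis using LINT_Lm_from[OF Di, of t] ftc[of t] that by simp
  qed
  have "(LINT x|Lm l. z x * ?D x) = (LINT x|Lm l. c * ?D x + integral {0..x} F * ?D x)"
    using z by (intro Bochner_Integration.integral_cong) (auto simp: algebra_simps)
  also have "\<dots> = (LINT x|Lm l. c * ?D x) + (LINT x|Lm l. integral {0..x} F * ?D x)"
  proof (rule Bochner_Integration.integral_add)
    have "continuous_on {0..l} (\<lambda>x. 0 + integral {0..x} F)"
      using assms(1) by (intro primitive_continuous_on F) simp
    then show "integrable (Lm l) (\<lambda>x. integral {0..x} F * ?D x)"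
      by (intro integrable_Lm_continuous continuous_intros cD) simp
  qed (use Di in simp)
  also have "(LINT x|Lm l. c * ?D x) = 0"
    using LINT_Lm[OF Di] ftc[of 0] test_fun_outside[OF \<phi>, of 0] assms(1) by simp
  also have "(LINT x|Lm l. integral {0..x} F * ?D x) = (LINT x|Lm l. LINT t|Lm l. f x t)"
    using 1 by (intro Bochner_Integration.integral_cong) auto
  also have "\<dots> = (LINT t|Lm l. - (F t * \<phi> t))"
    unfolding fub[symmetric] using 2 by (intro Bochner_Integration.integral_cong) auto
  finally show "(LINT x|Lm l. z x * ?D x) = - (LINT x|Lm l. F x * \<phi> x)" by simp
qed

lemma LINT_cutoff_tendsto:
  fixes k :: "real \<Rightarrow> complex"
  assumes "integrable (Lm l) k"
  shows "(\<lambda>n. LINT x|Lm l. k x * of_real (cutoff a b n x)) \<longlonglongrightarrow> (LINT x|Lm l. k x * indicator {a<..<b} x)"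
proof (rule integral_dominated_convergence)
  have [measurable]: "(\<lambda>t. t) \<in> borel_measurable (Lm l)" by (intro borel_measurable_Lm continuous_intros)
  have [measurable]: "k \<in> borel_measurable (Lm l)" using assms by auto
  have [measurable]: "cutoff a b n \<in> borel_measurable (Lm l)" for n
    by (intro borel_measurable_Lm smooth_continuous_on smooth_cutoff)
  have "indicator {a<..<b} x = (if a < x \<and> x < b then 1 else 0 :: complex)" for x by (auto simp: indicator_def)
  then show "(\<lambda>x. k x * indicator {a<..<b} x) \<in> borel_measurable (Lm l)" by simp measurable
  show "(\<lambda>x. k x * complex_of_real (cutoff a b n x)) \<in> borel_measurable (Lm l)" for n by measurable
  show "integrable (Lm l) (\<lambda>x. norm (k x))" using assms by (rule integrable_norm)
  show "AE x in Lm l. norm (k x * complex_of_real (cutoff a b n x)) \<le> norm (k x)" for n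
    using cutoff_bounds[of a b n] by (intro AE_I2) (auto simp: norm_mult intro!: mult_left_le)
  have "(\<lambda>n. complex_of_real (cutoff a b n x)) \<longlonglongrightarrow> indicator {a<..<b} x" for x
    using tendsto_of_real[OF cutoff_tendsto[of a b x], where 'a = complex] by (simp add: of_real_indicator)
  then show "AE x in Lm l. (\<lambda>n. k x * complex_of_real (cutoff a b n x)) \<longlonglongrightarrow> k x * indicator {a<..<b} x"
    by (intro AE_I2 tendsto_intros)
qed

text \<open>
  Cutoff functions show that the integral of \<open>k\<close> over every subinterval vanishes. Borel sets follow since
  intervals form an intersection-stable generator, and Lebesgue sets since they differ from Borel sets
  by null sets.
\<close>

lemma fundamental_lemma_calculus_of_variations:
  assumes k: "integrable (Lm l) k" and z: "\<And>\<phi>. \<phi> \<in> test_fun l \<Longrightarrow> (LINT x|Lm l. k x * \<phi> x) = 0"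
  shows "AE x in Lm l. k x = 0"
proof -
  interpret finite_measure "Lm l" by (rule finite_measure_Lm)
  have [measurable]: "(\<lambda>t. t) \<in> borel_measurable (Lm l)" by (intro borel_measurable_Lm continuous_intros)
  have km[measurable]: "k \<in> borel_measurable (Lm l)" using k by auto
  have sets_borel: "A \<inter> {0<..<l} \<in> sets (Lm l)" if "A \<in> sets borel" for A
  proof -
    have "A \<in> sets lebesgue" using that by simp
    then have "A \<inter> {0<..<l} \<in> sets lebesgue" by (intro sets.Int) auto
    then show ?thesis by (subst sets_restrict_space_iff) auto
  qed
  \<comment> \<open>\<open>Z A\<close> is proved for intervals, then for Borel sets.\<close>
  define Z where "Z A \<longleftrightarrow> (LINT x:A \<inter> {0<..<l}|Lm l. k x) = 0" for A
  have si: "set_integrable (Lm l) (A \<inter> {0<..<l}) k" if "A \<in> sets borel" for A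
    unfolding set_integrable_def using sets_borel[OF that] k by (rule integrable_mult_indicator)
  have interval: "(LINT x:{a<..<b}|Lm l. k x) = 0" if "0 \<le> a" "b \<le> l" for a b
  proof -
    have "(LINT x|Lm l. k x * of_real (cutoff a b n x)) = 0" for n
      using z[OF cutoff_test_fun[OF smooth_const that, of 1 n]] by simp
    then have "(\<lambda>n. 0) \<longlonglongrightarrow> (LINT x|Lm l. k x * indicator {a<..<b} x)"
      using LINT_cutoff_tendsto[OF k, of a b] by simp
    then have "(LINT x|Lm l. k x * indicator {a<..<b} x) = 0" using LIMSEQ_unique tendsto_const by blast
    moreover have "k x * indicator {a<..<b} x = indicator {a<..<b} x *\<^sub>R k x" for x by (auto simp: indicator_def)
    ultimately show ?thesis by (simp add: set_lebesgue_integral_def)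
  qed
  have borel: "Z A" if "A \<in> sets borel" for A
  proof -
    have A: "A \<in> sigma_sets UNIV (range greaterThan)" using that unfolding borel_Ioi by simp
    have Int: "Int_stable (range greaterThan :: real set set)"
    proof -
      have "{a<..} \<inter> {b<..} = {max a b<..}" for a b :: real by auto
      then show ?thesis unfolding Int_stable_def by blast
    qed
    have Pow: "range greaterThan \<subseteq> Pow (UNIV :: real set)" by simp
    show ?thesis
      using Int Pow A
    proof (induction rule: sigma_sets_induct_disjoint[consumes 3, case_names basic empty compl union])
      case (basic A)
      then obtain a where "A = {a<..}" by auto
      then have "A \<inter> {0<..<l} = {max a 0<..<l}" by auto
      then show ?case using interval[of "max a 0" l] by (simp add: Z_def)
    next
      case empty
      show ?case by (simp add: Z_def set_lebesgue_integral_def)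
    next
      case (compl A)
      then have A: "A \<in> sets borel" unfolding borel_Ioi by simp
      have 1: "(A \<inter> {0<..<l}) \<union> ((UNIV - A) \<inter> {0<..<l}) = {0<..<l}" by auto
      have 2: "(UNIV - A) \<in> sets borel" using A by auto
      have "(LINT x:(A \<inter> {0<..<l}) \<union> ((UNIV - A) \<inter> {0<..<l})|Lm l. k x) =
         (LINT x:A \<inter> {0<..<l}|Lm l. k x) + (LINT x:(UNIV - A) \<inter> {0<..<l}|Lm l. k x)"
        by (intro set_integral_Un si A 2) auto
      then show ?case using interval[of 0 l] compl unfolding Z_def 1 by simp
    next
      case (union A)
      then have A: "A i \<in> sets borel" for i unfolding borel_Ioi by auto
      then have U: "(\<Union>i. A i) \<in> sets borel" by auto
      have 1: "(\<Union>i. A i) \<inter> {0<..<l} = (\<Union>i. A i \<inter> {0<..<l})" by auto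
      have "(LINT x:(\<Union>i. A i \<inter> {0<..<l})|Lm l. k x) = (\<Sum>i. (LINT x:(A i \<inter> {0<..<l})|Lm l. k x))"
      proof (rule lebesgue_integral_countable_add)
        show "A i \<inter> {0<..<l} \<in> sets (Lm l)" for i using sets_borel[OF A] .
        show "A i \<inter> {0<..<l} \<inter> (A j \<inter> {0<..<l}) = {}" if "i \<noteq> j" for i j
          using union(1) that unfolding disjoint_family_on_def by blast
        show "set_integrable (Lm l) (\<Union>i. A i \<inter> {0<..<l}) k" using si[OF U] unfolding 1 .
      qed
      then show ?case using union unfolding Z_def 1 by simp
    qed
  qed
  show ?thesis
  proof (rule density_zero[OF k])
    fix A assume "A \<in> sets (Lm l)"
    then obtain B where B: "B \<in> sets lebesgue" "A = B \<inter> {0<..<l}"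
      unfolding sets_restrict_space by blast
    obtain S N N' where N: "B = S \<union> N" "N \<subseteq> N'" "N' \<in> null_sets lborel" "S \<in> sets lborel"
      using sets_completionE[OF B(1)] by metis
    have "N' \<in> null_sets lebesgue" using N(3) by (rule null_sets_completionI)
    then have "AE x in lebesgue. x \<notin> N'" by (rule AE_not_in)
    then have ae: "AE x in Lm l. x \<notin> N'" by (auto simp: AE_restrict_space_iff)
    have "(LINT x:A|Lm l. k x) = (LINT x:S \<inter> {0<..<l}|Lm l. k x)"
      unfolding set_lebesgue_integral_def
    proof (rule integral_cong_AE)
      show "AE x in Lm l. indicat_real A x *\<^sub>R k x = indicat_real (S \<inter> {0<..<l}) x *\<^sub>R k x"
        using ae by eventually_elim (use N B in \<open>auto simp: indicator_def\<close>)
      show "(\<lambda>x. indicat_real A x *\<^sub>R k x) \<in> borel_measurable (Lm l)"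
        using \<open>A \<in> sets (Lm l)\<close> by measurable
      show "(\<lambda>x. indicat_real (S \<inter> {0<..<l}) x *\<^sub>R k x) \<in> borel_measurable (Lm l)"
        using sets_borel[of S] N(4) by measurable
    qed
    then show "(LINT x:A|Lm l. k x) = 0" using borel[of S] N(4) by (simp add: Z_def)
  qed
qed

lemma test_fun_diff:
  assumes "\<phi> \<in> test_fun l" "\<psi> \<in> test_fun l"
  shows "(\<lambda>x. \<phi> x - a * \<psi> x) \<in> test_fun l"
proof -
  have "smooth (\<lambda>x. \<phi> x + (- a) * \<psi> x)"
    using assms unfolding test_fun_iff by (intro smooth_add smooth_mult smooth_const) auto
  moreover have "closure {x. \<phi> x - a * \<psi> x \<noteq> 0} \<subseteq> closure ({x. \<phi> x \<noteq> 0} \<union> {x. \<psi> x \<noteq> 0})"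
    by (intro closure_mono) auto
  ultimately show ?thesis using assms unfolding test_fun_iff closure_Un by auto
qed

lemma test_fun_integrable:
  assumes "\<phi> \<in> test_fun l"
  shows "integrable (Lm l) \<phi>" "continuous_on S \<phi>"
proof -
  have "smooth \<phi>" using assms unfolding test_fun_iff by blast
  then show "continuous_on S \<phi>" by (rule smooth_continuous_on)
  show "integrable (Lm l) \<phi>" by (rule integrable_Lm_continuous[OF smooth_continuous_on[OF \<open>smooth \<phi>\<close>]])
qed

lemma normalized_test_fun:
  assumes "0 < l"
  obtains \<phi> where "\<phi> \<in> test_fun l" "(LINT x|Lm l. \<phi> x) = 1"
proof -
  have "integrable (Lm l) (\<lambda>x. 1 :: complex)" by (intro integrable_Lm_continuous continuous_intros)
  from LINT_cutoff_tendsto[OF this, of 0 l]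
  have lim: "(\<lambda>n. LINT x|Lm l. of_real (cutoff 0 l n x)) \<longlonglongrightarrow> (LINT x|Lm l. indicator {0<..<l} x :: complex)" by simp
  have "(LINT x|Lm l. indicator {0<..<l} x :: complex) = (LINT x|Lm l. 1)"
    by (intro Bochner_Integration.integral_cong) auto
  also have "\<dots> = of_real l"
    using LINT_Lm[OF \<open>integrable (Lm l) (\<lambda>x. 1 :: complex)\<close>] assms by (simp add: scaleR_conv_of_real)
  finally have "\<forall>\<^sub>F n in sequentially. (LINT x|Lm l. complex_of_real (cutoff 0 l n x)) \<noteq> 0"
    using tendsto_imp_eventually_ne[OF lim, of 0] assms by simp
  then obtain n where n: "(LINT x|Lm l. complex_of_real (cutoff 0 l n x)) \<noteq> 0"
    by (auto dest: eventually_happens)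
  let ?c = "LINT x|Lm l. complex_of_real (cutoff 0 l n x)"
  show ?thesis
  proof (rule that)
    show "(\<lambda>x. inverse ?c * of_real (cutoff 0 l n x)) \<in> test_fun l"
      by (intro cutoff_test_fun smooth_const) auto
    show "(LINT x|Lm l. inverse ?c * of_real (cutoff 0 l n x)) = 1"
      unfolding integral_mult_right_zero using n by simp
  qed
qed

text \<open>
  After subtraction of the primitive of \<open>F\<close> the weak derivative is zero. A test function of mean value
  zero is the derivative of a test function, so the difference annihilates all of these, and it is
  therefore constant.
\<close>

lemma weak_deriv_imp_primitive:
  assumes "0 < l" and f: "integrable (Lm l) f" and F: "integrable (Lm l) F" and w: "has_weak_deriv l f F"
  shows "\<exists>c. AE x in Lm l. f x = c + integral {0..x} F"
proof -
  define G where "G x = 0 + integral {0..x} F" for x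
  define k where "k x = f x - G x" for x
  have cG: "continuous_on {0..l} G" unfolding G_def using assms(1) by (intro primitive_continuous_on F) simp
  then have Gi: "integrable (Lm l) G" by (rule integrable_Lm_continuous)
  have ki: "integrable (Lm l) k" unfolding k_def by (intro Bochner_Integration.integrable_diff f Gi)
  have wG: "has_weak_deriv l G F" by (rule weak_deriv_primitive[OF assms(1) F]) (simp add: G_def)
  have kz: "(LINT x|Lm l. k x * test_deriv \<phi> x) = 0" if "\<phi> \<in> test_fun l" for \<phi>
  proof -
    have cD: "continuous_on {0..l} (test_deriv \<phi>)" using test_fun_derivative(2)[OF that] smooth_continuous_on by blast
    have "(LINT x|Lm l. k x * test_deriv \<phi> x) = (LINT x|Lm l. f x * test_deriv \<phi> x - G x * test_deriv \<phi> x)"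
      by (simp add: k_def left_diff_distrib)
    also have "\<dots> = (LINT x|Lm l. f x * test_deriv \<phi> x) - (LINT x|Lm l. G x * test_deriv \<phi> x)"
      by (intro Bochner_Integration.integral_diff integrable_Lm_mult_continuous f Gi cD)
    also have "\<dots> = 0" using w wG that unfolding has_weak_deriv_def by simp
    finally show ?thesis .
  qed
  obtain \<phi>0 where \<phi>0: "\<phi>0 \<in> test_fun l" "(LINT x|Lm l. \<phi>0 x) = 1" using normalized_test_fun[OF assms(1)] .
  define c where "c = (LINT x|Lm l. k x * \<phi>0 x)"
  have "AE x in Lm l. k x - c = 0"
  proof (rule fundamental_lemma_calculus_of_variations)
    show "integrable (Lm l) (\<lambda>x. k x - c)"
      by (intro Bochner_Integration.integrable_diff ki integrable_Lm_continuous continuous_intros)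
    fix \<psi> assume \<psi>: "\<psi> \<in> test_fun l"
    define m where "m = (LINT x|Lm l. \<psi> x)"
    define \<psi>' where "\<psi>' x = \<psi> x - m * \<phi>0 x" for x
    have \<psi>': "\<psi>' \<in> test_fun l" unfolding \<psi>'_def by (rule test_fun_diff[OF \<psi> \<phi>0(1)])
    have "(LINT x|Lm l. \<psi>' x) = (LINT x|Lm l. \<psi> x) - (LINT x|Lm l. m * \<phi>0 x)"
      unfolding \<psi>'_def using test_fun_integrable(1) \<psi> \<phi>0
      by (intro Bochner_Integration.integral_diff integrable_mult_right) auto
    also have "\<dots> = 0" using \<phi>0(2) by (simp add: m_def)
    finally have "integral {0..l} \<psi>' = 0" using LINT_Lm[OF test_fun_integrable(1)[OF \<psi>']] by simp
    then obtain \<phi> where "\<phi> \<in> test_fun l" "test_deriv \<phi> = \<psi>'"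
      using test_fun_primitive[OF \<psi>' assms(1)] by metis
    then have 0: "(LINT x|Lm l. k x * \<psi>' x) = 0" using kz by metis
    have i: "integrable (Lm l) (\<lambda>x. k x * \<psi> x)" "integrable (Lm l) (\<lambda>x. k x * \<phi>0 x)"
      using integrable_Lm_mult_continuous[OF ki] test_fun_integrable(2) \<psi> \<phi>0(1) by blast+
    have "(LINT x|Lm l. k x * \<psi>' x) = (LINT x|Lm l. k x * \<psi> x - m * (k x * \<phi>0 x))"
      by (simp add: \<psi>'_def algebra_simps)
    also have "\<dots> = (LINT x|Lm l. k x * \<psi> x) - (LINT x|Lm l. m * (k x * \<phi>0 x))"
      by (intro Bochner_Integration.integral_diff i integrable_mult_right)
    also have "\<dots> = (LINT x|Lm l. k x * \<psi> x) - (LINT x|Lm l. c * \<psi> x)"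
      unfolding integral_mult_right_zero c_def m_def by simp
    also have "\<dots> = (LINT x|Lm l. k x * \<psi> x - c * \<psi> x)"
      by (intro Bochner_Integration.integral_diff[symmetric] i integrable_mult_right test_fun_integrable \<psi>)
    finally show "(LINT x|Lm l. (k x - c) * \<psi> x) = 0" using 0 by (simp add: left_diff_distrib)
  qed
  then have "AE x in Lm l. f x = c + integral {0..x} F"
    by eventually_elim (simp add: k_def G_def algebra_simps)
  then show ?thesis by blast
qed

section \<open>The space \<open>L\<^sup>2\<close>\<close>

lemma L2_D:
  assumes "f \<in> L2 l"
  shows "f \<in> borel_measurable (Lm l)" "integrable (Lm l) (\<lambda>x. (norm (f x))\<^sup>2)"
  using assms by (auto simp: L2_def)

lemma L2_integrable:
  fixes f :: "real \<Rightarrow> 'a::euclidean_space"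
  assumes "f \<in> L2 l"
  shows "integrable (Lm l) f"
proof -
  interpret finite_measure "Lm l" by (rule finite_measure_Lm)
  have [measurable]: "f \<in> borel_measurable (Lm l)" using L2_D[OF assms] by simp
  have "integrable (Lm l) (\<lambda>x. norm (f x))"
  proof (rule square_integrable_imp_integrable)
    show "(\<lambda>x. norm (f x)) \<in> borel_measurable (Lm l)" by measurable
    show "integrable (Lm l) (\<lambda>x. (norm (f x))\<^sup>2)" by (rule L2_D(2)[OF assms])
  qed
  then show ?thesis by (rule integrable_norm_cancel) simp
qed

lemma L2_bounded:
  fixes f :: "real \<Rightarrow> 'a::euclidean_space"
  assumes [measurable]: "f \<in> borel_measurable (Lm l)" and B: "\<And>x. x \<in> {0<..<l} \<Longrightarrow> norm (f x) \<le> B"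
  shows "f \<in> L2 l"
proof -
  have "integrable (Lm l) (\<lambda>x. (norm (f x))\<^sup>2)"
    using power_mono[OF B norm_ge_zero, of _ 2] by (intro integrable_Lm_bounded[of _ _ "B\<^sup>2"]) auto
  with assms(1) show ?thesis by (simp add: L2_def)
qed

lemma L2_continuous:
  fixes f :: "real \<Rightarrow> 'a::euclidean_space"
  assumes "continuous_on {0..l} f"
  shows "f \<in> L2 l"
proof -
  obtain B where "\<forall>x\<in>{0..l}. norm (f x) \<le> B" using continuous_on_Icc_bounded[OF assms] by auto
  then show ?thesis by (intro L2_bounded[of _ _ B] borel_measurable_Lm' assms) auto
qed

lemma L2_diff:
  fixes f g :: "real \<Rightarrow> 'a::euclidean_space"
  assumes "f \<in> L2 l" "g \<in> L2 l"
  shows "(\<lambda>x. f x - g x) \<in> L2 l"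
proof -
  have [measurable]: "f \<in> borel_measurable (Lm l)" "g \<in> borel_measurable (Lm l)"
    using L2_D(1) assms by auto
  have "integrable (Lm l) (\<lambda>x. 2 * (norm (f x))\<^sup>2 + 2 * (norm (g x))\<^sup>2)"
    using L2_D(2)[OF assms(1)] L2_D(2)[OF assms(2)] by auto
  then have "integrable (Lm l) (\<lambda>x. (norm (f x - g x))\<^sup>2)"
  proof (rule Bochner_Integration.integrable_bound)
    have "(norm (a - b))\<^sup>2 \<le> 2 * (norm a)\<^sup>2 + 2 * (norm b)\<^sup>2" for a b :: 'a
    proof -
      have "(norm (a - b))\<^sup>2 \<le> (norm a + norm b)\<^sup>2"
        using norm_triangle_ineq4[of a b] by (intro power_mono) auto
      moreover have "0 \<le> (norm a - norm b)\<^sup>2" by simp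
      ultimately show ?thesis by (simp add: power2_sum power2_diff)
    qed
    then show "AE x in Lm l. norm ((norm (f x - g x))\<^sup>2) \<le> norm (2 * (norm (f x))\<^sup>2 + 2 * (norm (g x))\<^sup>2)"
      by (intro AE_I2) (auto simp: abs_le_iff intro: order_trans)
  qed measurable
  then show ?thesis by (simp add: L2_def)
qed

lemma L2_Pair:
  fixes f g :: "real \<Rightarrow> complex"
  assumes "f \<in> L2 l" "g \<in> L2 l"
  shows "(\<lambda>x. (f x, g x)) \<in> L2 l"
proof -
  have "(\<lambda>x. (f x, g x)) \<in> borel_measurable (Lm l)"
    using L2_D(1)[OF assms(1)] L2_D(1)[OF assms(2)] by (rule borel_measurable_Pair)
  moreover have "integrable (Lm l) (\<lambda>x. (norm (f x))\<^sup>2 + (norm (g x))\<^sup>2)"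
    using L2_D(2)[OF assms(1)] L2_D(2)[OF assms(2)] by (rule Bochner_Integration.integrable_add)
  ultimately show ?thesis by (simp add: L2_def norm_Pair)
qed

lemma L2_linear_image:
  fixes f :: "real \<Rightarrow> 'a::euclidean_space" and T :: "'a \<Rightarrow> 'b::euclidean_space"
  assumes f: "f \<in> L2 l" and T: "bounded_linear T" and le: "\<And>z. norm (T z) \<le> norm z"
  shows "(\<lambda>x. T (f x)) \<in> L2 l"
proof -
  have m: "(\<lambda>x. T (f x)) \<in> borel_measurable (Lm l)"
    using measurable_compose[OF L2_D(1)[OF f] borel_measurable_continuous_onI[OF linear_continuous_on[OF T]]] .
  have "integrable (Lm l) (\<lambda>x. (norm (T (f x)))\<^sup>2)"
  proof (rule Bochner_Integration.integrable_bound[OF L2_D(2)[OF f]])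
    show "(\<lambda>x. (norm (T (f x)))\<^sup>2) \<in> borel_measurable (Lm l)" using m by measurable
    show "AE x in Lm l. norm ((norm (T (f x)))\<^sup>2) \<le> norm ((norm (f x))\<^sup>2)"
      using le by (intro AE_I2) (auto intro!: power_mono)
  qed
  with m show ?thesis by (simp add: L2_def)
qed

lemma measure_Lm:
  assumes "0 < l" shows "measure (Lm l) {0<..<l} = l"
proof -
  have "integrable (Lm l) (\<lambda>x. 1::real)" by (intro integrable_Lm_continuous continuous_on_const)
  from LINT_Lm[OF this] show ?thesis using assms by simp
qed

lemma LINT_const: "0 < l \<Longrightarrow> (LINT x|Lm l. c) = l * c" for c :: real
  by (simp add: measure_Lm)

text \<open>
  The Cauchy--Schwarz inequality against a constant, from the nonnegativity of the variance.
\<close>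

lemma L1_le_L2:
  fixes f :: "real \<Rightarrow> 'a::euclidean_space"
  assumes "0 < l" "f \<in> L2 l"
  shows "(LINT x|Lm l. norm (f x)) \<le> sqrt l * l2norm l f"
proof -
  define a where "a = (LINT x|Lm l. norm (f x))"
  define b where "b = (LINT x|Lm l. (norm (f x))\<^sup>2)"
  have i: "integrable (Lm l) (\<lambda>x. norm (f x))" using L2_integrable[OF assms(2)] by (rule integrable_norm)
  have i2: "integrable (Lm l) (\<lambda>x. (norm (f x))\<^sup>2)" using L2_D[OF assms(2)] by simp
  have ic: "integrable (Lm l) (\<lambda>x. (a / l)\<^sup>2)" by (intro integrable_Lm_continuous continuous_intros)
  \<comment> \<open>\<open>a / l\<close> is the mean value of \<open>norm (f x)\<close>.\<close>
  have "0 \<le> (LINT x|Lm l. (norm (f x) - a / l)\<^sup>2)" by simp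
  also have "\<dots> = (LINT x|Lm l. ((norm (f x))\<^sup>2 - (2 * (a / l)) * norm (f x)) + (a / l)\<^sup>2)"
    by (intro Bochner_Integration.integral_cong) (auto simp: power2_diff)
  also have "\<dots> = b - (2 * (a / l)) * a + l * (a / l)\<^sup>2"
    using i i2 ic assms(1)
    by (subst Bochner_Integration.integral_add, (auto)[2])
       (subst Bochner_Integration.integral_diff, auto simp: a_def b_def measure_Lm)
  also have "\<dots> = b - a\<^sup>2 / l" using assms(1) by (simp add: power2_eq_square field_simps)
  finally have "a\<^sup>2 \<le> l * b" using assms(1) by (simp add: field_simps)
  then have "a \<le> sqrt (l * b)" by (rule real_le_rsqrt)
  then show ?thesis by (simp add: a_def b_def l2norm_def real_sqrt_mult)
qed

lemma l2norm_le:
  fixes f :: "real \<Rightarrow> 'a::euclidean_space"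
  assumes "0 < l" "0 \<le> B" "\<And>x. x \<in> {0<..<l} \<Longrightarrow> norm (f x) \<le> B"
  shows "l2norm l f \<le> sqrt l * B"
proof -
  have "(LINT x|Lm l. (norm (f x))\<^sup>2) \<le> (LINT x|Lm l. B\<^sup>2)"
  proof (rule Bochner_Integration.integral_mono')
    show "integrable (Lm l) (\<lambda>x. B\<^sup>2)" by (intro integrable_Lm_continuous continuous_intros)
    show "(norm (f x))\<^sup>2 \<le> B\<^sup>2" if "x \<in> space (Lm l)" for x
      using power_mono[OF assms(3) norm_ge_zero, of x 2] that by simp
  qed simp
  also have "\<dots> = l * B\<^sup>2" using LINT_const[OF assms(1)] .
  finally have "l2norm l f \<le> sqrt (l * B\<^sup>2)" unfolding l2norm_def by (rule real_sqrt_le_mono)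
  then show ?thesis using assms by (simp add: real_sqrt_mult)
qed

lemma l2norm_nonneg: "0 \<le> l2norm l f"
  by (simp add: l2norm_def)

lemma l2norm_cong_AE:
  fixes f g :: "real \<Rightarrow> 'a::euclidean_space"
  assumes [measurable]: "f \<in> borel_measurable (Lm l)" "g \<in> borel_measurable (Lm l)" and "AE x in Lm l. f x = g x"
  shows "l2norm l f = l2norm l g"
proof -
  have "(LINT x|Lm l. (norm (f x))\<^sup>2) = (LINT x|Lm l. (norm (g x))\<^sup>2)"
    by (rule integral_cong_AE) (use assms(3) in auto)
  then show ?thesis by (simp add: l2norm_def)
qed

lemma l2norm_tendsto_0:
  fixes f :: "nat \<Rightarrow> real \<Rightarrow> 'a::euclidean_space"
  assumes [measurable]: "\<And>n. f n \<in> borel_measurable (Lm l)"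
    and B: "\<And>n x. x \<in> {0<..<l} \<Longrightarrow> norm (f n x) \<le> B"
    and lim: "\<And>x. x \<in> {0<..<l} \<Longrightarrow> (\<lambda>n. f n x) \<longlonglongrightarrow> 0"
  shows "(\<lambda>n. l2norm l (f n)) \<longlonglongrightarrow> 0"
proof -
  have "(\<lambda>n. LINT x|Lm l. (norm (f n x))\<^sup>2) \<longlonglongrightarrow> (LINT x|Lm l. 0)"
  proof (rule integral_dominated_convergence)
    show "integrable (Lm l) (\<lambda>x. B\<^sup>2)" by (intro integrable_Lm_continuous continuous_intros)
    show "AE x in Lm l. norm ((norm (f n x))\<^sup>2) \<le> B\<^sup>2" for n
      using power_mono[OF B norm_ge_zero, of _ n 2] by (intro AE_LmI) auto
    show "AE x in Lm l. (\<lambda>n. (norm (f n x))\<^sup>2) \<longlonglongrightarrow> 0"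
      using tendsto_power[OF tendsto_norm[OF lim], of _ 2] by (intro AE_LmI) simp
  qed auto
  from tendsto_real_sqrt[OF this] show ?thesis by (simp add: l2norm_def)
qed

text \<open>
  Joint continuity is uniform in \<open>x\<close> because \<open>[0, l]\<close> is compact.
\<close>

lemma L2_continuous_on_joint:
  assumes l: "0 < l" and c: "continuous_on (I \<times> {0..l}) (\<lambda>(t, x). U t x)"
  shows "L2_continuous_on l I U"
  unfolding L2_continuous_on_def
proof
  fix a assume a: "a \<in> I"
  show "((\<lambda>t. l2norm l (\<lambda>x. U t x - U a x)) \<longlongrightarrow> 0) (at a within I)"
  proof (rule tendstoI)
    fix e :: real assume e: "0 < e"
    define d where "d = e / (2 * sqrt l)"
    have d: "0 < d" using e l by (simp add: d_def)
    obtain X0 where X0: "a \<in> X0" "open X0" "\<forall>x\<in>X0 \<inter> I. \<forall>t\<in>{0..l}. dist (case (x, t) of (t, x) \<Rightarrow> U t x) (case (a, t) of (t, x) \<Rightarrow> U t x) \<le> d"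
      using continuous_on_prod_compactE[OF c compact_Icc a d] by metis
    have "\<forall>\<^sub>F t in at a within I. t \<in> X0 \<inter> I"
      using X0 by (auto simp: eventually_at_topological)
    then show "\<forall>\<^sub>F t in at a within I. dist (l2norm l (\<lambda>x. U t x - U a x)) 0 < e"
    proof eventually_elim
      case (elim t)
      have "l2norm l (\<lambda>x. U t x - U a x) \<le> sqrt l * d"
        using X0(3) elim d by (intro l2norm_le[OF l]) (auto simp: dist_norm)
      also have "\<dots> = e / 2" using l by (simp add: d_def)
      also have "\<dots> < e" using e by simp
      finally show ?case using l2norm_nonneg[of l "\<lambda>x. U t x - U a x"] by (simp add: dist_real_def)
    qed
  qed
qed

lemma primitive_diff_bound:
  fixes F G :: "real \<Rightarrow> 'a::euclidean_space"
  assumes "0 < l" "F \<in> L2 l" "G \<in> L2 l" "x \<in> {0..l}"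
  shows "norm (integral {0..x} F - integral {0..x} G) \<le> sqrt l * l2norm l (\<lambda>x. F x - G x)"
proof -
  note i = L2_integrable[OF assms(2)] L2_integrable[OF assms(3)] L2_diff[OF assms(2,3)]
  have "integral {0..x} F - integral {0..x} G = integral {0..x} (\<lambda>x. F x - G x)"
    by (intro Henstock_Kurzweil_Integration.integral_diff[symmetric] integrable_on_Lm(2)[OF _ assms(4)] i)
  also have "norm \<dots> \<le> (LINT t|Lm l. norm (F t - G t))"
    using primitive_bound[OF L2_integrable[OF i(3)] assms(4)] .
  also have "\<dots> \<le> sqrt l * l2norm l (\<lambda>x. F x - G x)" by (rule L1_le_L2[OF assms(1) i(3)])
  finally show ?thesis .
qed

lemma primitive_cong_AE:
  fixes F G :: "real \<Rightarrow> 'a::euclidean_space"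
  assumes F: "integrable (Lm l) F" and G: "integrable (Lm l) G" and "AE x in Lm l. F x = G x" and x: "x \<in> {0..l}"
  shows "integral {0..x} F = integral {0..x} G"
proof -
  have i: "integrable (Lm l) (\<lambda>x. F x - G x)" by (intro Bochner_Integration.integrable_diff F G)
  have "integral {0..x} F - integral {0..x} G = integral {0..x} (\<lambda>x. F x - G x)"
    by (intro Henstock_Kurzweil_Integration.integral_diff[symmetric] integrable_on_Lm(2)[OF _ x] F G)
  also have "norm \<dots> \<le> (LINT t|Lm l. norm (F t - G t))" by (rule primitive_bound[OF i x])
  also have "\<dots> = (LINT t|Lm l. 0)"
    by (rule integral_cong_AE) (use assms(3) borel_measurable_integrable[OF i] in auto)
  finally show ?thesis by simp
qed

lemma continuous_AE_eq:
  fixes f g :: "real \<Rightarrow> 'a::euclidean_space"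
  assumes "0 < l" and f: "continuous_on {0..l} f" and g: "continuous_on {0..l} g" and ae: "AE x in Lm l. f x = g x"
    and x: "x \<in> {0..l}"
  shows "f x = g x"
proof -
  have c: "continuous_on {0..l} (\<lambda>x. norm (f x - g x))" by (intro continuous_intros f g)
  have "(LINT x|Lm l. norm (f x - g x)) = (LINT x|Lm l. 0)"
    by (rule integral_cong_AE) (use ae borel_measurable_Lm'[OF c] in auto)
  then have "integral {0..l} (\<lambda>x. norm (f x - g x)) = 0"
    using LINT_Lm[OF integrable_Lm_continuous[OF c]] by simp
  then show ?thesis using integral_eq_0_iff[OF c assms(1)] x by simp
qed

section \<open>The domain of the Dirichlet operators\<close>

lemma weak_deriv_unique:
  assumes "integrable (Lm l) F" "integrable (Lm l) G" "has_weak_deriv l f F" "has_weak_deriv l f G"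
  shows "AE x in Lm l. F x = G x"
proof -
  have "AE x in Lm l. F x - G x = 0"
  proof (rule fundamental_lemma_calculus_of_variations)
    show "integrable (Lm l) (\<lambda>x. F x - G x)" using assms by auto
    fix \<phi> assume \<phi>: "\<phi> \<in> test_fun l"
    have "- (LINT x|Lm l. F x * \<phi> x) = - (LINT x|Lm l. G x * \<phi> x)"
      using bspec[OF assms(3)[unfolded has_weak_deriv_def] \<phi>] bspec[OF assms(4)[unfolded has_weak_deriv_def] \<phi>]
      by simp
    then have "(LINT x|Lm l. F x * \<phi> x) = (LINT x|Lm l. G x * \<phi> x)" by (simp only: neg_equal_iff_equal)
    moreover have "(LINT x|Lm l. F x * \<phi> x - G x * \<phi> x) = (LINT x|Lm l. F x * \<phi> x) - (LINT x|Lm l. G x * \<phi> x)"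
      by (intro Bochner_Integration.integral_diff integrable_Lm_mult_continuous assms test_fun_integrable[OF \<phi>])
    ultimately show "(LINT x|Lm l. (F x - G x) * \<phi> x) = 0" by (simp add: left_diff_distrib)
  qed
  then show ?thesis by simp
qed

lemma has_weak_deriv_cong_AE:
  assumes "integrable (Lm l) f" "integrable (Lm l) g" "AE x in Lm l. f x = g x"
    and "integrable (Lm l) F" "integrable (Lm l) G" "AE x in Lm l. F x = G x"
    and "has_weak_deriv l f F"
  shows "has_weak_deriv l g G"
  unfolding has_weak_deriv_def
proof
  fix \<phi> assume \<phi>: "\<phi> \<in> test_fun l"
  have [measurable]: "\<phi> \<in> borel_measurable (Lm l)" "test_deriv \<phi> \<in> borel_measurable (Lm l)"
    using test_fun_integrable[OF \<phi>] smooth_continuous_on[OF test_fun_derivative(2)[OF \<phi>]]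
    by (auto intro!: borel_measurable_Lm)
  have [measurable]: "f \<in> borel_measurable (Lm l)" "g \<in> borel_measurable (Lm l)"
    "F \<in> borel_measurable (Lm l)" "G \<in> borel_measurable (Lm l)" using assms by auto
  have "(LINT x|Lm l. g x * test_deriv \<phi> x) = (LINT x|Lm l. f x * test_deriv \<phi> x)"
    by (rule integral_cong_AE) (use assms(3) in auto)
  moreover have "(LINT x|Lm l. G x * \<phi> x) = (LINT x|Lm l. F x * \<phi> x)"
    by (rule integral_cong_AE) (use assms(6) in auto)
  ultimately show "(LINT x|Lm l. g x * test_deriv \<phi> x) = - (LINT x|Lm l. G x * \<phi> x)"
    using assms(7) \<phi> unfolding has_weak_deriv_def by simp
qed

lemma wderiv_AE:
  assumes "F \<in> L2 l" "has_weak_deriv l f F"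
  shows "wderiv l f \<in> L2 l" "has_weak_deriv l f (wderiv l f)" "AE x in Lm l. wderiv l f x = F x"
proof -
  have *: "wderiv l f \<in> L2 l \<and> has_weak_deriv l f (wderiv l f)"
    unfolding wderiv_def by (rule someI[of _ F]) (use assms in auto)
  then show "wderiv l f \<in> L2 l" "has_weak_deriv l f (wderiv l f)" by auto
  show "AE x in Lm l. wderiv l f x = F x"
    using * assms by (intro weak_deriv_unique[of l _ _ f] L2_integrable) auto
qed

lemma wderiv_wderiv_AE:
  assumes "F \<in> L2 l" "has_weak_deriv l f F" "G \<in> L2 l" "has_weak_deriv l F G"
  shows "AE x in Lm l. wderiv l (wderiv l f) x = G x"
proof (rule wderiv_AE(3)[OF assms(3)])
  note w = wderiv_AE[OF assms(1,2)]
  have "AE x in Lm l. F x = wderiv l f x" using w(3) by eventually_elim simp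
  then show "has_weak_deriv l (wderiv l f) G"
    by (rule has_weak_deriv_cong_AE[OF L2_integrable[OF assms(1)] L2_integrable[OF w(1)] _
        L2_integrable[OF assms(3)] L2_integrable[OF assms(3)] _ assms(4)]) simp
qed

lemma test_fun_as_primitive:
  assumes "\<phi> \<in> test_fun l" "x \<in> {0..l}"
  shows "\<phi> x = integral {0..x} (test_deriv \<phi>)"
proof -
  have "(test_deriv \<phi> has_integral (\<phi> x - \<phi> 0)) {0..x}"
    using assms(2) has_vector_derivative_at_within[OF test_fun_derivative(1)[OF assms(1)]]
    by (intro fundamental_theorem_of_calculus) simp_all
  then show ?thesis using test_fun_outside[OF assms(1), of 0] by (simp add: integral_unique)
qed

text \<open>
  Weak derivatives give \<open>f = c0 + \<integral> z'\<close> almost everywhere. The approximating test functions vanish at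
  \<open>0\<close> and \<open>l\<close> and their derivatives converge to \<open>z'\<close> in \<open>L\<^sup>2\<close>, so they converge uniformly to \<open>\<integral> z'\<close>: this forces
  both \<open>c0 = 0\<close> and the boundary value at \<open>l\<close>.
\<close>

lemma dom_L_representative:
  assumes l: "0 < l" and f: "f \<in> dom_L l"
  shows "\<exists>z z' c F. continuous_on {0..l} z \<and> continuous_on {0..l} z' \<and> F \<in> L2 l \<and>
    (\<forall>x\<in>{0..l}. z x = integral {0..x} z') \<and> (\<forall>x\<in>{0..l}. z' x = c + integral {0..x} F) \<and> z l = 0 \<and>
    (AE x in Lm l. f x = z x) \<and> (AE x in Lm l. wderiv l (wderiv l f) x = F x)"
proof -
  obtain f' F where fF: "f \<in> L2 l" "f' \<in> L2 l" "F \<in> L2 l" "has_weak_deriv l f f'" "has_weak_deriv l f' F"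
    using f unfolding dom_L_def H2_def by auto
  obtain \<phi> where \<phi>: "\<And>n. \<phi> n \<in> test_fun l" "(\<lambda>n. l2norm l (\<lambda>x. f x - \<phi> n x)) \<longlonglongrightarrow> 0"
     "(\<lambda>n. l2norm l (\<lambda>x. wderiv l f x - test_deriv (\<phi> n) x)) \<longlonglongrightarrow> 0"
    using f unfolding dom_L_def H10_def by auto
  obtain c where c: "AE x in Lm l. f' x = c + integral {0..x} F"
    using weak_deriv_imp_primitive[OF l L2_integrable[OF fF(2)] L2_integrable[OF fF(3)] fF(5)] by blast
  define z' where "z' x = c + integral {0..x} F" for x
  have cz': "continuous_on {0..l} z'" unfolding z'_def using l fF by (intro primitive_continuous_on L2_integrable) auto
  have z'L2: "z' \<in> L2 l" by (rule L2_continuous[OF cz'])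
  have f'z': "AE x in Lm l. f' x = z' x" using c by (simp add: z'_def)
  have wz': "has_weak_deriv l f z'"
    by (rule has_weak_deriv_cong_AE[OF L2_integrable[OF fF(1)] L2_integrable[OF fF(1)] _
        L2_integrable[OF fF(2)] L2_integrable[OF z'L2] f'z' fF(4)]) simp
  obtain c0 where c0: "AE x in Lm l. f x = c0 + integral {0..x} z'"
    using weak_deriv_imp_primitive[OF l L2_integrable[OF fF(1)] L2_integrable[OF z'L2] wz'] by blast
  define b where "b n = l2norm l (\<lambda>x. z' x - test_deriv (\<phi> n) x)" for n
  have cD: "continuous_on S (test_deriv (\<phi> n))" for n S
    by (rule smooth_continuous_on[OF test_fun_derivative(2)[OF \<phi>(1)]])
  note w = wderiv_AE[OF z'L2 wz']
  have "l2norm l (\<lambda>x. wderiv l f x - test_deriv (\<phi> n) x) = b n" for n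
    unfolding b_def
  proof (rule l2norm_cong_AE)
    show "AE x in Lm l. wderiv l f x - test_deriv (\<phi> n) x = z' x - test_deriv (\<phi> n) x"
      using w(3) by eventually_elim simp
    show "(\<lambda>x. wderiv l f x - test_deriv (\<phi> n) x) \<in> borel_measurable (Lm l)"
      "(\<lambda>x. z' x - test_deriv (\<phi> n) x) \<in> borel_measurable (Lm l)"
      using L2_D(1)[OF w(1)] L2_D(1)[OF z'L2] borel_measurable_Lm[OF cD] by (auto intro!: borel_measurable_diff)
  qed
  then have b0: "b \<longlonglongrightarrow> 0" using \<phi>(3) by simp
  have bd: "norm (integral {0..x} z' - \<phi> n x) \<le> sqrt l * b n" if "x \<in> {0..l}" for x n
    using primitive_diff_bound[OF l z'L2 L2_continuous[OF cD] that] test_fun_as_primitive[OF \<phi>(1) that]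
    by (simp add: b_def)
  have lim0: "(\<lambda>n. sqrt l * b n) \<longlonglongrightarrow> 0" using tendsto_mult_right_zero[OF b0] .
  have zl: "integral {0..l} z' = 0"
  proof -
    have "norm (integral {0..l} z') \<le> sqrt l * b n" for n
      using bd[of l n] test_fun_outside[OF \<phi>(1), of l] l by simp
    then have "norm (integral {0..l} z') \<le> 0" by (intro LIMSEQ_le_const[OF lim0]) auto
    then show ?thesis by simp
  qed
  \<comment> \<open>Averaging \<open>c0 = (f - \<phi> n) - (\<integral> z' - \<phi> n)\<close> over the interval leaves only quantities that tend to \<open>0\<close>.\<close>
  have "c0 = 0"
  proof -
    define a where "a n = l2norm l (\<lambda>x. f x - \<phi> n x)" for n
    have "l * norm c0 \<le> sqrt l * a n + l * (sqrt l * b n)" for n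
    proof -
      have L: "(\<lambda>x. f x - \<phi> n x) \<in> L2 l"
        using test_fun_integrable(2)[OF \<phi>(1)] by (intro L2_diff fF L2_continuous)
      have i: "integrable (Lm l) (\<lambda>x. norm (f x - \<phi> n x))" by (intro integrable_norm L2_integrable L)
      have "l * norm c0 = (LINT x|Lm l. norm c0)" by (simp add: measure_Lm[OF l])
      also have "\<dots> \<le> (LINT x|Lm l. norm (f x - \<phi> n x) + sqrt l * b n)"
      proof (rule integral_mono_AE)
        show "integrable (Lm l) (\<lambda>x. norm c0)" by (intro integrable_Lm_continuous continuous_intros)
        show "integrable (Lm l) (\<lambda>x. norm (f x - \<phi> n x) + sqrt l * b n)"
          by (intro Bochner_Integration.integrable_add i integrable_Lm_continuous continuous_intros)
        have "AE x in Lm l. norm (integral {0..x} z' - \<phi> n x) \<le> sqrt l * b n" using bd by (intro AE_LmI) auto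
        with c0 show "AE x in Lm l. norm c0 \<le> norm (f x - \<phi> n x) + sqrt l * b n"
        proof eventually_elim
          case (elim x)
          have "c0 = (f x - \<phi> n x) - (integral {0..x} z' - \<phi> n x)" using elim(1) by simp
          then have "norm c0 \<le> norm (f x - \<phi> n x) + norm (integral {0..x} z' - \<phi> n x)"
            using norm_triangle_ineq4[of "f x - \<phi> n x" "integral {0..x} z' - \<phi> n x"] by simp
          with elim(2) show ?case by simp
        qed
      qed
      also have "\<dots> = (LINT x|Lm l. norm (f x - \<phi> n x)) + l * (sqrt l * b n)"
        by (subst Bochner_Integration.integral_add[OF i])
          (auto intro!: integrable_Lm_continuous simp: measure_Lm[OF l])
      also have "(LINT x|Lm l. norm (f x - \<phi> n x)) \<le> sqrt l * a n" unfolding a_def by (rule L1_le_L2[OF l L])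
      finally show ?thesis by simp
    qed
    moreover have "(\<lambda>n. sqrt l * a n + l * (sqrt l * b n)) \<longlonglongrightarrow> 0"
      using tendsto_add[OF tendsto_mult_right_zero[OF \<phi>(2), of "sqrt l"] tendsto_mult_right_zero[OF lim0, of l]]
      by (simp add: a_def)
    ultimately have "l * norm c0 \<le> 0" by (intro LIMSEQ_le_const[of "\<lambda>n. sqrt l * a n + l * (sqrt l * b n)"]) auto
    then show ?thesis using l by (simp add: mult_le_0_iff)
  qed
  define z where "z x = integral {0..x} z'" for x
  have "continuous_on {0..l} (\<lambda>x. 0 + integral {0..x} z')"
    using l z'L2 by (intro primitive_continuous_on L2_integrable) auto
  then have "continuous_on {0..l} z" by (simp add: z_def[abs_def])
  moreover have "has_weak_deriv l z' F"
    by (rule has_weak_deriv_cong_AE[OF L2_integrable[OF fF(2)] L2_integrable[OF z'L2] f'z'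
        L2_integrable[OF fF(3)] L2_integrable[OF fF(3)] _ fF(5)]) simp
  then have "AE x in Lm l. wderiv l (wderiv l f) x = F x"
    using wderiv_wderiv_AE[OF z'L2 wz' fF(3)] by blast
  ultimately show ?thesis
    using cz' fF(3) zl c0 \<open>c0 = 0\<close>
    by (intro exI[of _ z] exI[of _ z'] exI[of _ c] exI[of _ F]) (auto simp: z_def z'_def)
qed

lemma dom_L_L2:
  assumes "f \<in> dom_L l"
  shows "f \<in> L2 l" "wderiv l (wderiv l f) \<in> L2 l"
proof -
  obtain f' F where fF: "f \<in> L2 l" "f' \<in> L2 l" "F \<in> L2 l" "has_weak_deriv l f f'" "has_weak_deriv l f' F"
    using assms unfolding dom_L_def H2_def by auto
  note w = wderiv_AE[OF fF(2,4)]
  show "f \<in> L2 l" by (rule fF)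
  have "has_weak_deriv l (wderiv l f) F"
    by (rule has_weak_deriv_cong_AE[OF L2_integrable[OF fF(2)] L2_integrable[OF w(1)] _
        L2_integrable[OF fF(3)] L2_integrable[OF fF(3)] _ fF(5)]) (use w(3) in auto)
  then show "wderiv l (wderiv l f) \<in> L2 l" by (rule wderiv_AE(1)[OF fF(3)])
qed

lemma dom_L_borel:
  assumes "cplx f \<in> dom_L l" shows "f \<in> borel_measurable (Lm l)"
proof -
  have "(\<lambda>x. Re (cplx f x)) \<in> borel_measurable (Lm l)"
    using measurable_compose[OF L2_D(1)[OF dom_L_L2(1)[OF assms]] borel_measurable_continuous_onI[OF continuous_on_Re[OF continuous_on_id]]]
    by simp
  then show ?thesis by (simp add: cplx_def)
qed

text \<open>
  A polynomial approximation of \<open>F\<close>, cut off near the end points, is a test function that is close to \<open>F\<close>.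
  A multiple of a fixed test function of integral \<open>1\<close> corrects its mean value to \<open>0\<close>, and then it is the
  derivative of a test function; the correction tends to \<open>0\<close> because \<open>F\<close> has mean value \<open>0\<close>.
\<close>

lemma test_fun_dense_primitive:
  assumes l: "0 < l" and F: "continuous_on {0..l} F" and 0: "integral {0..l} F = (0 :: complex)"
  obtains \<phi> where "\<And>n. \<phi> n \<in> test_fun l"
    "(\<lambda>n. l2norm l (\<lambda>x. F x - test_deriv (\<phi> n) x)) \<longlonglongrightarrow> 0"
proof -
  have "\<exists>g. polynomial_function g \<and> (\<forall>x\<in>{0..l}. norm (F x - g x) < 1 / real (Suc n))" for n
    by (rule Stone_Weierstrass_polynomial_function[OF compact_Icc F]) simp
  then obtain p where p: "\<And>n. polynomial_function (p n)" "\<And>n x. x \<in> {0..l} \<Longrightarrow> norm (F x - p n x) < 1 / real (Suc n)"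
    by metis
  obtain B where B: "0 \<le> B" "\<forall>x\<in>{0..l}. norm (F x) \<le> B" using continuous_on_Icc_bounded[OF F] by auto
  define \<psi> where "\<psi> n x = p n x * of_real (cutoff 0 l n x)" for n x
  have \<psi>: "\<psi> n \<in> test_fun l" for n
    unfolding \<psi>_def[abs_def] by (intro cutoff_test_fun smooth_polynomial p) auto
  have \<psi>B: "norm (\<psi> n x) \<le> B + 1" if "x \<in> {0<..<l}" for n x
  proof -
    have "norm (\<psi> n x) \<le> norm (p n x) * 1"
      unfolding \<psi>_def norm_mult using cutoff_bounds[of 0 l n x] by (intro mult_left_mono) auto
    also have "\<dots> \<le> norm (F x) + norm (F x - p n x)"
      using norm_triangle_ineq4[of "F x" "F x - p n x"] by simp
    also have "\<dots> \<le> B + 1"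
    proof (rule add_mono)
      have "norm (F x - p n x) < 1 / real (Suc n)" using that by (intro p) auto
      also have "\<dots> \<le> 1" by simp
      finally show "norm (F x - p n x) \<le> 1" by simp
    qed (use B that in auto)
    finally show ?thesis .
  qed
  have \<psi>lim: "(\<lambda>n. \<psi> n x) \<longlonglongrightarrow> F x" if "x \<in> {0<..<l}" for x
  proof -
    have "(\<lambda>n. F x - p n x) \<longlonglongrightarrow> 0"
    proof (rule Lim_null_comparison)
      show "\<forall>\<^sub>F n in sequentially. norm (F x - p n x) \<le> 1 / real (Suc n)"
        using p(2)[of x] that by (intro always_eventually allI less_imp_le) auto
      show "(\<lambda>n. 1 / real (Suc n)) \<longlonglongrightarrow> 0" using LIMSEQ_inverse_real_of_nat by (simp add: divide_inverse)
    qed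
    from tendsto_diff[OF tendsto_const[of "F x"] this] have "(\<lambda>n. p n x) \<longlonglongrightarrow> F x" by simp
    from tendsto_mult[OF this tendsto_of_real[OF cutoff_tendsto[of 0 l x]]] show ?thesis
      unfolding \<psi>_def using that by simp
  qed
  obtain \<phi>0 where \<phi>0: "\<phi>0 \<in> test_fun l" "(LINT x|Lm l. \<phi>0 x) = 1" using normalized_test_fun[OF l] .
  obtain B0 where B0: "0 \<le> B0" "\<forall>x\<in>{0..l}. norm (\<phi>0 x) \<le> B0"
    using continuous_on_Icc_bounded[OF test_fun_integrable(2)[OF \<phi>0(1)]] by metis
  define m where "m n = (LINT x|Lm l. \<psi> n x)" for n
  have Fm[measurable]: "F \<in> borel_measurable (Lm l)" by (rule borel_measurable_Lm'[OF F])
  have \<psi>m[measurable]: "\<psi> n \<in> borel_measurable (Lm l)" for n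
    by (intro borel_measurable_Lm test_fun_integrable(2)[OF \<psi>])
  have \<phi>0m[measurable]: "\<phi>0 \<in> borel_measurable (Lm l)"
    by (intro borel_measurable_Lm test_fun_integrable(2)[OF \<phi>0(1)])
  have "m \<longlonglongrightarrow> (LINT x|Lm l. F x)"
    unfolding m_def
  proof (rule integral_dominated_convergence[where w = "\<lambda>x. B + 1"])
    show "integrable (Lm l) (\<lambda>x. B + 1)" by (intro integrable_Lm_continuous continuous_intros)
  qed (use \<psi>B \<psi>lim in \<open>auto intro!: AE_LmI\<close>)
  then have m0: "m \<longlonglongrightarrow> 0" using LINT_Lm[OF integrable_Lm_continuous[OF F]] 0 by simp
  then have "Bseq m" by (intro convergent_imp_Bseq convergentI)
  then obtain M where M: "\<And>n. norm (m n) \<le> M" unfolding Bseq_def by auto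
  define \<eta> where "\<eta> n x = \<psi> n x - m n * \<phi>0 x" for n x
  have \<eta>: "\<eta> n \<in> test_fun l" for n unfolding \<eta>_def[abs_def] by (rule test_fun_diff[OF \<psi> \<phi>0(1)])
  have "integral {0..l} (\<eta> n) = 0" for n
  proof -
    have "(LINT x|Lm l. \<eta> n x) = (LINT x|Lm l. \<psi> n x) - (LINT x|Lm l. m n * \<phi>0 x)"
      unfolding \<eta>_def
      by (intro Bochner_Integration.integral_diff integrable_mult_right test_fun_integrable(1)[OF \<psi>] test_fun_integrable(1)[OF \<phi>0(1)])
    also have "\<dots> = 0" using \<phi>0(2) by (simp add: m_def)
    finally show ?thesis using LINT_Lm[OF test_fun_integrable(1)[OF \<eta>]] by simp
  qed
  then have "\<exists>\<phi>. \<phi> \<in> test_fun l \<and> test_deriv \<phi> = \<eta> n" for n using test_fun_primitive[OF \<eta> l] by metis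
  then obtain \<phi> where \<phi>: "\<And>n. \<phi> n \<in> test_fun l" "\<And>n. test_deriv (\<phi> n) = \<eta> n" by metis
  have "(\<lambda>n. l2norm l (\<lambda>x. F x - \<eta> n x)) \<longlonglongrightarrow> 0"
  proof (rule l2norm_tendsto_0[where B = "B + ((B + 1) + M * B0)"])
    show "(\<lambda>x. F x - \<eta> n x) \<in> borel_measurable (Lm l)" for n unfolding \<eta>_def by measurable
    fix x assume x: "x \<in> {0<..<l}"
    show "norm (F x - \<eta> n x) \<le> B + ((B + 1) + M * B0)" for n
    proof -
      have "norm (F x - \<eta> n x) \<le> norm (F x) + (norm (\<psi> n x) + norm (m n * \<phi>0 x))"
        unfolding \<eta>_def using norm_triangle_ineq4[of "F x" "\<psi> n x - m n * \<phi>0 x"] norm_triangle_ineq4[of "\<psi> n x" "m n * \<phi>0 x"]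
        by simp
      also have "\<dots> \<le> B + ((B + 1) + M * B0)"
        unfolding norm_mult using x B B0 M[of n] \<psi>B[OF x, of n] order_trans[OF norm_ge_zero M[of n]]
        by (intro add_mono mult_mono) auto
      finally show ?thesis .
    qed
    have "(\<lambda>n. F x - (\<psi> n x - m n * \<phi>0 x)) \<longlonglongrightarrow> F x - (F x - 0 * \<phi>0 x)"
      by (intro tendsto_intros \<psi>lim x m0)
    then show "(\<lambda>n. F x - \<eta> n x) \<longlonglongrightarrow> 0" by (simp add: \<eta>_def)
  qed
  then show ?thesis using that[of \<phi>] \<phi> by simp
qed

text \<open>
  The converse of \<open>dom_L_representative\<close>. The derivatives of suitable test functions approximate
  \<open>z'\<close> in \<open>L\<^sup>2\<close>, and integration gives uniform convergence of the test functions themselves.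
\<close>

lemma dom_L_intro:
  assumes l: "0 < l" and F: "F \<in> L2 l"
    and z': "\<And>x. x \<in> {0..l} \<Longrightarrow> z' x = c + integral {0..x} F"
    and z: "\<And>x. x \<in> {0..l} \<Longrightarrow> z x = integral {0..x} z'" and "z l = 0"
  shows "z \<in> dom_L l" "AE x in Lm l. wderiv l (wderiv l z) x = F x"
proof -
  have "continuous_on {0..l} (\<lambda>x. c + integral {0..x} F)"
    using l F by (intro primitive_continuous_on L2_integrable) auto
  then have cz': "continuous_on {0..l} z'" by (rule continuous_on_eq) (use z' in auto)
  have z'L2: "z' \<in> L2 l" by (rule L2_continuous[OF cz'])
  have "continuous_on {0..l} (\<lambda>x. 0 + integral {0..x} z')"
    using l z'L2 by (intro primitive_continuous_on L2_integrable) auto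
  then have cz: "continuous_on {0..l} z" by (rule continuous_on_eq) (use z in auto)
  have zL2: "z \<in> L2 l" by (rule L2_continuous[OF cz])
  have w1: "has_weak_deriv l z z'"
    by (rule weak_deriv_primitive[OF l L2_integrable[OF z'L2], of _ 0]) (use z in auto)
  have w2: "has_weak_deriv l z' F"
    by (rule weak_deriv_primitive[OF l L2_integrable[OF F], of _ c]) (use z' in auto)
  show "AE x in Lm l. wderiv l (wderiv l z) x = F x"
    by (rule wderiv_wderiv_AE[OF z'L2 w1 F w2])
  have "integral {0..l} z' = 0" using z[of l] \<open>z l = 0\<close> l by simp
  then obtain \<phi> where \<phi>: "\<And>n. \<phi> n \<in> test_fun l" "(\<lambda>n. l2norm l (\<lambda>x. z' x - test_deriv (\<phi> n) x)) \<longlonglongrightarrow> 0"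
    using test_fun_dense_primitive[OF l cz'] by metis
  note w = wderiv_AE[OF z'L2 w1]
  have cD: "continuous_on S (test_deriv (\<phi> n))" for n S
    by (rule smooth_continuous_on[OF test_fun_derivative(2)[OF \<phi>(1)]])
  have "l2norm l (\<lambda>x. wderiv l z x - test_deriv (\<phi> n) x) = l2norm l (\<lambda>x. z' x - test_deriv (\<phi> n) x)" for n
  proof (rule l2norm_cong_AE)
    show "AE x in Lm l. wderiv l z x - test_deriv (\<phi> n) x = z' x - test_deriv (\<phi> n) x"
      using w(3) by eventually_elim simp
    show "(\<lambda>x. wderiv l z x - test_deriv (\<phi> n) x) \<in> borel_measurable (Lm l)"
      "(\<lambda>x. z' x - test_deriv (\<phi> n) x) \<in> borel_measurable (Lm l)"
      using L2_D(1)[OF w(1)] L2_D(1)[OF z'L2] borel_measurable_Lm[OF cD] by (auto intro!: borel_measurable_diff)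
  qed
  then have 1: "(\<lambda>n. l2norm l (\<lambda>x. wderiv l z x - test_deriv (\<phi> n) x)) \<longlonglongrightarrow> 0" using \<phi>(2) by simp
  have 2: "(\<lambda>n. l2norm l (\<lambda>x. z x - \<phi> n x)) \<longlonglongrightarrow> 0"
  proof (rule Lim_null_comparison)
    have "l2norm l (\<lambda>x. z x - \<phi> n x) \<le> sqrt l * (sqrt l * l2norm l (\<lambda>x. z' x - test_deriv (\<phi> n) x))" for n
    proof (rule l2norm_le[OF l])
      show "0 \<le> sqrt l * l2norm l (\<lambda>x. z' x - test_deriv (\<phi> n) x)" using l by (intro mult_nonneg_nonneg l2norm_nonneg) simp
      fix x assume "x \<in> {0<..<l}"
      then have x: "x \<in> {0..l}" by simp
      show "norm (z x - \<phi> n x) \<le> sqrt l * l2norm l (\<lambda>x. z' x - test_deriv (\<phi> n) x)"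
        using primitive_diff_bound[OF l z'L2 L2_continuous[OF cD] x, of n] z[OF x] test_fun_as_primitive[OF \<phi>(1) x, of n]
        by simp
    qed
    then show "\<forall>\<^sub>F n in sequentially. norm (l2norm l (\<lambda>x. z x - \<phi> n x)) \<le> sqrt l * (sqrt l * l2norm l (\<lambda>x. z' x - test_deriv (\<phi> n) x))"
      by (intro always_eventually allI) (simp add: l2norm_nonneg)
    show "(\<lambda>n. sqrt l * (sqrt l * l2norm l (\<lambda>x. z' x - test_deriv (\<phi> n) x))) \<longlonglongrightarrow> 0"
      by (intro tendsto_mult_right_zero \<phi>(2))
  qed
  have "z \<in> H1 l" unfolding H1_def using zL2 z'L2 w1 by auto
  then have "z \<in> H10 l" unfolding H10_def using \<phi>(1) 1 2 by auto
  moreover have "z \<in> H2 l" unfolding H2_def using zL2 z'L2 F w1 w2 by auto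
  ultimately show "z \<in> dom_L l" by (simp add: dom_L_def)
qed

section \<open>Eigenfunctions and pairings of the scalar operators\<close>

text \<open>
  The representative of \<open>f\<close> and \<open>c P + Y\<close> solve the same second-order equation; with \<open>c\<close> chosen as the initial slope of the
  former the difference has zero initial data, hence vanishes. The constant is a priori
  complex, and its real part serves since \<open>f\<close> is real.
\<close>

lemma scalar_eigen_representative:
  assumes l: "0 < l" and q: "continuous_on {0..l} (\<lambda>x. s\<^sup>2 * q (s * x))"
    and f: "cplx f \<in> dom_L l"
    and eq: "AE x in Lm l. Lop l q s (cplx f) x = of_real (\<kappa> x)" and \<kappa>: "continuous_on {0..l} \<kappa>"
    and P: "ode2 l (\<lambda>x. s\<^sup>2 * q (s * x)) (\<lambda>x. 0) 1 P P'"
    and Y: "ode2 l (\<lambda>x. s\<^sup>2 * q (s * x)) (\<lambda>x. - \<kappa> x) 0 Y Y'"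
  shows "\<exists>c. (AE x in Lm l. f x = c * P x + Y x) \<and> c * P l + Y l = 0"
proof -
  define Q where "Q x = s\<^sup>2 * q (s * x)" for x
  have cQ: "continuous_on {0..l} Q" using q by (simp add: Q_def[abs_def])
  obtain z z' c F where z: "continuous_on {0..l} z" "continuous_on {0..l} z'" "F \<in> L2 l"
    "\<forall>x\<in>{0..l}. z x = integral {0..x} z'" "\<forall>x\<in>{0..l}. z' x = c + integral {0..x} F" "z l = 0"
    "AE x in Lm l. cplx f x = z x" "AE x in Lm l. wderiv l (wderiv l (cplx f)) x = F x"
    using dom_L_representative[OF l f] by blast
  have ode: "ode2 l Q (\<lambda>x. 0) 1 P P'" "ode2 l Q (\<lambda>x. - \<kappa> x) 0 Y Y'" using P Y by (simp_all add: Q_def[abs_def])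
  note c1 = ode2_continuous_on[OF ode(1)] and c2 = ode2_continuous_on[OF ode(2)]
  define F' where "F' x = - of_real (Q x) * z x - of_real (\<kappa> x)" for x
  have cF': "continuous_on {0..l} F'" unfolding F'_def by (intro continuous_intros cQ z \<kappa>)
  have FF': "AE x in Lm l. F x = F' x"
    using z(7,8) eq
  proof eventually_elim
    case (elim x)
    then have "- F x - of_real (Q x) * z x = of_real (\<kappa> x)" by (simp add: Lop_def Q_def)
    moreover have "F x = - (- F x - of_real (Q x) * z x) - of_real (Q x) * z x" by simp
    ultimately show ?case unfolding F'_def by simp
  qed
  have intF: "integral {0..x} F = integral {0..x} F'" if "x \<in> {0..l}" for x
    by (rule primitive_cong_AE[OF L2_integrable[OF z(3)] integrable_Lm_continuous[OF cF'] FF' that])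
  define y where "y x = z x - (c * of_real (P x) + of_real (Y x))" for x
  define y' where "y' x = z' x - (c * of_real (P' x) + of_real (Y' x))" for x
  have ofr: "((\<lambda>t. complex_of_real (a t)) has_integral of_real b) S" if "(a has_integral b) S" for a b and S :: "real set"
    using has_integral_linear[OF that bounded_linear_of_real] by (simp add: o_def)
  have "continuous_on {0..l} y" "continuous_on {0..l} y'"
    unfolding y_def y'_def by (intro continuous_intros z c1 c2)+
  moreover have "(y' has_integral y x) {0..x}" if x: "x \<in> {0..l}" for x
  proof -
    have "(z' has_integral z x) {0..x}"
      using z(4) x by (auto intro!: integrable_integral integrable_continuous_real continuous_on_subset[OF z(2)])
    moreover have "(P' has_integral P x) {0..x}" "(Y' has_integral Y x) {0..x}"
      using has_integral_of_derivative[of l P P' x] has_integral_of_derivative[of l Y Y' x] ode x by (auto simp: ode2_def)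
    ultimately show ?thesis unfolding y_def y'_def
      by (intro has_integral_diff has_integral_add has_integral_mult_right ofr)
  qed
  moreover have "((\<lambda>t. - of_real (Q t) * y t) has_integral (y' x - 0)) {0..x}" if x: "x \<in> {0..l}" for x
  proof -
    have "(F' has_integral (z' x - c)) {0..x}"
      using z(5) x intF[OF x]
      by (auto intro!: integrable_integral integrable_continuous_real continuous_on_subset[OF cF'])
    moreover have "((\<lambda>x. - Q x * P x) has_integral (P' x - 1)) {0..x}" "((\<lambda>x. - \<kappa> x - Q x * Y x) has_integral Y' x) {0..x}"
      using has_integral_of_derivative[of l P' "\<lambda>x. 0 - Q x * P x" x] has_integral_of_derivative[of l Y' "\<lambda>x. - \<kappa> x - Q x * Y x" x] ode x
      by (auto simp: ode2_def)
    ultimately have "((\<lambda>t. F' t - (c * of_real (- Q t * P t) + of_real (- \<kappa> t - Q t * Y t))) has_integral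
       (z' x - c - (c * of_real (P' x - 1) + of_real (Y' x)))) {0..x}"
      by (intro has_integral_diff has_integral_add has_integral_mult_right ofr)
    then show ?thesis
      by (simp add: F'_def y_def y'_def algebra_simps)
  qed
  moreover obtain K where K: "0 \<le> K" "\<forall>x\<in>{0..l}. norm (Q x) \<le> K" using continuous_on_Icc_bounded[OF cQ] by auto
  have "norm (- complex_of_real (Q t) * v) \<le> K * norm v" if "t \<in> {0..l}" for t v
    using K that by (auto simp: norm_mult intro!: mult_right_mono)
  ultimately have "norm (y x) \<le> 2 * 0 * exp (2 * (1 + K) * l)" if "x \<in> {0..l}" for x
    using second_order_bound(1)[of K l 0 "\<lambda>t v. - of_real (Q t) * v" y y' "\<lambda>x. 0" x] K(1) l that by auto
  then have y0: "z x = c * of_real (P x) + of_real (Y x)" if "x \<in> {0..l}" for x using that by (simp add: y_def)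
  have "AE x in Lm l. cplx f x = c * of_real (P x) + of_real (Y x)"
  proof -
    have "AE x in Lm l. z x = c * of_real (P x) + of_real (Y x)" by (rule AE_LmI) (use y0 in auto)
    with z(7) show ?thesis by eventually_elim simp
  qed
  then have "AE x in Lm l. f x = Re c * P x + Y x"
    by eventually_elim (auto simp: cplx_def dest: arg_cong[of _ _ Re])
  moreover have "Re c * P l + Y l = 0" using arg_cong[OF y0[of l], of Re] z(6) l by simp
  ultimately show ?thesis by blast
qed

lemma real_derivative_unique_Icc:
  fixes f :: "real \<Rightarrow> real"
  assumes "a < b" "x \<in> {a..b}" "(f has_real_derivative d) (at x within {a..b})" "(f has_real_derivative e) (at x within {a..b})"
  shows "d = e"
  using vector_derivative_unique_within_closed_interval[of a b x f d e] assms
  by (simp add: has_real_derivative_iff_has_vector_derivative)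

lemma dx_end_eq:
  assumes l: "0 < l" and ae: "AE x in Lm l. f x = w x"
    and w: "\<And>x. x \<in> {0..l} \<Longrightarrow> (w has_real_derivative w' x) (at x within {0..l})" "continuous_on {0..l} w'"
  shows "dx_end l f = w' l"
  unfolding dx_end_def
proof (rule the_equality)
  show "\<exists>v v'. aeq l f v \<and> (\<forall>x\<in>{0..l}. (v has_real_derivative v' x) (at x within {0..l})) \<and> continuous_on {0..l} v' \<and> w' l = v' l"
    using ae w by (intro exI[of _ w] exI[of _ w']) (auto simp: aeq_def)
  fix d assume "\<exists>v v'. aeq l f v \<and> (\<forall>x\<in>{0..l}. (v has_real_derivative v' x) (at x within {0..l})) \<and> continuous_on {0..l} v' \<and> d = v' l"
  then obtain v v' where v: "AE x in Lm l. f x = v x" "\<And>x. x \<in> {0..l} \<Longrightarrow> (v has_real_derivative v' x) (at x within {0..l})" "d = v' l"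
    unfolding aeq_def by blast
  have c: "continuous_on {0..l} v" "continuous_on {0..l} w" by (rule DERIV_continuous_on[OF v(2)], simp, rule DERIV_continuous_on[OF w(1)])
  have "AE x in Lm l. v x = w x" using v(1) ae by eventually_elim simp
  then have eq: "v x = w x" if "x \<in> {0..l}" for x using continuous_AE_eq[OF l c _ that] by blast
  have ll: "l \<in> {0..l}" using l by simp
  have "(w has_real_derivative v' l) (at l within {0..l})"
    by (rule has_field_derivative_transform_within[OF v(2)[OF ll] zero_less_one ll]) (use eq in auto)
  then show "d = w' l" using real_derivative_unique_Icc[OF l ll _ w(1)[OF ll]] v(3) by blast
qed

lemma ip_eq_integral:
  assumes f: "cplx f \<in> dom_L l" and g: "cplx g \<in> dom_L l" and ae: "AE x in Lm l. f x = F x" "AE x in Lm l. g x = G x"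
    and c: "continuous_on {0..l} F" "continuous_on {0..l} G"
  shows "ip l f g = integral {0..l} (\<lambda>x. F x * G x)"
proof -
  have cFG: "continuous_on {0..l} (\<lambda>x. F x * G x)" by (intro continuous_intros c)
  have "ip l f g = (LINT x|Lm l. F x * G x)"
    unfolding ip_def
  proof (rule integral_cong_AE)
    show "(\<lambda>x. f x * g x) \<in> borel_measurable (Lm l)" using dom_L_borel[OF f] dom_L_borel[OF g] by measurable
    show "(\<lambda>x. F x * G x) \<in> borel_measurable (Lm l)" by (rule borel_measurable_Lm'[OF cFG])
    show "AE x in Lm l. f x * g x = F x * G x" using ae by eventually_elim simp
  qed
  then show ?thesis using LINT_Lm[OF integrable_Lm_continuous[OF cFG]] by simp
qed

lemma eigenfun_L_representative:
  assumes l: "0 < l" and q: "continuous_on {0..l} (\<lambda>x. s\<^sup>2 * q (s * x))"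
    and u: "eigenfun_L l q s 0 u" and P: "ode2 l (\<lambda>x. s\<^sup>2 * q (s * x)) (\<lambda>x. 0) 1 P P'"
  shows "\<exists>c. c \<noteq> 0 \<and> (AE x in Lm l. u x = c * P x) \<and> P l = 0 \<and> dx_end l u = c * P' l"
proof -
  have d: "cplx u \<in> dom_L l" and ne: "\<not> (AE x in Lm l. u x = 0)" and eq: "AE x in Lm l. Lop l q s (cplx u) x = of_real 0"
    using u by (auto simp: eigenfun_L_def aeq_def)
  have "ode2 l (\<lambda>x. s\<^sup>2 * q (s * x)) (\<lambda>x. - 0) 0 (\<lambda>x. 0) (\<lambda>x. 0)" by (simp add: ode2_def)
  from scalar_eigen_representative[OF l q d eq continuous_on_const P this]
  obtain c where c: "AE x in Lm l. u x = c * P x" "c * P l = 0" by auto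
  have "c \<noteq> 0"
  proof
    assume "c = 0"
    with c(1) ne show False by simp
  qed
  moreover have "dx_end l u = c * P' l"
    by (rule dx_end_eq[OF l c(1)]) (use P ode2_continuous_on[OF P] in \<open>auto simp: ode2_def intro!: DERIV_cmult continuous_intros\<close>)
  ultimately show ?thesis using c by auto
qed

text \<open>
  Up to a multiple of the kernel function \<open>Q\<close> of the other operator, \<open>v\<close> is the rescaled coefficient
  \<open>b 0\<close>, called \<open>Y\<close>. The pairing of \<open>Q\<close> with \<open>u\<close> is a boundary term that vanishes with \<open>b 0 (s * l)\<close>, which
  is why the result does not depend on the choice of \<open>v\<close>. The pairing of \<open>Y\<close> with \<open>u\<close> is the Wronskian of
  \<open>a 1\<close> and \<open>a 0\<close>. For \<open>\<sigma> = 1\<close> this evaluates \<open>\<langle>v, u\<rangle>\<close> for \<open>- L v = u\<close>, for \<open>\<sigma> = -1\<close> for \<open>L v = u\<close>.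
\<close>

lemma resolvent_pairing:
  assumes l: "0 < l" and s: "0 < s" "s * l \<le> L" and g: "continuous_on {0..L} g" and h: "continuous_on {0..L} h"
    and pair: "analytic_pair L g h \<sigma> \<rho> a a' b b'" and \<sigma>: "\<sigma> * \<sigma> = 1"
    and e: "ode2 L h (\<lambda>x. 0) 1 e e'" and z: "a 0 (s * l) = 0" "e (s * l) = 0" "b 0 (s * l) = 0"
    and p: "a' 0 (s * l) \<noteq> 0"
    and u: "cplx u \<in> dom_L l" "AE x in Lm l. u x = k * (inverse s * a 0 (s * x))" "k \<noteq> 0"
    and v: "cplx v \<in> dom_L l" "AE x in Lm l. Lop l h s (cplx v) x = of_real (- \<sigma> * u x)"
  shows "ip l v u / (k * a' 0 (s * l))\<^sup>2 = \<sigma> * inverse s ^ 5 * (a 1 (s * l) / a' 0 (s * l))"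
proof -
  have ll: "l \<in> {0..l}" using l by simp
  have im: "(\<lambda>x. s * x) ` {0..l} \<subseteq> {0..L}" using rescale_in[OF s] by blast
  have cg: "continuous_on {0..l} (\<lambda>x. s\<^sup>2 * g (s * x))" "continuous_on {0..l} (\<lambda>x. s\<^sup>2 * h (s * x))"
    by (intro continuous_intros continuous_on_compose2[OF g] continuous_on_compose2[OF h] im)+
  have oa: "ode2 L g (\<lambda>x. 0) 1 (a 0) (a' 0)" and ob: "ode2 L h (\<lambda>x. \<sigma> * a 0 x) 0 (b 0) (b' 0)"
    and oa1: "ode2 L g (\<lambda>x. - \<sigma> * b 0 x) 0 (a 1) (a' 1)" using pair by (auto simp: analytic_pair_def)
  define P where "P x = inverse s * a 0 (s * x)" for x
  define P' where "P' x = inverse s * s * a' 0 (s * x)" for x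
  define Q where "Q x = inverse s * e (s * x)" for x
  define Q' where "Q' x = inverse s * s * e' (s * x)" for x
  \<comment> \<open>The powers of \<open>inverse s\<close> come from rescaling: two for each step of the recursion, one for the slope.\<close>
  define Y where "Y x = k * inverse s ^ 3 * b 0 (s * x)" for x
  define Y' where "Y' x = k * inverse s ^ 3 * s * b' 0 (s * x)" for x
  define Z where "Z x = k * inverse s ^ 5 * a 1 (s * x)" for x
  define Z' where "Z' x = k * inverse s ^ 5 * s * a' 1 (s * x)" for x
  have oP: "ode2 l (\<lambda>x. s\<^sup>2 * g (s * x)) (\<lambda>x. 0) 1 P P'"
    unfolding P_def[abs_def] P'_def[abs_def] by (rule ode2_cong[OF ode2_rescale[OF oa s]]) (use s in auto)
  have oQ: "ode2 l (\<lambda>x. s\<^sup>2 * h (s * x)) (\<lambda>x. 0) 1 Q Q'"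
    unfolding Q_def[abs_def] Q'_def[abs_def] by (rule ode2_cong[OF ode2_rescale[OF e s]]) (use s in auto)
  have oY: "ode2 l (\<lambda>x. s\<^sup>2 * h (s * x)) (\<lambda>x. \<sigma> * (k * P x)) 0 Y Y'"
    unfolding Y_def[abs_def] Y'_def[abs_def]
    by (rule ode2_cong[OF ode2_rescale[OF ob s]]) (use s in \<open>auto simp: P_def power2_eq_square power3_eq_cube field_simps\<close>)
  have oZ: "ode2 l (\<lambda>x. s\<^sup>2 * g (s * x)) (\<lambda>x. - \<sigma> * Y x) 0 Z Z'"
    unfolding Z_def[abs_def] Z'_def[abs_def]
    by (rule ode2_cong[OF ode2_rescale[OF oa1 s]])
      (use s in \<open>auto simp: Y_def power2_eq_square power3_eq_cube eval_nat_numeral field_simps\<close>)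
  note cP = ode2_continuous_on(1)[OF oP] and cQ = ode2_continuous_on(1)[OF oQ] and cY = ode2_continuous_on(1)[OF oY]
  have uP: "AE x in Lm l. u x = k * P x" using u(2) by (simp add: P_def)
  have eqv: "AE x in Lm l. Lop l h s (cplx v) x = of_real (- (\<sigma> * (k * P x)))"
    using v(2) uP by eventually_elim simp
  have "ode2 l (\<lambda>x. s\<^sup>2 * h (s * x)) (\<lambda>x. - (- (\<sigma> * (k * P x)))) 0 Y Y'" using oY by simp
  moreover have "continuous_on {0..l} (\<lambda>x. - (\<sigma> * (k * P x)))" by (intro continuous_intros cP)
  ultimately obtain m where m: "AE x in Lm l. v x = m * Q x + Y x"
    using scalar_eigen_representative[OF l cg(2) v(1) eqv _ oQ] by blast
  have ip: "ip l v u = integral {0..l} (\<lambda>x. (m * Q x + Y x) * (k * P x))"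
    by (intro ip_eq_integral[OF v(1) u(1) m uP] continuous_intros cP cQ cY)
  have PQ: "((\<lambda>t. \<sigma> * (k * P t) * Q t - 0 * Y t) has_integral (Y' l * Q l - Y l * Q' l)) {0..l}"
    by (rule ode2_wronskian[OF oY oQ ll])
  have YP: "((\<lambda>t. (- \<sigma> * Y t) * P t - 0 * Z t) has_integral (Z' l * P l - Z l * P' l)) {0..l}"
    by (rule ode2_wronskian[OF oZ oP ll])
  have "Y' l * Q l - Y l * Q' l = 0" "Z' l * P l - Z l * P' l = - (Z l * P' l)"
    using z by (simp_all add: Y_def Q_def P_def)
  with PQ YP have "((\<lambda>t. \<sigma> * m * (\<sigma> * (k * P t) * Q t) + (- \<sigma> * k) * ((- \<sigma> * Y t) * P t)) has_integral
      (\<sigma> * m * 0 + (- \<sigma> * k) * (- (Z l * P' l)))) {0..l}"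
    by (intro has_integral_add has_integral_mult_right) auto
  moreover have "\<sigma> * m * (\<sigma> * (k * P t) * Q t) + (- \<sigma> * k) * ((- \<sigma> * Y t) * P t) = (m * Q t + Y t) * (k * P t)" for t
  proof -
    have "\<sigma> * m * (\<sigma> * (k * P t) * Q t) + (- \<sigma> * k) * ((- \<sigma> * Y t) * P t) = (\<sigma> * \<sigma>) * ((m * Q t + Y t) * (k * P t))"
      by (simp add: algebra_simps)
    then show ?thesis by (simp add: \<sigma>)
  qed
  ultimately have "ip l v u = \<sigma> * k * (Z l * P' l)" using ip by (simp add: integral_unique)
  then have "ip l v u = \<sigma> * k * (k * inverse s ^ 5 * a 1 (s * l) * a' 0 (s * l))"
    using s by (simp add: Z_def P'_def)
  then show ?thesis using p u(3) by (simp add: power2_eq_square)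
qed

section \<open>The resolvent and the eigenfunctions of \<open>N\<close>\<close>

text \<open>
  The right-hand side of \<open>w'' = sysA t w\<close>, the form that \<open>N\<^sub>s w = \<mu> w\<close> takes with
  \<open>G x = s\<^sup>2 g (s x)\<close> and \<open>H x = s\<^sup>2 h (s x)\<close>.
\<close>

definition sysA :: "(real \<Rightarrow> real) \<Rightarrow> (real \<Rightarrow> real) \<Rightarrow> real \<Rightarrow> real \<Rightarrow> complex \<times> complex \<Rightarrow> complex \<times> complex" where
  "sysA G H \<mu> t z = (- of_real (G t) * fst z - of_real \<mu> * snd z, of_real \<mu> * fst z - of_real (H t) * snd z)"

definition solves_sys :: "real \<Rightarrow> (real \<Rightarrow> real) \<Rightarrow> (real \<Rightarrow> real) \<Rightarrow> real \<Rightarrow>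
    (real \<Rightarrow> real) \<Rightarrow> (real \<Rightarrow> real) \<Rightarrow> (real \<Rightarrow> real) \<Rightarrow> (real \<Rightarrow> real) \<Rightarrow> bool" where
  "solves_sys l G H \<mu> u u' v v' \<longleftrightarrow> u 0 = 0 \<and> v 0 = 0 \<and>
     (\<forall>x\<in>{0..l}. (u has_real_derivative u' x) (at x within {0..l}) \<and>
        (v has_real_derivative v' x) (at x within {0..l}) \<and>
        (u' has_real_derivative (- G x * u x - \<mu> * v x)) (at x within {0..l}) \<and>
        (v' has_real_derivative (\<mu> * u x - H x * v x)) (at x within {0..l}))"

lemma solves_sys_continuous_on:
  assumes "solves_sys l G H \<mu> u u' v v'"
  shows "continuous_on {0..l} u" "continuous_on {0..l} u'" "continuous_on {0..l} v" "continuous_on {0..l} v'"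
proof -
  have "(u has_real_derivative u' x) (at x within {0..l})" "(v has_real_derivative v' x) (at x within {0..l})"
    "(u' has_real_derivative (- G x * u x - \<mu> * v x)) (at x within {0..l})"
    "(v' has_real_derivative (\<mu> * u x - H x * v x)) (at x within {0..l})" if "x \<in> {0..l}" for x
    using assms that unfolding solves_sys_def by auto
  note * = this
  show "continuous_on {0..l} u" by (rule DERIV_continuous_on[OF *(1)])
  show "continuous_on {0..l} v" by (rule DERIV_continuous_on[OF *(2)])
  show "continuous_on {0..l} u'" by (rule DERIV_continuous_on[OF *(3)])
  show "continuous_on {0..l} v'" by (rule DERIV_continuous_on[OF *(4)])
qed

lemma sysA_diff: "sysA G H \<mu> t v - sysA G H \<mu> t w = sysA G H \<mu> t (v - w)"
  by (simp add: sysA_def prod_eq_iff algebra_simps)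

lemma sysA_add: "sysA G H \<mu> t (v + w) = sysA G H \<mu> t v + sysA G H \<mu> t w"
  by (simp add: sysA_def prod_eq_iff algebra_simps)

lemma sysA_bound:
  assumes "continuous_on {0..l} G" "continuous_on {0..l} H"
  shows "\<exists>K\<ge>0. \<forall>t\<in>{0..l}. \<forall>v. norm (sysA G H \<mu> t v) \<le> K * norm v"
proof -
  obtain K1 where K1: "0 \<le> K1" "\<forall>x\<in>{0..l}. norm (G x) \<le> K1" using continuous_on_Icc_bounded[OF assms(1)] by auto
  obtain K2 where K2: "0 \<le> K2" "\<forall>x\<in>{0..l}. norm (H x) \<le> K2" using continuous_on_Icc_bounded[OF assms(2)] by auto
  have "norm (sysA G H \<mu> t v) \<le> (K1 + \<bar>\<mu>\<bar> + (\<bar>\<mu>\<bar> + K2)) * norm v" if t: "t \<in> {0..l}" for t v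
  proof -
    have f: "norm (fst v) \<le> norm v" and s: "norm (snd v) \<le> norm v"
      by (metis norm_fst_le prod.collapse) (metis norm_snd_le prod.collapse)
    have "norm (sysA G H \<mu> t v) \<le> norm (- of_real (G t) * fst v - of_real \<mu> * snd v) + norm (of_real \<mu> * fst v - of_real (H t) * snd v)"
      unfolding sysA_def by (rule norm_Pair_le)
    also have "\<dots> \<le> (norm (- of_real (G t) * fst v) + norm (of_real \<mu> * snd v)) + (norm (of_real \<mu> * fst v) + norm (of_real (H t) * snd v))"
      by (intro add_mono norm_triangle_ineq4)
    also have "\<dots> = (\<bar>G t\<bar> * norm (fst v) + \<bar>\<mu>\<bar> * norm (snd v)) + (\<bar>\<mu>\<bar> * norm (fst v) + \<bar>H t\<bar> * norm (snd v))"
      by (simp add: norm_mult)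
    also have "\<dots> \<le> (K1 * norm v + \<bar>\<mu>\<bar> * norm v) + (\<bar>\<mu>\<bar> * norm v + K2 * norm v)"
      using K1 K2 t f s by (intro add_mono mult_mono) auto
    finally show ?thesis by (simp add: algebra_simps)
  qed
  then show ?thesis using K1(1) K2(1) by (intro exI[of _ "K1 + \<bar>\<mu>\<bar> + (\<bar>\<mu>\<bar> + K2)"]) auto
qed

lemma sysA_continuous_on:
  assumes "continuous_on {0..l} G" "continuous_on {0..l} H"
  shows "continuous_on ({0..l} \<times> UNIV) (\<lambda>(t, v). sysA G H \<mu> t v)"
    and "continuous_on {0..l} w \<Longrightarrow> continuous_on {0..l} (\<lambda>t. sysA G H \<mu> t (w t))"
  unfolding sysA_def case_prod_beta
  by (auto intro!: continuous_intros continuous_on_compose2[OF assms(1)] continuous_on_compose2[OF assms(2)])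

definition comb :: "complex \<Rightarrow> complex \<Rightarrow> (real \<Rightarrow> real) \<Rightarrow> (real \<Rightarrow> real) \<Rightarrow> (real \<Rightarrow> real) \<Rightarrow> (real \<Rightarrow> real) \<Rightarrow> real \<Rightarrow> complex \<times> complex" where
  "comb a b u1 v1 u2 v2 x = (a * of_real (u1 x) + b * of_real (u2 x), a * of_real (v1 x) + b * of_real (v2 x))"

lemma comb_solves_sys:
  assumes "solves_sys l G H \<mu> u1 u1' v1 v1'" "solves_sys l G H \<mu> u2 u2' v2 v2'" "x \<in> {0..l}"
  shows "(comb a b u1' v1' u2' v2' has_integral comb a b u1 v1 u2 v2 x) {0..x}"
    "((\<lambda>t. sysA G H \<mu> t (comb a b u1 v1 u2 v2 t)) has_integral
       (comb a b u1' v1' u2' v2' x - comb a b u1' v1' u2' v2' 0)) {0..x}"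
proof -
  let ?W = "comb a b u1 v1 u2 v2" and ?W' = "comb a b u1' v1' u2' v2'"
  have ofr: "((\<lambda>t. complex_of_real (a t)) has_vector_derivative of_real b) F" if "(a has_real_derivative b) F" for a b F
    using bounded_linear.has_vector_derivative[OF bounded_linear_of_real] that
    by (simp add: has_real_derivative_iff_has_vector_derivative)
  have d1: "(?W has_vector_derivative ?W' t) (at t within {0..l})" if "t \<in> {0..l}" for t
    unfolding comb_def using assms(1,2) that unfolding solves_sys_def
    by (intro has_vector_derivative_Pair has_vector_derivative_add has_vector_derivative_mult_right ofr) auto
  have d2: "(?W' has_vector_derivative sysA G H \<mu> t (?W t)) (at t within {0..l})" if "t \<in> {0..l}" for t
  proof (rule has_vector_derivative_eq_rhs)
    show "(?W' has_vector_derivative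
      (a * of_real (- G t * u1 t - \<mu> * v1 t) + b * of_real (- G t * u2 t - \<mu> * v2 t),
       a * of_real (\<mu> * u1 t - H t * v1 t) + b * of_real (\<mu> * u2 t - H t * v2 t))) (at t within {0..l})"
      unfolding comb_def using assms(1,2) that unfolding solves_sys_def
      by (intro has_vector_derivative_Pair has_vector_derivative_add has_vector_derivative_mult_right ofr) auto
  qed (simp add: sysA_def comb_def algebra_simps)
  have sub: "t \<in> {0..l}" "{0..x} \<subseteq> {0..l}" if "t \<in> {0..x}" for t using that assms(3) by auto
  have "(?W' has_integral (?W x - ?W 0)) {0..x}"
    using assms(3) has_vector_derivative_within_subset[OF d1 sub(2)] sub(1)
    by (intro fundamental_theorem_of_calculus) simp_all
  moreover have "?W 0 = 0"
    using assms(1,2) by (simp add: comb_def solves_sys_def zero_prod_def)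
  ultimately show "(?W' has_integral ?W x) {0..x}" by simp
  show "((\<lambda>t. sysA G H \<mu> t (?W t)) has_integral (?W' x - ?W' 0)) {0..x}"
    using assms(3) has_vector_derivative_within_subset[OF d2 sub(2)] sub(1)
    by (intro fundamental_theorem_of_calculus) simp_all
qed

lemma comb_continuous_on:
  assumes "continuous_on S u1" "continuous_on S v1" "continuous_on S u2" "continuous_on S v2"
  shows "continuous_on S (comb a b u1 v1 u2 v2)"
  unfolding comb_def[abs_def] by (intro continuous_intros assms)

text \<open>
  The equation \<open>w'' = sysA w - R\<close> with \<open>w = 0\<close> at both ends and \<open>w' 0 = c\<close>, integrated since \<open>R\<close> need not be
  continuous. The first integral relation at \<open>x = 0\<close> contains \<open>w 0 = 0\<close>.
\<close>

definition bvp :: "real \<Rightarrow> (real \<Rightarrow> real) \<Rightarrow> (real \<Rightarrow> real) \<Rightarrow> real \<Rightarrow> (real \<Rightarrow> complex \<times> complex) \<Rightarrow>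
    (real \<Rightarrow> complex \<times> complex) \<Rightarrow> complex \<times> complex \<Rightarrow> (real \<Rightarrow> complex \<times> complex) \<Rightarrow> bool" where
  "bvp l G H \<mu> w w' c R \<longleftrightarrow> continuous_on {0..l} w \<and> continuous_on {0..l} w' \<and>
     (\<forall>x\<in>{0..l}. (w' has_integral w x) {0..x}) \<and>
     (\<forall>x\<in>{0..l}. ((\<lambda>t. sysA G H \<mu> t (w t)) has_integral (w' x - (c - integral {0..x} R))) {0..x}) \<and> w l = 0"

text \<open>
  The homogeneous solution \<open>W\<close> with the initial slope \<open>c\<close> differs from \<open>w\<close> by at most a multiple of the
  \<open>L\<^sup>1\<close> norm of \<open>R\<close>. Since \<open>w l = 0\<close>, this bounds \<open>W l\<close>, and Cramer's rule with the nonzero determinant bounds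
  \<open>c\<close> and therefore \<open>W\<close>.
\<close>

lemma bvp_bound:
  assumes l: "0 < l" and G: "continuous_on {0..l} G" and H: "continuous_on {0..l} H"
    and s1: "solves_sys l G H \<mu> u1 u1' v1 v1'" "u1' 0 = 1" "v1' 0 = 0"
    and s2: "solves_sys l G H \<mu> u2 u2' v2 v2'" "u2' 0 = 0" "v2' 0 = 1"
    and D: "u1 l * v2 l - u2 l * v1 l \<noteq> 0"
  shows "\<exists>C\<ge>0. \<forall>w w' c R. bvp l G H \<mu> w w' c R \<longrightarrow> integrable (Lm l) R \<longrightarrow>
     (\<forall>x\<in>{0..l}. norm (w x) \<le> C * (LINT t|Lm l. norm (R t)))"
proof -
  obtain K where K: "0 \<le> K" "\<And>t v. t \<in> {0..l} \<Longrightarrow> norm (sysA G H \<mu> t v) \<le> K * norm v"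
    using sysA_bound[OF G H, of \<mu>] by auto
  define E where "E = 2 * exp (2 * (1 + K) * l)"
  note c1 = solves_sys_continuous_on[OF s1(1)] and c2 = solves_sys_continuous_on[OF s2(1)]
  have "continuous_on {0..l} (\<lambda>x. \<bar>u1 x\<bar> + \<bar>u2 x\<bar> + \<bar>v1 x\<bar> + \<bar>v2 x\<bar>)" by (intro continuous_intros c1 c2)
  from continuous_on_Icc_bounded[OF this] obtain B where B: "0 \<le> B"
    "\<And>x. x \<in> {0..l} \<Longrightarrow> \<bar>u1 x\<bar> + \<bar>u2 x\<bar> + \<bar>v1 x\<bar> + \<bar>v2 x\<bar> \<le> B" by auto
  define D0 where "D0 = u1 l * v2 l - u2 l * v1 l"
  define C where "C = E + 2 * B * (2 * B * E / \<bar>D0\<bar>)"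
  have E0: "0 \<le> E" by (simp add: E_def)
  have "norm (w x) \<le> C * (LINT t|Lm l. norm (R t))"
    if b: "bvp l G H \<mu> w w' c R" and R: "integrable (Lm l) R" and x: "x \<in> {0..l}" for w w' c R x
  proof -
    define M where "M = (LINT t|Lm l. norm (R t))"
    have M0: "0 \<le> M" by (simp add: M_def)
    define W where "W = comb (fst c) (snd c) u1 v1 u2 v2"
    define W' where "W' = comb (fst c) (snd c) u1' v1' u2' v2'"
    have W'0: "W' 0 = c" using s1 s2 by (simp add: W'_def comb_def)
    have cW: "continuous_on {0..l} W" "continuous_on {0..l} W'"
      unfolding W_def W'_def by (intro comb_continuous_on c1 c2)+
    have bd: "norm (w x - W x) \<le> 2 * M * exp (2 * (1 + K) * l)" if x: "x \<in> {0..l}" for x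
    proof (rule second_order_bound(1)[OF K(1) _ M0 K(2) _ _ _ _ _ x, where w' = "\<lambda>x. w' x - W' x" and \<psi> = "\<lambda>x. - integral {0..x} R"])
      show "continuous_on {0..l} (\<lambda>x. w x - W x)" "continuous_on {0..l} (\<lambda>x. w' x - W' x)"
        using b cW by (auto simp: bvp_def intro!: continuous_intros)
      fix x assume x: "x \<in> {0..l}"
      show "((\<lambda>x. w' x - W' x) has_integral (w x - W x)) {0..x}"
        using b x comb_solves_sys(1)[OF s1(1) s2(1) x] unfolding bvp_def W_def W'_def
        by (intro has_integral_diff) auto
      have "((\<lambda>t. sysA G H \<mu> t (w t) - sysA G H \<mu> t (W t)) has_integral
          ((w' x - (c - integral {0..x} R)) - (W' x - W' 0))) {0..x}"
        using b x comb_solves_sys(2)[OF s1(1) s2(1) x] unfolding bvp_def W_def W'_def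
        by (intro has_integral_diff) auto
      then show "((\<lambda>t. sysA G H \<mu> t (w t - W t)) has_integral ((w' x - W' x) - - integral {0..x} R)) {0..x}"
        by (simp add: sysA_diff W'0 algebra_simps)
      show "norm (- integral {0..x} R) \<le> M"
        using primitive_bound[OF R x] by (simp add: M_def)
    qed (use l in auto)
    have "norm (W l) \<le> E * M" using bd[of l] b l by (simp add: bvp_def E_def mult_ac)
    then have Wl: "norm (fst (W l)) \<le> E * M" "norm (snd (W l)) \<le> E * M"
      by (metis norm_fst_le order_trans prod.collapse) (metis \<open>norm (W l) \<le> E * M\<close> norm_snd_le order_trans prod.collapse)
    have e1: "fst c * of_real D0 = fst (W l) * of_real (v2 l) - snd (W l) * of_real (u2 l)"
      by (simp add: W_def comb_def D0_def algebra_simps)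
    have e2: "snd c * of_real D0 = snd (W l) * of_real (u1 l) - fst (W l) * of_real (v1 l)"
      by (simp add: W_def comb_def D0_def algebra_simps)
    have aux: "norm z \<le> 2 * B * E / \<bar>D0\<bar> * M"
      if "z * of_real D0 = p * of_real a - q * of_real b" "norm p \<le> E * M" "norm q \<le> E * M" "\<bar>a\<bar> \<le> B" "\<bar>b\<bar> \<le> B"
      for z p q :: complex and a b :: real
    proof -
      have "norm z * \<bar>D0\<bar> = norm (p * of_real a - q * of_real b)" using that(1) by (metis norm_mult norm_of_real)
      also have "\<dots> \<le> norm p * \<bar>a\<bar> + norm q * \<bar>b\<bar>"
        using norm_triangle_ineq4[of "p * of_real a" "q * of_real b"] by (simp add: norm_mult)
      also have "\<dots> \<le> (E * M) * B + (E * M) * B"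
        using that M0 E0 B(1) by (intro add_mono mult_mono) auto
      finally show ?thesis using D by (simp add: D0_def[symmetric] field_simps)
    qed
    have Bl: "\<bar>u1 y\<bar> \<le> B" "\<bar>u2 y\<bar> \<le> B" "\<bar>v1 y\<bar> \<le> B" "\<bar>v2 y\<bar> \<le> B" if "y \<in> {0..l}" for y
      using B(2)[OF that] by linarith+
    have ll: "l \<in> {0..l}" using l by simp
    have n1: "norm (fst c) \<le> 2 * B * E / \<bar>D0\<bar> * M" by (rule aux[OF e1 Wl(1) Wl(2) Bl(4)[OF ll] Bl(2)[OF ll]])
    have n2: "norm (snd c) \<le> 2 * B * E / \<bar>D0\<bar> * M" by (rule aux[OF e2 Wl(2) Wl(1) Bl(1)[OF ll] Bl(3)[OF ll]])
    have "norm (W x) \<le> norm (fst c * of_real (u1 x) + snd c * of_real (u2 x)) + norm (fst c * of_real (v1 x) + snd c * of_real (v2 x))"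
      unfolding W_def comb_def by (rule norm_Pair_le)
    also have "\<dots> \<le> (norm (fst c) * \<bar>u1 x\<bar> + norm (snd c) * \<bar>u2 x\<bar>) + (norm (fst c) * \<bar>v1 x\<bar> + norm (snd c) * \<bar>v2 x\<bar>)"
      using norm_triangle_ineq[of "fst c * of_real (u1 x)" "snd c * of_real (u2 x)"]
        norm_triangle_ineq[of "fst c * of_real (v1 x)" "snd c * of_real (v2 x)"]
      by (simp add: norm_mult)
    also have "\<dots> \<le> ((2 * B * E / \<bar>D0\<bar> * M) * \<bar>u1 x\<bar> + (2 * B * E / \<bar>D0\<bar> * M) * \<bar>u2 x\<bar>) + ((2 * B * E / \<bar>D0\<bar> * M) * \<bar>v1 x\<bar> + (2 * B * E / \<bar>D0\<bar> * M) * \<bar>v2 x\<bar>)"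
      by (intro add_mono mult_right_mono n1 n2) auto
    also have "\<dots> = (2 * B * E / \<bar>D0\<bar> * M) * (\<bar>u1 x\<bar> + \<bar>u2 x\<bar> + \<bar>v1 x\<bar> + \<bar>v2 x\<bar>)"
      by (simp only: distrib_left)
    also have "\<dots> \<le> (2 * B * E / \<bar>D0\<bar> * M) * (2 * B)"
      using B(2)[OF x] B(1) E0 M0 by (intro mult_left_mono) auto
    finally have "norm (W x) \<le> (2 * B * (2 * B * E / \<bar>D0\<bar>)) * M" by (simp add: mult_ac)
    moreover have "norm (w x) \<le> norm (w x - W x) + norm (W x)" using norm_triangle_ineq[of "w x - W x" "W x"] by simp
    moreover have "norm (w x - W x) \<le> E * M" using bd[OF x] by (simp add: E_def mult_ac)
    ultimately show ?thesis unfolding C_def M_def[symmetric] by (simp add: distrib_right)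
  qed
  moreover have "0 \<le> C" using E0 B(1) by (simp add: C_def)
  ultimately show ?thesis by blast
qed

text \<open>
  A particular solution of the initial value problem is corrected by a homogeneous one whose
  coefficients come from Cramer's rule.
\<close>

lemma bvp_solvable:
  assumes l: "0 < l" and G: "continuous_on {0..l} G" and H: "continuous_on {0..l} H"
    and s1: "solves_sys l G H \<mu> u1 u1' v1 v1'" and s2: "solves_sys l G H \<mu> u2 u2' v2 v2'"
    and D: "u1 l * v2 l - u2 l * v1 l \<noteq> 0" and R: "integrable (Lm l) R"
  shows "\<exists>w w' c. bvp l G H \<mu> w w' c R"
proof -
  obtain K where K: "0 \<le> K" "\<And>t v. t \<in> {0..l} \<Longrightarrow> norm (sysA G H \<mu> t v) \<le> K * norm v"
    using sysA_bound[OF G H, of \<mu>] by auto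
  have lip: "norm (sysA G H \<mu> t v - sysA G H \<mu> t w) \<le> K * norm (v - w)" if "t \<in> {0..l}" for t v w
    unfolding sysA_diff by (rule K(2)[OF that])
  have i: "integrable (Lm l) (\<lambda>x. - R x)" using R by simp
  have "continuous_on {0..l} (\<lambda>x. 0 + integral {0..x} (\<lambda>x. - R x))"
    using l by (intro primitive_continuous_on i) simp
  then have c\<psi>: "continuous_on {0..l} (\<lambda>x. - integral {0..x} R)" by simp
  obtain y y' where y: "continuous_on {0..l} y" "continuous_on {0..l} y'"
    "\<forall>x\<in>{0..l}. (y' has_integral y x) {0..x}"
    "\<forall>x\<in>{0..l}. ((\<lambda>t. sysA G H \<mu> t (y t)) has_integral (y' x - - integral {0..x} R)) {0..x}"
    using second_order_exists[OF K(1) _ lip sysA_continuous_on(1)[OF G H] c\<psi>] l by auto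
  define D0 where "D0 = u1 l * v2 l - u2 l * v1 l"
  have D0: "D0 \<noteq> 0" using D by (simp add: D0_def)
  define a where "a = - (fst (y l) * of_real (v2 l) - snd (y l) * of_real (u2 l)) / of_real D0"
  define b where "b = - (snd (y l) * of_real (u1 l) - fst (y l) * of_real (v1 l)) / of_real D0"
  define W where "W = comb a b u1 v1 u2 v2"
  define W' where "W' = comb a b u1' v1' u2' v2'"
  have e1: "of_real D0 * (a * of_real (u1 l) + b * of_real (u2 l)) = - fst (y l) * of_real D0"
  proof -
    have "of_real D0 * (a * of_real (u1 l) + b * of_real (u2 l)) = (of_real D0 * a) * of_real (u1 l) + (of_real D0 * b) * of_real (u2 l)"
      by (simp add: algebra_simps)
    also have "of_real D0 * a = - (fst (y l) * of_real (v2 l) - snd (y l) * of_real (u2 l))" using D0 by (simp add: a_def)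
    also have "of_real D0 * b = - (snd (y l) * of_real (u1 l) - fst (y l) * of_real (v1 l))" using D0 by (simp add: b_def)
    finally show ?thesis by (simp add: D0_def algebra_simps)
  qed
  have e2: "of_real D0 * (a * of_real (v1 l) + b * of_real (v2 l)) = - snd (y l) * of_real D0"
  proof -
    have "of_real D0 * (a * of_real (v1 l) + b * of_real (v2 l)) = (of_real D0 * a) * of_real (v1 l) + (of_real D0 * b) * of_real (v2 l)"
      by (simp add: algebra_simps)
    also have "of_real D0 * a = - (fst (y l) * of_real (v2 l) - snd (y l) * of_real (u2 l))" using D0 by (simp add: a_def)
    also have "of_real D0 * b = - (snd (y l) * of_real (u1 l) - fst (y l) * of_real (v1 l))" using D0 by (simp add: b_def)
    finally show ?thesis by (simp add: D0_def algebra_simps)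
  qed
  have Wl: "y l + W l = 0"
  proof -
    have cancel: "Y + X = 0" if "d * X = - Y * d" "d \<noteq> 0" for d X Y :: complex
    proof -
      have "d * (Y + X) = d * Y + d * X" by (rule distrib_left)
      also have "\<dots> = 0" using that(1) by simp
      finally show ?thesis using that(2) by simp
    qed
    have "fst (y l) + (a * of_real (u1 l) + b * of_real (u2 l)) = 0"
      "snd (y l) + (a * of_real (v1 l) + b * of_real (v2 l)) = 0"
      by (rule cancel[OF e1], simp add: D0, rule cancel[OF e2], simp add: D0)
    then show ?thesis by (simp add: W_def comb_def prod_eq_iff)
  qed
  note c1 = solves_sys_continuous_on[OF s1] and c2 = solves_sys_continuous_on[OF s2]
  have cW: "continuous_on {0..l} W" "continuous_on {0..l} W'"
    unfolding W_def W'_def by (intro comb_continuous_on c1 c2)+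
  have "bvp l G H \<mu> (\<lambda>x. y x + W x) (\<lambda>x. y' x + W' x) (W' 0) R"
    unfolding bvp_def
  proof (intro conjI ballI)
    show "continuous_on {0..l} (\<lambda>x. y x + W x)" "continuous_on {0..l} (\<lambda>x. y' x + W' x)"
      by (intro continuous_intros y cW)+
    show "y l + W l = 0" by (rule Wl)
    fix x assume x: "x \<in> {0..l}"
    show "((\<lambda>x. y' x + W' x) has_integral y x + W x) {0..x}"
      using y(3) x comb_solves_sys(1)[OF s1 s2 x] unfolding W_def W'_def by (intro has_integral_add) auto
    have "((\<lambda>t. sysA G H \<mu> t (y t) + sysA G H \<mu> t (W t)) has_integral (y' x - - integral {0..x} R) + (W' x - W' 0)) {0..x}"
      using y(4) x comb_solves_sys(2)[OF s1 s2 x] unfolding W_def W'_def by (intro has_integral_add) auto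
    then show "((\<lambda>t. sysA G H \<mu> t (y t + W t)) has_integral y' x + W' x - (W' 0 - integral {0..x} R)) {0..x}"
      by (simp add: sysA_add algebra_simps)
  qed
  then show ?thesis by blast
qed

lemma has_integral_complex_Pair:
  fixes f g :: "real \<Rightarrow> complex"
  assumes "(f has_integral a) S" "(g has_integral b) S"
  shows "((\<lambda>x. (f x, g x)) has_integral (a, b)) S"
proof -
  have "bounded_linear (\<lambda>z. (z, 0) :: complex \<times> complex)" "bounded_linear (\<lambda>z. (0, z) :: complex \<times> complex)"
    by (intro bounded_linear_Pair bounded_linear_ident bounded_linear_zero)+
  from has_integral_add[OF has_integral_linear[OF assms(1) this(1)] has_integral_linear[OF assms(2) this(2)]]
  show ?thesis by (simp add: o_def)
qed

lemma dom_N_representative: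
  assumes l: "0 < l" and f: "f \<in> dom_N l"
  shows "\<exists>w w' c F. continuous_on {0..l} w \<and> continuous_on {0..l} w' \<and> F \<in> L2 l \<and>
     (\<forall>x\<in>{0..l}. (w' has_integral w x) {0..x}) \<and> (\<forall>x\<in>{0..l}. (F has_integral (w' x - c)) {0..x}) \<and> w l = 0 \<and>
     (AE x in Lm l. f x = w x) \<and>
     (AE x in Lm l. (wderiv l (wderiv l (fst \<circ> f)) x, wderiv l (wderiv l (snd \<circ> f)) x) = F x)"
proof -
  have d: "fst \<circ> f \<in> dom_L l" "snd \<circ> f \<in> dom_L l" using f by (auto simp: dom_N_def)
  obtain z1 z1' c1 F1 where z1: "continuous_on {0..l} z1" "continuous_on {0..l} z1'" "F1 \<in> L2 l"
    "\<forall>x\<in>{0..l}. z1 x = integral {0..x} z1'" "\<forall>x\<in>{0..l}. z1' x = c1 + integral {0..x} F1" "z1 l = 0"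
    "AE x in Lm l. (fst \<circ> f) x = z1 x" "AE x in Lm l. wderiv l (wderiv l (fst \<circ> f)) x = F1 x"
    using dom_L_representative[OF l d(1)] by blast
  obtain z2 z2' c2 F2 where z2: "continuous_on {0..l} z2" "continuous_on {0..l} z2'" "F2 \<in> L2 l"
    "\<forall>x\<in>{0..l}. z2 x = integral {0..x} z2'" "\<forall>x\<in>{0..l}. z2' x = c2 + integral {0..x} F2" "z2 l = 0"
    "AE x in Lm l. (snd \<circ> f) x = z2 x" "AE x in Lm l. wderiv l (wderiv l (snd \<circ> f)) x = F2 x"
    using dom_L_representative[OF l d(2)] by blast
  have hi: "(z' has_integral z x) {0..x}" if "continuous_on {0..l} z'" "\<forall>x\<in>{0..l}. z x = integral {0..x} z'" "x \<in> {0..l}"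
    for z z' :: "real \<Rightarrow> complex" and x
    using that by (auto intro!: integrable_integral integrable_continuous_real continuous_on_subset[OF that(1)])
  have hF: "(F has_integral (z' x - c)) {0..x}" if "F \<in> L2 l" "\<forall>x\<in>{0..l}. z' x = c + integral {0..x} F" "x \<in> {0..l}"
    for F z' :: "real \<Rightarrow> complex" and x c
    using that integrable_integral[OF integrable_on_Lm(2)[OF L2_integrable[OF that(1)] that(3)]] by simp
  show ?thesis
  proof (rule exI[of _ "\<lambda>x. (z1 x, z2 x)"], rule exI[of _ "\<lambda>x. (z1' x, z2' x)"], rule exI[of _ "(c1, c2)"],
      rule exI[of _ "\<lambda>x. (F1 x, F2 x)"], intro conjI ballI)
    show "continuous_on {0..l} (\<lambda>x. (z1 x, z2 x))" "continuous_on {0..l} (\<lambda>x. (z1' x, z2' x))"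
      by (intro continuous_intros z1 z2)+
    show "(\<lambda>x. (F1 x, F2 x)) \<in> L2 l" by (rule L2_Pair[OF z1(3) z2(3)])
    show "(z1 l, z2 l) = 0" using z1(6) z2(6) by (simp add: zero_prod_def)
    show "AE x in Lm l. f x = (z1 x, z2 x)" using z1(7) z2(7) by eventually_elim (simp add: prod_eq_iff)
    show "AE x in Lm l. (wderiv l (wderiv l (fst \<circ> f)) x, wderiv l (wderiv l (snd \<circ> f)) x) = (F1 x, F2 x)"
      using z1(8) z2(8) by eventually_elim simp
    fix x assume x: "x \<in> {0..l}"
    show "((\<lambda>x. (z1' x, z2' x)) has_integral (z1 x, z2 x)) {0..x}"
      by (intro has_integral_complex_Pair hi[OF z1(2,4) x] hi[OF z2(2,4) x])
    show "((\<lambda>x. (F1 x, F2 x)) has_integral ((z1' x, z2' x) - (c1, c2))) {0..x}"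
      using has_integral_complex_Pair[OF hF[OF z1(3,5) x] hF[OF z2(3,5) x]] by simp
  qed
qed

text \<open>
  Componentwise, \<open>(N - \<mu>) f = r\<close> says that \<open>f''\<close> is \<open>sysA f\<close> minus \<open>r\<close> turned by a right angle.
\<close>

lemma Nop_eq_sysA:
  "(wderiv l (wderiv l (fst \<circ> f)) x, wderiv l (wderiv l (snd \<circ> f)) x) =
     sysA (\<lambda>x. s\<^sup>2 * g (s * x)) (\<lambda>x. s\<^sup>2 * h (s * x)) \<mu> x (f x)
     - (snd (Nop l g h s f x - smul (of_real \<mu>) (f x)), - fst (Nop l g h s f x - smul (of_real \<mu>) (f x)))"
  by (simp add: sysA_def Nop_def Lop_def smul_def)

text \<open>
  The estimate \<open>key\<close> holds for every function of the domain; it gives both injectivity and the bounded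
  inverse, and \<open>bvp_solvable\<close> gives surjectivity.
\<close>

lemma not_in_Spec_N:
  fixes g h :: "real \<Rightarrow> real" and s l \<mu> :: real
  defines "G \<equiv> \<lambda>x. s\<^sup>2 * g (s * x)" and "H \<equiv> \<lambda>x. s\<^sup>2 * h (s * x)"
  assumes l: "0 < l" and G: "continuous_on {0..l} G" and H: "continuous_on {0..l} H"
    and s1: "solves_sys l G H \<mu> u1 u1' v1 v1'" "u1' 0 = 1" "v1' 0 = 0"
    and s2: "solves_sys l G H \<mu> u2 u2' v2 v2'" "u2' 0 = 0" "v2' 0 = 1"
    and D: "u1 l * v2 l - u2 l * v1 l \<noteq> 0"
  shows "complex_of_real \<mu> \<notin> Spec_N l g h s"
proof -
  define res where "res f x = Nop l g h s f x - smul (of_real \<mu>) (f x)" for f x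
  define rot where "rot z = (snd z, - fst z)" for z :: "complex \<times> complex"
  have rot: "bounded_linear rot" "norm (rot z) = norm z" for z
    unfolding rot_def by (auto intro!: bounded_linear_Pair bounded_linear_snd bounded_linear_minus bounded_linear_fst
      simp: norm_prod_def add.commute)
  obtain C where C: "0 \<le> C" "\<forall>w w' c R. bvp l G H \<mu> w w' c R \<longrightarrow> integrable (Lm l) R \<longrightarrow>
     (\<forall>x\<in>{0..l}. norm (w x) \<le> C * (LINT t|Lm l. norm (R t)))"
    using bvp_bound[OF l G H s1 s2 D] by blast
  have key: "l2norm l f \<le> sqrt l * (C * (sqrt l * l2norm l (res f))) \<and> res f \<in> borel_measurable (Lm l) \<and>
      (\<exists>w. (AE x in Lm l. f x = w x) \<and> (\<forall>x\<in>{0..l}. norm (w x) \<le> C * (sqrt l * l2norm l (res f))))"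
    if f: "f \<in> dom_N l" for f
  proof -
    obtain w w' c F where w: "continuous_on {0..l} w" "continuous_on {0..l} w'" "F \<in> L2 l"
      "\<forall>x\<in>{0..l}. (w' has_integral w x) {0..x}" "\<forall>x\<in>{0..l}. (F has_integral (w' x - c)) {0..x}" "w l = 0"
      "AE x in Lm l. f x = w x"
      "AE x in Lm l. (wderiv l (wderiv l (fst \<circ> f)) x, wderiv l (wderiv l (snd \<circ> f)) x) = F x"
      using dom_N_representative[OF l f] by blast
    have cA: "continuous_on {0..l} (\<lambda>x. sysA G H \<mu> x (w x))" by (rule sysA_continuous_on(2)[OF G H w(1)])
    define R where "R x = sysA G H \<mu> x (w x) - F x" for x
    have RL2: "R \<in> L2 l" unfolding R_def[abs_def] by (rule L2_diff[OF L2_continuous[OF cA] w(3)])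
    have Rrot: "AE x in Lm l. R x = rot (res f x)"
      using w(7,8)
    proof eventually_elim
      case (elim x)
      have "F x = sysA G H \<mu> x (f x) - rot (res f x)"
        using trans[OF elim(2)[symmetric] Nop_eq_sysA[of l f x s g h \<mu>]] by (simp only: rot_def res_def G_def H_def)
      then show ?case using elim(1) by (simp add: R_def)
    qed
    have "bvp l G H \<mu> w w' c R"
      unfolding bvp_def
    proof (intro conjI ballI w(1,2,6))
      fix x assume x: "x \<in> {0..l}"
      show "(w' has_integral w x) {0..x}" using w(4) x by blast
      have "(R has_integral integral {0..x} R) {0..x}"
        by (rule integrable_integral[OF integrable_on_Lm(2)[OF L2_integrable[OF RL2] x]])
      then have "((\<lambda>x. R x + F x) has_integral (integral {0..x} R + (w' x - c))) {0..x}"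
        using w(5) x by (intro has_integral_add) auto
      then show "((\<lambda>t. sysA G H \<mu> t (w t)) has_integral (w' x - (c - integral {0..x} R))) {0..x}"
        by (simp add: R_def[abs_def] algebra_simps)
    qed
    then have wb: "norm (w x) \<le> C * (LINT t|Lm l. norm (R t))" if "x \<in> {0..l}" for x
      using C(2) L2_integrable[OF RL2] that by blast
    have dL: "fst \<circ> f \<in> dom_L l" "snd \<circ> f \<in> dom_L l" using f by (auto simp: dom_N_def)
    have m1: "(\<lambda>x. fst (f x)) \<in> borel_measurable (Lm l)" "(\<lambda>x. snd (f x)) \<in> borel_measurable (Lm l)"
      using L2_D(1)[OF dom_L_L2(1)[OF dL(1)]] L2_D(1)[OF dom_L_L2(1)[OF dL(2)]] by (simp_all add: o_def)
    note m2 = L2_D(1)[OF dom_L_L2(2)[OF dL(1)]] L2_D(1)[OF dom_L_L2(2)[OF dL(2)]]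
    have fm: "f \<in> borel_measurable (Lm l)"
      using borel_measurable_Pair[OF m1] by simp
    have mG: "(\<lambda>x. complex_of_real (G x)) \<in> borel_measurable (Lm l)" "(\<lambda>x. complex_of_real (H x)) \<in> borel_measurable (Lm l)"
      by (intro borel_measurable_Lm' continuous_intros G H)+
    have "(\<lambda>x. (- (- wderiv l (wderiv l (snd \<circ> f)) x - complex_of_real (H x) * snd (f x)) - of_real \<mu> * fst (f x),
        (- wderiv l (wderiv l (fst \<circ> f)) x - complex_of_real (G x) * fst (f x)) - of_real \<mu> * snd (f x))) \<in> borel_measurable (Lm l)"
      by (intro borel_measurable_Pair borel_measurable_diff borel_measurable_uminus borel_measurable_times
          borel_measurable_const m1 m2 mG)
    moreover have "res f = (\<lambda>x. (- (- wderiv l (wderiv l (snd \<circ> f)) x - complex_of_real (H x) * snd (f x)) - of_real \<mu> * fst (f x),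
        (- wderiv l (wderiv l (fst \<circ> f)) x - complex_of_real (G x) * fst (f x)) - of_real \<mu> * snd (f x)))"
      by (simp add: res_def[abs_def] Nop_def Lop_def smul_def G_def H_def)
    ultimately have rm: "res f \<in> borel_measurable (Lm l)" by simp
    have rotm: "(\<lambda>x. rot (res f x)) \<in> borel_measurable (Lm l)"
      using measurable_compose[OF rm borel_measurable_continuous_onI[OF linear_continuous_on[OF rot(1)]]] .
    have "l2norm l R = l2norm l (\<lambda>x. rot (res f x))" by (rule l2norm_cong_AE[OF L2_D(1)[OF RL2] rotm Rrot])
    then have lR: "l2norm l R = l2norm l (res f)" by (simp add: l2norm_def rot(2))
    have wb': "norm (w x) \<le> C * (sqrt l * l2norm l (res f))" if "x \<in> {0..l}" for x
      using wb[OF that] mult_left_mono[OF L1_le_L2[OF l RL2] C(1)] by (simp add: lR)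
    have "l2norm l f = l2norm l w" by (rule l2norm_cong_AE[OF fm borel_measurable_Lm'[OF w(1)] w(7)])
    also have "\<dots> \<le> sqrt l * (C * (sqrt l * l2norm l (res f)))"
      using wb' C(1) l by (intro l2norm_le[OF l] mult_nonneg_nonneg l2norm_nonneg) auto
    finally show ?thesis using rm w(7) wb' by blast
  qed
  have "aeq l f (\<lambda>x. 0)" if f: "f \<in> dom_N l" and z: "aeq l (res f) (\<lambda>x. 0)" for f
  proof -
    obtain w where w: "AE x in Lm l. f x = w x" "\<forall>x\<in>{0..l}. norm (w x) \<le> C * (sqrt l * l2norm l (res f))"
      and m: "res f \<in> borel_measurable (Lm l)"
      using key[OF f] by blast
    have "l2norm l (res f) = l2norm l (\<lambda>x. 0 :: complex \<times> complex)"
      using z by (intro l2norm_cong_AE m) (auto simp: aeq_def)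
    then have "l2norm l (res f) = 0" by (simp add: l2norm_def)
    then have "\<forall>x\<in>{0..l}. w x = 0" using w(2) by simp
    then have "AE x in Lm l. w x = 0" by (intro AE_LmI) auto
    with w(1) show ?thesis unfolding aeq_def by eventually_elim simp
  qed
  moreover have "\<exists>f\<in>dom_N l. aeq l (res f) r" if r: "r \<in> L2 l" for r
  proof -
    define R where "R x = rot (r x)" for x
    have RL2: "R \<in> L2 l" unfolding R_def[abs_def] by (rule L2_linear_image[OF r rot(1)]) (simp add: rot(2))
    obtain w w' c where b: "bvp l G H \<mu> w w' c R"
      using bvp_solvable[OF l G H s1(1) s2(1) D L2_integrable[OF RL2]] by blast
    \<comment> \<open>The second derivative that a solution must have.\<close>
    define F where "F x = sysA G H \<mu> x (w x) - R x" for x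
    have cA: "continuous_on {0..l} (\<lambda>x. sysA G H \<mu> x (w x))"
      using b by (intro sysA_continuous_on(2)[OF G H]) (simp add: bvp_def)
    have FL2: "F \<in> L2 l" unfolding F_def[abs_def] by (rule L2_diff[OF L2_continuous[OF cA] RL2])
    have Fint: "(F has_integral (w' x - c)) {0..x}" if x: "x \<in> {0..l}" for x
    proof -
      have "(R has_integral integral {0..x} R) {0..x}"
        by (rule integrable_integral[OF integrable_on_Lm(2)[OF L2_integrable[OF RL2] x]])
      then have "(F has_integral ((w' x - (c - integral {0..x} R)) - integral {0..x} R)) {0..x}"
        using b x unfolding F_def[abs_def] bvp_def by (intro has_integral_diff) auto
      then show ?thesis by simp
    qed
    have w'int: "(w' has_integral w x) {0..x}" if "x \<in> {0..l}" for x using b that by (simp add: bvp_def)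
    have wl: "w l = 0" using b by (simp add: bvp_def)
    have lin: "T (w' x) = T c + integral {0..x} (\<lambda>x. T (F x))" "T (w x) = integral {0..x} (\<lambda>x. T (w' x))"
      if T: "bounded_linear T" and x: "x \<in> {0..l}" for T :: "complex \<times> complex \<Rightarrow> complex" and x
    proof -
      interpret bounded_linear T by (rule T)
      show "T (w' x) = T c + integral {0..x} (\<lambda>x. T (F x))"
        using integral_unique[OF has_integral_linear[OF Fint[OF x] T]] by (simp add: o_def diff)
      show "T (w x) = integral {0..x} (\<lambda>x. T (w' x))"
        using integral_unique[OF has_integral_linear[OF w'int[OF x] T]] by (simp add: o_def)
    qed
    have F1: "(\<lambda>x. fst (F x)) \<in> L2 l" and F2: "(\<lambda>x. snd (F x)) \<in> L2 l"
      using L2_linear_image[OF FL2 bounded_linear_fst] L2_linear_image[OF FL2 bounded_linear_snd]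
      by (metis norm_fst_le prod.collapse, metis norm_snd_le prod.collapse)
    note d1 = dom_L_intro[OF l F1 lin[OF bounded_linear_fst]] and d2 = dom_L_intro[OF l F2 lin[OF bounded_linear_snd]]
    have dN: "w \<in> dom_N l"
      using d1(1) d2(1) wl by (simp add: dom_N_def o_def)
    have "aeq l (res w) r"
      unfolding aeq_def
    proof -
      have "AE x in Lm l. wderiv l (wderiv l (fst \<circ> w)) x = fst (F x)"
        "AE x in Lm l. wderiv l (wderiv l (snd \<circ> w)) x = snd (F x)"
        using d1(2) d2(2) wl by (simp_all add: o_def)
      then show "AE x in Lm l. res w x = r x"
      proof eventually_elim
        case (elim x)
        have "F x = sysA G H \<mu> x (w x) - rot (res w x)"
          using Nop_eq_sysA[of l w x s g h \<mu>] elim by (simp add: rot_def res_def G_def H_def)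
        then have "rot (r x) = rot (res w x)" by (simp add: F_def R_def)
        then show ?case by (auto simp: rot_def prod_eq_iff)
      qed
    qed
    with dN show ?thesis by blast
  qed
  moreover have "l2norm l f \<le> (sqrt l * (C * sqrt l)) * l2norm l (res f)" if "f \<in> dom_N l" for f
    using conjunct1[OF key[OF that]] by (simp only: mult.assoc)
  ultimately show ?thesis
    unfolding Spec_N_def resolvent_set_def res_def by blast
qed

text \<open>
  A continuous function that vanishes almost everywhere vanishes identically, so the nonzero slope at \<open>0\<close>
  makes the solution nontrivial also in \<open>L\<^sup>2\<close>.
\<close>

lemma eigenfun_N_intro:
  assumes l: "0 < l" and G: "continuous_on {0..l} (\<lambda>x. s\<^sup>2 * g (s * x))" and H: "continuous_on {0..l} (\<lambda>x. s\<^sup>2 * h (s * x))"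
    and sol: "solves_sys l (\<lambda>x. s\<^sup>2 * g (s * x)) (\<lambda>x. s\<^sup>2 * h (s * x)) \<mu> u u' v v'"
    and "u l = 0" "v l = 0" "u' 0 \<noteq> 0 \<or> v' 0 \<noteq> 0"
  shows "eigenfun_N l g h s \<mu> (\<lambda>x. (u x, v x))"
proof -
  note c = solves_sys_continuous_on[OF sol]
  have ofr: "((\<lambda>t. complex_of_real (a t)) has_integral of_real b) S" if "(a has_integral b) S" for a b and S :: "real set"
    using has_integral_linear[OF that bounded_linear_of_real] by (simp add: o_def)
  define Fu where "Fu x = - (s\<^sup>2 * g (s * x)) * u x - \<mu> * v x" for x
  define Fv where "Fv x = \<mu> * u x - s\<^sup>2 * h (s * x) * v x" for x
  have cF: "continuous_on {0..l} Fu" "continuous_on {0..l} Fv"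
    unfolding Fu_def[abs_def] Fv_def[abs_def] by (intro continuous_intros c G H)+
  have d: "cplx z \<in> dom_L l \<and> (AE x in Lm l. wderiv l (wderiv l (cplx z)) x = of_real (F x))"
    if cF: "continuous_on {0..l} F" and z: "\<And>x. x \<in> {0..l} \<Longrightarrow> (z has_real_derivative z' x) (at x within {0..l})"
      "\<And>x. x \<in> {0..l} \<Longrightarrow> (z' has_real_derivative F x) (at x within {0..l})" "z 0 = 0" "z l = 0" for z z' F
  proof -
    have 1: "cplx z x = integral {0..x} (\<lambda>x. of_real (z' x))" if x: "x \<in> {0..l}" for x
      using integral_unique[OF ofr[OF has_integral_of_derivative[OF z(1) x]]] z(3) by (simp add: cplx_def)
    have 2: "complex_of_real (z' x) = of_real (z' 0) + integral {0..x} (\<lambda>x. of_real (F x))" if x: "x \<in> {0..l}" for x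
      using integral_unique[OF ofr[OF has_integral_of_derivative[OF z(2) x]]] by simp
    have "(\<lambda>x. complex_of_real (F x)) \<in> L2 l" by (intro L2_continuous continuous_intros cF)
    from dom_L_intro[OF l this 2 1] z(4) show ?thesis by (simp add: cplx_def)
  qed
  have du: "cplx u \<in> dom_L l \<and> (AE x in Lm l. wderiv l (wderiv l (cplx u)) x = of_real (Fu x))"
    by (rule d[OF cF(1), of u u']) (use sol assms in \<open>auto simp: solves_sys_def Fu_def\<close>)
  have dv: "cplx v \<in> dom_L l \<and> (AE x in Lm l. wderiv l (wderiv l (cplx v)) x = of_real (Fv x))"
    by (rule d[OF cF(2), of v v']) (use sol assms in \<open>auto simp: solves_sys_def Fv_def\<close>)
  let ?w = "\<lambda>x. (u x, v x)"
  have comp: "fst \<circ> cplx2 ?w = cplx u" "snd \<circ> cplx2 ?w = cplx v"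
    by (auto simp: cplx2_def cplx_def)
  have "\<not> aeq l ?w (\<lambda>x. 0)"
  proof
    assume "aeq l ?w (\<lambda>x. 0)"
    then have "AE x in Lm l. (u x, v x) = 0" by (simp add: aeq_def)
    then have w0: "(u x, v x) = 0" if "x \<in> {0..l}" for x
      using continuous_AE_eq[OF l _ continuous_on_const _ that, of ?w 0] c by (auto intro: continuous_intros)
    have 0: "(0::real) \<in> {0..l}" using l by simp
    have zero: "z' 0 = 0" if "(z has_real_derivative z' 0) (at 0 within {0..l})" "\<And>x. x \<in> {0..l} \<Longrightarrow> z x = 0" for z z' :: "real \<Rightarrow> real"
    proof -
      have "((\<lambda>x. 0) has_real_derivative z' 0) (at 0 within {0..l})"
        using has_field_derivative_transform_within[OF that(1) zero_less_one 0, of "\<lambda>x. 0"] that(2) by auto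
      moreover have "((\<lambda>x. 0) has_real_derivative 0) (at 0 within {0..l})" by simp
      ultimately show ?thesis using l by (metis has_real_derivative_iff_has_vector_derivative vector_derivative_unique_within trivial_limit_within islimpt_Icc 0)
    qed
    have "u' 0 = 0" "v' 0 = 0"
      using zero[of u u'] zero[of v v'] sol 0 w0 by (auto simp: solves_sys_def zero_prod_def)
    with assms show False by simp
  qed
  moreover have "aeq l (Nop l g h s (cplx2 ?w)) (\<lambda>x. smul (complex_of_real \<mu>) (cplx2 ?w x))"
  proof -
    have "AE x in Lm l. wderiv l (wderiv l (cplx u)) x = of_real (Fu x)" "AE x in Lm l. wderiv l (wderiv l (cplx v)) x = of_real (Fv x)"
      using du dv by auto
    then show ?thesis unfolding aeq_def
    proof eventually_elim
      case (elim x)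
      then show ?case
        by (simp only: Nop_def Lop_def comp elim)
           (simp add: smul_def Fu_def Fv_def cplx_def cplx2_def algebra_simps)
    qed
  qed
  ultimately show ?thesis
    using du dv by (simp add: eigenfun_N_def dom_N_def comp)
qed

lemma eigenfun_N_in_Spec_N:
  assumes "eigenfun_N l g h s \<mu> w"
  shows "complex_of_real \<mu> \<in> Spec_N l g h s"
proof -
  have w: "cplx2 w \<in> dom_N l" "\<not> aeq l w (\<lambda>x. 0)"
    "AE x in Lm l. Nop l g h s (cplx2 w) x = smul (complex_of_real \<mu>) (cplx2 w x)"
    using assms by (auto simp: eigenfun_N_def aeq_def)
  have "aeq l (\<lambda>x. Nop l g h s (cplx2 w) x - smul (complex_of_real \<mu>) (cplx2 w x)) (\<lambda>x. 0)"
    unfolding aeq_def using w(3) by eventually_elim simp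
  moreover have "\<not> aeq l (cplx2 w) (\<lambda>x. 0)"
  proof
    assume "aeq l (cplx2 w) (\<lambda>x. 0)"
    then have "AE x in Lm l. w x = 0"
      unfolding aeq_def by eventually_elim (simp add: cplx2_def zero_prod_def prod_eq_iff)
    with w(2) show False by (simp add: aeq_def)
  qed
  ultimately show ?thesis using w(1) unfolding Spec_N_def resolvent_set_def by blast
qed

section \<open>The determinant of the boundary value problem\<close>

text \<open>
  With \<open>x = \<lambda>\<^sup>2\<close>, the pairs \<open>(A, \<lambda> B)\<close> and \<open>(\<lambda> C, E)\<close> formed from the four series span the solutions of
  \<open>U'' = - g U - \<lambda> V\<close>, \<open>V'' = - h V + \<lambda> U\<close> that vanish at \<open>0\<close>.
\<close>

locale analytic_system =
  fixes L \<rho> :: real and g h :: "real \<Rightarrow> real" and a a' b b' e e' c c' :: "nat \<Rightarrow> real \<Rightarrow> real"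
  assumes g: "continuous_on {0..L} g" and h: "continuous_on {0..L} h"
    and pair1: "analytic_pair L g h 1 \<rho> a a' b b'" and pair2: "analytic_pair L h g (-1) \<rho> e e' c c'"
begin

text \<open>
  The general solution of the system that vanishes at \<open>0\<close>, with \<open>\<nu>\<close> the spectral parameter and initial
  slopes \<open>\<alpha>\<close> and \<open>\<beta>\<close>.
\<close>

definition soln_u :: "real \<Rightarrow> real \<Rightarrow> real \<Rightarrow> real \<Rightarrow> real" where
  "soln_u \<nu> \<alpha> \<beta> y = \<alpha> * pser a (\<nu>\<^sup>2, y) + \<beta> * (\<nu> * pser c (\<nu>\<^sup>2, y))"

definition soln_v :: "real \<Rightarrow> real \<Rightarrow> real \<Rightarrow> real \<Rightarrow> real" where
  "soln_v \<nu> \<alpha> \<beta> y = \<alpha> * (\<nu> * pser b (\<nu>\<^sup>2, y)) + \<beta> * pser e (\<nu>\<^sup>2, y)"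

lemma coefficients_continuous_on:
  assumes "0 < s" "s * l \<le> L"
  shows "continuous_on {0..l} (\<lambda>x. s\<^sup>2 * g (s * x))" "continuous_on {0..l} (\<lambda>x. s\<^sup>2 * h (s * x))"
proof -
  have "(\<lambda>x. s * x) ` {0..l} \<subseteq> {0..L}" by (rule image_subsetI) (rule rescale_in[OF assms])
  then have "continuous_on {0..l} (\<lambda>x. f (s * x))" if "continuous_on {0..L} f" for f :: "real \<Rightarrow> real"
    by (intro continuous_on_compose2[OF that] continuous_intros)
  note comp = this[OF g] this[OF h]
  show "continuous_on {0..l} (\<lambda>x. s\<^sup>2 * g (s * x))" by (rule continuous_on_mult[OF continuous_on_const comp(1)])
  show "continuous_on {0..l} (\<lambda>x. s\<^sup>2 * h (s * x))" by (rule continuous_on_mult[OF continuous_on_const comp(2)])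
qed

lemma solves_sys_soln:
  assumes \<nu>: "\<nu>\<^sup>2 \<in> {-\<rho><..<\<rho>}" and s: "0 < s" "s * l \<le> L"
  shows "solves_sys l (\<lambda>x. s\<^sup>2 * g (s * x)) (\<lambda>x. s\<^sup>2 * h (s * x)) (s\<^sup>2 * \<nu>)
    (\<lambda>x. \<kappa> * soln_u \<nu> \<alpha> \<beta> (s * x)) (\<lambda>x. \<kappa> * (s * (\<alpha> * pser a' (\<nu>\<^sup>2, s * x) + \<beta> * (\<nu> * pser c' (\<nu>\<^sup>2, s * x)))))
    (\<lambda>x. \<kappa> * soln_v \<nu> \<alpha> \<beta> (s * x)) (\<lambda>x. \<kappa> * (s * (\<alpha> * (\<nu> * pser b' (\<nu>\<^sup>2, s * x)) + \<beta> * pser e' (\<nu>\<^sup>2, s * x))))"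
  unfolding solves_sys_def
proof (intro conjI ballI)
  have z: "pser a (\<nu>\<^sup>2, 0) = 0" "pser b (\<nu>\<^sup>2, 0) = 0" "pser c (\<nu>\<^sup>2, 0) = 0" "pser e (\<nu>\<^sup>2, 0) = 0"
    using pair1 pair2 \<nu> unfolding analytic_pair_def by blast+
  then show "\<kappa> * soln_u \<nu> \<alpha> \<beta> (s * 0) = 0" "\<kappa> * soln_v \<nu> \<alpha> \<beta> (s * 0) = 0"
    by (simp_all add: soln_u_def soln_v_def)
  fix x assume x: "x \<in> {0..l}"
  define y where "y = s * x"
  have y: "y \<in> {0..L}" unfolding y_def by (rule rescale_in[OF s x])
  have d1: "((\<lambda>y. pser a (\<nu>\<^sup>2, y)) has_real_derivative pser a' (\<nu>\<^sup>2, y)) (at y within {0..L})"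
    "((\<lambda>y. pser b (\<nu>\<^sup>2, y)) has_real_derivative pser b' (\<nu>\<^sup>2, y)) (at y within {0..L})"
    "((\<lambda>y. pser a' (\<nu>\<^sup>2, y)) has_real_derivative (- g y * pser a (\<nu>\<^sup>2, y) - 1 * (\<nu>\<^sup>2 * pser b (\<nu>\<^sup>2, y)))) (at y within {0..L})"
    "((\<lambda>y. pser b' (\<nu>\<^sup>2, y)) has_real_derivative (1 * pser a (\<nu>\<^sup>2, y) - h y * pser b (\<nu>\<^sup>2, y))) (at y within {0..L})"
    using pair1 \<nu> y unfolding analytic_pair_def by blast+
  have d2: "((\<lambda>y. pser e (\<nu>\<^sup>2, y)) has_real_derivative pser e' (\<nu>\<^sup>2, y)) (at y within {0..L})"
    "((\<lambda>y. pser c (\<nu>\<^sup>2, y)) has_real_derivative pser c' (\<nu>\<^sup>2, y)) (at y within {0..L})"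
    "((\<lambda>y. pser e' (\<nu>\<^sup>2, y)) has_real_derivative (- h y * pser e (\<nu>\<^sup>2, y) - - 1 * (\<nu>\<^sup>2 * pser c (\<nu>\<^sup>2, y)))) (at y within {0..L})"
    "((\<lambda>y. pser c' (\<nu>\<^sup>2, y)) has_real_derivative (- 1 * pser e (\<nu>\<^sup>2, y) - g y * pser c (\<nu>\<^sup>2, y))) (at y within {0..L})"
    using pair2 \<nu> y unfolding analytic_pair_def by blast+
  note r1 = d1[unfolded y_def, THEN DERIV_rescale, OF s x] and r2 = d2[unfolded y_def, THEN DERIV_rescale, OF s x]
  have "((\<lambda>x. \<kappa> * soln_u \<nu> \<alpha> \<beta> (s * x)) has_real_derivative
     \<kappa> * (\<alpha> * (s * pser a' (\<nu>\<^sup>2, s * x)) + \<beta> * (\<nu> * (s * pser c' (\<nu>\<^sup>2, s * x))))) (at x within {0..l})"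
    unfolding soln_u_def by (intro DERIV_cmult DERIV_add r1(1) r2(2))
  then show "((\<lambda>x. \<kappa> * soln_u \<nu> \<alpha> \<beta> (s * x)) has_real_derivative
     \<kappa> * (s * (\<alpha> * pser a' (\<nu>\<^sup>2, s * x) + \<beta> * (\<nu> * pser c' (\<nu>\<^sup>2, s * x))))) (at x within {0..l})"
    by (simp add: algebra_simps)
  have "((\<lambda>x. \<kappa> * soln_v \<nu> \<alpha> \<beta> (s * x)) has_real_derivative
     \<kappa> * (\<alpha> * (\<nu> * (s * pser b' (\<nu>\<^sup>2, s * x))) + \<beta> * (s * pser e' (\<nu>\<^sup>2, s * x)))) (at x within {0..l})"
    unfolding soln_v_def by (intro DERIV_cmult DERIV_add r1(2) r2(1))
  then show "((\<lambda>x. \<kappa> * soln_v \<nu> \<alpha> \<beta> (s * x)) has_real_derivative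
     \<kappa> * (s * (\<alpha> * (\<nu> * pser b' (\<nu>\<^sup>2, s * x)) + \<beta> * pser e' (\<nu>\<^sup>2, s * x)))) (at x within {0..l})"
    by (simp add: algebra_simps)
  have "((\<lambda>x. \<kappa> * (s * (\<alpha> * pser a' (\<nu>\<^sup>2, s * x) + \<beta> * (\<nu> * pser c' (\<nu>\<^sup>2, s * x))))) has_real_derivative
     \<kappa> * (s * (\<alpha> * (s * (- g (s * x) * pser a (\<nu>\<^sup>2, s * x) - 1 * (\<nu>\<^sup>2 * pser b (\<nu>\<^sup>2, s * x))))
      + \<beta> * (\<nu> * (s * (- 1 * pser e (\<nu>\<^sup>2, s * x) - g (s * x) * pser c (\<nu>\<^sup>2, s * x))))))) (at x within {0..l})"
    by (intro DERIV_cmult DERIV_add r1(3) r2(4))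
  then show "((\<lambda>x. \<kappa> * (s * (\<alpha> * pser a' (\<nu>\<^sup>2, s * x) + \<beta> * (\<nu> * pser c' (\<nu>\<^sup>2, s * x))))) has_real_derivative
     - (s\<^sup>2 * g (s * x)) * (\<kappa> * soln_u \<nu> \<alpha> \<beta> (s * x)) - s\<^sup>2 * \<nu> * (\<kappa> * soln_v \<nu> \<alpha> \<beta> (s * x))) (at x within {0..l})"
    by (rule DERIV_cong) (simp add: soln_u_def soln_v_def power2_eq_square algebra_simps)
  have "((\<lambda>x. \<kappa> * (s * (\<alpha> * (\<nu> * pser b' (\<nu>\<^sup>2, s * x)) + \<beta> * pser e' (\<nu>\<^sup>2, s * x)))) has_real_derivative
     \<kappa> * (s * (\<alpha> * (\<nu> * (s * (1 * pser a (\<nu>\<^sup>2, s * x) - h (s * x) * pser b (\<nu>\<^sup>2, s * x))))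
      + \<beta> * (s * (- h (s * x) * pser e (\<nu>\<^sup>2, s * x) - - 1 * (\<nu>\<^sup>2 * pser c (\<nu>\<^sup>2, s * x))))))) (at x within {0..l})"
    by (intro DERIV_cmult DERIV_add r1(4) r2(3))
  then show "((\<lambda>x. \<kappa> * (s * (\<alpha> * (\<nu> * pser b' (\<nu>\<^sup>2, s * x)) + \<beta> * pser e' (\<nu>\<^sup>2, s * x)))) has_real_derivative
     s\<^sup>2 * \<nu> * (\<kappa> * soln_u \<nu> \<alpha> \<beta> (s * x)) - s\<^sup>2 * h (s * x) * (\<kappa> * soln_v \<nu> \<alpha> \<beta> (s * x))) (at x within {0..l})"
    by (rule DERIV_cong) (simp add: soln_u_def soln_v_def power2_eq_square algebra_simps)
qed

lemma slopes_at_0: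
  assumes "\<nu>\<^sup>2 \<in> {-\<rho><..<\<rho>}"
  shows "pser a' (\<nu>\<^sup>2, 0) = 1" "pser b' (\<nu>\<^sup>2, 0) = 0" "pser c' (\<nu>\<^sup>2, 0) = 0" "pser e' (\<nu>\<^sup>2, 0) = 1"
  using pair1 pair2 assms unfolding analytic_pair_def by blast+

text \<open>
  The factor \<open>inverse s\<close> gives the two rescaled solutions unit slopes at \<open>x = 0\<close>.
\<close>

lemma determinant_nonzero_imp_resolvent:
  assumes \<nu>: "\<nu>\<^sup>2 \<in> {-\<rho><..<\<rho>}" and s: "0 < s" "s * l \<le> L" and l: "0 < l"
    and D: "pser a (\<nu>\<^sup>2, s * l) * pser e (\<nu>\<^sup>2, s * l) - \<nu>\<^sup>2 * (pser b (\<nu>\<^sup>2, s * l) * pser c (\<nu>\<^sup>2, s * l)) \<noteq> 0"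
  shows "complex_of_real (s\<^sup>2 * \<nu>) \<notin> Spec_N l g h s"
proof -
  have "inverse s * soln_u \<nu> 1 0 (s * l) * (inverse s * soln_v \<nu> 0 1 (s * l))
      - inverse s * soln_u \<nu> 0 1 (s * l) * (inverse s * soln_v \<nu> 1 0 (s * l))
    = (inverse s * inverse s) * (pser a (\<nu>\<^sup>2, s * l) * pser e (\<nu>\<^sup>2, s * l) - \<nu>\<^sup>2 * (pser b (\<nu>\<^sup>2, s * l) * pser c (\<nu>\<^sup>2, s * l)))"
    by (simp add: soln_u_def soln_v_def power2_eq_square algebra_simps)
  with D s have "inverse s * soln_u \<nu> 1 0 (s * l) * (inverse s * soln_v \<nu> 0 1 (s * l))
      - inverse s * soln_u \<nu> 0 1 (s * l) * (inverse s * soln_v \<nu> 1 0 (s * l)) \<noteq> 0"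
    by simp
  then show ?thesis
    using slopes_at_0[OF \<nu>] s
    by (intro not_in_Spec_N[OF l coefficients_continuous_on[OF s]
        solves_sys_soln[OF \<nu> s, where \<kappa> = "inverse s" and \<alpha> = 1 and \<beta> = 0] _ _
        solves_sys_soln[OF \<nu> s, where \<kappa> = "inverse s" and \<alpha> = 0 and \<beta> = 1]]) auto
qed

lemma soln_eigenfun_N:
  assumes \<nu>: "\<nu>\<^sup>2 \<in> {-\<rho><..<\<rho>}" and s: "0 < s" "s * l \<le> L" and l: "0 < l"
    and z: "soln_u \<nu> \<alpha> \<beta> (s * l) = 0" "soln_v \<nu> \<alpha> \<beta> (s * l) = 0" and "\<kappa> \<noteq> 0" "\<alpha> \<noteq> 0 \<or> \<beta> \<noteq> 0"
  shows "eigenfun_N l g h s (s\<^sup>2 * \<nu>) (\<lambda>x. (\<kappa> * soln_u \<nu> \<alpha> \<beta> (s * x), \<kappa> * soln_v \<nu> \<alpha> \<beta> (s * x)))"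
  using slopes_at_0[OF \<nu>] s z assms(7,8)
  by (intro eigenfun_N_intro[OF l coefficients_continuous_on[OF s] solves_sys_soln[OF \<nu> s]]) auto

lemma pser_continuous:
  "continuous_on ({-\<rho><..<\<rho>} \<times> {0..L}) (pser a)" "continuous_on ({-\<rho><..<\<rho>} \<times> {0..L}) (pser b)"
  "continuous_on ({-\<rho><..<\<rho>} \<times> {0..L}) (pser c)" "continuous_on ({-\<rho><..<\<rho>} \<times> {0..L}) (pser e)"
  using pair1 pair2 unfolding analytic_pair_def by (auto intro!: pser_continuous_on coeff_Ck_bdd)

text \<open>
  Write \<open>a = \<delta> P + x R\<^sub>a\<close> and \<open>e = \<delta> Q + x R\<^sub>e\<close> for the two series, with \<open>\<delta> = y - y0\<close>. Then \<open>p q\<close> times the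
  determinant is \<open>\<delta>\<^sup>2 X + x Y\<close>, where \<open>X\<close> and \<open>Y\<close> are continuous, \<open>X = (p q)\<^sup>2\<close> and
  \<open>Y = - b c p q = (b q)\<^sup>2\<close> at \<open>(0, y0)\<close>. For \<open>x \<ge> 0\<close> both summands are nonnegative near that point.
\<close>

lemma determinant_nonzero_near:
  assumes y0: "y0 \<in> {0<..<L}" and Ka: "Ck 3 {0<..<L} (a 0)" "Ck 3 {0<..<L} (e 0)"
    and z: "a 0 y0 = 0" "e 0 y0 = 0"
    and da: "(a 0 has_real_derivative p) (at y0)" "p \<noteq> 0" and de: "(e 0 has_real_derivative q) (at y0)" "q \<noteq> 0"
    and bc: "c 0 y0 * p = - (b 0 y0 * q)" "b 0 y0 \<noteq> 0"
  shows "\<forall>\<^sub>F z in nhds (0, y0). 0 \<le> fst z \<longrightarrow> z \<noteq> (0, y0) \<longrightarrow> pser a z * pser e z - fst z * (pser b z * pser c z) \<noteq> 0"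
proof -
  have \<rho>: "0 < \<rho>" using pair1 by (simp add: analytic_pair_def)
  define r where "r = min y0 (L - y0)"
  have r: "0 < r" "{y0 - r<..<y0 + r} \<subseteq> {0<..<L}" using y0 by (auto simp: r_def)
  have S: "Ck (Suc 2) {0<..<L} (a 0)" "Ck (Suc 2) {0<..<L} (e 0)"
    using Ka by (simp_all only: numeral_3_eq_3 numeral_2_eq_2)
  obtain P where P: "Ck 2 {-r<..<r} P" "\<forall>z\<in>{-r<..<r}. a 0 (y0 + z) = z * P z" "P 0 = p"
    using Hadamard_quotient_Ck[OF S(1) r z(1) da(1)] by blast
  obtain Q where Q: "Ck 2 {-r<..<r} Q" "\<forall>z\<in>{-r<..<r}. e 0 (y0 + z) = z * Q z" "Q 0 = q"
    using Hadamard_quotient_Ck[OF S(2) r z(2) de(1)] by blast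
  define RA where "RA = pser (\<lambda>k. a (Suc k))"
  define RE where "RE = pser (\<lambda>k. e (Suc k))"
  let ?S = "{-\<rho><..<\<rho>} \<times> {0<..<L}"
  have oS: "open ?S" by (intro open_Times) auto
  have z0S: "(0, y0) \<in> ?S" using \<rho> y0 by simp
  have ca: "coeff_bdd \<rho> {0..L} a" "coeff_bdd \<rho> {0..L} e"
    using pair1 pair2 unfolding analytic_pair_def by (auto intro!: coeff_Ck_bdd)
  have ic: "isCont f (0, y0)" if "continuous_on ({-\<rho><..<\<rho>} \<times> {0..L}) f" for f :: "real \<times> real \<Rightarrow> real"
  proof -
    have "continuous_on ?S f" by (rule continuous_on_subset[OF that]) auto
    then show ?thesis using continuous_on_eq_continuous_at[OF oS] z0S by blast
  qed
  have iR: "isCont RA (0, y0)" "isCont RE (0, y0)"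
    unfolding RA_def RE_def by (intro ic pser_continuous_on coeff_bdd_Suc ca)+
  have iB: "isCont (pser b) (0, y0)" "isCont (pser c) (0, y0)" by (intro ic pser_continuous)+
  have iP: "isCont (\<lambda>z. f (snd z - y0)) (0, y0)" if "Ck 2 {-r<..<r} f" for f and z :: "real \<times> real"
  proof -
    have "isCont f 0" using Ck_continuous_on[OF that] r(1) by (simp add: continuous_on_eq_continuous_at)
    then show ?thesis by (intro isCont_o2[of "(0, y0)" "\<lambda>z. snd z - y0" f] continuous_intros) simp
  qed
  define X where "X z = P (snd z - y0) * Q (snd z - y0) * (p * q)" for z :: "real \<times> real"
  define Y where "Y z = ((snd z - y0) * (P (snd z - y0) * RE z + Q (snd z - y0) * RA z) + fst z * (RA z * RE z) - pser b z * pser c z) * (p * q)" for z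
  have "isCont X (0, y0)" unfolding X_def by (intro continuous_intros iP P(1) Q(1))
  moreover have "X (0, y0) > 0"
  proof -
    have "X (0, y0) = (p * q) * (p * q)" by (simp add: X_def P(3) Q(3))
    moreover have "p * q \<noteq> 0" using da(2) de(2) by simp
    ultimately show ?thesis by (metis not_real_square_gt_zero)
  qed
  ultimately have evX: "\<forall>\<^sub>F z in nhds (0, y0). X z > 0"
    unfolding continuous_at by (metis order_tendstoD(1) continuous_at isCont_def tendsto_at_iff_tendsto_nhds)
  have "isCont Y (0, y0)" unfolding Y_def by (intro continuous_intros iP P(1) Q(1) iR iB)
  moreover have "Y (0, y0) > 0"
  proof -
    have "Y (0, y0) = - (b 0 y0 * c 0 y0) * (p * q)" by (simp add: Y_def pser_at_0)
    also have "\<dots> = - (b 0 y0 * q) * (c 0 y0 * p)" by (simp add: mult_ac)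
    also have "\<dots> = (b 0 y0 * q) * (b 0 y0 * q)" by (simp add: bc(1))
    finally have "Y (0, y0) = (b 0 y0 * q) * (b 0 y0 * q)" .
    moreover have "b 0 y0 * q \<noteq> 0" using bc(2) de(2) by simp
    ultimately show ?thesis by (metis not_real_square_gt_zero)
  qed
  ultimately have evY: "\<forall>\<^sub>F z in nhds (0, y0). Y z > 0"
    unfolding continuous_at by (metis order_tendstoD(1) continuous_at isCont_def tendsto_at_iff_tendsto_nhds)
  have "open ({-\<rho><..<\<rho>} \<times> {y0 - r<..<y0 + r})" by (intro open_Times) auto
  then have evS: "\<forall>\<^sub>F z in nhds (0, y0). z \<in> {-\<rho><..<\<rho>} \<times> {y0 - r<..<y0 + r}"
    using \<rho> r(1) by (intro eventually_nhds_in_open) auto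
  show ?thesis
    using evX evY evS
  proof eventually_elim
    case (elim z)
    define \<delta> where "\<delta> = snd z - y0"
    have \<delta>: "\<delta> \<in> {-r<..<r}" "snd z = y0 + \<delta>" using elim(3) by (auto simp: \<delta>_def)
    have sz: "snd z \<in> {0..L}"
    proof -
      have "snd z \<in> {0<..<L}" using elim(3) by (intro subsetD[OF r(2)]) auto
      then show ?thesis by auto
    qed
    have A: "pser a z = \<delta> * P \<delta> + fst z * RA z" "pser e z = \<delta> * Q \<delta> + fst z * RE z"
      using pser_Suc[OF ca(1), of "fst z" "snd z"] pser_Suc[OF ca(2), of "fst z" "snd z"] elim(3) sz P(2) Q(2) \<delta>
      by (auto simp: RA_def RE_def)
    have eq: "(pser a z * pser e z - fst z * (pser b z * pser c z)) * (p * q) = \<delta>\<^sup>2 * X z + fst z * Y z"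
      unfolding A X_def Y_def \<delta>_def[symmetric] by (simp add: power2_eq_square algebra_simps)
    show ?case
    proof (intro impI notI)
      assume z: "0 \<le> fst z" "z \<noteq> (0, y0)" and D0: "pser a z * pser e z - fst z * (pser b z * pser c z) = 0"
      have "\<delta>\<^sup>2 * X z + fst z * Y z = 0" using eq D0 by simp
      moreover have "0 \<le> \<delta>\<^sup>2 * X z" "0 \<le> fst z * Y z" using elim z by auto
      ultimately have "\<delta>\<^sup>2 * X z = 0" "fst z * Y z = 0" by linarith+
      then have "\<delta> = 0" "fst z = 0" using elim by auto
      with z(2) show False by (auto simp: \<delta>_def prod_eq_iff)
    qed
  qed
qed

text \<open>
  Along a curve of zeros of the determinant the combination with coefficients \<open>\<alpha>\<close>, \<open>\<beta>\<close> vanishes at the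
  end point, and it is jointly continuous in the parameter and in \<open>x\<close>, hence continuous in \<open>L\<^sup>2\<close>.
  The factor \<open>\<kappa>\<close> normalizes the limit to the given eigenfunction.
\<close>

lemma eigenpair_curve:
  assumes l: "0 < l" and T: "Ck 2 {-\<epsilon><..<\<epsilon>} T" and \<epsilon>: "0 < \<epsilon>" and \<delta>: "0 < \<delta>" "\<delta> \<le> 1" "\<delta> \<le> \<epsilon>"
    and \<alpha>: "continuous_on {-\<delta><..<\<delta>} \<alpha>" and \<beta>: "continuous_on {-\<delta><..<\<delta>} \<beta>"
    and s: "s = (\<lambda>x. s0 + x\<^sup>2 * T (x\<^sup>2) / l)"
    and sol: "\<And>x. x \<in> {-\<delta><..<\<delta>} \<Longrightarrow> x\<^sup>2 \<in> {-\<rho><..<\<rho>} \<and> s x * l \<in> {0<..<L} \<and>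
       soln_u x (\<alpha> x) (\<beta> x) (s x * l) = 0 \<and> soln_v x (\<alpha> x) (\<beta> x) (s x * l) = 0 \<and> (\<alpha> x \<noteq> 0 \<or> \<beta> x \<noteq> 0)"
    and \<kappa>: "\<kappa> \<noteq> 0" and W: "W \<in> borel_measurable (Lm l)"
    and lim: "AE x in Lm l. W x = (\<kappa> * (\<alpha> 0 * a 0 (s0 * x)), \<kappa> * (\<beta> 0 * e 0 (s0 * x)))"
  shows "C2_on {-\<delta><..<\<delta>} s \<and> s 0 = s0 \<and> deriv s 0 = 0 \<and> deriv (deriv s) 0 = 2 * T 0 / l \<and>
    (\<forall>x\<in>{-\<delta><..<\<delta>}. 0 < s x \<and> s x * l \<le> L \<and> complex_of_real ((s x)\<^sup>2 * x) \<in> Spec_N l g h (s x)) \<and>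
    (\<exists>U. (\<forall>x\<in>{-\<delta><..<\<delta>}. eigenfun_N l g h (s x) ((s x)\<^sup>2 * x) (U x)) \<and> L2_continuous_on l {-\<delta><..<\<delta>} U \<and>
       ((\<lambda>t. l2norm l (\<lambda>x. U t x - W x)) \<longlongrightarrow> 0) (at 0))"
proof -
  note c2 = curve_C2[OF T \<epsilon> \<delta>, of s0 l, folded s]
  have s00: "s 0 = s0" by (simp add: s)
  have pos: "0 < s x" "s x * l \<le> L" if "x \<in> {-\<delta><..<\<delta>}" for x
    using sol[OF that] l by (auto simp: zero_less_mult_iff)
  define U where "U t x = (\<kappa> * soln_u t (\<alpha> t) (\<beta> t) (s t * x), \<kappa> * soln_v t (\<alpha> t) (\<beta> t) (s t * x))" for t x
  have ef: "eigenfun_N l g h (s x) ((s x)\<^sup>2 * x) (U x)" if "x \<in> {-\<delta><..<\<delta>}" for x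
    unfolding U_def using sol[OF that] \<kappa> by (intro soln_eigenfun_N pos[OF that] l) auto
  have "continuous_on ({-\<delta><..<\<delta>} \<times> {0..l}) (\<lambda>z. U (fst z) (snd z))"
  proof -
    have fst': "continuous_on ({-\<delta><..<\<delta>} \<times> {0..l}) (\<lambda>z. f (fst z))" if "continuous_on {-\<delta><..<\<delta>} f" for f :: "real \<Rightarrow> real"
      by (rule continuous_on_compose2[OF that]) (auto intro!: continuous_intros)
    have arg: "continuous_on ({-\<delta><..<\<delta>} \<times> {0..l}) (\<lambda>z. f ((fst z)\<^sup>2, s (fst z) * snd z))"
      if "continuous_on ({-\<rho><..<\<rho>} \<times> {0..L}) f" for f :: "real \<times> real \<Rightarrow> real"
    proof (rule continuous_on_compose2[OF that])
      show "continuous_on ({-\<delta><..<\<delta>} \<times> {0..l}) (\<lambda>z. ((fst z)\<^sup>2, s (fst z) * snd z))"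
        by (intro continuous_intros fst' c2(5))
      show "(\<lambda>z. ((fst z)\<^sup>2, s (fst z) * snd z)) ` ({-\<delta><..<\<delta>} \<times> {0..l}) \<subseteq> {-\<rho><..<\<rho>} \<times> {0..L}"
      proof (rule image_subsetI)
        fix z assume z: "z \<in> {-\<delta><..<\<delta>} \<times> {0..l}"
        then have "fst z \<in> {-\<delta><..<\<delta>}" "snd z \<in> {0..l}" by auto
        then show "((fst z)\<^sup>2, s (fst z) * snd z) \<in> {-\<rho><..<\<rho>} \<times> {0..L}"
          using sol[of "fst z"] rescale_in[OF pos, of "fst z" "snd z"] by blast
      qed
    qed
    show ?thesis
      unfolding U_def soln_u_def soln_v_def
      by (intro continuous_on_Pair continuous_on_mult continuous_on_add continuous_on_const continuous_on_fst
          continuous_on_id fst'[OF \<alpha>] fst'[OF \<beta>] arg pser_continuous)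
  qed
  then have L2c: "L2_continuous_on l {-\<delta><..<\<delta>} U"
    by (intro L2_continuous_on_joint[OF l]) (simp add: case_prod_beta)
  have 0: "0 \<in> {-\<delta><..<\<delta>}" using \<delta> by simp
  have "((\<lambda>t. l2norm l (\<lambda>x. U t x - U 0 x)) \<longlongrightarrow> 0) (at 0 within {-\<delta><..<\<delta>})"
    using L2c 0 unfolding L2_continuous_on_def by blast
  then have lim0: "((\<lambda>t. l2norm l (\<lambda>x. U t x - U 0 x)) \<longlongrightarrow> 0) (at 0)"
    using at_within_open[OF 0] by simp
  have U0: "U 0 x = (\<kappa> * (\<alpha> 0 * a 0 (s0 * x)), \<kappa> * (\<beta> 0 * e 0 (s0 * x)))" for x
    using s00 by (simp add: U_def soln_u_def soln_v_def pser_at_0)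
  have aeW: "AE x in Lm l. U 0 x = W x" using lim by eventually_elim (simp add: U0)
  have Um: "U t \<in> borel_measurable (Lm l)" if "t \<in> {-\<delta><..<\<delta>}" for t
  proof (rule borel_measurable_Lm')
    have "continuous_on {0..l} (\<lambda>x. (\<lambda>z. U (fst z) (snd z)) (t, x))"
      by (rule continuous_on_compose2[OF \<open>continuous_on _ (\<lambda>z. U (fst z) (snd z))\<close>]) (use that in \<open>auto intro!: continuous_intros\<close>)
    then show "continuous_on {0..l} (U t)" by simp
  qed
  have eq: "l2norm l (\<lambda>x. U t x - U 0 x) = l2norm l (\<lambda>x. U t x - W x)" if "t \<in> {-\<delta><..<\<delta>}" for t
  proof (rule l2norm_cong_AE)
    show "(\<lambda>x. U t x - U 0 x) \<in> borel_measurable (Lm l)" "(\<lambda>x. U t x - W x) \<in> borel_measurable (Lm l)"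
      by (intro borel_measurable_diff Um that 0 W)+
    show "AE x in Lm l. U t x - U 0 x = U t x - W x" using aeW by eventually_elim simp
  qed
  have "((\<lambda>t. l2norm l (\<lambda>x. U t x - W x)) \<longlongrightarrow> 0) (at 0)"
  proof (rule Lim_transform_eventually[OF lim0])
    have "\<forall>\<^sub>F t in at 0. t \<in> {-\<delta><..<\<delta>}" using 0 by (intro eventually_at_in_open') auto
    then show "\<forall>\<^sub>F t in at 0. l2norm l (\<lambda>x. U t x - U 0 x) = l2norm l (\<lambda>x. U t x - W x)"
      by eventually_elim (rule eq)
  qed
  moreover have "complex_of_real ((s x)\<^sup>2 * x) \<in> Spec_N l g h (s x)" if "x \<in> {-\<delta><..<\<delta>}" for x
    by (rule eigenfun_N_in_Spec_N[OF ef[OF that]])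
  ultimately show ?thesis using c2(1,3,4) s00 pos ef L2c by blast
qed

end

section \<open>The spectrum near the crossing\<close>

lemma C2_on_imp_Ck_1:
  assumes "C2_on {0..L} g"
  shows "continuous_on {0..L} g" "Ck 1 {0<..<L} g"
proof -
  obtain g' g'' where g: "\<And>x. x \<in> {0..L} \<Longrightarrow> (g has_real_derivative g' x) (at x within {0..L})"
    "\<And>x. x \<in> {0..L} \<Longrightarrow> (g' has_real_derivative g'' x) (at x within {0..L})"
    using assms unfolding C2_on_def by metis
  show "continuous_on {0..L} g" by (rule DERIV_continuous_on[OF g(1)])
  have sub: "{0<..<L} \<subseteq> {0..L}" by auto
  have "continuous_on {0<..<L} g'" using DERIV_continuous_on[OF g(2)] by (rule continuous_on_subset[OF _ sub])
  then have c: "Ck 0 {0<..<L} g'" by simp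
  have d: "(g has_real_derivative g' x) (at x within {0<..<L})" if "x \<in> {0<..<L}" for x
    using g(1)[OF subsetD[OF sub that]] DERIV_subset sub by blast
  show "Ck 1 {0<..<L} g" unfolding One_nat_def by (rule Ck_real_SucI[where f' = g', OF _ c]) (rule d)
qed

lemma dom_L_eigen: "eigenfun_L l q s \<mu> u \<Longrightarrow> cplx u \<in> dom_L l"
  by (simp add: eigenfun_L_def)

theorem theorem4p6:
  fixes l l' s0 :: real
    and g h u1 v2 :: "real \<Rightarrow> real"
  assumes "0 < l" and "l \<le> l'" and "s0 = 1 \<Longrightarrow> l < l'"
    and "C2_on {0..l'} g" and "C2_on {0..l'} h"
    and "0 < s0" and "s0 \<le> 1"
    and "has_dim l (ker_N l g h s0) 2"
    and "eigenfun_L l g s0 0 u1"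
    and "eigenfun_L l h s0 0 v2"
  shows
    "(ip l u1 v2 \<noteq> 0 \<longrightarrow>
        (\<forall>\<^sub>F (lam, s) in at (0, s0). complex_of_real (s\<^sup>2 * lam) \<notin> Spec_N l g h s))
     \<and>
     (\<forall>uhat vhat :: real \<Rightarrow> real.
        ip l u1 v2 = 0 \<and>
        cplx uhat \<in> dom_L l \<and> aeq l (Lop l g s0 (cplx uhat)) (cplx v2) \<and>
        cplx vhat \<in> dom_L l \<and> aeq l (\<lambda>x. - Lop l h s0 (cplx vhat) x) (cplx u1) \<and>
        ip l vhat u1 / (dx_end l u1)\<^sup>2 + ip l uhat v2 / (dx_end l v2)\<^sup>2 \<noteq> 0
        \<longrightarrow>
        (\<exists>\<epsilon>>0. \<exists>s1 s2 :: real \<Rightarrow> real.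
           C2_on {-\<epsilon><..<\<epsilon>} s1 \<and> C2_on {-\<epsilon><..<\<epsilon>} s2 \<and>
           (\<forall>s\<in>{s1, s2}.
              (\<forall>lam\<in>{-\<epsilon><..<\<epsilon>}. 0 < s lam \<and> s lam * l \<le> l' \<and>
                 complex_of_real ((s lam)\<^sup>2 * lam) \<in> Spec_N l g h (s lam)) \<and>
              s 0 = s0 \<and>
              deriv s 0 = 0) \<and>
           deriv (deriv s1) 0 = - (2 * s0 ^ 5 / l) * (ip l vhat u1 / (dx_end l u1)\<^sup>2) \<and>
           deriv (deriv s2) 0 = (2 * s0 ^ 5 / l) * (ip l uhat v2 / (dx_end l v2)\<^sup>2) \<and>
           (\<exists>U1 U2 :: real \<Rightarrow> real \<Rightarrow> real \<times> real.
              (\<forall>lam\<in>{-\<epsilon><..<\<epsilon>}.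
                 eigenfun_N l g h (s1 lam) ((s1 lam)\<^sup>2 * lam) (U1 lam) \<and>
                 eigenfun_N l g h (s2 lam) ((s2 lam)\<^sup>2 * lam) (U2 lam)) \<and>
              L2_continuous_on l {-\<epsilon><..<\<epsilon>} U1 \<and> L2_continuous_on l {-\<epsilon><..<\<epsilon>} U2 \<and>
              ((\<lambda>lam. l2norm l (\<lambda>x. U1 lam x - (u1 x, 0))) \<longlongrightarrow> 0) (at 0) \<and>
              ((\<lambda>lam. l2norm l (\<lambda>x. U2 lam x - (0, v2 x))) \<longlongrightarrow> 0) (at 0))))"
proof -
  note l = \<open>0 < l\<close>
  \<comment> \<open>The end point of the rescaled interval lies in the interior of the interval on which \<open>g\<close> and \<open>h\<close> are given.\<close>
  define y0 where "y0 = s0 * l"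
  have y0: "y0 \<in> {0<..<l'}"
  proof -
    have "0 < y0" using assms by (simp add: y0_def)
    moreover have "y0 < l'"
    proof (cases "s0 = 1")
      case False
      then have "s0 * l < 1 * l" using assms by (intro mult_strict_right_mono) auto
      then show ?thesis using assms(2) by (simp add: y0_def)
    qed (use assms in \<open>simp add: y0_def\<close>)
    ultimately show ?thesis by simp
  qed
  have L: "0 \<le> l'" using y0 by simp
  have s0: "0 < s0" "s0 * l \<le> l'" using assms y0 by (auto simp: y0_def)
  have y0': "y0 \<in> {0..l'}" using y0 by auto
  note cg = C2_on_imp_Ck_1[OF assms(4)] and ch = C2_on_imp_Ck_1[OF assms(5)]
  \<comment> \<open>The four series; their common radius of convergence is the smaller of two.\<close>
  obtain \<rho>1 a a' b b' where f1: "analytic_pair l' g h 1 \<rho>1 a a' b b'"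
    using analytic_pair_exists[OF L cg(1) ch(1), of 1] by auto
  obtain \<rho>2 e e' c c' where f2: "analytic_pair l' h g (-1) \<rho>2 e e' c c'"
    using analytic_pair_exists[OF L ch(1) cg(1), of "-1"] by auto
  define \<rho> where "\<rho> = min \<rho>1 \<rho>2"
  have \<rho>: "0 < \<rho>" using f1 f2 by (simp add: \<rho>_def analytic_pair_def)
  have pair1: "analytic_pair l' g h 1 \<rho> a a' b b'" and pair2: "analytic_pair l' h g (-1) \<rho> e e' c c'"
    using analytic_pair_radius_mono[OF f1 \<rho>] analytic_pair_radius_mono[OF f2 \<rho>] by (auto simp: \<rho>_def)
  interpret analytic_system l' \<rho> g h a a' b b' e e' c c'
    by unfold_locales (rule cg(1) ch(1) pair1 pair2)+
  have odes: "ode2 l' g (\<lambda>x. 0) 1 (a 0) (a' 0)" "ode2 l' h (\<lambda>x. 1 * a 0 x) 0 (b 0) (b' 0)"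
    "ode2 l' h (\<lambda>x. 0) 1 (e 0) (e' 0)" "ode2 l' g (\<lambda>x. - 1 * e 0 x) 0 (c 0) (c' 0)"
    using pair1 pair2 unfolding analytic_pair_def by blast+
  have K3: "Ck 3 {0<..<l'} (a 0)" "Ck 3 {0<..<l'} (e 0)"
    by (rule ode2_Ck[OF odes(1) cg(2) Ck_const], rule ode2_Ck[OF odes(3) ch(2) Ck_const])
  have K1: "Ck 1 {0<..<l'} (a 0)" "Ck 1 {0<..<l'} (e 0)" by (rule Ck_mono[OF K3(1)], simp) (rule Ck_mono[OF K3(2)], simp)
  have K3': "Ck 3 {0<..<l'} (b 0)" "Ck 3 {0<..<l'} (c 0)"
    by (rule ode2_Ck[OF odes(2) ch(2) Ck_mult[OF Ck_const K1(1)]], rule ode2_Ck[OF odes(4) cg(2) Ck_mult[OF Ck_const K1(2)]])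
  have Ca: "coeff_Ck 2 \<rho> {0..l'} a" "coeff_Ck 2 \<rho> {0..l'} b" "coeff_Ck 2 \<rho> {0..l'} c" "coeff_Ck 2 \<rho> {0..l'} e"
    using pair1 pair2 unfolding analytic_pair_def by blast+
  note coef = coefficients_continuous_on[OF s0]
  \<comment> \<open>The solutions of the scalar equations on \<open>[0, l]\<close> with initial slope \<open>1\<close>, of which \<open>u1\<close> and \<open>v2\<close> are multiples.\<close>
  define P where "P x = inverse s0 * a 0 (s0 * x)" for x
  define P' where "P' x = inverse s0 * s0 * a' 0 (s0 * x)" for x
  define Q where "Q x = inverse s0 * e 0 (s0 * x)" for x
  define Q' where "Q' x = inverse s0 * s0 * e' 0 (s0 * x)" for x
  have oP: "ode2 l (\<lambda>x. s0\<^sup>2 * g (s0 * x)) (\<lambda>x. 0) 1 P P'"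
    unfolding P_def[abs_def] P'_def[abs_def] by (rule ode2_cong[OF ode2_rescale[OF odes(1) s0]]) (use s0 in auto)
  have oQ: "ode2 l (\<lambda>x. s0\<^sup>2 * h (s0 * x)) (\<lambda>x. 0) 1 Q Q'"
    unfolding Q_def[abs_def] Q'_def[abs_def] by (rule ode2_cong[OF ode2_rescale[OF odes(3) s0]]) (use s0 in auto)
  obtain c1 where c1: "c1 \<noteq> 0" "AE x in Lm l. u1 x = c1 * P x" "P l = 0" "dx_end l u1 = c1 * P' l"
    using eigenfun_L_representative[OF l coef(1) assms(9) oP] by blast
  obtain c2 where c2: "c2 \<noteq> 0" "AE x in Lm l. v2 x = c2 * Q x" "Q l = 0" "dx_end l v2 = c2 * Q' l"
    using eigenfun_L_representative[OF l coef(2) assms(10) oQ] by blast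
  have z: "a 0 y0 = 0" "e 0 y0 = 0" using c1(3) c2(3) s0 by (simp_all add: P_def Q_def y0_def)
  define p where "p = a' 0 y0"
  define q where "q = e' 0 y0"
  have pq: "p \<noteq> 0" "q \<noteq> 0"
    using ode2_zero_slope_nonzero[OF L cg(1) odes(1) y0'] ode2_zero_slope_nonzero[OF L ch(1) odes(3) y0'] y0 z
    by (auto simp: p_def q_def)
  have dx: "dx_end l u1 = c1 * a' 0 (s0 * l)" "dx_end l v2 = c2 * e' 0 (s0 * l)"
    using c1(4) c2(4) s0 by (simp_all add: P'_def Q'_def)
  have at: "at y0 within {0..l'} = at y0" using y0 by (intro at_within_interior) (simp add: interior_atLeastAtMost_real)
  have dp: "(a 0 has_real_derivative p) (at y0)" and dq: "(e 0 has_real_derivative q) (at y0)"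
    using odes(1,3) y0' unfolding ode2_def p_def q_def by (auto simp flip: at)
  note du = dom_L_eigen[OF assms(9)] and dv = dom_L_eigen[OF assms(10)]
  \<comment> \<open>At \<open>y0\<close>, where \<open>a 0\<close> and \<open>e 0\<close> vanish, each identity leaves a single boundary term.\<close>
  have PQb: "((\<lambda>t. 1 * a 0 t * e 0 t - 0 * b 0 t) has_integral (b' 0 y0 * e 0 y0 - b 0 y0 * e' 0 y0)) {0..y0}"
    by (rule ode2_wronskian[OF odes(2,3) y0'])
  have PQc: "((\<lambda>t. (- 1 * e 0 t) * a 0 t - 0 * c 0 t) has_integral (c' 0 y0 * a 0 y0 - c 0 y0 * a' 0 y0)) {0..y0}"
    by (rule ode2_wronskian[OF odes(4,1) y0'])
  have bc: "c 0 y0 * p = - (b 0 y0 * q)"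
  proof -
    have "((\<lambda>t. e 0 t * a 0 t) has_integral c 0 y0 * p) {0..y0}"
      using has_integral_neg[OF PQc] z by (simp add: p_def)
    moreover have "((\<lambda>t. e 0 t * a 0 t) has_integral - (b 0 y0 * q)) {0..y0}"
      using PQb z by (simp add: q_def mult.commute)
    ultimately show ?thesis by (rule has_integral_unique)
  qed
  \<comment> \<open>The inner product is a nonzero multiple of \<open>b 0 y0\<close>, so its vanishing decides between the two parts.\<close>
  have ipb: "ip l u1 v2 = - (c1 * c2 * inverse s0 ^ 3) * (b 0 y0 * q)"
  proof -
    have "ip l u1 v2 = integral {0..l} (\<lambda>x. (c1 * P x) * (c2 * Q x))"
      by (intro ip_eq_integral[OF du dv c1(2) c2(2)] continuous_intros ode2_continuous_on[OF oP] ode2_continuous_on[OF oQ])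
    moreover have "((\<lambda>t. P t * Q t - 0 * (inverse s0 ^ 3 * b 0 (s0 * t))) has_integral
        (inverse s0 ^ 3 * s0 * b' 0 (s0 * l) * Q l - inverse s0 ^ 3 * b 0 (s0 * l) * Q' l)) {0..l}"
    proof (rule ode2_wronskian[OF _ oQ])
      show "ode2 l (\<lambda>x. s0\<^sup>2 * h (s0 * x)) P 0 (\<lambda>x. inverse s0 ^ 3 * b 0 (s0 * x)) (\<lambda>x. inverse s0 ^ 3 * s0 * b' 0 (s0 * x))"
        by (rule ode2_cong[OF ode2_rescale[OF odes(2) s0]])
          (use s0 in \<open>auto simp: P_def power2_eq_square power3_eq_cube field_simps\<close>)
    qed (use l in simp)
    then have "((\<lambda>t. (c1 * P t) * (c2 * Q t)) has_integral (c1 * c2) * (- (inverse s0 ^ 3 * b 0 y0 * q))) {0..l}"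
      using has_integral_mult_right[of "\<lambda>t. P t * Q t" "- (inverse s0 ^ 3 * b 0 y0 * q)" "{0..l}" "c1 * c2"] s0 c2(3)
      by (simp add: Q'_def q_def y0_def mult_ac)
    ultimately show ?thesis by (simp add: integral_unique)
  qed
  have ip_iff: "ip l u1 v2 = 0 \<longleftrightarrow> b 0 y0 = 0"
    unfolding ipb using c1(1) c2(1) s0 pq by simp
  \<comment> \<open>The pair \<open>(\<lambda>\<^sup>2, s l)\<close> tends to \<open>(0, y0)\<close> without attaining it in the punctured neighbourhood.\<close>
  have part1: "\<forall>\<^sub>F (lam, s) in at (0, s0). complex_of_real (s\<^sup>2 * lam) \<notin> Spec_N l g h s" if "ip l u1 v2 \<noteq> 0"
  proof -
    have "b 0 y0 \<noteq> 0" using that ip_iff by simp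
    note near = determinant_nonzero_near[OF y0 K3 z dp pq(1) dq pq(2) bc this]
    have lim: "((\<lambda>z::real \<times> real. ((fst z)\<^sup>2, snd z * l)) \<longlongrightarrow> (0, y0)) (at (0, s0))"
    proof -
      have "((\<lambda>z::real \<times> real. ((fst z)\<^sup>2, snd z * l)) \<longlongrightarrow> ((fst (0::real, s0))\<^sup>2, snd (0::real, s0) * l)) (at (0, s0))"
        by (intro tendsto_intros)
      then show ?thesis by (simp add: y0_def)
    qed
    have ev1: "\<forall>\<^sub>F z in at (0, s0). 0 \<le> fst ((fst z)\<^sup>2, snd z * l) \<longrightarrow> ((fst z)\<^sup>2, snd z * l) \<noteq> (0, y0) \<longrightarrow>
       pser a ((fst z)\<^sup>2, snd z * l) * pser e ((fst z)\<^sup>2, snd z * l)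
        - fst ((fst z)\<^sup>2, snd z * l) * (pser b ((fst z)\<^sup>2, snd z * l) * pser c ((fst z)\<^sup>2, snd z * l)) \<noteq> 0"
      by (rule eventually_compose_filterlim[OF near lim])
    have "open ({-\<rho><..<\<rho>} \<times> {0<..<l'})" by (intro open_Times) auto
    then have ev2: "\<forall>\<^sub>F z in at (0, s0). ((fst z)\<^sup>2, snd z * l) \<in> {-\<rho><..<\<rho>} \<times> {0<..<l'}"
      using \<rho> y0 by (intro topological_tendstoD[OF lim]) auto
    have ev3: "\<forall>\<^sub>F z in at (0, s0). z \<noteq> (0, s0)" by (simp add: eventually_at_filter)
    show ?thesis
      using ev1 ev2 ev3
    proof eventually_elim
      case (elim z)
      obtain lam s where zz: "z = (lam, s)" by (cases z)
      have "(lam\<^sup>2, s * l) \<noteq> (0, y0)" using elim(3) l by (auto simp: zz y0_def)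
      moreover have "0 < s" "s * l \<le> l'" using elim(2) l by (auto simp: zz zero_less_mult_iff)
      moreover have "lam\<^sup>2 \<in> {-\<rho><..<\<rho>}" using elim(2) by (simp add: zz)
      ultimately have "complex_of_real (s\<^sup>2 * lam) \<notin> Spec_N l g h s"
        using elim(1) by (intro determinant_nonzero_imp_resolvent[OF _ _ _ l]) (simp_all add: zz)
      then show ?case by (simp add: zz)
    qed
  qed
  have part2: "\<exists>\<epsilon>>0. \<exists>s1 s2 :: real \<Rightarrow> real.
           C2_on {-\<epsilon><..<\<epsilon>} s1 \<and> C2_on {-\<epsilon><..<\<epsilon>} s2 \<and>
           (\<forall>s\<in>{s1, s2}.
              (\<forall>lam\<in>{-\<epsilon><..<\<epsilon>}. 0 < s lam \<and> s lam * l \<le> l' \<and>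
                 complex_of_real ((s lam)\<^sup>2 * lam) \<in> Spec_N l g h (s lam)) \<and>
              s 0 = s0 \<and>
              deriv s 0 = 0) \<and>
           deriv (deriv s1) 0 = - (2 * s0 ^ 5 / l) * (ip l vhat u1 / (dx_end l u1)\<^sup>2) \<and>
           deriv (deriv s2) 0 = (2 * s0 ^ 5 / l) * (ip l uhat v2 / (dx_end l v2)\<^sup>2) \<and>
           (\<exists>U1 U2 :: real \<Rightarrow> real \<Rightarrow> real \<times> real.
              (\<forall>lam\<in>{-\<epsilon><..<\<epsilon>}.
                 eigenfun_N l g h (s1 lam) ((s1 lam)\<^sup>2 * lam) (U1 lam) \<and>
                 eigenfun_N l g h (s2 lam) ((s2 lam)\<^sup>2 * lam) (U2 lam)) \<and>
              L2_continuous_on l {-\<epsilon><..<\<epsilon>} U1 \<and> L2_continuous_on l {-\<epsilon><..<\<epsilon>} U2 \<and>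
              ((\<lambda>lam. l2norm l (\<lambda>x. U1 lam x - (u1 x, 0))) \<longlongrightarrow> 0) (at 0) \<and>
              ((\<lambda>lam. l2norm l (\<lambda>x. U2 lam x - (0, v2 x))) \<longlongrightarrow> 0) (at 0))"
    if ip0: "ip l u1 v2 = 0" and uhat: "cplx uhat \<in> dom_L l" "aeq l (Lop l g s0 (cplx uhat)) (cplx v2)"
      and vhat: "cplx vhat \<in> dom_L l" "aeq l (\<lambda>x. - Lop l h s0 (cplx vhat) x) (cplx u1)"
      and nd: "ip l vhat u1 / (dx_end l u1)\<^sup>2 + ip l uhat v2 / (dx_end l v2)\<^sup>2 \<noteq> 0" for uhat vhat
  proof -
    have b0: "b 0 y0 = 0" using ip0 ip_iff by simp
    then have c0: "c 0 y0 = 0" using bc pq by simp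
    have av: "AE x in Lm l. Lop l h s0 (cplx vhat) x = of_real (- 1 * u1 x)"
      using vhat(2) unfolding aeq_def
    proof eventually_elim
      case (elim x)
      from arg_cong[OF this, of uminus] show ?case by (simp add: cplx_def)
    qed
    have au: "AE x in Lm l. Lop l g s0 (cplx uhat) x = of_real (- (- 1) * v2 x)"
      using uhat(2) unfolding aeq_def by eventually_elim (simp add: cplx_def)
    \<comment> \<open>The two quotients of the nondegeneracy condition in terms of the two roots.\<close>
    have r1: "ip l vhat u1 / (dx_end l u1)\<^sup>2 = inverse s0 ^ 5 * (a 1 y0 / p)"
    proof -
      have "ip l vhat u1 / (c1 * a' 0 (s0 * l))\<^sup>2 = 1 * inverse s0 ^ 5 * (a 1 (s0 * l) / a' 0 (s0 * l))"
        using z b0 pq c1 by (intro resolvent_pairing[OF l s0 cg(1) ch(1) pair1 _ odes(3) _ _ _ _ du _ _ vhat(1) av])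
          (auto simp: y0_def p_def P_def)
      then show ?thesis by (simp add: dx y0_def p_def)
    qed
    have r2: "ip l uhat v2 / (dx_end l v2)\<^sup>2 = - (inverse s0 ^ 5 * (e 1 y0 / q))"
    proof -
      have "ip l uhat v2 / (c2 * e' 0 (s0 * l))\<^sup>2 = - 1 * inverse s0 ^ 5 * (e 1 (s0 * l) / e' 0 (s0 * l))"
        using z c0 pq c2 by (intro resolvent_pairing[OF l s0 ch(1) cg(1) pair2 _ odes(1) _ _ _ _ dv _ _ uhat(1) au])
          (auto simp: y0_def q_def Q_def)
      then show ?thesis by (simp add: dx y0_def q_def)
    qed
    have ne: "- a 1 y0 / p \<noteq> - e 1 y0 / q"
    proof
      assume "- a 1 y0 / p = - e 1 y0 / q"
      then have "a 1 y0 / p = e 1 y0 / q" by simp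
      from nd[unfolded r1 r2 this] show False by simp
    qed
    \<comment> \<open>The situation is symmetric under exchanging the two pairs of series, which gives the second curve.\<close>
    obtain \<epsilon>1 T1 k1 where e1: "0 < \<epsilon>1" "Ck 2 {-\<epsilon>1<..<\<epsilon>1} T1" "T1 0 = - a 1 y0 / p" "continuous_on {-\<epsilon>1<..<\<epsilon>1} k1"
      "\<forall>x\<in>{-\<epsilon>1<..<\<epsilon>1}. x \<in> {-\<rho><..<\<rho>} \<and> y0 + x * T1 x \<in> {0<..<l'} \<and>
        pser a (x, y0 + x * T1 x) + x * k1 x * pser c (x, y0 + x * T1 x) = 0 \<and>
        pser b (x, y0 + x * T1 x) + k1 x * pser e (x, y0 + x * T1 x) = 0"
      using bifurcating_curve[OF y0 \<rho> Ca(1,2,3,4) K3(1) K3'(1) K3'(2) K3(2) z(1) b0 c0 z(2) dp pq(1) dq pq(2) ne] by blast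
    obtain \<epsilon>2 T2 k2 where e2: "0 < \<epsilon>2" "Ck 2 {-\<epsilon>2<..<\<epsilon>2} T2" "T2 0 = - e 1 y0 / q" "continuous_on {-\<epsilon>2<..<\<epsilon>2} k2"
      "\<forall>x\<in>{-\<epsilon>2<..<\<epsilon>2}. x \<in> {-\<rho><..<\<rho>} \<and> y0 + x * T2 x \<in> {0<..<l'} \<and>
        pser e (x, y0 + x * T2 x) + x * k2 x * pser b (x, y0 + x * T2 x) = 0 \<and>
        pser c (x, y0 + x * T2 x) + k2 x * pser a (x, y0 + x * T2 x) = 0"
      using bifurcating_curve[OF y0 \<rho> Ca(4,3,2,1) K3(2) K3'(2) K3'(1) K3(1) z(2) c0 b0 z(1) dq pq(2) dp pq(1) ne[symmetric]] by blast
    define \<delta> where "\<delta> = min 1 (min \<epsilon>1 \<epsilon>2)"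
    have \<delta>: "0 < \<delta>" "\<delta> \<le> 1" "\<delta> \<le> \<epsilon>1" "\<delta> \<le> \<epsilon>2" using e1(1) e2(1) by (auto simp: \<delta>_def)
    have sq: "x\<^sup>2 \<in> {-\<delta><..<\<delta>}" if "x \<in> {-\<delta><..<\<delta>}" for x
      using square_in_interval[OF that \<delta>(2) order_refl] .
    have sub: "{-\<delta><..<\<delta>} \<subseteq> {-\<epsilon>1<..<\<epsilon>1}" "{-\<delta><..<\<delta>} \<subseteq> {-\<epsilon>2<..<\<epsilon>2}" using \<delta> by auto
    have csq: "continuous_on {-\<delta><..<\<delta>} (\<lambda>x. x * k (x\<^sup>2))" if "continuous_on {-\<delta><..<\<delta>} k" for k
      using sq by (intro continuous_intros continuous_on_compose2[OF that]) auto
    define s1 where "s1 = (\<lambda>x. s0 + x\<^sup>2 * T1 (x\<^sup>2) / l)"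
    define s2 where "s2 = (\<lambda>x. s0 + x\<^sup>2 * T2 (x\<^sup>2) / l)"
    have sl: "s1 x * l = y0 + x\<^sup>2 * T1 (x\<^sup>2)" "s2 x * l = y0 + x\<^sup>2 * T2 (x\<^sup>2)" for x
      using l by (simp_all add: s1_def s2_def y0_def distrib_right)
    have m1: "(\<lambda>x. (u1 x, 0::real)) \<in> borel_measurable (Lm l)" "(\<lambda>x. (0::real, v2 x)) \<in> borel_measurable (Lm l)"
      by (intro borel_measurable_Pair dom_L_borel[OF du] dom_L_borel[OF dv] borel_measurable_const)+
    \<comment> \<open>The kernel vector \<open>(1, \<lambda> k1)\<close> tends to \<open>(1, 0)\<close>, so in the limit the second component disappears.\<close>
    have C1: "C2_on {-\<delta><..<\<delta>} s1 \<and> s1 0 = s0 \<and> deriv s1 0 = 0 \<and> deriv (deriv s1) 0 = 2 * T1 0 / l \<and>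
      (\<forall>x\<in>{-\<delta><..<\<delta>}. 0 < s1 x \<and> s1 x * l \<le> l' \<and> complex_of_real ((s1 x)\<^sup>2 * x) \<in> Spec_N l g h (s1 x)) \<and>
      (\<exists>U. (\<forall>x\<in>{-\<delta><..<\<delta>}. eigenfun_N l g h (s1 x) ((s1 x)\<^sup>2 * x) (U x)) \<and> L2_continuous_on l {-\<delta><..<\<delta>} U \<and>
       ((\<lambda>t. l2norm l (\<lambda>x. U t x - (u1 x, 0))) \<longlongrightarrow> 0) (at 0))"
    proof (rule eigenpair_curve[OF l e1(2) e1(1) \<delta>(1,2,3), where \<alpha> = "\<lambda>x. 1" and \<beta> = "\<lambda>x. x * k1 (x\<^sup>2)" and \<kappa> = "c1 * inverse s0"])
      show "continuous_on {-\<delta><..<\<delta>} (\<lambda>x. x * k1 (x\<^sup>2))" by (rule csq[OF continuous_on_subset[OF e1(4) sub(1)]])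
      show "AE x in Lm l. (u1 x, 0) = (c1 * inverse s0 * (1 * a 0 (s0 * x)), c1 * inverse s0 * (0 * k1 (0\<^sup>2) * e 0 (s0 * x)))"
        using c1(2) by eventually_elim (simp add: P_def)
      fix x assume x: "x \<in> {-\<delta><..<\<delta>}"
      have *: "x\<^sup>2 \<in> {-\<rho><..<\<rho>}" "s1 x * l \<in> {0<..<l'}"
        "pser a (x\<^sup>2, s1 x * l) + x\<^sup>2 * k1 (x\<^sup>2) * pser c (x\<^sup>2, s1 x * l) = 0"
        "pser b (x\<^sup>2, s1 x * l) + k1 (x\<^sup>2) * pser e (x\<^sup>2, s1 x * l) = 0"
        using bspec[OF e1(5) subsetD[OF sub(1) sq[OF x]]] unfolding sl by blast+
      have "soln_u x 1 (x * k1 (x\<^sup>2)) (s1 x * l) = pser a (x\<^sup>2, s1 x * l) + x\<^sup>2 * k1 (x\<^sup>2) * pser c (x\<^sup>2, s1 x * l)"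
        "soln_v x 1 (x * k1 (x\<^sup>2)) (s1 x * l) = x * (pser b (x\<^sup>2, s1 x * l) + k1 (x\<^sup>2) * pser e (x\<^sup>2, s1 x * l))"
        by (simp_all add: soln_u_def soln_v_def power2_eq_square algebra_simps)
      then show "x\<^sup>2 \<in> {-\<rho><..<\<rho>} \<and> s1 x * l \<in> {0<..<l'} \<and> soln_u x 1 (x * k1 (x\<^sup>2)) (s1 x * l) = 0 \<and>
          soln_v x 1 (x * k1 (x\<^sup>2)) (s1 x * l) = 0 \<and> ((1::real) \<noteq> 0 \<or> x * k1 (x\<^sup>2) \<noteq> 0)"
        using * by simp
    qed (use m1 c1(1) s0 in \<open>simp_all add: s1_def\<close>)
    have C2: "C2_on {-\<delta><..<\<delta>} s2 \<and> s2 0 = s0 \<and> deriv s2 0 = 0 \<and> deriv (deriv s2) 0 = 2 * T2 0 / l \<and>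
      (\<forall>x\<in>{-\<delta><..<\<delta>}. 0 < s2 x \<and> s2 x * l \<le> l' \<and> complex_of_real ((s2 x)\<^sup>2 * x) \<in> Spec_N l g h (s2 x)) \<and>
      (\<exists>U. (\<forall>x\<in>{-\<delta><..<\<delta>}. eigenfun_N l g h (s2 x) ((s2 x)\<^sup>2 * x) (U x)) \<and> L2_continuous_on l {-\<delta><..<\<delta>} U \<and>
       ((\<lambda>t. l2norm l (\<lambda>x. U t x - (0, v2 x))) \<longlongrightarrow> 0) (at 0))"
    proof (rule eigenpair_curve[OF l e2(2) e2(1) \<delta>(1,2,4), where \<alpha> = "\<lambda>x. x * k2 (x\<^sup>2)" and \<beta> = "\<lambda>x. 1" and \<kappa> = "c2 * inverse s0"])
      show "continuous_on {-\<delta><..<\<delta>} (\<lambda>x. x * k2 (x\<^sup>2))" by (rule csq[OF continuous_on_subset[OF e2(4) sub(2)]])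
      show "AE x in Lm l. (0, v2 x) = (c2 * inverse s0 * (0 * k2 (0\<^sup>2) * a 0 (s0 * x)), c2 * inverse s0 * (1 * e 0 (s0 * x)))"
        using c2(2) by eventually_elim (simp add: Q_def)
      fix x assume x: "x \<in> {-\<delta><..<\<delta>}"
      have *: "x\<^sup>2 \<in> {-\<rho><..<\<rho>}" "s2 x * l \<in> {0<..<l'}"
        "pser e (x\<^sup>2, s2 x * l) + x\<^sup>2 * k2 (x\<^sup>2) * pser b (x\<^sup>2, s2 x * l) = 0"
        "pser c (x\<^sup>2, s2 x * l) + k2 (x\<^sup>2) * pser a (x\<^sup>2, s2 x * l) = 0"
        using bspec[OF e2(5) subsetD[OF sub(2) sq[OF x]]] unfolding sl by blast+
      have "soln_u x (x * k2 (x\<^sup>2)) 1 (s2 x * l) = x * (pser c (x\<^sup>2, s2 x * l) + k2 (x\<^sup>2) * pser a (x\<^sup>2, s2 x * l))"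
        "soln_v x (x * k2 (x\<^sup>2)) 1 (s2 x * l) = pser e (x\<^sup>2, s2 x * l) + x\<^sup>2 * k2 (x\<^sup>2) * pser b (x\<^sup>2, s2 x * l)"
        by (simp_all add: soln_u_def soln_v_def power2_eq_square algebra_simps)
      then show "x\<^sup>2 \<in> {-\<rho><..<\<rho>} \<and> s2 x * l \<in> {0<..<l'} \<and> soln_u x (x * k2 (x\<^sup>2)) 1 (s2 x * l) = 0 \<and>
          soln_v x (x * k2 (x\<^sup>2)) 1 (s2 x * l) = 0 \<and> (x * k2 (x\<^sup>2) \<noteq> 0 \<or> (1::real) \<noteq> 0)"
        using * by simp
    qed (use m1 c2(1) s0 in \<open>simp_all add: s2_def\<close>)
    \<comment> \<open>The factor \<open>s0\<^sup>5\<close> of the claim cancels the powers of \<open>inverse s0\<close> produced by rescaling.\<close>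
    have canc: "2 * X / l = (2 * s0 ^ 5 / l) * (inverse s0 ^ 5 * X)" for X
    proof -
      have "s0 ^ 5 * inverse s0 ^ 5 = 1" using s0 by (simp flip: power_mult_distrib)
      then show ?thesis by (metis (no_types, opaque_lifting) mult.assoc mult.commute mult_1 times_divide_eq_right)
    qed
    have dd1: "2 * T1 0 / l = - (2 * s0 ^ 5 / l) * (ip l vhat u1 / (dx_end l u1)\<^sup>2)"
      unfolding r1 e1(3) using canc[of "a 1 y0 / p"] by simp
    have dd2: "2 * T2 0 / l = (2 * s0 ^ 5 / l) * (ip l uhat v2 / (dx_end l v2)\<^sup>2)"
      unfolding r2 e2(3) using canc[of "e 1 y0 / q"] by simp
    obtain U1 where U1: "\<forall>x\<in>{-\<delta><..<\<delta>}. eigenfun_N l g h (s1 x) ((s1 x)\<^sup>2 * x) (U1 x)" "L2_continuous_on l {-\<delta><..<\<delta>} U1"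
       "((\<lambda>t. l2norm l (\<lambda>x. U1 t x - (u1 x, 0))) \<longlongrightarrow> 0) (at 0)" using C1 by blast
    obtain U2 where U2: "\<forall>x\<in>{-\<delta><..<\<delta>}. eigenfun_N l g h (s2 x) ((s2 x)\<^sup>2 * x) (U2 x)" "L2_continuous_on l {-\<delta><..<\<delta>} U2"
       "((\<lambda>t. l2norm l (\<lambda>x. U2 t x - (0, v2 x))) \<longlongrightarrow> 0) (at 0)" using C2 by blast
    show ?thesis
    proof (rule exI[of _ \<delta>], intro conjI \<delta>(1), rule exI[of _ s1], rule exI[of _ s2], intro conjI)
      show "deriv (deriv s1) 0 = - (2 * s0 ^ 5 / l) * (ip l vhat u1 / (dx_end l u1)\<^sup>2)" using C1 dd1 by simp
      show "deriv (deriv s2) 0 = (2 * s0 ^ 5 / l) * (ip l uhat v2 / (dx_end l v2)\<^sup>2)" using C2 dd2 by simp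
      show "\<forall>s\<in>{s1, s2}. (\<forall>lam\<in>{-\<delta><..<\<delta>}. 0 < s lam \<and> s lam * l \<le> l' \<and>
                 complex_of_real ((s lam)\<^sup>2 * lam) \<in> Spec_N l g h (s lam)) \<and> s 0 = s0 \<and> deriv s 0 = 0"
        using C1 C2 by blast
      show "\<exists>U1 U2 :: real \<Rightarrow> real \<Rightarrow> real \<times> real.
              (\<forall>lam\<in>{-\<delta><..<\<delta>}.
                 eigenfun_N l g h (s1 lam) ((s1 lam)\<^sup>2 * lam) (U1 lam) \<and>
                 eigenfun_N l g h (s2 lam) ((s2 lam)\<^sup>2 * lam) (U2 lam)) \<and>
              L2_continuous_on l {-\<delta><..<\<delta>} U1 \<and> L2_continuous_on l {-\<delta><..<\<delta>} U2 \<and>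
              ((\<lambda>lam. l2norm l (\<lambda>x. U1 lam x - (u1 x, 0))) \<longlongrightarrow> 0) (at 0) \<and>
              ((\<lambda>lam. l2norm l (\<lambda>x. U2 lam x - (0, v2 x))) \<longlongrightarrow> 0) (at 0)"
        using U1 U2 by (intro exI[of _ U1] exI[of _ U2]) blast
    qed (use C1 C2 in blast)+
  qed
  show ?thesis using part1 part2 by blast
qed

end
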